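(* Let $\mathfrak{g}$ be a semisimple Lie algebra of finite dimension over $\mathbb{C}$ and let $V$ be a Banach $\mathfrak{g}$-module. Then the Taylor spectrum $\sigma_{\mathfrak{g}}(V)$ coincides with the set of isomorphism classes of simple submodules of $V$.
   Context: All Lie algebras are over $\mathbb{C}$. A Banach $\mathfrak{g}$-module is a complex Banach space $V$ with a left $\mathfrak{g}$-module structure in which every element of $\mathfrak{g}$ acts by a bounded linear operator. For a finite-dimensional Lie algebra $\mathfrak{g}$, $U\mathfrak{g}$ is its universal enveloping algebra and $\hat{\mathfrak{g}}$ is the set of isomorphism classes of simple finite-dimensional left $\mathfrak{g}$-modules (a simple module and its class are denoted by the same letter). The Taylor spectrum of a left $\mathfrak{g}$-module $V$ is $$\sigma_{\mathfrak{g}}(V)=\{ S\in \hat{\mathfrak{g}} : \operatorname{Tor}^{U\mathfrak{g}}_k(S^*,V)\neq 0 \text{ for some } k\geq 0 \},$$ where $\operatorname{Tor}$ is the purely algebraic one and $S^*$ is the dual vector space of $S$ with the right $\mathfrak{g}$-action $(f\cdot x)(s)=f(x\cdot s)$ for $f\in S^*$, $x\in\mathfrak{g}$, $s\in S$. *)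

theory Defs
  imports Complex_Main "HOL-Algebra.Algebra" "HOL-Library.Function_Algebras"
begin

section \<open>Lie algebras\<close>

locale lie_algebra = vector_space scale
  for scale :: "complex \<Rightarrow> 'g::ab_group_add \<Rightarrow> 'g" +
  fixes bracket :: "'g \<Rightarrow> 'g \<Rightarrow> 'g"
  assumes bracket_add_left: "bracket (x + y) z = bracket x z + bracket y z"
    and bracket_scale_left: "bracket (scale c x) y = scale c (bracket x y)"
    and bracket_add_right: "bracket x (y + z) = bracket x y + bracket x z"
    and bracket_scale_right: "bracket x (scale c y) = scale c (bracket x y)"
    and bracket_self: "bracket x x = 0"
    and jacobi: "bracket x (bracket y z) + bracket y (bracket z x) + bracket z (bracket x y) = 0"
begin

definition lie_ideal :: "'g set \<Rightarrow> bool" where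
  "lie_ideal I \<longleftrightarrow> subspace I \<and> (\<forall>x. \<forall>y\<in>I. bracket x y \<in> I)"

primrec derived_series :: "'g set \<Rightarrow> nat \<Rightarrow> 'g set" where
  "derived_series I 0 = I"
| "derived_series I (Suc n) =
     span {bracket x y | x y. x \<in> derived_series I n \<and> y \<in> derived_series I n}"

definition solvable_ideal :: "'g set \<Rightarrow> bool" where
  "solvable_ideal I \<longleftrightarrow> lie_ideal I \<and> (\<exists>n. derived_series I n = {0})"

end

text \<open>Semisimplicity is vanishing of the radical; the zero Lie algebra is included.\<close>

locale semisimple_lie_algebra = lie_algebra scale bracket
  for scale :: "complex \<Rightarrow> 'g::ab_group_add \<Rightarrow> 'g" and bracket +
  assumes finite_dimensional: "\<exists>B. finite B \<and> span B = UNIV"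
    and radical_trivial: "solvable_ideal I \<Longrightarrow> I = {0}"


section \<open>Modules over a Lie algebra\<close>

text \<open>The underlying vector space is a subspace \<open>mcarrier\<close> of an ambient complex vector space, given
  by the addition of the type and by \<open>mscale\<close>. The values of \<open>mact\<close> outside the carrier are
  irrelevant. The same record is used for right modules, with \<open>mact x v\<close> standing for \<open>v \<cdot> x\<close>.\<close>

record ('g, 'a) lmod =
  mcarrier :: "'a set"
  mscale :: "complex \<Rightarrow> 'a \<Rightarrow> 'a"
  mact :: "'g \<Rightarrow> 'a \<Rightarrow> 'a"

locale lie_module = g: lie_algebra scale bracket + vector_space "mscale M"
  for scale :: "complex \<Rightarrow> 'g::ab_group_add \<Rightarrow> 'g" and bracket
    and M :: "('g, 'a::ab_group_add) lmod" +
  assumes subspace_carrier: "subspace (mcarrier M)"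
    and act_closed: "v \<in> mcarrier M \<Longrightarrow> mact M x v \<in> mcarrier M"
    and act_add: "u \<in> mcarrier M \<Longrightarrow> v \<in> mcarrier M \<Longrightarrow> mact M x (u + v) = mact M x u + mact M x v"
    and act_scale: "v \<in> mcarrier M \<Longrightarrow> mact M x (mscale M c v) = mscale M c (mact M x v)"
    and add_act: "v \<in> mcarrier M \<Longrightarrow> mact M (x + y) v = mact M x v + mact M y v"
    and scale_act: "v \<in> mcarrier M \<Longrightarrow> mact M (scale c x) v = mscale M c (mact M x v)"
    and bracket_act: "v \<in> mcarrier M \<Longrightarrow>
      mact M (bracket x y) v = mact M x (mact M y v) - mact M y (mact M x v)"
begin

definition submodule :: "'a set \<Rightarrow> bool" where
  "submodule W \<longleftrightarrow> subspace W \<and> W \<subseteq> mcarrier M \<and> (\<forall>x. \<forall>v\<in>W. mact M x v \<in> W)"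

end

locale simple_lie_module = lie_module scale bracket M
  for scale :: "complex \<Rightarrow> 'g::ab_group_add \<Rightarrow> 'g" and bracket
    and M :: "('g, 'a::ab_group_add) lmod" +
  assumes nonzero: "mcarrier M \<noteq> {0}"
    and simple: "submodule W \<Longrightarrow> W = {0} \<or> W = mcarrier M"

locale fd_lie_module = lie_module scale bracket M
  for scale :: "complex \<Rightarrow> 'g::ab_group_add \<Rightarrow> 'g" and bracket
    and M :: "('g, 'a::ab_group_add) lmod" +
  assumes finite_dimensional: "\<exists>B. finite B \<and> mcarrier M = span B"

text \<open>The module is the whole of a (real) Banach space type whose norm is also homogeneous for
  the complex scalars.\<close>

locale banach_lie_module = lie_module scale bracket "\<lparr>mcarrier = UNIV, mscale = cscale, mact = act\<rparr>"
  for scale :: "complex \<Rightarrow> 'g::ab_group_add \<Rightarrow> 'g" and bracket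
    and cscale :: "complex \<Rightarrow> 'v::banach \<Rightarrow> 'v" and act :: "'g \<Rightarrow> 'v \<Rightarrow> 'v" +
  assumes cscale_of_real: "cscale (of_real r) v = r *\<^sub>R v"
    and norm_cscale: "norm (cscale c v) = cmod c * norm v"
    and bounded_act: "bounded_linear (act x)"

definition lmod_iso :: "('g, 'a::ab_group_add) lmod \<Rightarrow> ('g, 'b::ab_group_add) lmod \<Rightarrow> bool" where
  "lmod_iso M N \<longleftrightarrow> (\<exists>f. bij_betw f (mcarrier M) (mcarrier N) \<and>
     (\<forall>u\<in>mcarrier M. \<forall>v\<in>mcarrier M. f (u + v) = f u + f v) \<and>
     (\<forall>c. \<forall>v\<in>mcarrier M. f (mscale M c v) = mscale N c (f v)) \<and>
     (\<forall>x. \<forall>v\<in>mcarrier M. f (mact M x v) = mact N x (f v)))"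

text \<open>Isomorphism classes are formed in a universe independent of the module: modules carried by
  subspaces of \<open>nat \<Rightarrow> complex\<close>. Every module of countable dimension has an isomorphic copy there, so
  on finite-dimensional modules \<open>iso_class\<close> is a nonempty set and a complete isomorphism invariant.
  A module too large to have a copy would get the class \<open>{}\<close>, which is not a member of
  \<open>simple_dual\<close>.\<close>

type_synonym 'g coord_lmod = "('g, nat \<Rightarrow> complex) lmod"

definition iso_class ::
  "(complex \<Rightarrow> 'g::ab_group_add \<Rightarrow> 'g) \<Rightarrow> ('g \<Rightarrow> 'g \<Rightarrow> 'g) \<Rightarrow> ('g, 'a::ab_group_add) lmod \<Rightarrow> 'g coord_lmod set" where
  "iso_class scale bracket M = {N. lie_module scale bracket N \<and> lmod_iso M N}"

definition simple_dual ::
  "(complex \<Rightarrow> 'g::ab_group_add \<Rightarrow> 'g) \<Rightarrow> ('g \<Rightarrow> 'g \<Rightarrow> 'g) \<Rightarrow> 'g coord_lmod set set" where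
  "simple_dual scale bracket = {iso_class scale bracket S | S :: 'g coord_lmod.
     simple_lie_module scale bracket S \<and> fd_lie_module scale bracket S}"

text \<open>The dual as a right module. Functionals are extended by zero outside the carrier.\<close>

definition dual_lmod :: "('g, 'a::ab_group_add) lmod \<Rightarrow> ('g, 'a \<Rightarrow> complex) lmod" where
  "dual_lmod S =
    \<lparr>mcarrier = {\<phi>. (\<forall>s. s \<notin> mcarrier S \<longrightarrow> \<phi> s = 0) \<and>
       (\<forall>s\<in>mcarrier S. \<forall>t\<in>mcarrier S. \<phi> (s + t) = \<phi> s + \<phi> t) \<and>
       (\<forall>c. \<forall>s\<in>mcarrier S. \<phi> (mscale S c s) = c * \<phi> s)},
     mscale = (\<lambda>c \<phi> s. c * \<phi> s),
     mact = (\<lambda>x \<phi> s. if s \<in> mcarrier S then \<phi> (mact S x s) else 0)\<rparr>"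


section \<open>The universal enveloping algebra\<close>

text \<open>The free associative algebra on the set \<open>'g\<close>; a word is a list and an element is a finitely
  supported function on words.\<close>

definition free_algebra :: "('g list \<Rightarrow> complex) ring" where
  "free_algebra =
    \<lparr>carrier = {f. finite {w. f w \<noteq> 0}},
     monoid.mult = (\<lambda>f g w. \<Sum>i\<le>length w. f (take i w) * g (drop i w)),
     one = (\<lambda>w. if w = [] then 1 else 0),
     ring.zero = (\<lambda>w. 0),
     add = (\<lambda>f g w. f w + g w)\<rparr>"

definition word :: "'g list \<Rightarrow> 'g list \<Rightarrow> complex" where
  "word u = (\<lambda>w. if w = u then 1 else 0)"

text \<open>The first two families of relations turn the free algebra on the set \<open>'g\<close> into the tensor
  algebra of the vector space \<open>'g\<close>.\<close>

definition uea_relations ::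
  "(complex \<Rightarrow> 'g::ab_group_add \<Rightarrow> 'g) \<Rightarrow> ('g \<Rightarrow> 'g \<Rightarrow> 'g) \<Rightarrow> ('g list \<Rightarrow> complex) set" where
  "uea_relations scale bracket =
     {\<lambda>w. word [x + y] w - word [x] w - word [y] w | x y. True}
   \<union> {\<lambda>w. word [scale c x] w - c * word [x] w | c x. True}
   \<union> {\<lambda>w. word [x, y] w - word [y, x] w - word [bracket x y] w | x y. True}"

definition uea ::
  "(complex \<Rightarrow> 'g::ab_group_add \<Rightarrow> 'g) \<Rightarrow> ('g \<Rightarrow> 'g \<Rightarrow> 'g) \<Rightarrow> ('g list \<Rightarrow> complex) set ring" where
  "uea scale bracket =
     free_algebra Quot (Idl\<^bsub>free_algebra\<^esub> (uea_relations scale bracket))"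

text \<open>A Lie module as a module over the enveloping algebra: a word \<open>[x1, ..., xn]\<close> acts on the left
  by \<open>x1 \<cdot> (x2 \<cdot> ... (xn \<cdot> v))\<close> and on the right by \<open>((v \<cdot> x1) \<cdot> x2) ... \<cdot> xn\<close>, and a residue class
  acts through any representative. Here and below, the fields \<open>mult\<close> and \<open>one\<close> that the record
  type \<open>module\<close> inherits from \<open>ring\<close> play no role.\<close>

definition left_uea_module ::
  "('g, 'a::ab_group_add) lmod \<Rightarrow> (('g list \<Rightarrow> complex) set, 'a) module" where
  "left_uea_module M =
    \<lparr>carrier = mcarrier M, monoid.mult = undefined, one = undefined, ring.zero = 0, add = (+),
     smult = (\<lambda>u v. the_elem
       ((\<lambda>f. \<Sum>w | f w \<noteq> 0. mscale M (f w) (foldr (mact M) w v)) ` u))\<rparr>"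

definition right_uea_module ::
  "('g, 'a::ab_group_add) lmod \<Rightarrow> (('g list \<Rightarrow> complex) set, 'a) module" where
  "right_uea_module M =
    \<lparr>carrier = mcarrier M, monoid.mult = undefined, one = undefined, ring.zero = 0, add = (+),
     smult = (\<lambda>u v. the_elem
       ((\<lambda>f. \<Sum>w | f w \<noteq> 0. mscale M (f w) (fold (mact M) w v)) ` u))\<rparr>"


section \<open>Tensor products and Tor over a noncommutative ring\<close>

locale left_module = R: ring R + M: abelian_group M
  for R :: "('r, 'x) ring_scheme" and M :: "('r, 'm, 'y) module_scheme" +
  assumes smult_closed: "r \<in> carrier R \<Longrightarrow> m \<in> carrier M \<Longrightarrow> r \<odot>\<^bsub>M\<^esub> m \<in> carrier M"
    and smult_l_distr: "r \<in> carrier R \<Longrightarrow> s \<in> carrier R \<Longrightarrow> m \<in> carrier M \<Longrightarrow>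
      (r \<oplus>\<^bsub>R\<^esub> s) \<odot>\<^bsub>M\<^esub> m = r \<odot>\<^bsub>M\<^esub> m \<oplus>\<^bsub>M\<^esub> s \<odot>\<^bsub>M\<^esub> m"
    and smult_r_distr: "r \<in> carrier R \<Longrightarrow> m \<in> carrier M \<Longrightarrow> n \<in> carrier M \<Longrightarrow>
      r \<odot>\<^bsub>M\<^esub> (m \<oplus>\<^bsub>M\<^esub> n) = r \<odot>\<^bsub>M\<^esub> m \<oplus>\<^bsub>M\<^esub> r \<odot>\<^bsub>M\<^esub> n"
    and smult_assoc: "r \<in> carrier R \<Longrightarrow> s \<in> carrier R \<Longrightarrow> m \<in> carrier M \<Longrightarrow>
      (r \<otimes>\<^bsub>R\<^esub> s) \<odot>\<^bsub>M\<^esub> m = r \<odot>\<^bsub>M\<^esub> (s \<odot>\<^bsub>M\<^esub> m)"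
    and smult_one: "m \<in> carrier M \<Longrightarrow> \<one>\<^bsub>R\<^esub> \<odot>\<^bsub>M\<^esub> m = m"

definition left_module_hom :: "('r, 'x) ring_scheme \<Rightarrow> ('r, 'm, 'y) module_scheme \<Rightarrow>
    ('r, 'n, 'z) module_scheme \<Rightarrow> ('m \<Rightarrow> 'n) set" where
  "left_module_hom R M N = {h. h \<in> carrier M \<rightarrow> carrier N \<and>
     (\<forall>m\<in>carrier M. \<forall>m'\<in>carrier M. h (m \<oplus>\<^bsub>M\<^esub> m') = h m \<oplus>\<^bsub>N\<^esub> h m') \<and>
     (\<forall>r\<in>carrier R. \<forall>m\<in>carrier M. h (r \<odot>\<^bsub>M\<^esub> m) = r \<odot>\<^bsub>N\<^esub> h m)}"

definition free_module :: "('r, 'x) ring_scheme \<Rightarrow> 'b set \<Rightarrow> ('r, 'b \<Rightarrow> 'r) module" where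
  "free_module R B =
    \<lparr>carrier = {f. (\<forall>b. f b \<in> carrier R) \<and> (\<forall>b. b \<notin> B \<longrightarrow> f b = \<zero>\<^bsub>R\<^esub>) \<and> finite {b. f b \<noteq> \<zero>\<^bsub>R\<^esub>}},
     monoid.mult = undefined, one = undefined,
     ring.zero = (\<lambda>b. \<zero>\<^bsub>R\<^esub>),
     add = (\<lambda>f g b. f b \<oplus>\<^bsub>R\<^esub> g b),
     smult = (\<lambda>r f b. r \<otimes>\<^bsub>R\<^esub> f b)\<rparr>"

text \<open>For a right module, \<open>r \<odot> m\<close> stands for \<open>m \<cdot> r\<close>.\<close>

definition tensor_relations :: "('r, 'x) ring_scheme \<Rightarrow> ('r, 'm, 'y) module_scheme \<Rightarrow>
    ('r, 'n, 'z) module_scheme \<Rightarrow> ('m \<times> 'n \<Rightarrow>\<^sub>0 int) set" where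
  "tensor_relations R M N =
     {frag_of (m \<oplus>\<^bsub>M\<^esub> m', n) - frag_of (m, n) - frag_of (m', n) | m m' n.
        m \<in> carrier M \<and> m' \<in> carrier M \<and> n \<in> carrier N}
   \<union> {frag_of (m, n \<oplus>\<^bsub>N\<^esub> n') - frag_of (m, n) - frag_of (m, n') | m n n'.
        m \<in> carrier M \<and> n \<in> carrier N \<and> n' \<in> carrier N}
   \<union> {frag_of (r \<odot>\<^bsub>M\<^esub> m, n) - frag_of (m, r \<odot>\<^bsub>N\<^esub> n) | r m n.
        r \<in> carrier R \<and> m \<in> carrier M \<and> n \<in> carrier N}"

definition tensor_kernel :: "('r, 'x) ring_scheme \<Rightarrow> ('r, 'm, 'y) module_scheme \<Rightarrow>
    ('r, 'n, 'z) module_scheme \<Rightarrow> ('m \<times> 'n \<Rightarrow>\<^sub>0 int) set" where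
  "tensor_kernel R M N =
     generate (free_Abelian_group (carrier M \<times> carrier N)) (tensor_relations R M N)"

definition tensor :: "('r, 'x) ring_scheme \<Rightarrow> ('r, 'm, 'y) module_scheme \<Rightarrow>
    ('r, 'n, 'z) module_scheme \<Rightarrow> ('m \<times> 'n \<Rightarrow>\<^sub>0 int) set monoid" where
  "tensor R M N = free_Abelian_group (carrier M \<times> carrier N) Mod tensor_kernel R M N"

text \<open>The map \<open>id \<otimes> h : M \<otimes> N \<rightarrow> M \<otimes> N'\<close>, which sends a coset to the coset of the image of any
  representative.\<close>

definition tensor_map :: "('r, 'x) ring_scheme \<Rightarrow> ('r, 'm, 'y) module_scheme \<Rightarrow>
    ('r, 'n2, 'z) module_scheme \<Rightarrow> ('n \<Rightarrow> 'n2) \<Rightarrow>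
    ('m \<times> 'n \<Rightarrow>\<^sub>0 int) set \<Rightarrow> ('m \<times> 'n2 \<Rightarrow>\<^sub>0 int) set" where
  "tensor_map R M N' h t = the_elem
     ((\<lambda>a. tensor_kernel R M N' #>\<^bsub>free_Abelian_group (carrier M \<times> carrier N')\<^esub>
             frag_extend (\<lambda>(m, n). frag_of (m, h n)) a) ` t)"

definition free_resolution :: "('r, 'x) ring_scheme \<Rightarrow> ('r, 'n, 'y) module_scheme \<Rightarrow>
    (nat \<Rightarrow> 'b set) \<Rightarrow> (nat \<Rightarrow> ('b \<Rightarrow> 'r) \<Rightarrow> ('b \<Rightarrow> 'r)) \<Rightarrow> (('b \<Rightarrow> 'r) \<Rightarrow> 'n) \<Rightarrow> bool" where
  "free_resolution R N B d \<epsilon> \<longleftrightarrow>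
     \<epsilon> \<in> left_module_hom R (free_module R (B 0)) N \<and>
     (\<forall>k. d k \<in> left_module_hom R (free_module R (B (Suc k))) (free_module R (B k))) \<and>
     \<epsilon> ` carrier (free_module R (B 0)) = carrier N \<and>
     d 0 ` carrier (free_module R (B 1)) =
       {f \<in> carrier (free_module R (B 0)). \<epsilon> f = \<zero>\<^bsub>N\<^esub>} \<and>
     (\<forall>k. d (Suc k) ` carrier (free_module R (B (Suc (Suc k)))) =
       {f \<in> carrier (free_module R (B (Suc k))). d k f = \<zero>\<^bsub>free_module R (B k)\<^esub>})"

definition tensor_homology :: "('r, 'x) ring_scheme \<Rightarrow> nat \<Rightarrow> ('r, 'm, 'y) module_scheme \<Rightarrow>
    (nat \<Rightarrow> 'b set) \<Rightarrow> (nat \<Rightarrow> ('b \<Rightarrow> 'r) \<Rightarrow> ('b \<Rightarrow> 'r)) \<Rightarrow> ('m \<times> ('b \<Rightarrow> 'r) \<Rightarrow>\<^sub>0 int) set set monoid" where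
  "tensor_homology R k M B d =
    (let T = (\<lambda>j. tensor R M (free_module R (B j)));
         \<delta> = (\<lambda>j. tensor_map R M (free_module R (B j)) (d j));
         Z = (case k of 0 \<Rightarrow> carrier (T 0) | Suc j \<Rightarrow> kernel (T (Suc j)) (T j) (\<delta> j))
     in (T k)\<lparr>carrier := Z\<rparr> Mod (\<delta> k ` carrier (T (Suc k))))"

text \<open>\<open>Tor\<close> is computed from a chosen free resolution. The bases are taken in the type \<open>gen\<close>, which
  is large enough for every \<open>N\<close> to have a resolution (lemma \<open>free_resolution_exists\<close>): the elements
  of \<open>N\<close> and, recursively, finite linear combinations of generators, are again generators.\<close>

datatype ('r, 'n) gen = Elt 'n | Syz "('r \<times> ('r, 'n) gen) list"

definition tor :: "('r, 'x) ring_scheme \<Rightarrow> nat \<Rightarrow> ('r, 'm, 'y) module_scheme \<Rightarrow>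
    ('r, 'n, 'z) module_scheme \<Rightarrow> ('m \<times> (('r, 'n) gen \<Rightarrow> 'r) \<Rightarrow>\<^sub>0 int) set set monoid" where
  "tor R k M N = (case SOME (B, d, \<epsilon>). free_resolution R N B d \<epsilon> of
     (B, d, \<epsilon>) \<Rightarrow> tensor_homology R k M B d)"

definition left_submodule :: "('r, 'x) ring_scheme \<Rightarrow> ('r, 'm, 'y) module_scheme \<Rightarrow> 'm set \<Rightarrow> bool" where
  "left_submodule R M K \<longleftrightarrow> K \<subseteq> carrier M \<and> \<zero>\<^bsub>M\<^esub> \<in> K \<and>
     (\<forall>u\<in>K. \<forall>v\<in>K. u \<oplus>\<^bsub>M\<^esub> v \<in> K) \<and> (\<forall>r\<in>carrier R. \<forall>v\<in>K. r \<odot>\<^bsub>M\<^esub> v \<in> K)"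

lemma free_module_sel [simp]:
  "f \<in> carrier (free_module R B) \<longleftrightarrow>
     (\<forall>b. f b \<in> carrier R) \<and> (\<forall>b. b \<notin> B \<longrightarrow> f b = \<zero>\<^bsub>R\<^esub>) \<and> finite {b. f b \<noteq> \<zero>\<^bsub>R\<^esub>}"
  "\<zero>\<^bsub>free_module R B\<^esub> = (\<lambda>b. \<zero>\<^bsub>R\<^esub>)"
  "f \<oplus>\<^bsub>free_module R B\<^esub> g = (\<lambda>b. f b \<oplus>\<^bsub>R\<^esub> g b)"
  "r \<odot>\<^bsub>free_module R B\<^esub> f = (\<lambda>b. r \<otimes>\<^bsub>R\<^esub> f b)"
  by (auto simp: free_module_def)

lemma (in ring) left_module_free_module: "left_module R (free_module R B)"
proof -
  have fin_add: "finite {b. f b \<oplus> g b \<noteq> \<zero>}"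
    if "finite {b. f b \<noteq> \<zero>}" "finite {b. g b \<noteq> \<zero>}" for f g :: "'c \<Rightarrow> 'a"
    by (rule finite_subset[OF _ finite_UnI[OF that]]) auto
  have fin_smult: "finite {b. r \<otimes> f b \<noteq> \<zero>}"
    if "finite {b. f b \<noteq> \<zero>}" "r \<in> carrier R" for r and f :: "'c \<Rightarrow> 'a"
    by (rule finite_subset[OF _ that(1)]) (use that(2) in auto)
  have inv: "\<exists>g\<in>carrier (free_module R B). g \<oplus>\<^bsub>free_module R B\<^esub> f = \<zero>\<^bsub>free_module R B\<^esub>"
    if "f \<in> carrier (free_module R B)" for f
  proof (rule bexI[of _ "\<lambda>b. \<ominus> f b"])
    have "{b. \<ominus> f b \<noteq> \<zero>} \<subseteq> {b. f b \<noteq> \<zero>}" by auto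
    then show "(\<lambda>b. \<ominus> f b) \<in> carrier (free_module R B)"
      using that by (auto intro: finite_subset)
  qed (use that in \<open>auto simp: l_neg\<close>)
  have "abelian_group (free_module R B)"
    by (rule abelian_groupI) (use inv in \<open>auto simp: fin_add a_ac\<close>)
  then show ?thesis
    unfolding left_module_def left_module_axioms_def
    by (auto simp: ring_axioms fin_smult l_distr r_distr m_assoc)
qed

context left_module
begin

lemma smult_zero_left: "m \<in> carrier M \<Longrightarrow> \<zero>\<^bsub>R\<^esub> \<odot>\<^bsub>M\<^esub> m = \<zero>\<^bsub>M\<^esub>"
  using smult_l_distr[of "\<zero>\<^bsub>R\<^esub>" "\<zero>\<^bsub>R\<^esub>" m] smult_closed[of "\<zero>\<^bsub>R\<^esub>" m]
  by (metis M.add.l_cancel_one' R.add.r_one R.zero_closed)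

lemma smult_zero_right: "r \<in> carrier R \<Longrightarrow> r \<odot>\<^bsub>M\<^esub> \<zero>\<^bsub>M\<^esub> = \<zero>\<^bsub>M\<^esub>"
  using smult_r_distr[of r "\<zero>\<^bsub>M\<^esub>" "\<zero>\<^bsub>M\<^esub>"] smult_closed[of r "\<zero>\<^bsub>M\<^esub>"]
  by (metis M.add.l_cancel_one' M.add.r_one M.zero_closed)

lemma smult_finsum:
  assumes "finite A" "r \<in> carrier R" "h \<in> A \<rightarrow> carrier M"
  shows "r \<odot>\<^bsub>M\<^esub> finsum M h A = finsum M (\<lambda>a. r \<odot>\<^bsub>M\<^esub> h a) A"
  using assms by (induction A) (auto simp: smult_zero_right Pi_def smult_r_distr smult_closed)

lemma finsum_in_submodule:
  assumes "finite A" "h \<in> A \<rightarrow> K" "K \<subseteq> carrier M" "\<zero>\<^bsub>M\<^esub> \<in> K"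
    and "\<And>u v. u \<in> K \<Longrightarrow> v \<in> K \<Longrightarrow> u \<oplus>\<^bsub>M\<^esub> v \<in> K"
  shows "finsum M h A \<in> K"
  using assms(1,2)
proof induction
  case (insert a A)
  then have "h \<in> A \<rightarrow> carrier M" "h a \<in> carrier M" using assms(3) by auto
  then show ?case using insert assms(5) by auto
qed (use assms in auto)

text \<open>A submodule \<open>K\<close> is the image of a free module on any set of generators.\<close>

lemma free_cover:
  assumes sub: "left_submodule R M K" and v: "v ` B = K"
  shows "\<exists>e\<in>left_module_hom R (free_module R B) M. e ` carrier (free_module R B) = K"
proof -
  have K: "K \<subseteq> carrier M" "\<zero>\<^bsub>M\<^esub> \<in> K"
      "\<And>u v. u \<in> K \<Longrightarrow> v \<in> K \<Longrightarrow> u \<oplus>\<^bsub>M\<^esub> v \<in> K"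
      "\<And>r v. r \<in> carrier R \<Longrightarrow> v \<in> K \<Longrightarrow> r \<odot>\<^bsub>M\<^esub> v \<in> K"
    using sub by (auto simp: left_submodule_def)
  define e where "e f = finsum M (\<lambda>b. f b \<odot>\<^bsub>M\<^esub> v b) {b. f b \<noteq> \<zero>\<^bsub>R\<^esub>}" for f
  let ?F = "free_module R B"
  have vM: "v b \<in> carrier M" if "b \<in> B" for b using that v K(1) by auto
  have terms: "(\<lambda>b. f b \<odot>\<^bsub>M\<^esub> v b) \<in> A \<rightarrow> carrier M" if "f \<in> carrier ?F" "A \<subseteq> B" for f A
    using that vM by (auto intro!: smult_closed)
  have supp: "{b. f b \<noteq> \<zero>\<^bsub>R\<^esub>} \<subseteq> B" if "f \<in> carrier ?F" for f
    using that by auto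
  have e_eq: "e f = finsum M (\<lambda>b. f b \<odot>\<^bsub>M\<^esub> v b) A"
    if f: "f \<in> carrier ?F" and A: "finite A" "{b. f b \<noteq> \<zero>\<^bsub>R\<^esub>} \<subseteq> A" "A \<subseteq> B" for f A
    unfolding e_def
  proof (rule M.add.finprod_mono_neutral_cong_left)
    show "\<And>i. i \<in> A - {b. f b \<noteq> \<zero>\<^bsub>R\<^esub>} \<Longrightarrow> f i \<odot>\<^bsub>M\<^esub> v i = \<zero>\<^bsub>M\<^esub>"
      using A vM by (auto simp: smult_zero_left)
  qed (use f A terms[OF f A(3)] in auto)
  have e_K: "e f \<in> K" if f: "f \<in> carrier ?F" for f
    unfolding e_def
  proof (rule finsum_in_submodule[OF _ _ K(1,2,3)])
    show "(\<lambda>b. f b \<odot>\<^bsub>M\<^esub> v b) \<in> {b. f b \<noteq> \<zero>\<^bsub>R\<^esub>} \<rightarrow> K"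
    proof
      fix b assume "b \<in> {b. f b \<noteq> \<zero>\<^bsub>R\<^esub>}"
      then have "v b \<in> K" using supp[OF f] v by auto
      then show "f b \<odot>\<^bsub>M\<^esub> v b \<in> K" using f by (intro K(4)) auto
    qed
  qed (use f in auto)
  have e_add: "e (\<lambda>b. f b \<oplus>\<^bsub>R\<^esub> g b) = e f \<oplus>\<^bsub>M\<^esub> e g"
    if f: "f \<in> carrier ?F" and g: "g \<in> carrier ?F" for f g
  proof -
    let ?A = "{b. f b \<noteq> \<zero>\<^bsub>R\<^esub>} \<union> {b. g b \<noteq> \<zero>\<^bsub>R\<^esub>}"
    interpret F: left_module R ?F by (rule R.left_module_free_module)
    have fg: "(\<lambda>b. f b \<oplus>\<^bsub>R\<^esub> g b) \<in> carrier ?F"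
      using F.M.a_closed[OF f g] by simp
    have A: "finite ?A" "?A \<subseteq> B" using f g by auto
    have "e (\<lambda>b. f b \<oplus>\<^bsub>R\<^esub> g b) = finsum M (\<lambda>b. (f b \<oplus>\<^bsub>R\<^esub> g b) \<odot>\<^bsub>M\<^esub> v b) ?A"
      by (rule e_eq[OF fg A(1) _ A(2)]) auto
    also have "\<dots> = finsum M (\<lambda>b. f b \<odot>\<^bsub>M\<^esub> v b \<oplus>\<^bsub>M\<^esub> g b \<odot>\<^bsub>M\<^esub> v b) ?A"
      using f g A vM by (intro M.finsum_cong') (auto simp: smult_l_distr smult_closed Pi_def subset_iff)
    also have "\<dots> = finsum M (\<lambda>b. f b \<odot>\<^bsub>M\<^esub> v b) ?A \<oplus>\<^bsub>M\<^esub> finsum M (\<lambda>b. g b \<odot>\<^bsub>M\<^esub> v b) ?A"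
      by (rule M.finsum_addf[OF terms[OF f A(2)] terms[OF g A(2)]])
    also have "\<dots> = e f \<oplus>\<^bsub>M\<^esub> e g"
      using e_eq[OF f A(1) _ A(2)] e_eq[OF g A(1) _ A(2)] by auto
    finally show ?thesis .
  qed
  have e_smult: "e (\<lambda>b. r \<otimes>\<^bsub>R\<^esub> f b) = r \<odot>\<^bsub>M\<^esub> e f"
    if f: "f \<in> carrier ?F" and r: "r \<in> carrier R" for f r
  proof -
    let ?A = "{b. f b \<noteq> \<zero>\<^bsub>R\<^esub>}"
    interpret F: left_module R ?F by (rule R.left_module_free_module)
    have rf: "(\<lambda>b. r \<otimes>\<^bsub>R\<^esub> f b) \<in> carrier ?F"
      using F.smult_closed[OF r f] by simp
    have A: "finite ?A" "?A \<subseteq> B" using f by auto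
    have "e (\<lambda>b. r \<otimes>\<^bsub>R\<^esub> f b) = finsum M (\<lambda>b. (r \<otimes>\<^bsub>R\<^esub> f b) \<odot>\<^bsub>M\<^esub> v b) ?A"
      by (rule e_eq[OF rf A(1) _ A(2)]) (use r in auto)
    also have "\<dots> = finsum M (\<lambda>b. r \<odot>\<^bsub>M\<^esub> (f b \<odot>\<^bsub>M\<^esub> v b)) ?A"
      using f r A vM by (intro M.finsum_cong') (auto simp: smult_assoc smult_closed Pi_def subset_iff)
    also have "\<dots> = r \<odot>\<^bsub>M\<^esub> e f"
      unfolding e_def by (rule smult_finsum[OF A(1) r terms[OF f A(2)], symmetric])
    finally show ?thesis .
  qed
  have "e ` carrier ?F = K"
  proof (intro equalityI subsetI)
    fix k assume "k \<in> K"
    then obtain b where b: "b \<in> B" "k = v b" using v by auto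
    let ?f = "\<lambda>c. if c = b then \<one>\<^bsub>R\<^esub> else \<zero>\<^bsub>R\<^esub>"
    have f: "?f \<in> carrier ?F" using b by auto
    have "e ?f = finsum M (\<lambda>c. ?f c \<odot>\<^bsub>M\<^esub> v c) {b}"
      by (rule e_eq[OF f]) (use b in auto)
    also have "\<dots> = k" using b vM smult_one by (simp add: M.add.finprod_insert)
    finally show "k \<in> e ` carrier ?F" using f by blast
  qed (use e_K in auto)
  moreover have "e \<in> left_module_hom R ?F M"
    unfolding left_module_hom_def using e_add e_smult e_K K(1) by (auto simp del: free_module_sel(1))
  ultimately show ?thesis by blast
qed

end

lemma left_module_hom_kernel:
  assumes "left_module R M" "left_module R N" "h \<in> left_module_hom R M N"
  shows "left_submodule R M {m \<in> carrier M. h m = \<zero>\<^bsub>N\<^esub>}"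
proof -
  interpret M: left_module R M by fact
  interpret N: left_module R N by fact
  have h: "h \<in> carrier M \<rightarrow> carrier N"
    "\<And>m m'. m \<in> carrier M \<Longrightarrow> m' \<in> carrier M \<Longrightarrow> h (m \<oplus>\<^bsub>M\<^esub> m') = h m \<oplus>\<^bsub>N\<^esub> h m'"
    "\<And>r m. r \<in> carrier R \<Longrightarrow> m \<in> carrier M \<Longrightarrow> h (r \<odot>\<^bsub>M\<^esub> m) = r \<odot>\<^bsub>N\<^esub> h m"
    using assms(3) by (auto simp: left_module_hom_def)
  have z: "h \<zero>\<^bsub>M\<^esub> = \<zero>\<^bsub>N\<^esub>"
    using h(3)[of "\<zero>\<^bsub>R\<^esub>" "\<zero>\<^bsub>M\<^esub>"] h(1) M.smult_zero_left N.smult_zero_left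
    by (metis M.M.zero_closed M.R.zero_closed PiE)
  show ?thesis
    by (auto simp: left_submodule_def h z M.smult_closed N.smult_zero_right)
qed

lemma gen_encoding:
  "\<exists>c :: (('r, 'n) gen \<Rightarrow> 'r) \<Rightarrow> ('r, 'n) gen. inj_on c {f. finite {b. f b \<noteq> z}}"
proof -
  define c :: "(('r, 'n) gen \<Rightarrow> 'r) \<Rightarrow> ('r, 'n) gen" where
    "c f = Syz (SOME xs. set xs = (\<lambda>b. (f b, b)) ` {b. f b \<noteq> z})" for f
  have c: "\<exists>xs. c f = Syz xs \<and> set xs = (\<lambda>b. (f b, b)) ` {b. f b \<noteq> z}"
    if "finite {b. f b \<noteq> z}" for f
    using someI_ex[OF finite_list[OF finite_imageI[OF that, of "\<lambda>b. (f b, b)"]]] by (auto simp: c_def)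
  have "f = g" if fin: "finite {b. f b \<noteq> z}" "finite {b. g b \<noteq> z}" and eq: "c f = c g" for f g
  proof
    fix b
    have "(\<lambda>b. (f b, b)) ` {b. f b \<noteq> z} = (\<lambda>b. (g b, b)) ` {b. g b \<noteq> z}"
      using c[OF fin(1)] c[OF fin(2)] eq by auto
    then show "f b = g b" by (auto simp: set_eq_iff image_iff) metis
  qed
  then show ?thesis by (auto simp: inj_on_def)
qed

lemma free_resolution_exists:
  fixes R :: "('r, 'x) ring_scheme" and N :: "('r, 'n, 'y) module_scheme"
  assumes "left_module R N"
  shows "\<exists>(B :: nat \<Rightarrow> ('r, 'n) gen set) d \<epsilon>. free_resolution R N B d \<epsilon>"
proof -
  interpret N: left_module R N by fact
  obtain c :: "(('r, 'n) gen \<Rightarrow> 'r) \<Rightarrow> ('r, 'n) gen" where c: "inj_on c {f. finite {b. f b \<noteq> \<zero>\<^bsub>R\<^esub>}}"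
    using gen_encoding[of "\<zero>\<^bsub>R\<^esub>"] by (elim exE)
  have free: "left_module R (free_module R B)" for B :: "('r, 'n) gen set"
    by (rule N.R.left_module_free_module)
  have cover: "\<exists>B' :: ('r, 'n) gen set. \<exists>e\<in>left_module_hom R (free_module R B') (free_module R B).
      e ` carrier (free_module R B') = K"
    if K: "left_submodule R (free_module R B) K"
    for B :: "('r, 'n) gen set" and K
  proof -
    interpret F: left_module R "free_module R B" by (rule free)
    have "inj_on c K" by (rule inj_on_subset[OF c]) (use K in \<open>auto simp: left_submodule_def\<close>)
    then have "inv_into K c ` (c ` K) = K" by (simp add: inv_into_image_cancel)
    from F.free_cover[OF K this] show ?thesis by (rule exI)
  qed
  have elt: "(\<lambda>g. case g of Elt n \<Rightarrow> n | Syz _ \<Rightarrow> \<zero>\<^bsub>N\<^esub>) ` (Elt ` carrier N :: ('r, 'n) gen set) = carrier N"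
    by (simp add: image_image)
  have "\<exists>e\<in>left_module_hom R (free_module R (Elt ` carrier N :: ('r, 'n) gen set)) N.
      e ` carrier (free_module R (Elt ` carrier N :: ('r, 'n) gen set)) = carrier N"
    by (rule N.free_cover[OF _ elt]) (simp add: left_submodule_def N.smult_closed)
  then obtain B0 :: "('r, 'n) gen set" and \<epsilon> where
    \<epsilon>: "\<epsilon> \<in> left_module_hom R (free_module R B0) N" "\<epsilon> ` carrier (free_module R B0) = carrier N"
    by blast
  define Q where "Q = (\<lambda>(B, B', d).
    d \<in> left_module_hom R (free_module R (B' :: ('r, 'n) gen set)) (free_module R (B :: ('r, 'n) gen set)))"
  define S where "S = (\<lambda>(B, B', d) (C, C', d').
    C = B' \<and> d' ` carrier (free_module R (C' :: ('r, 'n) gen set)) =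
      {f \<in> carrier (free_module R (B' :: ('r, 'n) gen set)). d f = \<zero>\<^bsub>free_module R (B :: ('r, 'n) gen set)\<^esub>})"
  obtain B1 :: "('r, 'n) gen set" and d0 where d0: "d0 \<in> left_module_hom R (free_module R B1) (free_module R B0)"
    "d0 ` carrier (free_module R B1) = {f \<in> carrier (free_module R B0). \<epsilon> f = \<zero>\<^bsub>N\<^esub>}"
    using cover[OF left_module_hom_kernel[OF free assms \<epsilon>(1)]] by blast
  have "\<exists>t. \<forall>k. (Q (t k) \<and> (k = 0 \<longrightarrow> t k = (B0, B1, d0))) \<and> S (t k) (t (Suc k))"
  proof (rule dependent_nat_choice)
    show "\<exists>x. Q x \<and> (0 = (0::nat) \<longrightarrow> x = (B0, B1, d0))"
      using d0 by (auto simp: Q_def)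
  next
    fix x and k :: nat
    assume x: "Q x \<and> (k = 0 \<longrightarrow> x = (B0, B1, d0))"
    obtain B B' d where xe: "x = (B, B', d)" by (cases x)
    have d: "d \<in> left_module_hom R (free_module R B') (free_module R B)"
      using x by (simp add: xe Q_def)
    show "\<exists>y. (Q y \<and> (Suc k = 0 \<longrightarrow> y = (B0, B1, d0))) \<and> S x y"
    proof -
      obtain C :: "('r, 'n) gen set" and e where "e \<in> left_module_hom R (free_module R C) (free_module R B')"
        "e ` carrier (free_module R C) =
          {f \<in> carrier (free_module R B'). d f = \<zero>\<^bsub>free_module R B\<^esub>}"
        using cover[OF left_module_hom_kernel[OF free free d]] by blast
      then show ?thesis
        by (intro exI[of _ "(B', C, e)"]) (simp only: xe Q_def S_def prod.case, simp)
    qed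
  qed
  then obtain t where t': "\<And>k. (Q (t k) \<and> (k = 0 \<longrightarrow> t k = (B0, B1, d0))) \<and> S (t k) (t (Suc k))"
    by (elim exE) (rule that, erule spec)
  have t: "Q (t k)" "t 0 = (B0, B1, d0)" "S (t k) (t (Suc k))" for k
    using t'[of k] t'[of 0] by (simp_all only: simp_thms)
  define B where "B k = fst (t k)" for k
  define d where "d k = snd (snd (t k))" for k
  have tk: "t k = (B k, B (Suc k), d k)" for k
  proof -
    obtain C C' e D D' e' where *: "t k = (C, C', e)" "t (Suc k) = (D, D', e')"
      by (metis surj_pair)
    have "D = C'" using t(3)[of k] by (simp only: * S_def prod.case)
    then show ?thesis by (simp add: B_def d_def *)
  qed
  have B01: "B 0 = B0" "B 1 = B1" "d 0 = d0"
    using t(2) tk[of 0] by (simp_all only: prod.inject One_nat_def)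
  have "free_resolution R N B d \<epsilon>"
    unfolding free_resolution_def
  proof (intro conjI allI)
    fix k
    show "d k \<in> left_module_hom R (free_module R (B (Suc k))) (free_module R (B k))"
      using t(1)[of k] by (simp only: tk Q_def prod.case)
    show "d (Suc k) ` carrier (free_module R (B (Suc (Suc k)))) =
       {f \<in> carrier (free_module R (B (Suc k))). d k f = \<zero>\<^bsub>free_module R (B k)\<^esub>}"
      using t(3)[of k] by (simp only: tk S_def prod.case)
  qed (use \<epsilon> d0 B01 in \<open>simp_all only:\<close>)
  then show ?thesis by blast
qed


section \<open>The Taylor spectrum\<close>

definition taylor_tor ::
  "(complex \<Rightarrow> 'g::ab_group_add \<Rightarrow> 'g) \<Rightarrow> ('g \<Rightarrow> 'g \<Rightarrow> 'g) \<Rightarrow> nat \<Rightarrow>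
    ('g, 's::ab_group_add) lmod \<Rightarrow> ('g, 'v::ab_group_add) lmod \<Rightarrow>
    (('s \<Rightarrow> complex) \<times> (((('g list \<Rightarrow> complex) set, 'v) gen) \<Rightarrow> ('g list \<Rightarrow> complex) set) \<Rightarrow>\<^sub>0 int) set set monoid" where
  "taylor_tor scale bracket k S V =
     tor (uea scale bracket) k (right_uea_module (dual_lmod S)) (left_uea_module V)"

definition taylor_spectrum ::
  "(complex \<Rightarrow> 'g::ab_group_add \<Rightarrow> 'g) \<Rightarrow> ('g \<Rightarrow> 'g \<Rightarrow> 'g) \<Rightarrow> ('g, 'v::ab_group_add) lmod \<Rightarrow> 'g coord_lmod set set" where
  "taylor_spectrum scale bracket V = {c \<in> simple_dual scale bracket.
     \<exists>S\<in>c. \<exists>k. carrier (taylor_tor scale bracket k S V) \<noteq> {\<one>\<^bsub>taylor_tor scale bracket k S V\<^esub>}}"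

definition simple_submodule_classes ::
  "(complex \<Rightarrow> 'g::ab_group_add \<Rightarrow> 'g) \<Rightarrow> ('g \<Rightarrow> 'g \<Rightarrow> 'g) \<Rightarrow> ('g, 'v::ab_group_add) lmod \<Rightarrow> 'g coord_lmod set set" where
  "simple_submodule_classes scale bracket V = {iso_class scale bracket (V\<lparr>mcarrier := W\<rparr>) | W.
     lie_module.submodule V W \<and> simple_lie_module scale bracket (V\<lparr>mcarrier := W\<rparr>)}"

end

theory Submission
  imports Defs "HOL-Computational_Algebra.Polynomial" "HOL-Computational_Algebra.Fundamental_Theorem_Algebra"
begin

text \<open>As an ideal with trivial orthogonal complement, the span of the elements \<open>x\<close> lying in a generalized
  eigenspace of some \<open>ad h\<close> for an eigenvalue \<open>l \<noteq> 0\<close> is all of the semisimple Lie algebra. On a Banach module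
  \<open>V\<close> such an \<open>x\<close> acts nilpotently, because its powers are eigenvectors of \<open>ad h\<close> for the eigenvalues \<open>n l\<close>,
  which a bounded operator admits for finitely many \<open>n\<close> only. Hence the enveloping algebra \<open>U\<close> acts on \<open>V\<close>
  through a finite-dimensional algebra, and submodules of \<open>V\<close> are complemented as in Weyl's theorem.

  If \<open>S\<close> embeds in \<open>V\<close>, an equivariant projection of \<open>V\<close> onto its image gives a nonzero balanced map
  \<open>(\<phi>, v) \<mapsto> \<phi> (p v)\<close> on \<open>S\<^sup>* \<times> V\<close>, so \<open>Tor\<^sub>0 \<noteq> 0\<close>. If \<open>S\<close> does not embed, then the annihilator of \<open>V\<close>
  in \<open>U\<close> acts nontrivially on \<open>S\<close>, and, again by complete reducibility, it contains a central element that is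
  \<open>1\<close> on \<open>S\<close>; as it is \<open>0\<close> on \<open>V\<close>, it acts on \<open>Tor\<close> both as \<open>1\<close> and as \<open>0\<close>.\<close>

section \<open>Polynomials in an operator\<close>

text \<open>Weyl's argument needs finite dimension, which \<open>V\<close> may lack. Complete
  reducibility is therefore used only through \<open>invariant_vector\<close>: on a
  finite-dimensional representation, a nonzero functional that vanishes on all
  \<open>act x v\<close> is nonzero at some invariant vector. What remains is to find, each time, a
  finite-dimensional space with such a functional. For a complement of \<open>W\<close> it is the
  space generated under commutators by a linear projection onto \<open>W\<close>, with the scalar by
  which an operator acts on \<open>W\<close> as functional; it is finite-dimensional because the
  image of \<open>U\<close> is. For the central element it is a piece of the length filtration of
  \<open>U\<close>, cut down to the annihilator of \<open>V\<close>: commutators with elements of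
  the Lie algebra do not increase word length. The Lie theory works with the generalized eigenspaces
  of one \<open>ad h\<close> at a time, \<open>h\<close> being arbitrary, so neither a Cartan
  subalgebra nor a root system is chosen.\<close>

lemma bezout_linear_power:
  fixes q :: "complex poly"
  assumes "poly q l \<noteq> 0"
  shows "\<exists>a b. a * q + b * [:-l, 1:] ^ k = 1"
proof -
  define c where "c = poly q l"
  have "poly (1 - smult (1/c) q) l = 0" using assms by (simp add: c_def)
  then obtain r where r: "1 - smult (1/c) q = [:-l, 1:] * r" by (metis dvdE poly_eq_0_iff_dvd)
  \<comment> \<open>\<open>y\<close> is a multiple of \<open>[:-l, 1:]\<close> and
    \<open>1 - y\<close> is one of \<open>q\<close>, so factoring \<open>1 - y ^ k\<close> yields
    both cofactors at once.\<close>
  define y where "y = 1 - smult (1/c) q"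
  have "1 - y ^ k = (1 - y) * (\<Sum>i<k. y ^ i)" by (rule one_diff_power_eq)
  also have "\<dots> = smult (1/c) (\<Sum>i<k. y ^ i) * q"
    by (simp add: y_def mult.commute)
  finally have "smult (1/c) (\<Sum>i<k. y ^ i) * q + r ^ k * [:-l, 1:] ^ k = 1"
    unfolding r[folded y_def] power_mult_distrib mult.commute[of "r ^ k"] diff_eq_eq by (rule sym)
  then show ?thesis by blast
qed

locale complex_space = vector_space scale
  for scale :: "complex \<Rightarrow> 'b::ab_group_add \<Rightarrow> 'b"  (infixr "*s" 75)
begin

text \<open>Operators are linear on the whole type and finite-dimensional spaces enter as stable
  subspaces, so restricting an operator needs no new type.\<close>

definition endo :: "('b \<Rightarrow> 'b) \<Rightarrow> bool" where
  "endo T \<longleftrightarrow> (\<forall>u v. T (u + v) = T u + T v) \<and> (\<forall>c v. T (c *s v) = c *s T v)"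

lemma endo_add: "endo T \<Longrightarrow> T (u + v) = T u + T v"
  and endo_scale: "endo T \<Longrightarrow> T (c *s v) = c *s T v"
  by (auto simp: endo_def)

lemma endo_linear: "endo T \<longleftrightarrow> Vector_Spaces.linear scale scale T"
  using vector_space_axioms by (auto simp: endo_def Vector_Spaces.linear_iff)

lemma endo_zero: "endo T \<Longrightarrow> T 0 = 0"
  using endo_scale[of T 0 0] by simp

lemma endo_minus: "endo T \<Longrightarrow> T (- v) = - T v"
  using endo_scale[of T "-1" v] by simp

lemma endo_diff: "endo T \<Longrightarrow> T (u - v) = T u - T v"
  using endo_add[of T u "- v"] endo_minus[of T v] by simp

lemma endo_sum: "endo T \<Longrightarrow> T (\<Sum>i\<in>A. f i) = (\<Sum>i\<in>A. T (f i))"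
  by (induction A rule: infinite_finite_induct) (auto simp: endo_zero endo_add)

lemma endo_id: "endo (\<lambda>v. v)"
  and endo_comp: "endo S \<Longrightarrow> endo T \<Longrightarrow> endo (\<lambda>v. S (T v))"
  and endo_plus: "endo S \<Longrightarrow> endo T \<Longrightarrow> endo (\<lambda>v. S v + T v)"
  and endo_scaled: "endo T \<Longrightarrow> endo (\<lambda>v. c *s T v)"
  by (auto simp: endo_def scale_right_distrib algebra_simps)

lemma endo_subtract: "endo S \<Longrightarrow> endo T \<Longrightarrow> endo (\<lambda>v. S v - T v)"
  by (auto simp: endo_def algebra_simps scale_right_diff_distrib)

lemma endo_summed: "(\<And>i. i \<in> A \<Longrightarrow> endo (f i)) \<Longrightarrow> endo (\<lambda>v. \<Sum>i\<in>A. f i v)"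
  by (auto simp: endo_def sum.distrib scale_sum_right)

lemma endo_funpow: "endo T \<Longrightarrow> endo (T ^^ n)"
  by (induction n) (auto simp: endo_def)

lemma endo_span_image:
  assumes "endo T" "v \<in> span A" shows "T v \<in> span (T ` A)"
  by (rule span_induct_alt[OF assms(2)])
    (use assms(1) in \<open>auto simp: endo_zero endo_add endo_scale intro: span_zero span_add span_scale[OF span_base]\<close>)

lemma endo_image_subspace:
  assumes "endo T" "subspace E" shows "subspace (T ` E)"
proof (rule subspaceI)
  show "0 \<in> T ` E" using assms subspace_0 endo_zero by (metis image_eqI)
  show "x + y \<in> T ` E" if "x \<in> T ` E" "y \<in> T ` E" for x y
    using that assms(2) by (auto simp: subspace_add simp flip: endo_add[OF assms(1)])
  show "c *s x \<in> T ` E" if "x \<in> T ` E" for c x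
    using that assms(2) by (auto simp: subspace_scale simp flip: endo_scale[OF assms(1)])
qed

text \<open>Evaluation of \<open>p\<close> at \<open>T\<close>, the structure of a module over the
  polynomial ring.\<close>

definition papply :: "('b \<Rightarrow> 'b) \<Rightarrow> complex poly \<Rightarrow> 'b \<Rightarrow> 'b" where
  "papply T p v = (\<Sum>i\<le>degree p. coeff p i *s (T ^^ i) v)"

lemma papply_sum:
  assumes "degree p \<le> n" shows "papply T p v = (\<Sum>i\<le>n. coeff p i *s (T ^^ i) v)"
  unfolding papply_def
  by (rule sum.mono_neutral_left) (use assms in \<open>auto simp: coeff_eq_0\<close>)

lemma papply_0 [simp]: "papply T 0 v = 0"
  by (simp add: papply_def)

lemma papply_const [simp]: "papply T [:a:] v = a *s v"
  by (simp add: papply_def)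

lemma papply_1 [simp]: "papply T 1 v = v"
  by (simp add: papply_def)

lemma papply_pCons:
  assumes "endo T" shows "papply T (pCons a p) v = a *s v + T (papply T p v)"
proof -
  have "papply T (pCons a p) v = (\<Sum>i\<le>Suc (degree p). coeff (pCons a p) i *s (T ^^ i) v)"
    by (rule papply_sum) (simp add: degree_pCons_le)
  also have "\<dots> = a *s v + (\<Sum>i\<le>degree p. coeff p i *s T ((T ^^ i) v))"
    by (subst sum.atMost_Suc_shift) simp
  also have "\<dots> = a *s v + T (papply T p v)"
    using assms by (simp add: papply_def endo_sum endo_scale)
  finally show ?thesis .
qed

lemma endo_papply: "endo T \<Longrightarrow> endo (papply T p)"
  by (induction p) (auto simp: papply_pCons endo_def algebra_simps scale_right_distrib)

lemma papply_comm: "endo T \<Longrightarrow> papply T p (T v) = T (papply T p v)"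
  by (induction p) (auto simp: papply_pCons endo_zero endo_add endo_scale)

lemma papply_add: "endo T \<Longrightarrow> papply T (p + q) v = papply T p v + papply T q v"
  by (induction p q rule: poly_induct2) (auto simp: papply_pCons algebra_simps scale_left_distrib endo_add)

lemma papply_smult: "endo T \<Longrightarrow> papply T (smult c p) v = c *s papply T p v"
  by (induction p) (auto simp: papply_pCons scale_right_distrib endo_scale)

lemma papply_diff: "endo T \<Longrightarrow> papply T (p - q) v = papply T p v - papply T q v"
  using papply_add[of T p "- q" v] papply_smult[of T "-1" q v] by simp

lemma papply_mult: "endo T \<Longrightarrow> papply T (p * q) v = papply T p (papply T q v)"
  by (induction p) (auto simp: papply_pCons papply_add papply_smult endo_papply mult_pCons_left)

lemma papply_in_subspace:
  assumes "endo T" "subspace E" "\<And>v. v \<in> E \<Longrightarrow> T v \<in> E" "v \<in> E"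
  shows "papply T p v \<in> E"
  using assms by (induction p) (auto simp: papply_pCons subspace_0 subspace_add subspace_scale)

lemma papply_zero: "endo T \<Longrightarrow> papply T p 0 = 0"
  by (simp add: endo_papply endo_zero)

lemma papply_linear: "endo T \<Longrightarrow> papply T [:-l, 1:] v = T v - l *s v"
  by (simp add: papply_pCons)

lemma papply_eigenvector: "endo T \<Longrightarrow> T v = l *s v \<Longrightarrow> papply T p v = poly p l *s v"
  by (induction p) (auto simp: papply_pCons endo_scale scale_left_distrib mult.commute)

section \<open>Generalized eigenspaces\<close>

definition gen_eig :: "('b \<Rightarrow> 'b) \<Rightarrow> complex \<Rightarrow> 'b set" where
  "gen_eig T l = {v. \<exists>k. papply T ([:-l, 1:] ^ k) v = 0}"

lemma papply_power_zero_mono: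
  assumes "endo T" "papply T (p ^ k) v = 0" "k \<le> n" shows "papply T (p ^ n) v = 0"
proof -
  have "p ^ n = p ^ (n - k) * p ^ k" using assms(3) by (simp flip: power_add)
  then show ?thesis using assms by (simp add: papply_mult papply_zero)
qed

text \<open>Local nilpotency is mostly stated as membership in \<open>gen_eig T 0\<close> from here
  on.\<close>

lemma gen_eig_0_iff: "endo T \<Longrightarrow> v \<in> gen_eig T 0 \<longleftrightarrow> (\<exists>k. (T ^^ k) v = 0)"
proof -
  assume T: "endo T"
  have "papply T ([:0, 1:] ^ k) v = (T ^^ k) v" for k v
    by (induction k arbitrary: v) (simp_all add: papply_mult[OF T] papply_pCons[OF T] papply_comm[OF T] endo_zero[OF T]
        del: mult_pCons_left mult_pCons_right)
  then show ?thesis by (simp add: gen_eig_def)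
qed

lemma subspace_gen_eig: assumes "endo T" shows "subspace (gen_eig T l)"
proof (rule subspaceI)
  show "0 \<in> gen_eig T l" using assms by (auto simp: gen_eig_def papply_zero)
  show "u + v \<in> gen_eig T l" if uv: "u \<in> gen_eig T l" "v \<in> gen_eig T l" for u v
  proof -
    from uv obtain j k where "papply T ([:-l, 1:] ^ j) u = 0" "papply T ([:-l, 1:] ^ k) v = 0"
      by (auto simp: gen_eig_def)
    then have "papply T ([:-l, 1:] ^ (max j k)) u = 0" "papply T ([:-l, 1:] ^ (max j k)) v = 0"
      using papply_power_zero_mono assms by (meson max.cobounded1 max.cobounded2)+
    then have "papply T ([:-l, 1:] ^ (max j k)) (u + v) = 0"
      using assms by (simp add: endo_add endo_papply)
    then show ?thesis by (auto simp: gen_eig_def)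
  qed
  show "c *s v \<in> gen_eig T l" if "v \<in> gen_eig T l" for c v
    using that assms by (auto simp: gen_eig_def endo_scale endo_papply)
qed

text \<open>Commutation is asked on \<open>E\<close> only, because the Casimir operator commutes
  with the action just on the submodule for which it is built.\<close>

lemma gen_eig_stable:
  assumes T: "endo T" and S: "endo S" and E: "subspace E" "\<And>v. v \<in> E \<Longrightarrow> T v \<in> E"
    and comm: "\<And>v. v \<in> E \<Longrightarrow> S (T v) = T (S v)" and v: "v \<in> E" "v \<in> gen_eig T l"
  shows "S v \<in> gen_eig T l"
proof -
  have "papply T p (S v) = S (papply T p v)" for p
    by (induction p)
      (use S comm papply_in_subspace[OF T E v(1)] in \<open>auto simp: papply_pCons[OF T] endo_zero endo_add endo_scale\<close>)
  moreover obtain k where "papply T ([:-l, 1:] ^ k) v = 0" using v(2) by (auto simp: gen_eig_def)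
  ultimately have "papply T ([:-l, 1:] ^ k) (S v) = 0" using endo_zero[OF S] by metis
  then show ?thesis by (auto simp: gen_eig_def)
qed

text \<open>Powers of two distinct linear polynomials are coprime, so a Bezout identity writes
  \<open>v\<close> as a sum of two zeros.\<close>

lemma gen_eig_disjoint:
  assumes T: "endo T" and v: "v \<in> gen_eig T l" "v \<in> gen_eig T m" "l \<noteq> m" shows "v = 0"
proof -
  obtain j k where z: "papply T ([:-l, 1:] ^ j) v = 0" "papply T ([:-m, 1:] ^ k) v = 0"
    using v by (auto simp: gen_eig_def)
  obtain a b where "a * [:-l, 1:] ^ j + b * [:-m, 1:] ^ k = 1"
    using bezout_linear_power[of "[:-l, 1:] ^ j" m k] v(3) by auto
  then have "v = papply T (a * [:-l, 1:] ^ j + b * [:-m, 1:] ^ k) v" by simp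
  also have "\<dots> = 0" by (simp only: papply_add[OF T] papply_mult[OF T] z papply_zero[OF T] add_0)
  finally show ?thesis .
qed

text \<open>The summands are polynomials in \<open>T\<close> applied to \<open>v\<close>, so they stay in every \<open>T\<close>-stable subspace
  that contains \<open>v\<close>.\<close>

lemma gen_eig_decomposition:
  assumes T: "endo T" and p: "p \<noteq> 0" "papply T p v = 0"
  shows "v \<in> span {w. (\<exists>r. w = papply T r v) \<and> (\<exists>l. w \<in> gen_eig T l)}"
  using p
proof (induction "degree p" arbitrary: p v rule: less_induct)
  case less
  show ?case
  proof (cases "degree p = 0")
    case True
    then obtain a where "p = [:a:]" by (metis degree_eq_zeroE)
    then have "v = 0" using less.prems by simp
    then show ?thesis by (simp add: span_zero)
  next
    case False
    then obtain l where l: "poly p l = 0"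
      using fundamental_theorem_of_algebra[of p] by (auto simp: constant_degree)
    define k where "k = order l p"
    obtain q where q: "p = [:-l, 1:] ^ k * q" "\<not> [:-l, 1:] dvd q"
      using order_decomp[OF less.prems(1), of l] by (auto simp: k_def)
    have k: "k \<noteq> 0" using l less.prems(1) by (simp add: k_def order_root)
    have q0: "q \<noteq> 0" using less.prems q by auto
    have "degree p = k + degree q"
      using q q0 by (simp add: degree_mult_eq degree_linear_power)
    then have dq: "degree q < degree p" using k by simp
    obtain a b where ab: "a * q + b * [:-l, 1:] ^ k = 1"
      using bezout_linear_power[of q l k] q(2) by (auto simp: poly_eq_0_iff_dvd)
    \<comment> \<open>The identity \<open>ab\<close> splits \<open>v\<close> into a part killed by a
      power of \<open>[:-l, 1:]\<close> and a part killed by \<open>q\<close>, whose degree is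
      smaller because \<open>l\<close> is a root.\<close>
    define w where "w = papply T (a * q) v"
    define u where "u = papply T (b * [:-l, 1:] ^ k) v"
    have v: "v = w + u" using ab T by (metis papply_1 papply_add w_def u_def)
    have "papply T ([:-l, 1:] ^ k) w = papply T (([:-l, 1:] ^ k) * (a * q)) v"
      unfolding w_def using T by (simp only: papply_mult)
    also have "\<dots> = papply T (a * p) v" by (simp add: q algebra_simps)
    also have "\<dots> = 0" using T less.prems by (simp add: papply_mult papply_zero)
    finally have w: "w \<in> gen_eig T l" by (auto simp: gen_eig_def)
    have "papply T q u = papply T (q * (b * [:-l, 1:] ^ k)) v"
      unfolding u_def using T by (simp only: papply_mult)
    also have "\<dots> = papply T (b * p) v" by (simp add: q algebra_simps)
    also have "\<dots> = 0" using T less.prems by (simp add: papply_mult papply_zero)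
    finally have "papply T q u = 0" .
    then have "u \<in> span {w. (\<exists>r. w = papply T r u) \<and> (\<exists>l. w \<in> gen_eig T l)}"
      using less.hyps[OF dq q0] by blast
    moreover have "{w. (\<exists>r. w = papply T r u) \<and> (\<exists>l. w \<in> gen_eig T l)}
        \<subseteq> {w. (\<exists>r. w = papply T r v) \<and> (\<exists>l. w \<in> gen_eig T l)}"
      using T by (auto simp: u_def simp flip: papply_mult)
    ultimately have "u \<in> span {w. (\<exists>r. w = papply T r v) \<and> (\<exists>l. w \<in> gen_eig T l)}"
      using span_mono by blast
    moreover have "w \<in> span {w. (\<exists>r. w = papply T r v) \<and> (\<exists>l. w \<in> gen_eig T l)}"
      using w by (intro span_base) (auto simp: w_def)
    ultimately show ?thesis unfolding v by (auto intro: span_add)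
  qed
qed

section \<open>Finite-dimensional subspaces and traces\<close>

text \<open>The finite set may lie outside \<open>E\<close>, which makes the notion inherit to
  subspaces at once.\<close>

definition fdim :: "'b set \<Rightarrow> bool" where
  "fdim E \<longleftrightarrow> subspace E \<and> (\<exists>A. finite A \<and> E \<subseteq> span A)"

lemma fdimI: "subspace E \<Longrightarrow> finite A \<Longrightarrow> E \<subseteq> span A \<Longrightarrow> fdim E"
  by (auto simp: fdim_def)

lemma fdim_subspace: "fdim E \<Longrightarrow> subspace E"
  by (simp add: fdim_def)

lemma fdim_subset: "fdim E \<Longrightarrow> F \<subseteq> E \<Longrightarrow> subspace F \<Longrightarrow> fdim F"
  by (auto simp: fdim_def)

lemma fdim_extend_basis:
  assumes "fdim E" "independent C" "C \<subseteq> E"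
  obtains B where "C \<subseteq> B" "finite B" "independent B" "span B = E"
proof -
  obtain B where B: "C \<subseteq> B" "B \<subseteq> E" "independent B" "E \<subseteq> span B"
    using maximal_independent_subset_extend[OF assms(3,2)] by blast
  obtain A where "finite A" "E \<subseteq> span A" using assms(1) by (auto simp: fdim_def)
  then have "finite B" using independent_span_bound[of A B] B by auto
  moreover have "span B = E"
    using B assms(1) span_minimal[of B E] by (auto simp: fdim_def)
  ultimately show ?thesis using that B by blast
qed

lemma fdim_basis:
  assumes "fdim E" obtains B where "finite B" "independent B" "span B = E"
  using fdim_extend_basis[OF assms, of "{}"] independent_empty by blast

lemma fdim_independent:
  assumes "fdim E" "independent C" "C \<subseteq> E" shows "finite C \<and> card C \<le> dim E"
proof -
  obtain B where B: "finite B" "independent B" "span B = E" using fdim_basis[OF assms(1)] .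
  then have "card B = dim E" using dim_span_eq_card_independent[of B] by simp
  then show ?thesis using independent_span_bound[OF B(1) assms(2)] B(3) assms(3) by simp
qed

lemma fdim_dim_less:
  assumes "fdim E" "subspace F" "F \<subset> E" shows "dim F < dim E"
proof -
  have F: "fdim F" using fdim_subset assms by blast
  obtain C where C: "finite C" "independent C" "span C = F" using fdim_basis[OF F] .
  then have "C \<subseteq> E" using assms(3) span_superset by blast
  then obtain B where B: "C \<subseteq> B" "finite B" "independent B" "span B = E"
    using fdim_extend_basis[OF assms(1) C(2)] by blast
  have "C \<noteq> B" using B C assms(3) by auto
  then have "card C < card B" using B by (simp add: psubset_card_mono psubset_eq)
  moreover have "dim F = card C" "dim E = card B" using B C by (metis dim_span dim_eq_card_independent)+
  ultimately show ?thesis by simp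
qed

text \<open>The first \<open>dim E + 1\<close> iterates of \<open>v\<close> cannot be independent,
  and a linear relation between them is a polynomial.\<close>

lemma fdim_annihilator:
  assumes T: "endo T" and E: "fdim E" "\<And>v. v \<in> E \<Longrightarrow> T v \<in> E" and v: "v \<in> E"
  obtains p where "p \<noteq> 0" "papply T p v = 0"
proof -
  define n where "n = dim E"
  let ?f = "\<lambda>i. (T ^^ i) v"
  have fE: "?f i \<in> E" for i using E v by (induction i) auto
  show ?thesis
  proof (cases "inj_on ?f {..n}")
    \<comment> \<open>If an iterate repeats, the set of iterates may be too small for the dimension
      count, and the polynomial comes from the repetition itself.\<close>
    case False
    then obtain i j where ij: "i \<noteq> j" "?f i = ?f j" by (auto simp: inj_on_def)
    have m: "papply T (monom 1 i) v = ?f i" for i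
    proof -
      have "papply T (monom 1 i) v = (\<Sum>j\<le>i. (if j = i then 1 else 0) *s ?f j)"
        by (simp add: papply_def degree_monom_eq eq_commute[of i])
      also have "\<dots> = (\<Sum>j\<le>i. if j = i then ?f j else 0)" by (intro sum.cong) auto
      finally show ?thesis by simp
    qed
    show ?thesis
    proof (rule that[of "monom 1 i - monom 1 j"])
      show "monom 1 i - monom 1 j \<noteq> (0::complex poly)" 
        using ij(1) by (metis coeff_monom eq_iff_diff_eq_0 zero_neq_one)
      show "papply T (monom 1 i - monom 1 j) v = 0" using T ij m by (simp add: papply_diff)
    qed
  next
    case True
    let ?S = "?f ` {..n}"
    have "card ?S = Suc n" using True by (simp add: card_image)
    then have "dependent ?S" using fdim_independent[OF E(1), of ?S] fE by (auto simp: n_def)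
    then obtain u where u: "\<exists>w\<in>?S. u w \<noteq> 0" "(\<Sum>w\<in>?S. u w *s w) = 0"
      using dependent_finite[of ?S] by auto
    define p where "p = (\<Sum>i\<le>n. monom (u (?f i)) i)"
    have c: "coeff p i = (if i \<le> n then u (?f i) else 0)" for i
      by (simp add: p_def coeff_sum)
    have "degree p \<le> n" by (intro degree_le) (auto simp: c)
    then have "papply T p v = (\<Sum>i\<le>n. u (?f i) *s ?f i)"
      by (simp add: papply_sum c)
    also have "\<dots> = 0" using u(2) True by (simp add: sum.reindex)
    finally have "papply T p v = 0" .
    moreover obtain i where "i \<le> n" "u (?f i) \<noteq> 0" using u(1) by blast
    then have "p \<noteq> 0" using c[of i] by auto
    ultimately show ?thesis using that by blast
  qed
qed

lemma gen_eig_span: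
  assumes T: "endo T" and E: "fdim E" "\<And>v. v \<in> E \<Longrightarrow> T v \<in> E" and v: "v \<in> E"
  shows "v \<in> span {w \<in> E. \<exists>l. w \<in> gen_eig T l}"
proof -
  obtain p where p: "p \<noteq> 0" "papply T p v = 0" using fdim_annihilator[OF T E v] by blast
  have "{w. (\<exists>r. w = papply T r v) \<and> (\<exists>l. w \<in> gen_eig T l)} \<subseteq> {w \<in> E. \<exists>l. w \<in> gen_eig T l}"
    using papply_in_subspace[OF T fdim_subspace[OF E(1)] E(2) v] by auto
  then show ?thesis using gen_eig_decomposition[OF T p] span_mono by blast
qed

text \<open>The last nonzero vector of the chain of powers of \<open>T - l\<close> is an
  eigenvector. \<open>E\<close> may be infinite-dimensional, as it may be when this is applied to
  bounded operators.\<close>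

lemma gen_eig_imp_eigenvector:
  assumes T: "endo T" and E: "\<And>v. v \<in> E \<Longrightarrow> T v \<in> E" "subspace E" and v: "v \<in> E" "v \<noteq> 0" "v \<in> gen_eig T l"
  obtains e where "e \<in> E" "e \<noteq> 0" "T e = l *s e"
proof -
  let ?P = "\<lambda>k. papply T ([:-l, 1:] ^ k) v = 0"
  define k where "k = (LEAST k. ?P k)"
  have k: "?P k" unfolding k_def by (rule LeastI_ex) (use v in \<open>auto simp: gen_eig_def\<close>)
  have "k \<noteq> 0" using k v by (metis papply_1 power_0)
  then obtain j where j: "k = Suc j" using not0_implies_Suc by blast
  let ?e = "papply T ([:-l, 1:] ^ j) v"
  have "?e \<noteq> 0" using not_less_Least[of j ?P] j by (auto simp: k_def)
  moreover have "T ?e = l *s ?e"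
    using k j papply_mult[OF T, of "[:-l, 1:]" "[:-l, 1:] ^ j" v] papply_linear[OF T] by simp
  moreover have "?e \<in> E" by (rule papply_in_subspace[OF T E(2,1) v(1)])
  ultimately show ?thesis using that by blast
qed

lemma eigenvector_exists:
  assumes T: "endo T" and E: "fdim E" "\<And>v. v \<in> E \<Longrightarrow> T v \<in> E" and ne: "E \<noteq> {0}"
  obtains l e where "e \<in> E" "e \<noteq> 0" "T e = l *s e"
proof -
  obtain v where v: "v \<in> E" "v \<noteq> 0" using ne fdim_subspace[OF E(1)] subspace_0 by blast
  have "\<exists>w\<in>E. w \<noteq> 0 \<and> (\<exists>l. w \<in> gen_eig T l)"
  proof (rule ccontr)
    assume "\<not> ?thesis"
    then have "{w \<in> E. \<exists>l. w \<in> gen_eig T l} \<subseteq> {0}" by auto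
    then have "v \<in> span {0}" using gen_eig_span[OF T E v(1)] span_mono by blast
    then show False using v by (auto simp: span_insert_0[of "{}", simplified])
  qed
  then obtain w l where "w \<in> E" "w \<noteq> 0" "w \<in> gen_eig T l" by blast
  then show ?thesis using gen_eig_imp_eigenvector[OF T E(2) fdim_subspace[OF E(1)]] that by blast
qed

text \<open>The trace of the restriction of \<open>f\<close> to \<open>E\<close>. For a linear
  \<open>f\<close> that maps \<open>E\<close> into itself the chosen basis does not matter, by
  \<open>tr_basis\<close>.\<close>

definition tr :: "'b set \<Rightarrow> ('b \<Rightarrow> 'b) \<Rightarrow> complex" where
  "tr E f = (let B = (SOME B. finite B \<and> independent B \<and> span B = E)
     in \<Sum>b\<in>B. representation B (f b) b)"

lemma representation_image:
  assumes "endo f" "finite C" "independent C" "v \<in> span C"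
    and "independent B" "\<And>c. c \<in> C \<Longrightarrow> f c \<in> span B"
  shows "representation B (f v) b = (\<Sum>c\<in>C. representation C v c * representation B (f c) b)"
proof -
  have "f v = f (\<Sum>c\<in>C. representation C v c *s c)"
    by (subst sum_representation_eq) (use assms in auto)
  also have "\<dots> = (\<Sum>c\<in>C. representation C v c *s f c)"
    using assms(1) by (simp add: endo_sum endo_scale)
  finally show ?thesis
    using assms by (simp add: representation_sum representation_scale span_scale)
qed

text \<open>Two facts in one double sum: the identity for \<open>g\<close> gives independence of the
  basis, and a common basis gives the commutation of factors under the trace.\<close>

lemma trace_bases_commute:
  assumes B: "finite B" "independent B" "span B = E" and C: "finite C" "independent C" "span C = E"
    and f: "endo f" "\<And>v. v \<in> E \<Longrightarrow> f v \<in> E" and g: "endo g" "\<And>v. v \<in> E \<Longrightarrow> g v \<in> E"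
  shows "(\<Sum>b\<in>B. representation B (f (g b)) b) = (\<Sum>c\<in>C. representation C (g (f c)) c)"
proof -
  have E: "b \<in> E" if "b \<in> B" for b using B that span_base by blast
  have E': "c \<in> E" if "c \<in> C" for c using C that span_base by blast
  have "(\<Sum>b\<in>B. representation B (f (g b)) b)
      = (\<Sum>b\<in>B. \<Sum>c\<in>C. representation C (g b) c * representation B (f c) b)"
    by (intro sum.cong refl representation_image[OF f(1) C(1,2) _ B(2)]) (use B C f g E E' in auto)
  also have "\<dots> = (\<Sum>c\<in>C. \<Sum>b\<in>B. representation B (f c) b * representation C (g b) c)"
    by (subst sum.swap) (simp add: mult.commute)
  also have "\<dots> = (\<Sum>c\<in>C. representation C (g (f c)) c)"
    by (intro sum.cong refl representation_image[OF g(1) B(1,2) _ C(2), symmetric]) (use B C f g E E' in auto)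
  finally show ?thesis .
qed

lemma tr_basis:
  assumes B: "finite B" "independent B" "span B = E" and f: "endo f" "\<And>v. v \<in> E \<Longrightarrow> f v \<in> E"
  shows "tr E f = (\<Sum>b\<in>B. representation B (f b) b)"
proof -
  define C where "C = (SOME B. finite B \<and> independent B \<and> span B = E)"
  have C: "finite C \<and> independent C \<and> span C = E"
    unfolding C_def by (rule someI[of _ B]) (use B in auto)
  have "(\<Sum>b\<in>C. representation C (f b) b) = (\<Sum>b\<in>B. representation B (f b) b)"
    using trace_bases_commute[of C E B f "\<lambda>v. v"] B C f by (simp add: endo_id)
  then show ?thesis by (simp add: tr_def C_def Let_def)
qed

lemma tr_commute:
  assumes "fdim E" and f: "endo f" "\<And>v. v \<in> E \<Longrightarrow> f v \<in> E" and g: "endo g" "\<And>v. v \<in> E \<Longrightarrow> g v \<in> E"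
  shows "tr E (\<lambda>v. f (g v)) = tr E (\<lambda>v. g (f v))"
proof -
  obtain B where B: "finite B" "independent B" "span B = E" using fdim_basis[OF assms(1)] .
  show ?thesis
    using trace_bases_commute[OF B B f g] f g tr_basis[OF B, of "\<lambda>v. f (g v)"] tr_basis[OF B, of "\<lambda>v. g (f v)"]
    by (simp add: endo_comp)
qed

lemma tr_cong:
  assumes "\<And>v. v \<in> E \<Longrightarrow> f v = g v" "fdim E" shows "tr E f = tr E g"
proof -
  define B where "B = (SOME B. finite B \<and> independent B \<and> span B = E)"
  have "finite B \<and> independent B \<and> span B = E"
    unfolding B_def by (rule someI_ex) (metis fdim_basis[OF assms(2)])
  then show ?thesis using assms(1) by (auto simp: tr_def Let_def span_base simp flip: B_def intro!: sum.cong)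
qed

lemma tr_add:
  assumes "fdim E" and f: "endo f" "\<And>v. v \<in> E \<Longrightarrow> f v \<in> E" and g: "endo g" "\<And>v. v \<in> E \<Longrightarrow> g v \<in> E"
  shows "tr E (\<lambda>v. f v + g v) = tr E f + tr E g"
proof -
  obtain B where B: "finite B" "independent B" "span B = E" using fdim_basis[OF assms(1)] .
  have "b \<in> E" if "b \<in> B" for b using B that span_base by blast
  then show ?thesis
    using f g B fdim_subspace[OF assms(1)]
    by (simp add: tr_basis[OF B] endo_plus subspace_add representation_add sum.distrib)
qed

lemma tr_scale:
  assumes "fdim E" and f: "endo f" "\<And>v. v \<in> E \<Longrightarrow> f v \<in> E"
  shows "tr E (\<lambda>v. c *s f v) = c * tr E f"
proof -
  obtain B where B: "finite B" "independent B" "span B = E" using fdim_basis[OF assms(1)] .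
  have "b \<in> E" if "b \<in> B" for b using B that span_base by blast
  then show ?thesis
    using f B fdim_subspace[OF assms(1)]
    by (simp add: tr_basis[OF B] endo_scaled subspace_scale representation_scale sum_distrib_left)
qed

lemma tr_diff:
  assumes "fdim E" and f: "endo f" "\<And>v. v \<in> E \<Longrightarrow> f v \<in> E" and g: "endo g" "\<And>v. v \<in> E \<Longrightarrow> g v \<in> E"
  shows "tr E (\<lambda>v. f v - g v) = tr E f - tr E g"
  using tr_add[OF assms(1) f, of "\<lambda>v. (-1) *s g v"] tr_scale[OF assms(1) g, of "-1"] g
    fdim_subspace[OF assms(1)] by (simp add: endo_scaled[of g "-1", simplified] subspace_neg)

lemma tr_sum:
  assumes "fdim E" "finite A" "\<And>i. i \<in> A \<Longrightarrow> endo (f i)" "\<And>i v. i \<in> A \<Longrightarrow> v \<in> E \<Longrightarrow> f i v \<in> E"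
  shows "tr E (\<lambda>v. \<Sum>i\<in>A. f i v) = (\<Sum>i\<in>A. tr E (f i))"
  using assms(2-)
proof (induction A)
  case empty
  show ?case using tr_scale[OF assms(1) endo_id, of 0] by simp
next
  case (insert a A)
  then show ?case
    using tr_add[OF assms(1), of "f a" "\<lambda>v. \<Sum>i\<in>A. f i v"] fdim_subspace[OF assms(1)]
    by (simp add: endo_summed subspace_sum)
qed

lemma tr_identity: assumes "fdim E" shows "tr E (\<lambda>v. v) = of_nat (dim E)"
proof -
  obtain B where B: "finite B" "independent B" "span B = E" using fdim_basis[OF assms(1)] .
  have "tr E (\<lambda>v. v) = (\<Sum>b\<in>B. 1)"
    by (subst tr_basis[OF B endo_id]) (auto simp: B representation_basis)
  then show ?thesis using B dim_span_eq_card_independent[of B] by simp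
qed

text \<open>In a basis of \<open>E\<close> that extends one of \<open>U\<close>, the added vectors
  contribute no diagonal entry, since \<open>f\<close> has values in \<open>U\<close>.\<close>

lemma tr_subspace:
  assumes E: "fdim E" and U: "subspace U" "U \<subseteq> E" and f: "endo f" "\<And>v. v \<in> E \<Longrightarrow> f v \<in> U"
  shows "tr E f = tr U f"
proof -
  obtain C where C: "finite C" "independent C" "span C = U" using fdim_basis[OF fdim_subset[OF E U(2,1)]] .
  then have "C \<subseteq> E" using U(2) span_superset by blast
  then obtain B where B: "C \<subseteq> B" "finite B" "independent B" "span B = E"
    using fdim_extend_basis[OF E C(2)] by blast
  have fU: "f b \<in> span C" if "b \<in> B" for b using f(2) B C that span_base by blast
  have "tr E f = (\<Sum>b\<in>B. representation B (f b) b)"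
    by (rule tr_basis[OF B(2-4) f(1)]) (use f U in auto)
  also have "\<dots> = (\<Sum>b\<in>B. representation C (f b) b)"
    using representation_extend[OF B(3) fU B(1)] by simp
  also have "\<dots> = (\<Sum>b\<in>C. representation C (f b) b)"
    by (rule sum.mono_neutral_right) (use B representation_ne_zero in blast)+
  also have "\<dots> = tr U f" by (rule tr_basis[OF C f(1), symmetric]) (use f U in auto)
  finally show ?thesis .
qed

text \<open>The list consists of the eigenvalues with multiplicity; it is found by passing from \<open>E\<close> to
  \<open>(T - \<mu>) E\<close> for an eigenvalue \<open>\<mu>\<close>.\<close>

lemma trace_polynomial:
  assumes T: "endo T" and E: "fdim E" "\<And>v. v \<in> E \<Longrightarrow> T v \<in> E"
  shows "\<exists>ms. (\<forall>p. tr E (papply T p) = (\<Sum>\<mu>\<leftarrow>ms. poly p \<mu>)) \<and>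
    (\<forall>v\<in>E. papply T (\<Prod>\<mu>\<leftarrow>ms. [:-\<mu>, 1:]) v = 0) \<and>
    (\<forall>\<mu>\<in>set ms. \<exists>e\<in>E. e \<noteq> 0 \<and> T e = \<mu> *s e)"
  using E
proof (induction "dim E" arbitrary: E rule: less_induct)
  case less
  note E = less.prems(1) and TE = less.prems(2)
  show ?case
  proof (cases "E = {0}")
    case True
    have "tr E (papply T p) = 0" for p
      using tr_basis[of "{}" E "papply T p"] True T independent_empty by (simp add: endo_papply papply_zero)
    then show ?thesis using True by (intro exI[of _ "[]"]) simp
  next
    case False
    obtain \<mu> e where e: "e \<in> E" "e \<noteq> 0" "T e = \<mu> *s e" using eigenvector_exists[OF T E TE False] .
    define N where "N v = T v - \<mu> *s v" for v
    have N: "endo N" unfolding N_def by (intro endo_subtract endo_scaled endo_id T)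
    have NE: "N v \<in> E" if "v \<in> E" for v
      using that TE fdim_subspace[OF E] by (auto simp: N_def subspace_diff subspace_scale)
    define U where "U = N ` E"
    have U: "subspace U"
      unfolding U_def by (rule endo_image_subspace[OF N fdim_subspace[OF E]])
    have UE: "U \<subseteq> E" using NE by (auto simp: U_def)
    have TU: "T u \<in> U" if "u \<in> U" for u
    proof -
      from that obtain v where v: "v \<in> E" "u = N v" unfolding U_def by blast
      have "T u = N (T v)" using v T by (simp add: N_def endo_diff endo_scale)
      then show ?thesis using v TE by (auto simp: U_def)
    qed
    obtain B where B: "{e} \<subseteq> B" "finite B" "independent B" "span B = E"
      using fdim_extend_basis[OF E, of "{e}"] e by auto
    \<comment> \<open>\<open>N\<close> kills \<open>e\<close>, so its image is spanned by fewer
      vectors than a basis of \<open>E\<close> has; this is what makes the dimension drop.\<close>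
    have "U \<subseteq> span (N ` (B - {e}))"
    proof
      fix u assume "u \<in> U"
      then obtain v where v: "v \<in> span B" "u = N v" using B unfolding U_def by blast
      have "N ` B \<subseteq> insert 0 (N ` (B - {e}))" using e by (auto simp: N_def)
      then have "span (N ` B) \<subseteq> span (N ` (B - {e}))" using span_mono span_insert_0 by metis
      then show "u \<in> span (N ` (B - {e}))" using endo_span_image[OF N v(1)] v(2) by auto
    qed
    then have "dim U \<le> card (N ` (B - {e}))" using B by (intro dim_le_card) auto
    also have "\<dots> \<le> card (B - {e})" using B by (intro card_image_le) auto
    also have "\<dots> < card B" using B by (intro psubset_card_mono) auto
    also have "\<dots> = dim E" using B dim_span_eq_card_independent[of B] by simp
    finally have d: "dim U < dim E" .
    obtain ms where ms: "\<And>p. tr U (papply T p) = (\<Sum>\<mu>\<leftarrow>ms. poly p \<mu>)"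
      "\<And>v. v \<in> U \<Longrightarrow> papply T (\<Prod>\<mu>\<leftarrow>ms. [:-\<mu>, 1:]) v = 0"
      "\<And>\<mu>. \<mu> \<in> set ms \<Longrightarrow> \<exists>e\<in>U. e \<noteq> 0 \<and> T e = \<mu> *s e"
      using less.hyps[OF d fdim_subset[OF E UE U] TU] by blast
    have fU: "fdim U" by (rule fdim_subset[OF E UE U])
    \<comment> \<open>On the quotient of \<open>E\<close> by \<open>U\<close> the operator
      \<open>T\<close> is multiplication by \<open>\<mu>\<close>, which therefore enters
      \<open>n\<close> times; further copies can come from \<open>U\<close>.\<close>
    define n where "n = dim E - dim U"
    have papE: "papply T p v \<in> E" if "v \<in> E" for v p
      by (rule papply_in_subspace[OF T fdim_subspace[OF E] TE that])
    have papU: "papply T p v \<in> U" if "v \<in> U" for v p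
      by (rule papply_in_subspace[OF T U TU that])
    have tr: "tr E (papply T p) = (\<Sum>\<mu>\<leftarrow>replicate n \<mu> @ ms. poly p \<mu>)" for p
    proof -
      let ?c = "poly p \<mu>"
      \<comment> \<open>Subtracting the constant \<open>poly p \<mu>\<close> leaves a multiple of
        \<open>[:-\<mu>, 1:]\<close>, so the difference maps \<open>E\<close> into \<open>U\<close>
        and \<open>tr_subspace\<close> applies.\<close>
      obtain r where "p - [:?c:] = [:-\<mu>, 1:] * r"
        using poly_eq_0_iff_dvd[of "p - [:?c:]" \<mu>] by (auto simp: dvd_def)
      then have r: "papply T p v - ?c *s v = N (papply T r v)" for v
        using T papply_diff[OF T, of p "[:?c:]" v] papply_mult[OF T, of "[:-\<mu>, 1:]" r v]
        by (simp add: papply_linear N_def)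
      have cE: "endo (\<lambda>v. ?c *s v)" by (intro endo_scaled endo_id)
      have "tr E (papply T p) - ?c * of_nat (dim E) = tr E (\<lambda>v. papply T p v - ?c *s v)"
        using tr_diff[OF E endo_papply[OF T] papE cE] tr_scale[OF E endo_id, of ?c] tr_identity[OF E]
          fdim_subspace[OF E] by (simp add: subspace_scale)
      also have "\<dots> = tr U (\<lambda>v. papply T p v - ?c *s v)"
        by (rule tr_subspace[OF E U UE])
          (auto simp: r U_def papE intro: endo_comp[OF N endo_papply[OF T], simplified])
      also have "\<dots> = tr U (papply T p) - ?c * of_nat (dim U)"
        using tr_diff[OF fU endo_papply[OF T] papU cE] tr_scale[OF fU endo_id, of ?c] tr_identity[OF fU] U
        by (simp add: subspace_scale)
      finally have "tr E (papply T p) = tr U (papply T p) + ?c * (of_nat (dim E) - of_nat (dim U))"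
        by (simp add: algebra_simps)
      also have "of_nat (dim E) - of_nat (dim U) = (of_nat n :: complex)"
        using d by (simp add: n_def of_nat_diff)
      finally show ?thesis using ms(1)[of p] by (simp add: sum_list_replicate)
    qed
    have kill: "papply T (\<Prod>\<mu>\<leftarrow>replicate n \<mu> @ ms. [:-\<mu>, 1:]) v = 0" if "v \<in> E" for v
    proof -
      \<comment> \<open>As \<open>n\<close> is positive, one factor can be spent on moving
        \<open>v\<close> into \<open>U\<close>, where the product for \<open>ms\<close>
        vanishes.\<close>
      obtain m where m: "n = Suc m" using d by (metis n_def zero_less_diff gr0_implies_Suc)
      have "(\<Prod>\<mu>\<leftarrow>replicate n \<mu> @ ms. [:-\<mu>, 1:]) = [:-\<mu>, 1:] ^ m * ((\<Prod>\<mu>\<leftarrow>ms. [:-\<mu>, 1:]) * [:-\<mu>, 1:])"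
        by (simp only: map_append prod_list.append map_replicate prod_list_replicate m power_Suc2 mult.assoc
            mult.commute[of "[:-\<mu>, 1:]"])
      moreover have "papply T [:-\<mu>, 1:] v \<in> U"
        using that T by (auto simp: papply_linear U_def N_def)
      ultimately show ?thesis using ms(2) by (simp only: papply_mult[OF T] papply_zero[OF T])
    qed
    have "\<exists>e\<in>E. e \<noteq> 0 \<and> T e = \<mu>' *s e" if "\<mu>' \<in> set (replicate n \<mu> @ ms)" for \<mu>'
    proof (cases "\<mu>' = \<mu>")
      case False
      then show ?thesis using that ms(3)[of \<mu>'] UE by auto
    qed (use e in blast)
    then show ?thesis using tr kill by blast
  qed
qed

lemma tr_nilpotent:
  assumes T: "endo T" and E: "fdim E" "\<And>v. v \<in> E \<Longrightarrow> T v \<in> E"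
    and nil: "\<And>v. v \<in> E \<Longrightarrow> v \<in> gen_eig T 0"
  shows "tr E T = 0"
proof -
  obtain ms where ms: "\<forall>p. tr E (papply T p) = (\<Sum>\<mu>\<leftarrow>ms. poly p \<mu>)"
    "\<forall>\<mu>\<in>set ms. \<exists>e\<in>E. e \<noteq> 0 \<and> T e = \<mu> *s e"
    using trace_polynomial[OF T E] by blast
  have "\<mu> = 0" if "\<mu> \<in> set ms" for \<mu>
  proof -
    from that ms(2) obtain e where e: "e \<in> E" "e \<noteq> 0" "T e = \<mu> *s e" by blast
    obtain k where "papply T ([:-0, 1:] ^ k) e = 0" using nil[OF e(1)] by (auto simp: gen_eig_def)
    then show ?thesis using papply_eigenvector[OF T e(3)] e by simp
  qed
  then have "(\<Sum>\<mu>\<leftarrow>ms. poly [:0, 1:] \<mu>) = (\<Sum>\<mu>\<leftarrow>ms. 0)" by (intro arg_cong[of _ _ sum_list] map_cong) auto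
  moreover have "papply T [:0, 1:] = T" using T by (auto simp: papply_pCons)
  ultimately show ?thesis using spec[OF ms(1), of "[:0, 1:]"] by simp
qed

lemma nilpotent_uniform:
  assumes T: "endo T" and E: "fdim E" "\<And>v. v \<in> E \<Longrightarrow> T v \<in> E"
    and nil: "\<And>v. v \<in> E \<Longrightarrow> v \<in> gen_eig T 0"
  shows "\<exists>n. \<forall>v\<in>E. (T ^^ n) v = 0"
proof -
  obtain B where B: "finite B" "independent B" "span B = E" using fdim_basis[OF E(1)] .
  have "\<exists>k. (T ^^ k) b = 0" if "b \<in> B" for b
    using nil[of b] B that span_base gen_eig_0_iff[OF T] by blast
  then obtain k where k: "\<And>b. b \<in> B \<Longrightarrow> (T ^^ k b) b = 0" by metis
  have "(T ^^ (\<Sum>b\<in>B. k b)) v = 0" if "v \<in> span B" for v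
    using that
  proof (rule span_induct_alt)
    fix c x y assume x: "x \<in> B" and y: "(T ^^ (\<Sum>b\<in>B. k b)) y = 0"
    have "(\<Sum>b\<in>B. k b) = (\<Sum>b\<in>B - {x}. k b) + k x" using B x by (simp add: sum.remove)
    then have "(T ^^ (\<Sum>b\<in>B. k b)) x = 0"
      using k[OF x] endo_zero[OF endo_funpow[OF T]] by (simp add: funpow_add)
    then show "(T ^^ (\<Sum>b\<in>B. k b)) (c *s x + y) = 0"
      using y endo_funpow[OF T] by (simp add: endo_add endo_scale)
  qed (simp add: endo_zero[OF endo_funpow[OF T]])
  then show ?thesis using B by blast
qed

lemma injective_endo_image:
  assumes T: "endo T" and E: "fdim E" "\<And>v. v \<in> E \<Longrightarrow> T v \<in> E"
    and inj: "\<And>v. v \<in> E \<Longrightarrow> T v = 0 \<Longrightarrow> v = 0"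
  shows "T ` E = E"
proof (rule ccontr)
  assume "T ` E \<noteq> E"
  then have TE: "T ` E \<subset> E" using E(2) by blast
  obtain B where B: "finite B" "independent B" "span B = E" using fdim_basis[OF E(1)] .
  have inj_on: "inj_on T (span B)"
  proof (rule inj_onI)
    fix x y assume xy: "x \<in> span B" "y \<in> span B" "T x = T y"
    then have "T (x - y) = 0" using T by (simp add: endo_diff)
    then show "x = y" using inj[of "x - y"] xy span_diff B by auto
  qed
  have BE: "B \<subseteq> E" using B span_superset by blast
  interpret vector_space_pair scale scale ..
  have "independent (T ` B)"
    using linear_independent_injective_image[of T B] T B inj_on by (simp add: endo_linear)
  moreover have sub: "subspace (T ` E)" by (rule endo_image_subspace[OF T fdim_subspace[OF E(1)]])
  ultimately have "card (T ` B) \<le> dim (T ` E)"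
    using fdim_independent[OF fdim_subset[OF E(1) _ sub]] TE BE by blast
  also have "\<dots> < dim E" by (rule fdim_dim_less[OF E(1) sub TE])
  also have "\<dots> = card B" using B dim_span_eq_card_independent[of B] by simp
  finally show False using inj_on by (simp add: card_image inj_on_subset[OF _ span_superset])
qed

text \<open>The map from \<open>P\<close> to its dual given by the form is injective, hence onto.
  \<open>\<phi>\<close> has to be linear on \<open>P\<close> only, so that coordinate functions
  \<open>representation B _ b\<close> are covered, which yields dual bases.\<close>

lemma nondegenerate_form_represents:
  assumes P: "fdim P"
    and left: "\<And>x x' y. \<beta> (x + x') y = \<beta> x y + \<beta> x' y" "\<And>c x y. \<beta> (c *s x) y = c * \<beta> x y"
    and right: "\<And>x y y'. \<beta> x (y + y') = \<beta> x y + \<beta> x y'" "\<And>c x y. \<beta> x (c *s y) = c * \<beta> x y"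
    and nondeg: "\<And>x. x \<in> P \<Longrightarrow> (\<And>y. y \<in> P \<Longrightarrow> \<beta> x y = 0) \<Longrightarrow> x = 0"
    and \<phi>: "\<And>x y. x \<in> P \<Longrightarrow> y \<in> P \<Longrightarrow> \<phi> (x + y) = \<phi> x + \<phi> y" "\<And>c x. x \<in> P \<Longrightarrow> \<phi> (c *s x) = c * \<phi> x"
  shows "\<exists>x\<in>P. \<forall>y\<in>P. \<beta> x y = \<phi> y"
proof -
  obtain B where B: "finite B" "independent B" "span B = P" using fdim_basis[OF P] .
  have BP: "b \<in> P" if "b \<in> B" for b using B that span_base by blast
  have \<phi>0: "\<phi> 0 = 0" using \<phi>(2)[of 0 0] fdim_subspace[OF P] by (simp add: subspace_0)
  have \<beta>0: "\<beta> x 0 = 0" for x using right(2)[of x 0 0] by simp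
  have agree: "\<beta> x y = \<phi> y" if x: "\<And>b. b \<in> B \<Longrightarrow> \<beta> x b = \<phi> b" and y: "y \<in> P" for x y
  proof -
    have "y \<in> span B" using y B by simp
    then have "y \<in> P \<and> \<beta> x y = \<phi> y"
    proof (rule span_induct_alt)
      fix c b y assume "b \<in> B" "y \<in> P \<and> \<beta> x y = \<phi> y"
      then show "c *s b + y \<in> P \<and> \<beta> x (c *s b + y) = \<phi> (c *s b + y)"
        using BP x fdim_subspace[OF P] by (simp add: subspace_add subspace_scale right \<phi>)
    qed (use \<beta>0 \<phi>0 fdim_subspace[OF P] subspace_0 in auto)
    then show ?thesis by blast
  qed
  have zero: "\<beta> x y = 0" if x: "\<And>b. b \<in> B \<Longrightarrow> \<beta> x b = 0" and y: "y \<in> P" for x y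
  proof -
    have "y \<in> span B" using y B by simp
    then show ?thesis
      by (rule span_induct_alt) (use x \<beta>0 in \<open>auto simp: right\<close>)
  qed
  \<comment> \<open>\<open>N\<close> is the map from \<open>P\<close> to its dual, written in the
    coordinates of \<open>B\<close> so that it becomes an operator on \<open>P\<close>.\<close>
  define N where "N x = (\<Sum>b\<in>B. \<beta> x b *s b)" for x
  have N: "endo N"
    by (auto simp: endo_def N_def left scale_left_distrib sum.distrib scale_sum_right)
  have coeffs: "f b = g b" if "(\<Sum>b\<in>B. f b *s b) = (\<Sum>b\<in>B. g b *s b)" "b \<in> B" for f g b
    using independentD[OF B(2,1) subset_refl, of "\<lambda>b. f b - g b" b] that
    by (simp add: scale_left_diff_distrib sum_subtractf)
  have "N ` P = P"
  proof (rule injective_endo_image[OF N P])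
    show "N v \<in> P" for v using BP fdim_subspace[OF P] by (auto simp: N_def intro!: subspace_sum subspace_scale)
    show "v = 0" if v: "v \<in> P" "N v = 0" for v
    proof (rule nondeg[OF v(1)])
      have "\<beta> v b = 0" if "b \<in> B" for b
        using coeffs[of "\<beta> v" "\<lambda>_. 0" b] v(2) that by (simp add: N_def)
      then show "\<beta> v y = 0" if "y \<in> P" for y using zero that by blast
    qed
  qed
  moreover have "(\<Sum>b\<in>B. \<phi> b *s b) \<in> P"
    using BP fdim_subspace[OF P] by (auto intro!: subspace_sum subspace_scale)
  ultimately obtain x where x: "x \<in> P" "N x = (\<Sum>b\<in>B. \<phi> b *s b)" by (metis imageE)
  then have "\<beta> x b = \<phi> b" if "b \<in> B" for b using coeffs[of "\<beta> x" \<phi> b] that by (simp add: N_def)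
  then show ?thesis using x(1) agree by blast
qed

end

section \<open>Lie algebras\<close>

text \<open>By the Leibniz rule \<open>der\<close>, \<open>T3 - (l + m)\<close> sends
  \<open>p u v\<close> to \<open>p\<close> of \<open>(T1 - l) u\<close> and \<open>v\<close> plus
  \<open>p\<close> of \<open>u\<close> and \<open>(T2 - m) v\<close>; after \<open>j + k\<close>
  steps one of the two arguments has vanished. The product \<open>p\<close> will be the bracket, the
  action and the composition of operators.\<close>

lemma gen_eig_bilinear:
  assumes T: "complex_space.endo s1 T1" "complex_space.endo s2 T2" "complex_space.endo s3 T3"
    and spaces: "complex_space s1" "complex_space s2" "complex_space s3"
    and D: "\<And>u. u \<in> D \<Longrightarrow> T1 u \<in> D" "module.subspace s1 D"
    and E: "\<And>v. v \<in> E \<Longrightarrow> T2 v \<in> E" "module.subspace s2 E"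
    and add: "\<And>u u' v. u \<in> D \<Longrightarrow> u' \<in> D \<Longrightarrow> v \<in> E \<Longrightarrow> p (u + u') v = p u v + p u' v"
      "\<And>u v v'. u \<in> D \<Longrightarrow> v \<in> E \<Longrightarrow> v' \<in> E \<Longrightarrow> p u (v + v') = p u v + p u v'"
    and scale: "\<And>c u v. u \<in> D \<Longrightarrow> v \<in> E \<Longrightarrow> p (s1 c u) v = s3 c (p u v)"
      "\<And>c u v. u \<in> D \<Longrightarrow> v \<in> E \<Longrightarrow> p u (s2 c v) = s3 c (p u v)"
    and der: "\<And>u v. u \<in> D \<Longrightarrow> v \<in> E \<Longrightarrow> T3 (p u v) = p (T1 u) v + p u (T2 v)"
    and uv: "u \<in> D" "v \<in> E" "u \<in> complex_space.gen_eig s1 T1 l" "v \<in> complex_space.gen_eig s2 T2 m"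
  shows "p u v \<in> complex_space.gen_eig s3 T3 (l + m)"
proof -
  interpret s1: complex_space s1 by fact
  interpret s2: complex_space s2 by fact
  interpret s3: complex_space s3 by fact
  have pow1: "s1.papply T1 ([:-l, 1:] ^ Suc j) u = s1.papply T1 ([:-l, 1:] ^ j) (T1 u - s1 l u)" for j u
    using T(1) s1.papply_mult[OF T(1)] by (simp only: power_Suc2 s1.papply_linear)
  have pow2: "s2.papply T2 ([:-m, 1:] ^ Suc j) v = s2.papply T2 ([:-m, 1:] ^ j) (T2 v - s2 m v)" for j v
    using T(2) s2.papply_mult[OF T(2)] by (simp only: power_Suc2 s2.papply_linear)
  have pow3: "s3.papply T3 ([:-(l + m), 1:] ^ Suc j) v
      = s3.papply T3 ([:-(l + m), 1:] ^ j) (T3 v - s3 (l + m) v)" for j v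
    using T(3) s3.papply_mult[OF T(3)] by (simp only: power_Suc2 s3.papply_linear)
  have zero: "p 0 v = 0" "p u 0 = 0" if "u \<in> D" "v \<in> E" for u v
    using scale(1)[of u v 0] scale(2)[of u v 0] that by simp_all
  have "s3.papply T3 ([:-(l + m), 1:] ^ n) (p u v) = 0"
    if "n = j + k" "s1.papply T1 ([:-l, 1:] ^ j) u = 0" "s2.papply T2 ([:-m, 1:] ^ k) v = 0" "u \<in> D" "v \<in> E"
    for n j k u v
    using that
  proof (induction n arbitrary: j k u v)
    case 0
    then show ?case using zero by auto
  next
    case (Suc n)
    show ?case
    proof (cases "j = 0 \<or> k = 0")
      case True
      then have "p u v = 0" using Suc.prems zero by auto
      then show ?thesis by (simp add: s3.papply_zero[OF T(3)])
    next
      case False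
      then obtain j' k' where jk: "j = Suc j'" "k = Suc k'" by (metis not0_implies_Suc)
      define u' where "u' = T1 u - s1 l u"
      define v' where "v' = T2 v - s2 m v"
      have u': "u' \<in> D" and v': "v' \<in> E"
        using Suc.prems D E by (auto simp: u'_def v'_def s1.subspace_diff s1.subspace_scale
            s2.subspace_diff s2.subspace_scale)
      have z1: "s3.papply T3 ([:-(l + m), 1:] ^ n) (p u' v) = 0"
        by (rule Suc.IH[of j' k]) (use Suc.prems jk pow1 u' in \<open>auto simp: u'_def\<close>)
      have z2: "s3.papply T3 ([:-(l + m), 1:] ^ n) (p u v') = 0"
        by (rule Suc.IH[of j k']) (use Suc.prems jk pow2 v' in \<open>auto simp: v'_def\<close>)
      have "T1 u = u' + s1 l u" "T2 v = v' + s2 m v" by (simp_all add: u'_def v'_def)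
      then have "T3 (p u v) = p (u' + s1 l u) v + p u (v' + s2 m v)"
        using der Suc.prems by simp
      also have "\<dots> = p u' v + s3 l (p u v) + (p u v' + s3 m (p u v))"
        using Suc.prems u' v' D(2) E(2) by (simp add: add scale s1.subspace_scale s2.subspace_scale)
      finally have "T3 (p u v) - s3 (l + m) (p u v) = p u' v + p u v'"
        by (simp add: s3.scale_left_distrib)
      then show ?thesis
        using z1 z2 by (simp only: pow3 s3.endo_add[OF s3.endo_papply[OF T(3)]] add_0)
    qed
  qed
  then show ?thesis
    using uv by (auto simp: s1.gen_eig_def s2.gen_eig_def s3.gen_eig_def) blast
qed

section \<open>Brackets, ideals and Engel's theorem\<close>

sublocale lie_algebra \<subseteq> complex_space scale ..

context lie_algebra
begin

lemma bracket_zero_right [simp]: "bracket x 0 = 0"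
  using bracket_scale_right[of x 0 0] by simp

lemma bracket_zero_left [simp]: "bracket 0 x = 0"
  using bracket_scale_left[of 0 0 x] by simp

lemma bracket_minus_right: "bracket x (- y) = - bracket x y"
  using bracket_scale_right[of x "-1" y] by simp

lemma bracket_skew: "bracket x y = - bracket y x"
proof -
  have "bracket (x + y) (x + y) = (bracket x x + bracket x y) + (bracket y x + bracket y y)"
    by (simp only: bracket_add_left bracket_add_right ac_simps)
  then have "bracket x y + bracket y x = 0" by (simp add: bracket_self)
  then show ?thesis by (simp add: eq_neg_iff_add_eq_0)
qed

lemma bracket_derivation: "bracket x (bracket y z) = bracket (bracket x y) z + bracket y (bracket x z)"
  using jacobi[of x y z] bracket_skew[of z "bracket x y"] bracket_skew[of z x]
  by (simp add: bracket_minus_right algebra_simps add_eq_0_iff)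

lemma bracket_bracket: "bracket (bracket x y) z = bracket x (bracket y z) - bracket y (bracket x z)"
  using bracket_derivation[of x y z] by simp

lemma endo_bracket: "endo (bracket x)"
  by (simp add: endo_def bracket_add_right bracket_scale_right)

lemma endo_bracket_left: "endo (\<lambda>x. bracket x y)"
  by (simp add: endo_def bracket_add_left bracket_scale_left)

lemma gen_eig_bracket:
  assumes "u \<in> gen_eig (bracket h) l" "v \<in> gen_eig (bracket h) m"
  shows "bracket u v \<in> gen_eig (bracket h) (l + m)"
  using gen_eig_bilinear[of scale "bracket h" scale "bracket h" scale "bracket h" UNIV UNIV bracket u v l m]
    assms complex_space_axioms endo_bracket
  by (simp add: bracket_add_left bracket_add_right bracket_scale_left bracket_scale_right
      bracket_derivation[of h])

lemma ideal_subspace: "lie_ideal I \<Longrightarrow> subspace I"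
  and ideal_bracket: "lie_ideal I \<Longrightarrow> y \<in> I \<Longrightarrow> bracket x y \<in> I"
  by (auto simp: lie_ideal_def)

lemma ideal_bracket_left: "lie_ideal I \<Longrightarrow> x \<in> I \<Longrightarrow> bracket x y \<in> I"
  using ideal_bracket[of I x y] bracket_skew[of x y] subspace_neg[OF ideal_subspace, of I "bracket y x"] by simp

lemma ideal_derived_series: "lie_ideal I \<Longrightarrow> lie_ideal (derived_series I n)"
proof (induction n)
  case (Suc n)
  let ?D = "derived_series I n"
  let ?S = "{bracket x y | x y. x \<in> ?D \<and> y \<in> ?D}"
  have D: "lie_ideal ?D" using Suc by simp
  have "bracket x y \<in> span ?S" if "y \<in> span ?S" for x y
    using that
  proof (rule span_induct_alt)
    fix c y z assume y: "y \<in> ?S" and z: "bracket x z \<in> span ?S"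
    obtain a b where ab: "y = bracket a b" "a \<in> ?D" "b \<in> ?D" using y by auto
    have "bracket x y = bracket (bracket x a) b + bracket a (bracket x b)"
      unfolding ab(1) by (rule bracket_derivation)
    moreover have "bracket (bracket x a) b \<in> ?S" "bracket a (bracket x b) \<in> ?S"
      using ab ideal_bracket[OF D] by blast+
    ultimately have "bracket x y \<in> span ?S" by (simp add: span_add span_base)
    then show "bracket x (scale c y + z) \<in> span ?S"
      using z by (simp add: bracket_add_right bracket_scale_right span_add span_scale)
  qed (simp add: span_zero)
  then show ?case by (simp add: lie_ideal_def)
qed simp

lemma derived_series_Suc_subset:
  assumes "lie_ideal I" shows "derived_series I (Suc n) \<subseteq> derived_series I n"
proof -
  have D: "lie_ideal (derived_series I n)" using ideal_derived_series assms by blast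
  show ?thesis
    unfolding derived_series.simps
    by (rule span_minimal) (use D ideal_bracket ideal_subspace in auto)
qed

lemma derived_series_antimono:
  assumes "lie_ideal I" "m \<le> n" shows "derived_series I n \<subseteq> derived_series I m"
  by (rule lift_Suc_antimono_le[of "derived_series I"])
    (use derived_series_Suc_subset[OF assms(1)] assms(2) in auto)

text \<open>A pair \<open>F \<subset> E\<close> of stable subspaces stands for the quotient module.
  Among the subalgebras \<open>K\<close> of \<open>L\<close> that satisfy the conclusion for all
  pairs, one of largest dimension is taken; if it is not \<open>L\<close>, it can be enlarged by one
  element that normalizes it.\<close>

lemma engel:
  assumes fin: "fdim UNIV" and L: "subspace L" "\<And>x y. x \<in> L \<Longrightarrow> y \<in> L \<Longrightarrow> bracket x y \<in> L"
    and nil: "\<And>x v. x \<in> L \<Longrightarrow> v \<in> gen_eig (bracket x) 0"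
    and EF: "subspace E" "subspace F" "F \<subset> E"
      "\<And>x v. x \<in> L \<Longrightarrow> v \<in> E \<Longrightarrow> bracket x v \<in> E" "\<And>x v. x \<in> L \<Longrightarrow> v \<in> F \<Longrightarrow> bracket x v \<in> F"
  shows "\<exists>v\<in>E - F. \<forall>x\<in>L. bracket x v \<in> F"
proof -
  define St where "St K E \<longleftrightarrow> (\<forall>x\<in>K. \<forall>v\<in>E. bracket x v \<in> E)" for K E
  define Q where "Q K \<longleftrightarrow> subspace K \<and> K \<subseteq> L \<and> St K K \<and>
    (\<forall>E F. subspace E \<longrightarrow> subspace F \<longrightarrow> F \<subset> E \<longrightarrow> St K E \<longrightarrow> St K F \<longrightarrow> (\<exists>v\<in>E - F. \<forall>x\<in>K. bracket x v \<in> F))" for K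
  have "Q {0}" using L(1) by (auto simp: Q_def St_def subspace_0)
  moreover have "dim K \<le> dim UNIV" if "Q K" for K
  proof (cases "K = UNIV")
    case False
    then have "K \<subset> UNIV" by blast
    then show ?thesis using fdim_dim_less[OF fin, of K] that by (simp add: Q_def)
  qed simp
  ultimately have "\<exists>K. Q K \<and> (\<forall>K'. Q K' \<longrightarrow> dim K' \<le> dim K)"
    by (intro ex_has_greatest_nat[of Q "{0}" dim "Suc (dim UNIV)"]) (simp_all add: less_Suc_eq_le)
  then obtain K where K: "Q K" "\<And>K'. Q K' \<Longrightarrow> dim K' \<le> dim K" by blast
  have Ks: "subspace K" "K \<subseteq> L" "St K K" using K(1) by (auto simp: Q_def)
  have KQ: "\<exists>v\<in>E - F. \<forall>x\<in>K. bracket x v \<in> F"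
    if "subspace E" "subspace F" "F \<subset> E" "St K E" "St K F" for E F
    using K(1) that unfolding Q_def by blast
  have "K = L"
  proof (rule ccontr)
    assume "K \<noteq> L"
    moreover have "St K L" using Ks(2) L(2) by (auto simp: St_def)
    \<comment> \<open>The property of \<open>K\<close>, applied to the pair of \<open>K\<close> and
      \<open>L\<close> themselves, gives an element that normalizes \<open>K\<close>.\<close>
    ultimately obtain z where z: "z \<in> L" "z \<notin> K" "\<forall>x\<in>K. bracket x z \<in> K"
      using KQ[OF L(1) Ks(1)] Ks(2,3) by blast
    define K' where "K' = span (insert z K)"
    have K'E: "\<exists>c. \<exists>k\<in>K. x = scale c z + k" if "x \<in> K'" for x
      using that Ks(1) unfolding K'_def span_insert
      by (auto simp: span_eq_iff[THEN iffD2]) (metis diff_add_cancel add.commute)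
    have K'sub: "K \<subseteq> K'" "z \<in> K'" by (auto simp: K'_def intro: span_base)
    have sK': "subspace K'" by (simp add: K'_def)
    have zK: "bracket z k \<in> K" if "k \<in> K" for k
      using z(3) that bracket_skew[of z k] Ks(1) by (auto simp: subspace_neg)
    have br: "bracket (scale c z + k) (scale d z + k') \<in> K" if "k \<in> K" "k' \<in> K" for c d k k'
      using that zK z(3) Ks
      by (auto simp: bracket_add_left bracket_add_right bracket_scale_left bracket_scale_right bracket_self St_def
          intro!: subspace_add subspace_scale)
    have "K' \<subseteq> L" unfolding K'_def by (rule span_minimal) (use z Ks L in auto)
    moreover have "St K' K'" using br K'E K'sub unfolding St_def by (metis subsetD)
    moreover have "\<exists>v\<in>E - F. \<forall>x\<in>K'. bracket x v \<in> F"
      if E: "subspace E" and F: "subspace F" and FE: "F \<subset> E" and StE: "St K' E" and StF: "St K' F" for E F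
    proof -
      have StK: "St K E" "St K F" using StE StF K'sub by (auto simp: St_def)
      obtain v where v: "v \<in> E - F" "\<forall>x\<in>K. bracket x v \<in> F" using KQ[OF E F FE StK] by blast
      obtain k where "((bracket z) ^^ k) v = 0"
        using nil[OF z(1), of v] gen_eig_0_iff[OF endo_bracket] by blast
      then have ex: "\<exists>k. ((bracket z) ^^ k) v \<in> F" using F by (metis subspace_0)
      \<comment> \<open>\<open>w\<close> will be the last iterate of \<open>v\<close> under
        \<open>ad z\<close> outside \<open>F\<close>. So \<open>z\<close> maps it into
        \<open>F\<close>, and \<open>K\<close> still does, because \<open>z\<close> normalizes
        \<open>K\<close>.\<close>
      define n where "n = (LEAST k. ((bracket z) ^^ k) v \<in> F)"
      have n: "((bracket z) ^^ n) v \<in> F" unfolding n_def using ex by (rule LeastI_ex)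
      have "n \<noteq> 0" using n v(1) by (cases n) auto
      then obtain m where m: "n = Suc m" by (metis not0_implies_Suc)
      define w where "w = ((bracket z) ^^ m) v"
      have wF: "w \<notin> F" using not_less_Least[of m "\<lambda>k. ((bracket z) ^^ k) v \<in> F"] m by (auto simp: n_def w_def)
      have orbit: "((bracket z) ^^ j) v \<in> E \<and> (\<forall>x\<in>K. bracket x (((bracket z) ^^ j) v) \<in> F)" for j
      proof (induction j)
        case (Suc j)
        let ?u = "((bracket z) ^^ j) v"
        have "bracket x (bracket z ?u) \<in> F" if "x \<in> K" for x
        proof -
          have "bracket x (bracket z ?u) = bracket (bracket x z) ?u + bracket z (bracket x ?u)"
            by (rule bracket_derivation)
          then show ?thesis using Suc z(3) that StF K'sub F by (auto simp: St_def subspace_add)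
        qed
        then show ?case using Suc StE K'sub by (auto simp: St_def)
      qed (use v in auto)
      have "bracket z w \<in> F" using n m by (simp add: w_def)
      then have "bracket x w \<in> F" if "x \<in> K'" for x
        using K'E[OF that] orbit[of m] F
        by (auto simp: w_def bracket_add_left bracket_scale_left subspace_add subspace_scale)
      then show ?thesis using wF orbit[of m] by (auto simp: w_def)
    qed
    ultimately have "Q K'" using sK' by (auto simp: Q_def)
    moreover have "dim K < dim K'"
      using fdim_dim_less[OF fdim_subset[OF fin _ sK'] Ks(1)] K'sub z(2) by blast
    ultimately show False using K(2) by fastforce
  qed
  then show ?thesis using KQ[OF EF(1,2,3)] EF(4,5) by (auto simp: St_def)
qed

end

context semisimple_lie_algebra
begin

lemma fdim_UNIV: "fdim UNIV"
  using finite_dimensional by (auto simp: fdim_def)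

lemma fdim_subspace_any: "subspace E \<Longrightarrow> fdim E"
  using fdim_subset[OF fdim_UNIV] by blast

lemma abelian_ideal_trivial:
  assumes "lie_ideal I" "\<And>x y. x \<in> I \<Longrightarrow> y \<in> I \<Longrightarrow> bracket x y = 0" shows "I = {0}"
proof -
  have "{bracket x y | x y. x \<in> I \<and> y \<in> I} \<subseteq> {0}" using assms(2) by auto
  then have "span {bracket x y | x y. x \<in> I \<and> y \<in> I} \<subseteq> {0}"
    by (rule span_minimal[OF _ subspace_single_0])
  then have "derived_series I 1 = {0}" using span_zero by auto
  then have "solvable_ideal I" unfolding solvable_ideal_def using assms(1) by blast
  then show ?thesis by (rule radical_trivial)
qed

text \<open>By Engel's theorem a term of the derived series that is not zero has a proper subspace
  containing all brackets.\<close>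

lemma ad_nilpotent_derived_ideal_trivial:
  assumes R: "lie_ideal R"
    and nil: "\<And>z v. z \<in> span {bracket x y | x y. x \<in> R \<and> y \<in> R} \<Longrightarrow> v \<in> gen_eig (bracket z) 0"
  shows "R = {0}"
proof -
  let ?D = "derived_series R"
  have D: "lie_ideal (?D n)" for n by (rule ideal_derived_series[OF R])
  \<comment> \<open>From index 1 on the terms lie in the span of the brackets of \<open>R\<close>,
    where \<open>nil\<close> applies; for \<open>R\<close> itself nothing is known.\<close>
  have less: "dim (?D (Suc n)) < dim (?D n)" if n: "n \<ge> 1" "?D n \<noteq> {0}" for n
  proof -
    define L where "L = ?D n"
    have L: "lie_ideal L" "subspace L" using D[of n] by (auto simp: L_def lie_ideal_def)
    have "L \<subseteq> ?D 1" unfolding L_def by (rule derived_series_antimono[OF R n(1)])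
    then have nilL: "v \<in> gen_eig (bracket z) 0" if "z \<in> L" for z v
      by (intro nil) (use that in auto)
    \<comment> \<open>Engel's vector, added to a largest proper stable subspace \<open>F\<close>,
      gives a stable subspace again, hence all of \<open>L\<close>. Since \<open>L\<close> maps that
      vector and \<open>F\<close> into \<open>F\<close>, all brackets fall into
      \<open>F\<close>.\<close>
    define P where "P F \<longleftrightarrow> subspace F \<and> F \<subset> L \<and> (\<forall>x\<in>L. \<forall>v\<in>F. bracket x v \<in> F)" for F
    have "P {0}" using n(2) L(2) by (auto simp: P_def L_def subspace_0)
    moreover have "dim F < dim L" if "P F" for F
      using that fdim_dim_less[OF fdim_subspace_any[OF L(2)]] by (auto simp: P_def)
    ultimately have "\<exists>F. P F \<and> (\<forall>F'. P F' \<longrightarrow> dim F' \<le> dim F)"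
      by (intro ex_has_greatest_nat[of P "{0}" dim "dim L"]) simp_all
    then obtain F where F: "P F" "\<And>F'. P F' \<Longrightarrow> dim F' \<le> dim F" by blast
    have Fs: "subspace F" "F \<subset> L" "\<And>x v. x \<in> L \<Longrightarrow> v \<in> F \<Longrightarrow> bracket x v \<in> F"
      using F(1) by (auto simp: P_def)
    have "\<exists>v\<in>L - F. \<forall>x\<in>L. bracket x v \<in> F"
      by (rule engel[OF fdim_UNIV L(2) _ nilL L(2) Fs(1,2)]) (use L ideal_bracket Fs(3) in auto)
    then obtain v where v: "v \<in> L" "v \<notin> F" "\<forall>x\<in>L. bracket x v \<in> F" by blast
    define F' where "F' = span (insert v F)"
    have F'E: "\<exists>c. \<exists>k\<in>F. x = scale c v + k" if "x \<in> F'" for x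
      using that Fs(1) unfolding F'_def span_insert
      by (auto simp: span_eq_iff[THEN iffD2]) (metis diff_add_cancel add.commute)
    have FF': "F \<subseteq> F'" "v \<in> F'" "subspace F'" by (auto simp: F'_def intro: span_base)
    have brF: "bracket x w \<in> F" if "x \<in> L" "w \<in> F'" for x w
      using F'E[OF that(2)] that(1) v(3) Fs
      by (auto simp: bracket_add_right bracket_scale_right intro!: subspace_add subspace_scale)
    have F'L: "F' \<subseteq> L" unfolding F'_def by (rule span_minimal) (use v Fs L in auto)
    have "F' = L"
    proof (rule ccontr)
      assume "F' \<noteq> L"
      then have "P F'" using brF FF' F'L by (auto simp: P_def)
      moreover have "dim F < dim F'"
        using fdim_dim_less[OF fdim_subspace_any[OF FF'(3)] Fs(1)] FF' v(2) by blast
      ultimately show False using F(2) by fastforce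
    qed
    then have "{bracket x y | x y. x \<in> ?D n \<and> y \<in> ?D n} \<subseteq> F" using brF by (auto simp: L_def)
    then have "?D (Suc n) \<subseteq> F" unfolding derived_series.simps by (rule span_minimal[OF _ Fs(1)])
    then have "?D (Suc n) \<subset> ?D n" using Fs(2) by (auto simp: L_def)
    then show ?thesis
      using fdim_dim_less[OF fdim_subspace_any] D ideal_subspace by blast
  qed
  have "\<exists>n. ?D n = {0}"
  proof (rule ccontr)
    assume ne: "\<not> ?thesis"
    have "dim (?D (Suc n)) + n \<le> dim (?D 1)" for n
    proof (induction n)
      case (Suc n)
      then show ?case using less[of "Suc n"] ne by fastforce
    qed simp
    from this[of "Suc (dim (?D 1))"] show False by simp
  qed
  then have "solvable_ideal R" unfolding solvable_ideal_def using R by blast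
  then show ?thesis by (rule radical_trivial)
qed

end

text \<open>The Chinese remainder theorem for constant residues.\<close>

lemma poly_congruences:
  fixes f :: "complex \<Rightarrow> complex"
  assumes "finite A" shows "\<exists>q. \<forall>\<mu>\<in>A. [:-\<mu>, 1:] ^ n dvd q - [:f \<mu>:]"
  using assms
proof induction
  case (insert \<nu> A)
  then obtain q where q: "\<And>\<mu>. \<mu> \<in> A \<Longrightarrow> [:-\<mu>, 1:] ^ n dvd q - [:f \<mu>:]" by blast
  define P where "P = (\<Prod>\<mu>\<in>A. [:-\<mu>, 1:] ^ n)"
  have "poly P \<nu> \<noteq> 0" using insert by (auto simp: P_def poly_prod)
  then obtain a b where ab: "a * P + b * [:-\<nu>, 1:] ^ n = 1"
    using bezout_linear_power by blast
  \<comment> \<open>The correction is a multiple of \<open>P\<close>, so the congruences already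
    achieved survive; modulo \<open>[:-\<nu>, 1:] ^ n\<close> the factor \<open>a * P\<close> is 1
    and \<open>q\<close> gets replaced by its new residue.\<close>
  define q' where "q' = q + a * P * ([:f \<nu>:] - q)"
  have A: "[:-\<mu>, 1:] ^ n dvd q' - [:f \<mu>:]" if "\<mu> \<in> A" for \<mu>
  proof -
    have "[:-\<mu>, 1:] ^ n dvd P" unfolding P_def using insert.hyps that by (intro dvd_prodI) auto
    moreover have "q' - [:f \<mu>:] = (q - [:f \<mu>:]) + P * (a * ([:f \<nu>:] - q))"
      by (simp add: q'_def algebra_simps)
    ultimately show ?thesis using q[OF that] by (simp only: dvd_add dvd_mult2)
  qed
  have "q' - [:f \<nu>:] = (q - [:f \<nu>:]) * (1 - a * P)" by (simp add: q'_def algebra_simps)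
  moreover have "1 - a * P = b * [:-\<nu>, 1:] ^ n" using ab by (metis add_diff_cancel_left')
  ultimately have "q' - [:f \<nu>:] = (q - [:f \<nu>:]) * (b * [:-\<nu>, 1:] ^ n)" by simp
  then have "[:-\<nu>, 1:] ^ n dvd q' - [:f \<nu>:]" by simp
  with A show ?case by blast
qed simp

text \<open>The operators are linear on the whole type, but the representation laws are asked on
  \<open>E\<close> only: commutators give a representation on spaces of linear maps, and normal
  forms in the free algebra give one on a stable subspace.\<close>

locale lie_rep = g: semisimple_lie_algebra gscale bracket + complex_space scale
  for gscale :: "complex \<Rightarrow> 'g::ab_group_add \<Rightarrow> 'g" and bracket
    and scale :: "complex \<Rightarrow> 'b::ab_group_add \<Rightarrow> 'b"  (infixr "*s" 75)
    and act :: "'g \<Rightarrow> 'b \<Rightarrow> 'b" and E :: "'b set" +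
  assumes endo_act: "endo (act x)"
    and subspace_E: "subspace E"
    and act_E: "v \<in> E \<Longrightarrow> act x v \<in> E"
    and add_act: "v \<in> E \<Longrightarrow> act (x + y) v = act x v + act y v"
    and scale_act: "v \<in> E \<Longrightarrow> act (gscale c x) v = c *s act x v"
    and bracket_act: "v \<in> E \<Longrightarrow> act (bracket x y) v = act x (act y v) - act y (act x v)"
begin

lemma zero_act: "v \<in> E \<Longrightarrow> act 0 v = 0"
  using scale_act[of v 0 0] by simp

lemma minus_act: "v \<in> E \<Longrightarrow> act (- x) v = - act x v"
  using scale_act[of v "-1" x] by simp

lemma act_zero [simp]: "act x 0 = 0"
  by (rule endo_zero[OF endo_act])

lemma act_sum: "act x (\<Sum>i\<in>A. f i) = (\<Sum>i\<in>A. act x (f i))"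
  by (rule endo_sum[OF endo_act])

lemma sum_act: "v \<in> E \<Longrightarrow> act (\<Sum>i\<in>A. f i) v = (\<Sum>i\<in>A. act (f i) v)"
  by (induction A rule: infinite_finite_induct) (auto simp: zero_act add_act)

lemma sub_rep:
  assumes "subspace F" "F \<subseteq> E" "\<And>x v. v \<in> F \<Longrightarrow> act x v \<in> F"
  shows "lie_rep gscale bracket scale act F"
  by unfold_locales (use assms endo_act add_act scale_act bracket_act in auto)

lemma gen_eig_act:
  assumes "v \<in> E" "w \<in> g.gen_eig (bracket z) l" "v \<in> gen_eig (act z) m"
  shows "act w v \<in> gen_eig (act z) (l + m)"
proof (rule gen_eig_bilinear[OF g.endo_bracket endo_act endo_act, where D = UNIV and E = E and p = act])
  show "complex_space gscale" "complex_space scale" by unfold_locales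
  show "module.subspace gscale UNIV" by simp
  show "act z (act u v) = act (bracket z u) v + act u (act z v)" if "v \<in> E" for u v
    using bracket_act[OF that, of z u] by simp
qed (use assms subspace_E act_E add_act scale_act endo_add[OF endo_act] endo_scale[OF endo_act] complex_space_axioms in auto)

text \<open>With \<open>\<mu>\<close> ranging over the eigenvalues of \<open>T = act z\<close>, let \<open>s\<close> be the polynomial in \<open>T\<close> that is
  multiplication by \<open>cnj \<mu>\<close> on the generalized eigenspace of \<open>\<mu>\<close>. Commutation with \<open>s\<close> preserves \<open>R\<close>, so
  the trace of \<open>T s\<close>, which is the sum of the \<open>\<bar>\<mu>\<bar>\<^sup>2\<close>, vanishes.\<close>

lemma cartan_criterion:
  assumes fE: "fdim E" and R: "g.lie_ideal R"
    and tr0: "\<And>x y. x \<in> R \<Longrightarrow> y \<in> R \<Longrightarrow> tr E (\<lambda>v. act x (act y v)) = 0"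
    and z: "z \<in> g.span {bracket x y | x y. x \<in> R \<and> y \<in> R}" and v: "v \<in> E"
  shows "v \<in> gen_eig (act z) 0"
proof -
  let ?T = "act z"
  have T: "endo ?T" and TE: "\<And>v. v \<in> E \<Longrightarrow> ?T v \<in> E" using endo_act act_E by auto
  obtain ms where ms: "\<forall>p. tr E (papply ?T p) = (\<Sum>\<mu>\<leftarrow>ms. poly p \<mu>)"
    "\<forall>v\<in>E. papply ?T (\<Prod>\<mu>\<leftarrow>ms. [:-\<mu>, 1:]) v = 0"
    using trace_polynomial[OF T fE TE] by blast
  define n where "n = length ms"
  define P where "P = (\<Prod>\<mu>\<leftarrow>ms. [:-\<mu>, 1:])"
  have P: "papply ?T P v = 0" if "v \<in> E" for v using ms(2) that by (simp add: P_def)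
  have polyP: "poly P \<mu> = (\<Prod>\<nu>\<leftarrow>ms. \<mu> - \<nu>)" for \<mu>
    unfolding P_def by (induction ms) (auto simp: algebra_simps)
  have degP: "degree P = n" "P \<noteq> 0"
    unfolding P_def n_def by (induction ms) (simp_all add: degree_mult_eq del: mult_pCons_left)
  \<comment> \<open>The exponent \<open>n\<close> is at least the multiplicity of every eigenvalue,
    so the congruences fix \<open>s\<close> on whole generalized eigenspaces.\<close>
  obtain q where q: "\<forall>\<mu>\<in>set ms. [:-\<mu>, 1:] ^ n dvd q - [:cnj \<mu>:]"
    using poly_congruences[of "set ms" n cnj] by auto
  define s where "s = papply ?T q"
  have s: "endo s" "\<And>v. v \<in> E \<Longrightarrow> s v \<in> E"
    using endo_papply[OF T] papply_in_subspace[OF T subspace_E TE] by (auto simp: s_def)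
  have s_eig: "s v = cnj \<mu> *s v" if v: "v \<in> E" "v \<in> gen_eig ?T \<mu>" for v \<mu>
  proof -
    obtain k where k: "papply ?T ([:-\<mu>, 1:] ^ k) v = 0" using v(2) by (auto simp: gen_eig_def)
    \<comment> \<open>The exponent \<open>k\<close> that belongs to \<open>v\<close> is unbounded;
      comparison with the annihilating polynomial \<open>P\<close> lowers it to the multiplicity
      \<open>c \<le> n\<close>.\<close>
    define c where "c = order \<mu> P"
    obtain r where r: "P = [:-\<mu>, 1:] ^ c * r" "\<not> [:-\<mu>, 1:] dvd r"
      using order_decomp[OF degP(2), of \<mu>] by (auto simp: c_def)
    obtain a b where ab: "a * r + b * [:-\<mu>, 1:] ^ k = 1"
      using bezout_linear_power[of r \<mu> k] r(2) by (auto simp: poly_eq_0_iff_dvd)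
    have "papply ?T ([:-\<mu>, 1:] ^ c) v
        = papply ?T ([:-\<mu>, 1:] ^ c * (a * r)) v + papply ?T ([:-\<mu>, 1:] ^ c * (b * [:-\<mu>, 1:] ^ k)) v"
      by (subst papply_add[OF T, symmetric]) (simp only: ab mult_1_right flip: distrib_left)
    also have "[:-\<mu>, 1:] ^ c * (a * r) = a * P" by (simp add: r(1))
    finally have c0: "papply ?T ([:-\<mu>, 1:] ^ c) v = 0"
      by (simp only: papply_mult[OF T] k P[OF v(1)] papply_zero[OF T] add_0)
    show ?thesis
    proof (cases "\<mu> \<in> set ms")
      case True
      have "c \<le> n" using order_degree[OF degP(2)] degP(1) by (simp add: c_def)
      then have "papply ?T ([:-\<mu>, 1:] ^ n) v = 0" using papply_power_zero_mono[OF T c0] by blast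
      moreover obtain t where "q - [:cnj \<mu>:] = t * [:-\<mu>, 1:] ^ n"
        using q True by (metis dvdE mult.commute)
      ultimately have "papply ?T (q - [:cnj \<mu>:]) v = 0"
        by (simp only: papply_mult[OF T] papply_zero[OF T])
      then show ?thesis using papply_diff[OF T, of q "[:cnj \<mu>:]" v] by (simp add: s_def)
    next
      case False
      then have "poly P \<mu> \<noteq> 0" by (auto simp: polyP prod_list_zero_iff)
      then have "c = 0" by (simp add: c_def order_0I)
      then show ?thesis using c0 endo_zero[OF s(1)] by simp
    qed
  qed
  have eig_span: "v \<in> span {w \<in> E. \<exists>l. w \<in> gen_eig ?T l}" if "v \<in> E" for v
    by (rule gen_eig_span[OF T fE TE that])
  \<comment> \<open>For a component \<open>w\<close> of \<open>b\<close> in the eigenspace of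
    \<open>ad z\<close> for \<open>l\<close>, the commutator with \<open>s\<close> is multiplication
    by \<open>- cnj l\<close>, because \<open>act w\<close> shifts the eigenvalues of
    \<open>act z\<close> by \<open>l\<close>. So \<open>b'\<close> rescales the components of
    \<open>b\<close>, which lie in \<open>R\<close>.\<close>
  have comm: "\<exists>b'\<in>R. \<forall>v\<in>E. act b (s v) - s (act b v) = act b' v" if "b \<in> R" for b
  proof -
    have "b \<in> g.span {w \<in> R. \<exists>l. w \<in> g.gen_eig (bracket z) l}"
      by (rule g.gen_eig_span[OF g.endo_bracket g.fdim_subspace_any[OF g.ideal_subspace[OF R]]])
        (use R g.ideal_bracket that in auto)
    then show ?thesis
    proof (rule g.span_induct_alt)
      show "\<exists>b'\<in>R. \<forall>v\<in>E. act 0 (s v) - s (act 0 v) = act b' v"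
        using s zero_act by (intro bexI[of _ 0]) (auto simp: endo_zero R g.ideal_subspace g.subspace_0)
    next
      fix c w b
      assume w: "w \<in> {w \<in> R. \<exists>l. w \<in> g.gen_eig (bracket z) l}"
        and "\<exists>b'\<in>R. \<forall>v\<in>E. act b (s v) - s (act b v) = act b' v"
      then obtain b' where b': "b' \<in> R" "\<And>v. v \<in> E \<Longrightarrow> act b (s v) - s (act b v) = act b' v" by blast
      obtain l where l: "w \<in> g.gen_eig (bracket z) l" using w by blast
      have w': "act w (s v) - s (act w v) = - cnj l *s act w v" if "v \<in> E" for v
        using eig_span[OF that]
      proof (rule span_induct_alt)
        fix d u v
        assume u: "u \<in> {w \<in> E. \<exists>l. w \<in> gen_eig ?T l}" and vv: "act w (s v) - s (act w v) = - cnj l *s act w v"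
        obtain \<mu> where \<mu>: "u \<in> gen_eig ?T \<mu>" "u \<in> E" using u by blast
        have "s (act w u) = cnj (l + \<mu>) *s act w u"
          by (rule s_eig[OF act_E[OF \<mu>(2)] gen_eig_act[OF \<mu>(2) l \<mu>(1)]])
        then have "act w (s u) - s (act w u) = - cnj l *s act w u"
          using s_eig[OF \<mu>(2,1)] endo_scale[OF endo_act]
          by (simp add: scale_left_distrib)
        then have "d *s act w (s u) - d *s s (act w u) = d *s (- cnj l *s act w u)"
          by (metis scale_right_diff_distrib)
        then show "act w (s (d *s u + v)) - s (act w (d *s u + v)) = - cnj l *s act w (d *s u + v)"
          using vv
          by (simp add: endo_add[OF endo_act] endo_add[OF s(1)] endo_scale[OF endo_act] endo_scale[OF s(1)]
              scale_right_distrib algebra_simps)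
      qed (simp add: endo_zero[OF s(1)])
      define b'' where "b'' = gscale (c * (- cnj l)) w + b'"
      have "b'' \<in> R"
        unfolding b''_def using b' w g.ideal_subspace[OF R] by (intro g.subspace_add g.subspace_scale) auto
      moreover have "act (gscale c w + b) (s v) - s (act (gscale c w + b) v) = act b'' v" if "v \<in> E" for v
      proof -
        have "act (gscale c w + b) (s v) - s (act (gscale c w + b) v)
            = c *s (act w (s v) - s (act w v)) + (act b (s v) - s (act b v))"
          using that s by (simp add: add_act scale_act endo_add endo_scale scale_right_diff_distrib)
        also have "\<dots> = act b'' v"
          unfolding w'[OF that] b'(2)[OF that] b''_def add_act[OF that] scale_act[OF that] by simp
        finally show ?thesis .
      qed
      ultimately show "\<exists>b'\<in>R. \<forall>v\<in>E. act (gscale c w + b) (s v) - s (act (gscale c w + b) v) = act b' v"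
        by blast
    qed
  qed
  have lin: "endo (\<lambda>v. act y (s v))" "\<And>v. v \<in> E \<Longrightarrow> act y (s v) \<in> E" for y
    using endo_comp[OF endo_act s(1)] act_E s(2) by auto
  have "tr E (\<lambda>v. act y (s v)) = 0" if "y \<in> g.span {bracket x y | x y. x \<in> R \<and> y \<in> R}" for y
    using that
  proof (rule g.span_induct_alt)
    have "tr E (\<lambda>v. act 0 (s v)) = tr E (\<lambda>v. 0 *s v)" by (rule tr_cong[OF _ fE]) (auto simp: zero_act s)
    then show "tr E (\<lambda>v. act 0 (s v)) = 0" using tr_scale[OF fE endo_id, of 0] by simp
  next
    fix c x y
    assume "x \<in> {bracket x y | x y. x \<in> R \<and> y \<in> R}" and y: "tr E (\<lambda>v. act y (s v)) = 0"
    then obtain a b where ab: "a \<in> R" "b \<in> R" "x = bracket a b" by blast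
    \<comment> \<open>The trace of \<open>[a, b] s\<close> equals that of
      \<open>a (b s - s b)\<close>, which is the trace of \<open>a b'\<close> and vanishes by
      \<open>tr0\<close>.\<close>
    obtain b' where b': "b' \<in> R" "\<forall>v\<in>E. act b (s v) - s (act b v) = act b' v" using comm[OF ab(2)] by blast
    have as: "endo (\<lambda>v. act a (s v))" "\<And>v. v \<in> E \<Longrightarrow> act a (s v) \<in> E" by (rule lin)+
    have "tr E (\<lambda>v. act x (s v)) = tr E (\<lambda>v. act a (act b (s v)) - act b (act a (s v)))"
      by (rule tr_cong[OF _ fE]) (simp add: ab bracket_act s)
    also have "\<dots> = tr E (\<lambda>v. act a (act b (s v))) - tr E (\<lambda>v. act b (act a (s v)))"
      by (rule tr_diff[OF fE]) (auto intro!: endo_comp[OF endo_act] lin act_E s)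
    also have "tr E (\<lambda>v. act b (act a (s v))) = tr E (\<lambda>v. act a (s (act b v)))"
      by (rule tr_commute[OF fE endo_act act_E as])
    also have "tr E (\<lambda>v. act a (act b (s v))) - tr E (\<lambda>v. act a (s (act b v)))
        = tr E (\<lambda>v. act a (act b (s v)) - act a (s (act b v)))"
      by (rule tr_diff[OF fE, symmetric]) (auto intro!: endo_comp[OF endo_act] endo_comp[OF as(1) endo_act] lin act_E s)
    also have "\<dots> = tr E (\<lambda>v. act a (act b' v))"
      by (rule tr_cong[OF _ fE]) (use b' in \<open>simp flip: endo_diff[OF endo_act]\<close>)
    also have "\<dots> = 0" by (rule tr0[OF ab(1) b'(1)])
    finally have x: "tr E (\<lambda>v. act x (s v)) = 0" .
    have "tr E (\<lambda>v. act (gscale c x + y) (s v)) = tr E (\<lambda>v. c *s act x (s v) + act y (s v))"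
      by (rule tr_cong[OF _ fE]) (simp add: add_act scale_act s)
    also have "\<dots> = c * tr E (\<lambda>v. act x (s v)) + tr E (\<lambda>v. act y (s v))"
      using tr_add[OF fE, of "\<lambda>v. c *s act x (s v)" "\<lambda>v. act y (s v)"] tr_scale[OF fE lin, of c x] lin
        endo_scaled[OF lin(1)] subspace_scale[OF subspace_E] by simp
    finally show "tr E (\<lambda>v. act (gscale c x + y) (s v)) = 0" using x y by simp
  qed
  moreover have "papply ?T ([:0, 1:] * q) = (\<lambda>v. ?T (s v))"
    by (rule ext) (simp add: s_def papply_mult[OF T] papply_pCons[OF T] del: mult_pCons_left mult_pCons_right)
  ultimately have "tr E (papply ?T ([:0, 1:] * q)) = 0" using z by simp
  then have "(\<Sum>\<mu>\<leftarrow>ms. poly ([:0, 1:] * q) \<mu>) = 0" using ms(1) by simp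
  also have "(\<Sum>\<mu>\<leftarrow>ms. poly ([:0, 1:] * q) \<mu>) = (\<Sum>\<mu>\<leftarrow>ms. of_real ((cmod \<mu>)\<^sup>2))"
  proof (intro arg_cong[of _ _ sum_list] map_cong refl)
    fix \<mu> assume \<mu>: "\<mu> \<in> set ms"
    then have "n \<noteq> 0" by (auto simp: n_def)
    then have "[:-\<mu>, 1:] dvd q - [:cnj \<mu>:]" using q \<mu> by (meson dvd_power dvd_trans neq0_conv)
    then have "poly q \<mu> = cnj \<mu>" by (simp flip: poly_eq_0_iff_dvd)
    then show "poly ([:0, 1:] * q) \<mu> = of_real ((cmod \<mu>)\<^sup>2)" by (simp flip: complex_norm_square)
  qed
  also have "\<dots> = of_real (\<Sum>\<mu>\<leftarrow>ms. (cmod \<mu>)\<^sup>2)" by (induction ms) auto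
  finally have sq: "(\<Sum>\<mu>\<leftarrow>ms. (cmod \<mu>)\<^sup>2) = 0" by simp
  have "\<mu> = 0" if "\<mu> \<in> set ms" for \<mu>
  proof -
    have "\<forall>x\<in>set (map (\<lambda>\<mu>. (cmod \<mu>)\<^sup>2) ms). x = 0"
      using sq by (subst (asm) sum_list_nonneg_eq_0_iff) auto
    then show ?thesis using that by simp
  qed
  then have "map (\<lambda>\<mu>. [:-\<mu>, 1:]) ms = map (\<lambda>_. [:-0, 1:]) ms" by (intro map_cong) auto
  then have "P = [:-0, 1:] ^ n" unfolding P_def n_def by (simp add: map_replicate_const)
  then show ?thesis using P[OF v] by (auto simp: gen_eig_def)
qed

end

section \<open>Trace forms\<close>

context lie_rep
begin

definition form :: "'g \<Rightarrow> 'g \<Rightarrow> complex" where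
  "form x y = tr E (\<lambda>v. act x (act y v))"

context
  assumes fE: "fdim E"
begin

lemma act_act: "endo (\<lambda>v. act x (act y v))" "v \<in> E \<Longrightarrow> act x (act y v) \<in> E"
  by (auto intro: endo_comp endo_act act_E)

lemma form_sym: "form x y = form y x"
  unfolding form_def by (rule tr_commute[OF fE endo_act act_E endo_act act_E])

lemma form_add_left: "form (x + x') y = form x y + form x' y"
proof -
  have "form (x + x') y = tr E (\<lambda>v. act x (act y v) + act x' (act y v))"
    unfolding form_def by (rule tr_cong[OF _ fE]) (simp add: add_act act_E)
  also have "\<dots> = form x y + form x' y"
    unfolding form_def by (rule tr_add[OF fE act_act act_act])
  finally show ?thesis .
qed

lemma form_scale_left: "form (gscale c x) y = c * form x y"
proof -
  have "form (gscale c x) y = tr E (\<lambda>v. c *s act x (act y v))"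
    unfolding form_def by (rule tr_cong[OF _ fE]) (simp add: scale_act act_E)
  also have "\<dots> = c * form x y"
    unfolding form_def by (rule tr_scale[OF fE act_act])
  finally show ?thesis .
qed

lemma form_add_right: "form x (y + y') = form x y + form x y'"
  and form_scale_right: "form x (gscale c y) = c * form x y"
  using form_add_left form_scale_left form_sym by metis+

lemma form_zero_left: "form 0 y = 0"
  using form_scale_left[of 0 0 y] by simp

lemma form_minus_left: "form (- x) y = - form x y"
  using form_scale_left[of "-1" x y] by simp

lemma form_diff_left: "form (x - y) z = form x z - form y z"
  using form_add_left[of x "- y" z] form_minus_left[of y z] by simp

lemma form_invariant: "form (bracket z x) y = - form x (bracket z y)"
proof -
  have cE: "endo (\<lambda>v. act a (act b (act c v)))" "v \<in> E \<Longrightarrow> act a (act b (act c v)) \<in> E" for a b c v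
    using endo_comp[OF endo_act act_act(1)] by (auto intro: act_E)
  have "form (bracket z x) y = tr E (\<lambda>v. act z (act x (act y v)) - act x (act z (act y v)))"
    unfolding form_def by (rule tr_cong[OF _ fE]) (simp add: bracket_act act_E)
  also have "\<dots> = tr E (\<lambda>v. act z (act x (act y v))) - tr E (\<lambda>v. act x (act z (act y v)))"
    by (rule tr_diff[OF fE cE cE])
  finally have 1: "form (bracket z x) y
      = tr E (\<lambda>v. act z (act x (act y v))) - tr E (\<lambda>v. act x (act z (act y v)))" .
  have "form x (bracket z y) = tr E (\<lambda>v. act x (act z (act y v)) - act x (act y (act z v)))"
    unfolding form_def by (rule tr_cong[OF _ fE]) (simp add: bracket_act act_E endo_diff[OF endo_act])
  also have "\<dots> = tr E (\<lambda>v. act x (act z (act y v))) - tr E (\<lambda>v. act x (act y (act z v)))"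
    by (rule tr_diff[OF fE cE cE])
  also have "tr E (\<lambda>v. act x (act y (act z v))) = tr E (\<lambda>v. act z (act x (act y v)))"
    by (rule tr_commute[OF fE act_act endo_act act_E])
  finally show ?thesis using 1 by simp
qed

lemma form_radical_ideal:
  assumes "g.lie_ideal I" shows "g.lie_ideal {x \<in> I. \<forall>y. form x y = 0}"
  using assms form_zero_left
  by (auto simp: g.lie_ideal_def g.subspace_def form_add_left form_scale_left form_invariant)

text \<open>The form vanishes on its radical, which is exactly the input of Cartan's
  criterion.\<close>

lemma form_radical_nilpotent:
  assumes "g.lie_ideal I" "z \<in> g.span {bracket x y | x y.
      x \<in> {x \<in> I. \<forall>y. form x y = 0} \<and> y \<in> {x \<in> I. \<forall>y. form x y = 0}}" "v \<in> E"
  shows "v \<in> gen_eig (act z) 0"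
  by (rule cartan_criterion[OF fE form_radical_ideal[OF assms(1)] _ assms(2,3)]) (auto simp flip: form_def)

end

end

section \<open>The Killing form and orthogonal ideals\<close>

context semisimple_lie_algebra
begin

lemma lie_rep_ad: "lie_rep scale bracket scale bracket UNIV"
  by unfold_locales (auto simp: endo_bracket bracket_add_left bracket_scale_left bracket_bracket)

interpretation ad: lie_rep scale bracket scale bracket UNIV
  by (rule lie_rep_ad)

definition killing :: "'g \<Rightarrow> 'g \<Rightarrow> complex" where "killing = ad.form"

lemmas killing_sym = ad.form_sym[OF fdim_UNIV, folded killing_def]
lemmas killing_add_left = ad.form_add_left[OF fdim_UNIV, folded killing_def]
lemmas killing_add_right = ad.form_add_right[OF fdim_UNIV, folded killing_def]
lemmas killing_scale_left = ad.form_scale_left[OF fdim_UNIV, folded killing_def]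
lemmas killing_scale_right = ad.form_scale_right[OF fdim_UNIV, folded killing_def]
lemmas killing_invariant = ad.form_invariant[OF fdim_UNIV, folded killing_def]
lemmas killing_diff_left = ad.form_diff_left[OF fdim_UNIV, folded killing_def]
lemmas killing_zero_left = ad.form_zero_left[OF fdim_UNIV, folded killing_def]

lemma ideal_UNIV: "lie_ideal UNIV"
  by (simp add: lie_ideal_def)

text \<open>The radical of the form is an ideal whose derived ideal is ad-nilpotent by Cartan's
  criterion, and such an ideal is zero.\<close>

lemma killing_nondegenerate:
  assumes "\<And>y. killing x y = 0" shows "x = 0"
proof -
  have "{x. \<forall>y. killing x y = 0} = {0}"
    using ad_nilpotent_derived_ideal_trivial[OF ad.form_radical_ideal[OF fdim_UNIV ideal_UNIV]
        ad.form_radical_nilpotent[OF fdim_UNIV ideal_UNIV]]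
    by (simp add: killing_def)
  then show ?thesis using assms by auto
qed

definition perp :: "'g set \<Rightarrow> 'g set" where "perp I = {x. \<forall>y\<in>I. killing x y = 0}"

lemma ideal_perp: assumes "lie_ideal I" shows "lie_ideal (perp I)"
  unfolding lie_ideal_def perp_def
  by (auto simp: subspace_def killing_add_left killing_scale_left killing_zero_left killing_invariant
      ideal_bracket[OF assms])

lemma ideal_Int: "lie_ideal I \<Longrightarrow> lie_ideal J \<Longrightarrow> lie_ideal (I \<inter> J)"
  by (auto simp: lie_ideal_def subspace_inter)

text \<open>By invariance, a bracket of two elements of the intersection is orthogonal to
  everything; so the intersection is an abelian ideal.\<close>

lemma ideal_Int_perp: assumes I: "lie_ideal I" shows "I \<inter> perp I = {0}"
proof (rule abelian_ideal_trivial)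
  show "lie_ideal (I \<inter> perp I)" using I ideal_perp ideal_Int by blast
  fix x y assume xy: "x \<in> I \<inter> perp I" "y \<in> I \<inter> perp I"
  show "bracket x y = 0"
  proof (rule killing_nondegenerate)
    fix w
    have "killing (bracket x y) w = - killing y (bracket x w)" by (rule killing_invariant)
    also have "bracket x w \<in> I" using I xy ideal_bracket_left by blast
    then have "killing y (bracket x w) = 0" using xy by (auto simp: perp_def)
    finally show "killing (bracket x y) w = 0" by simp
  qed
qed

text \<open>The Killing form stays nondegenerate on \<open>I\<close>, so pairing with
  \<open>x\<close> is represented on \<open>I\<close> by some \<open>k\<close>, the orthogonal
  projection of \<open>x\<close>.\<close>

lemma ideal_decomposition:
  assumes I: "lie_ideal I" obtains k p where "x = k + p" "k \<in> I" "p \<in> perp I"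
proof -
  have "\<exists>k\<in>I. \<forall>y\<in>I. killing k y = killing x y"
  proof (rule nondegenerate_form_represents[OF fdim_subspace_any[OF ideal_subspace[OF I]]])
    show "k = 0" if "k \<in> I" "\<And>y. y \<in> I \<Longrightarrow> killing k y = 0" for k
      using ideal_Int_perp[OF I] that by (auto simp: perp_def)
  qed (simp_all add: killing_add_left killing_add_right killing_scale_left killing_scale_right)
  then obtain k where k: "k \<in> I" "\<And>y. y \<in> I \<Longrightarrow> killing k y = killing x y" by blast
  then have "x - k \<in> perp I" by (simp add: perp_def killing_diff_left)
  then show ?thesis using that[of k "x - k"] k by simp
qed

end

section \<open>Invariant vectors\<close>

context lie_rep
begin

text \<open>Cartan's criterion makes a \<open>z\<close> from the derived ideal of the radical
  nilpotent on \<open>E\<close>; this has to be carried over to \<open>ad z\<close>. On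
  \<open>K\<close> it is zero, since these brackets fall into \<open>K \<inter> P\<close>. On
  \<open>P\<close>, if \<open>u\<close> belongs to an eigenvalue other than 0, then
  \<open>act u\<close> maps \<open>E\<close> into the corresponding eigenspace of a nilpotent
  operator; so \<open>u\<close> acts as zero and lies in \<open>K \<inter> P\<close>.\<close>

lemma trace_form_nondegenerate:
  assumes fE: "fdim E" and K: "K = {x. \<forall>v\<in>E. act x v = 0}"
  shows "g.lie_ideal K" "x \<in> g.perp K \<Longrightarrow> (\<And>y. y \<in> g.perp K \<Longrightarrow> form x y = 0) \<Longrightarrow> x = 0"
proof -
  show idK: "g.lie_ideal K"
    by (auto simp: K g.lie_ideal_def g.subspace_def zero_act add_act scale_act bracket_act act_E)
  define P where "P = g.perp K"
  have idP: "g.lie_ideal P" unfolding P_def by (rule g.ideal_perp[OF idK])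
  have KP: "K \<inter> P = {0}" unfolding P_def by (rule g.ideal_Int_perp[OF idK])
  define R where "R = {x \<in> P. \<forall>y. form x y = 0}"
  have idR: "g.lie_ideal R" unfolding R_def by (rule form_radical_ideal[OF fE idP])
  have R0: "R = {0}"
  proof (rule g.ad_nilpotent_derived_ideal_trivial[OF idR])
    fix z w assume z: "z \<in> g.span {bracket x y | x y. x \<in> R \<and> y \<in> R}"
    have nil: "v \<in> gen_eig (act z) 0" if "v \<in> E" for v
      by (rule form_radical_nilpotent[OF fE idP _ that]) (use z in \<open>simp add: R_def\<close>)
    have "z \<in> R"
      using z g.span_minimal[OF _ g.ideal_subspace[OF idR], of "{bracket x y | x y. x \<in> R \<and> y \<in> R}"]
        g.ideal_bracket[OF idR] by blast
    then have zP: "z \<in> P" by (simp add: R_def)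
    obtain k p where kp: "w = k + p" "k \<in> K" "p \<in> P"
      using g.ideal_decomposition[OF idK] unfolding P_def by blast
    have "bracket z k \<in> K \<inter> P"
      using kp(2) zP g.ideal_bracket[OF idK] g.ideal_bracket_left[OF idP] by blast
    then have "bracket z k = 0" using KP by blast
    then have k0: "k \<in> g.gen_eig (bracket z) 0"
      unfolding g.gen_eig_0_iff[OF g.endo_bracket] by (intro exI[of _ 1]) simp
    have "p \<in> g.span {w \<in> P. \<exists>l. w \<in> g.gen_eig (bracket z) l}"
      by (rule g.gen_eig_span[OF g.endo_bracket g.fdim_subspace_any[OF g.ideal_subspace[OF idP]]])
        (use kp g.ideal_bracket[OF idP] in auto)
    moreover have "{w \<in> P. \<exists>l. w \<in> g.gen_eig (bracket z) l} \<subseteq> g.gen_eig (bracket z) 0"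
    proof
      fix u assume "u \<in> {w \<in> P. \<exists>l. w \<in> g.gen_eig (bracket z) l}"
      then obtain l where l: "u \<in> g.gen_eig (bracket z) l" "u \<in> P" by blast
      show "u \<in> g.gen_eig (bracket z) 0"
      proof (cases "l = 0")
        case False
        have "act u v = 0" if v: "v \<in> E" for v
        proof (rule gen_eig_disjoint[OF endo_act _ nil[OF act_E[OF v]] False])
          show "act u v \<in> gen_eig (act z) l" using gen_eig_act[OF v l(1) nil[OF v]] by simp
        qed
        then have "u = 0" using KP l(2) K by blast
        then show ?thesis using g.subspace_gen_eig[OF g.endo_bracket] g.subspace_0 by blast
      qed (use l in simp)
    qed
    ultimately have "p \<in> g.gen_eig (bracket z) 0"
      using g.span_minimal g.subspace_gen_eig[OF g.endo_bracket] by blast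
    then show "w \<in> g.gen_eig (bracket z) 0"
      using k0 kp(1) g.subspace_add[OF g.subspace_gen_eig[OF g.endo_bracket]] by blast
  qed
  assume x: "x \<in> g.perp K" "\<And>y. y \<in> g.perp K \<Longrightarrow> form x y = 0"
  have "form x y = 0" for y
  proof -
    obtain k p where kp: "y = k + p" "k \<in> K" "p \<in> P"
      using g.ideal_decomposition[OF idK] unfolding P_def by blast
    have "form k x = tr E (\<lambda>v. 0 *s v)"
      unfolding form_def by (rule tr_cong[OF _ fE]) (use kp K act_E in auto)
    then have "form x k = 0" using form_sym[OF fE] tr_scale[OF fE endo_id, of 0] by simp
    then show ?thesis using kp x(2) by (simp add: form_add_right[OF fE] P_def)
  qed
  then show "x = 0" using R0 x(1) by (auto simp: R_def P_def)
qed

text \<open>Pass to a smallest submodule on which \<open>lam\<close> does not vanish. The Casimir operator of its trace form is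
  nilpotent there by minimality, so its trace, the dimension of the acting quotient algebra, is zero.\<close>

theorem invariant_vector:
  assumes fE: "fdim E"
    and lam_add: "\<And>u v. u \<in> E \<Longrightarrow> v \<in> E \<Longrightarrow> lam (u + v) = lam u + (lam v :: complex)"
    and lam_scale: "\<And>c v. v \<in> E \<Longrightarrow> lam (c *s v) = c * lam v"
    and lam_act: "\<And>x v. v \<in> E \<Longrightarrow> lam (act x v) = 0"
    and lam_ne: "v0 \<in> E" "lam v0 \<noteq> 0"
  shows "\<exists>v\<in>E. lam v \<noteq> 0 \<and> (\<forall>x. act x v = 0)"
proof -
  define Q where "Q F \<longleftrightarrow> subspace F \<and> F \<subseteq> E \<and> (\<forall>x. \<forall>v\<in>F. act x v \<in> F) \<and> (\<exists>v\<in>F. lam v \<noteq> 0)" for F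
  have "Q E" using subspace_E act_E lam_ne by (auto simp: Q_def)
  then obtain F where F: "Q F" "\<And>F'. Q F' \<Longrightarrow> dim F \<le> dim F'"
    using ex_has_least_nat[of Q E dim] by blast
  have Fs: "subspace F" "F \<subseteq> E" "\<And>x v. v \<in> F \<Longrightarrow> act x v \<in> F" using F(1) by (auto simp: Q_def)
  obtain v1 where v1: "v1 \<in> F" "lam v1 \<noteq> 0" using F(1) by (auto simp: Q_def)
  interpret F: lie_rep gscale bracket scale act F by (rule sub_rep[OF Fs])
  have fF: "fdim F" by (rule fdim_subset[OF fE Fs(2,1)])
  define K where "K = {x. \<forall>v\<in>F. act x v = 0}"
  define P where "P = g.perp K"
  note nondeg = F.trace_form_nondegenerate(2)[OF fF K_def, folded P_def]
  have idK: "g.lie_ideal K" by (rule F.trace_form_nondegenerate(1)[OF fF K_def])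
  have idP: "g.lie_ideal P" unfolding P_def by (rule g.ideal_perp[OF idK])
  have fP: "g.fdim P" by (rule g.fdim_subspace_any[OF g.ideal_subspace[OF idP]])
  have sP: "g.subspace P" by (rule g.ideal_subspace[OF idP])
  obtain B where B: "finite B" "g.independent B" "g.span B = P" using g.fdim_basis[OF fP] .
  have BP: "b \<in> P" if "b \<in> B" for b using B that g.span_base by blast
  have "\<exists>d\<in>P. \<forall>y\<in>P. F.form d y = g.representation B y b" if "b \<in> B" for b
    by (rule g.nondegenerate_form_represents[OF fP])
      (use nondeg B in \<open>auto simp: F.form_add_left[OF fF] F.form_add_right[OF fF] F.form_scale_left[OF fF]
        F.form_scale_right[OF fF] g.representation_add g.representation_scale\<close>)
  \<comment> \<open>\<open>d\<close> is the basis of \<open>P\<close> dual to \<open>B\<close> for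
    the trace form.\<close>
  then obtain d where d: "\<And>b. b \<in> B \<Longrightarrow> d b \<in> P"
    "\<And>b y. b \<in> B \<Longrightarrow> y \<in> P \<Longrightarrow> F.form (d b) y = g.representation B y b" by metis
  have exp_B: "p = (\<Sum>b\<in>B. gscale (g.representation B p b) b)" if "p \<in> P" for p
    using g.sum_representation_eq[OF B(2) _ B(1) subset_refl, of p] that B(3) by simp
  have exp_d: "p = (\<Sum>b\<in>B. gscale (F.form p b) (d b))" if p: "p \<in> P" for p
  proof -
    define q where "q = p - (\<Sum>b\<in>B. gscale (F.form p b) (d b))"
    have "q \<in> P" unfolding q_def
      by (intro g.subspace_diff[OF sP] g.subspace_sum[OF sP] g.subspace_scale[OF sP] p d)
    moreover have form_sum: "F.form (\<Sum>b\<in>A. f b) y = (\<Sum>b\<in>A. F.form (f b) y)" for A f y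
      by (induction A rule: infinite_finite_induct) (auto simp: F.form_zero_left[OF fF] F.form_add_left[OF fF])
    have qB: "F.form q c = 0" if c: "c \<in> B" for c
    proof -
      have "(\<Sum>b\<in>B. F.form p b * F.form (d b) c) = (\<Sum>b\<in>B. if b = c then F.form p b else 0)"
        by (intro sum.cong refl) (use d(2) BP[OF c] B(2) c in \<open>auto simp: g.representation_basis\<close>)
      then show ?thesis
        using B(1) c by (simp add: q_def F.form_diff_left[OF fF] form_sum F.form_scale_left[OF fF])
    qed
    have "F.form q y = 0" if "y \<in> P" for y
    proof -
      have "y \<in> g.span B" using that B by simp
      then show ?thesis
        by (rule g.span_induct_alt)
          (use qB in \<open>auto simp: F.form_add_right[OF fF] F.form_scale_right[OF fF]
            F.form_sym[OF fF, of q 0] F.form_zero_left[OF fF]\<close>)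
    qed
    ultimately show ?thesis using nondeg[of q] by (simp add: q_def)
  qed
  define C where "C v = (\<Sum>b\<in>B. act b (act (d b) v))" for v
  have C: "endo C" unfolding C_def by (rule endo_summed) (rule endo_comp[OF endo_act endo_act])
  have CF: "C v \<in> F" if "v \<in> F" for v
    using that Fs by (auto simp: C_def intro!: subspace_sum)
  have comm: "act x (C v) = C (act x v)" if v: "v \<in> F" for x v
  proof -
    let ?r = "\<lambda>y c. g.representation B (bracket x y) c"
    have e1: "act (bracket x b) w = (\<Sum>c\<in>B. ?r b c *s act c w)" if "b \<in> B" "w \<in> F" for b w
      using arg_cong[OF exp_B[OF g.ideal_bracket[OF idP BP[OF that(1)], of x]], of "\<lambda>y. act y w"] that(2)
      by (simp add: F.sum_act F.scale_act)
    \<comment> \<open>By invariance, \<open>ad x\<close> has in the dual basis the negative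
      transpose of its matrix in \<open>B\<close>; this is what cancels the double sum
      below.\<close>
    have "bracket x (d b) = (\<Sum>c\<in>B. gscale (- ?r c b) (d c))" if b: "b \<in> B" for b
    proof -
      have "F.form (bracket x (d b)) c = - ?r c b" if "c \<in> B" for c
        using d(2)[OF b g.ideal_bracket[OF idP BP[OF that], of x]] F.form_invariant[OF fF] by simp
      then have "(\<Sum>c\<in>B. gscale (F.form (bracket x (d b)) c) (d c)) = (\<Sum>c\<in>B. gscale (- ?r c b) (d c))"
        by (intro sum.cong refl) simp
      then show ?thesis using exp_d[OF g.ideal_bracket[OF idP d(1)[OF b], of x]] by simp
    qed
    then have e2: "act (bracket x (d b)) w = (\<Sum>c\<in>B. (- ?r c b) *s act (d c) w)" if "b \<in> B" "w \<in> F" for b w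
      using arg_cong[of "bracket x (d b)" _ "\<lambda>y. act y w"] that by (simp add: F.sum_act F.scale_act F.minus_act)
    have "act x (C v) - C (act x v) = (\<Sum>b\<in>B. act x (act b (act (d b) v)) - act b (act (d b) (act x v)))"
      by (simp add: C_def act_sum sum_subtractf)
    also have "\<dots> = (\<Sum>b\<in>B. act (bracket x b) (act (d b) v) + act b (act (bracket x (d b)) v))"
      by (intro sum.cong refl) (simp add: F.bracket_act Fs v endo_diff[OF endo_act])
    also have "\<dots> = (\<Sum>b\<in>B. (\<Sum>c\<in>B. ?r b c *s act c (act (d b) v)) + (\<Sum>c\<in>B. (- ?r c b) *s act b (act (d c) v)))"
      by (intro sum.cong refl) (simp add: e1 e2 Fs v act_sum endo_scale[OF endo_act] endo_minus[OF endo_act])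
    also have "\<dots> = 0"
      unfolding sum.distrib by (subst (2) sum.swap) (simp add: sum_negf)
    finally show ?thesis by simp
  qed
  have lam_zero: "lam 0 = 0" using lam_scale[of 0 0] subspace_E by (simp add: subspace_0)
  have lamC: "lam (C v) = 0" if "v \<in> F" for v
  proof -
    have "(\<Sum>b\<in>A. act b (act (d b) v)) \<in> E \<and> lam (\<Sum>b\<in>A. act b (act (d b) v)) = 0" if "finite A" for A
      using that
      by (induction A) (use \<open>v \<in> F\<close> Fs(2) act_E lam_zero lam_add lam_act subspace_E in
        \<open>auto simp: subspace_0 subspace_add\<close>)
    then show ?thesis using B(1) by (simp add: C_def)
  qed
  define F1 where "F1 = {v \<in> F. v \<in> gen_eig C 0}"
  \<comment> \<open>\<open>lam\<close> vanishes on the image of \<open>C\<close>, so shortening the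
    chain of powers of \<open>C - l\<close> gives \<open>l * lam w = 0\<close>. Hence the part of
    \<open>F\<close> for eigenvalue 0 still carries \<open>lam\<close>.\<close>
  have lam_gen: "lam w = 0" if "w \<in> F" "w \<in> gen_eig C l" "l \<noteq> 0" for w l
  proof -
    have "lam w = 0" if "papply C ([:-l, 1:] ^ k) w = 0" "w \<in> F" for k w
      using that
    proof (induction k arbitrary: w)
      case (Suc k)
      have "papply C ([:-l, 1:] ^ k) (C w - l *s w) = 0"
        using Suc.prems(1) papply_mult[OF C] by (simp only: power_Suc2 papply_linear[OF C])
      then have "lam (C w + (- l) *s w) = 0"
        using Suc.IH[of "C w - l *s w"] Suc.prems(2) CF Fs(1) by (simp add: subspace_diff subspace_scale)
      moreover have "lam (C w + (- l) *s w) = lam (C w) + (- l) * lam w"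
        using Suc.prems(2) CF[OF Suc.prems(2)] Fs(2) subspace_scale[OF subspace_E, of w "- l"] lam_scale[of w "- l"]
        by (subst lam_add) auto
      ultimately show ?case using lamC[OF Suc.prems(2)] \<open>l \<noteq> 0\<close> by simp
    qed (simp add: lam_zero)
    then show ?thesis using that by (auto simp: gen_eig_def)
  qed
  have "Q F1"
  proof -
    have "subspace F1"
      using subspace_inter[OF Fs(1) subspace_gen_eig[OF C, of 0]] by (simp add: F1_def Int_def)
    moreover have "act x v \<in> F1" if "v \<in> F1" for x v
    proof -
      have v: "v \<in> F" "v \<in> gen_eig C 0" using that by (auto simp: F1_def)
      have "act x v \<in> gen_eig C 0" by (rule gen_eig_stable[OF C endo_act Fs(1) CF comm v])
      then show ?thesis using Fs(3)[OF v(1)] by (simp add: F1_def)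
    qed
    moreover have "\<exists>v\<in>F1. lam v \<noteq> 0"
    proof (rule ccontr)
      assume "\<not> ?thesis"
      then have z: "lam w = 0" if "w \<in> F" "w \<in> gen_eig C l" for w l
        using that lam_gen[of w l] by (cases "l = 0") (auto simp: F1_def)
      have "v1 \<in> span {w \<in> F. \<exists>l. w \<in> gen_eig C l}" by (rule gen_eig_span[OF C fF CF v1(1)])
      then have "v1 \<in> F \<and> lam v1 = 0"
      proof (rule span_induct_alt)
        fix c x y assume x: "x \<in> {w \<in> F. \<exists>l. w \<in> gen_eig C l}" and y: "y \<in> F \<and> lam y = 0"
        then have "x \<in> F" "lam x = 0" using z by auto
        moreover from this have "lam (c *s x + y) = c * lam x + lam y"
          using y Fs(2) subspace_E lam_scale[of x c] by (subst lam_add) (auto intro: subspace_scale)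
        ultimately show "c *s x + y \<in> F \<and> lam (c *s x + y) = 0"
          using y Fs(1) by (simp add: subspace_add subspace_scale)
      qed (use Fs(1) lam_zero subspace_0 in auto)
      then show False using v1(2) by simp
    qed
    ultimately show ?thesis using Fs(2) by (auto simp: Q_def F1_def)
  qed
  then have "F1 = F"
    using F(2)[of F1] fdim_dim_less[OF fF, of F1] by (auto simp: Q_def F1_def)
  then have "tr F C = 0" using tr_nilpotent[OF C fF CF] by (auto simp: F1_def)
  moreover have "tr F C = (\<Sum>b\<in>B. F.form b (d b))"
    unfolding C_def F.form_def by (rule tr_sum[OF fF B(1) endo_comp[OF endo_act endo_act]]) (auto intro: Fs(3))
  moreover have "F.form b (d b) = 1" if "b \<in> B" for b
    using d(2)[OF that BP[OF that]] F.form_sym[OF fF, of b] B(2) that by (simp add: g.representation_basis)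
  ultimately have "of_nat (card B) = (0 :: complex)" by simp
  \<comment> \<open>With \<open>P\<close> zero, every element of the Lie algebra lies in
    \<open>K\<close> and acts on \<open>F\<close> as zero, so any vector of \<open>F\<close> off the
    kernel of \<open>lam\<close> is as wanted.\<close>
  then have "B = {}" using B(1) by simp
  then have "P = {0}" using B(3) by simp
  have "act x v1 = 0" for x
  proof -
    obtain k p where "x = k + p" "k \<in> K" "p \<in> P"
      using g.ideal_decomposition[OF idK] unfolding P_def by blast
    then show ?thesis using \<open>P = {0}\<close> v1(1) by (auto simp: K_def)
  qed
  then show ?thesis using v1 Fs(2) by blast
qed

end

section \<open>Nilpotent elements span\<close>

context semisimple_lie_algebra
begin

text \<open>Divided powers of \<open>ad x\<close>, the terms of its exponential series; they keep
  binomial coefficients out of the Leibniz rule.\<close>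

definition divpow :: "'g \<Rightarrow> nat \<Rightarrow> 'g \<Rightarrow> 'g" where
  "divpow x k v = scale (1 / fact k) ((bracket x ^^ k) v)"

lemma endo_divpow: "endo (divpow x k)"
  unfolding divpow_def by (rule endo_scaled[OF endo_funpow[OF endo_bracket]])

lemma bracket_divpow: "bracket x (divpow x k v) = scale (of_nat (Suc k)) (divpow x (Suc k) v)"
proof -
  have "of_nat (Suc k) * (1 / fact (Suc k)) = (1 / fact k :: complex)"
    by (simp add: fact_Suc del: of_nat_Suc)
  then show ?thesis by (simp only: divpow_def bracket_scale_right scale_scale funpow.simps comp_apply)
qed

text \<open>The inductive step is proved after multiplication by \<open>Suc n\<close>, which turns
  the next divided power into a bracket with \<open>x\<close>.\<close>

lemma divpow_bracket:
  "divpow x n (bracket u v) = (\<Sum>k\<le>n. bracket (divpow x k u) (divpow x (n - k) v))"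
proof (induction n)
  case 0
  then show ?case by (simp add: divpow_def)
next
  case (Suc n)
  let ?b = "\<lambda>k l. bracket (divpow x k u) (divpow x l v)"
  have "scale (of_nat (Suc n)) (divpow x (Suc n) (bracket u v)) = bracket x (divpow x n (bracket u v))"
    by (simp only: bracket_divpow)
  also have "\<dots> = (\<Sum>k\<le>n. bracket x (?b k (n - k)))"
    by (simp only: Suc endo_sum[OF endo_bracket])
  also have "\<dots> = (\<Sum>k\<le>n. scale (of_nat (Suc k)) (?b (Suc k) (n - k)) + scale (of_nat (Suc (n - k))) (?b k (Suc (n - k))))"
    by (intro sum.cong refl)
      (simp only: bracket_derivation[of x] bracket_divpow bracket_scale_left bracket_scale_right)
  also have "\<dots> = (\<Sum>k\<le>n. scale (of_nat (Suc k)) (?b (Suc k) (Suc n - Suc k)))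
      + (\<Sum>k\<le>n. scale (of_nat (Suc n - k)) (?b k (Suc n - k)))"
    by (simp add: sum.distrib Suc_diff_le)
  \<comment> \<open>Both sums are brought to the range up to \<open>Suc n\<close>; the added terms
    have coefficient 0, at \<open>k = 0\<close> here and at \<open>k = Suc n\<close> in the other
    sum.\<close>
  also have "(\<Sum>k\<le>n. scale (of_nat (Suc k)) (?b (Suc k) (Suc n - Suc k)))
      = (\<Sum>k\<le>Suc n. scale (of_nat k) (?b k (Suc n - k)))"
    by (subst sum.atMost_Suc_shift) simp
  also have "(\<Sum>k\<le>n. scale (of_nat (Suc n - k)) (?b k (Suc n - k)))
      = (\<Sum>k\<le>Suc n. scale (of_nat (Suc n - k)) (?b k (Suc n - k)))"
    by simp
  also have "(\<Sum>k\<le>Suc n. scale (of_nat k) (?b k (Suc n - k))) + (\<Sum>k\<le>Suc n. scale (of_nat (Suc n - k)) (?b k (Suc n - k)))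
      = (\<Sum>k\<le>Suc n. scale (of_nat (Suc n)) (?b k (Suc n - k)))"
    unfolding sum.distrib[symmetric]
    by (intro sum.cong refl) (simp add: of_nat_diff flip: scale_left_distrib)
  also have "\<dots> = scale (of_nat (Suc n)) (\<Sum>k\<le>Suc n. ?b k (Suc n - k))"
    by (simp only: scale_sum_right)
  finally show ?case by (simp only: scale_cancel_left) (simp add: of_nat_neq_0 del: of_nat_Suc)
qed

text \<open>The exponential of \<open>ad x\<close> respects brackets. The series ends at
  \<open>N\<close>, but it is cut at \<open>2 * N\<close>, so that the triangle
  \<open>k + l < 2 * N\<close> contains the square with all nonzero products.\<close>

lemma exp_bracket:
  assumes N: "\<And>v. (bracket x ^^ N) v = 0"
  shows "(\<Sum>k<2 * N. divpow x k (bracket u v))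
    = bracket (\<Sum>k<2 * N. divpow x k u) (\<Sum>k<2 * N. divpow x k v)"
proof -
  have z: "divpow x k v = 0" if "k \<ge> N" for k v
    using N[of "(bracket x ^^ (k - N)) v"] that
    by (simp add: divpow_def flip: funpow_add[THEN fun_cong, simplified comp_apply])
  have trunc: "(\<Sum>k<2 * N. divpow x k w) = (\<Sum>k<N. divpow x k w)" for w
    by (rule sum.mono_neutral_right) (use z in auto)
  let ?b = "\<lambda>k l. bracket (divpow x k u) (divpow x l v)"
  have "(\<Sum>n<2 * N. divpow x n (bracket u v)) = (\<Sum>n<2 * N. \<Sum>k\<le>n. ?b k (n - k))"
    by (simp only: divpow_bracket)
  also have "\<dots> = (\<Sum>(k, l)\<in>{(k, l). k + l < 2 * N}. ?b k l)"
    by (rule sum.triangle_reindex[symmetric])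
  also have "\<dots> = (\<Sum>(k, l)\<in>{..<N} \<times> {..<N}. ?b k l)"
  proof (rule sum.mono_neutral_right)
    show "finite {(k, l). k + l < 2 * N}"
      by (rule finite_subset[of _ "{..<2 * N} \<times> {..<2 * N}"]) auto
    show "\<forall>i\<in>{(k, l). k + l < 2 * N} - {..<N} \<times> {..<N}. (case i of (k, l) \<Rightarrow> ?b k l) = 0"
      using z by (auto simp: not_less) (metis not_less z bracket_zero_left bracket_zero_right)+
    show "{..<N} \<times> {..<N} \<subseteq> {(k, l). k + l < 2 * N}" by auto
  qed
  also have "\<dots> = (\<Sum>k<N. \<Sum>l<N. ?b k l)" by (simp add: sum.cartesian_product)
  also have "\<dots> = bracket (\<Sum>k<N. divpow x k u) (\<Sum>k<N. divpow x k v)"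
    by (subst sum.swap) (simp add: endo_sum[OF endo_bracket_left] endo_sum[OF endo_bracket])
  finally show ?thesis unfolding trunc[of u] trunc[of v] .
qed

lemma gen_eig_funpow_bracket:
  assumes "x \<in> gen_eig (bracket h) l" "v \<in> gen_eig (bracket h) m"
  shows "(bracket x ^^ k) v \<in> gen_eig (bracket h) (of_nat k * l + m)"
proof (induction k)
  case (Suc k)
  have "l + (of_nat k * l + m) = of_nat (Suc k) * l + m" by (simp add: algebra_simps)
  then show ?case using gen_eig_bracket[OF assms(1) Suc] by (simp only: funpow.simps comp_apply)
qed (use assms in simp)

text \<open>The analogue of the root vectors, with an \<open>h\<close> of its own for every
  \<open>x\<close> in place of a fixed Cartan subalgebra.\<close>

definition ad_eigen :: "'g set" where
  "ad_eigen = {x. \<exists>h l. l \<noteq> 0 \<and> x \<in> gen_eig (bracket h) l}"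

text \<open>Each application of \<open>ad x\<close> shifts the eigenvalue of \<open>ad h\<close> by
  \<open>l\<close>, and only finitely many numbers are eigenvalues.\<close>

lemma ad_eigen_nilpotent:
  assumes "l \<noteq> 0" "x \<in> gen_eig (bracket h) l" shows "v \<in> gen_eig (bracket x) 0"
proof -
  obtain ms where ms: "\<forall>v\<in>UNIV. papply (bracket h) (\<Prod>\<mu>\<leftarrow>ms. [:-\<mu>, 1:]) v = 0"
    using trace_polynomial[OF endo_bracket fdim_UNIV] by blast
  have spec: "m \<in> set ms" if v: "v \<in> gen_eig (bracket h) m" "v \<noteq> 0" for v m
  proof -
    obtain e where e: "e \<noteq> 0" "bracket h e = scale m e"
      using gen_eig_imp_eigenvector[OF endo_bracket _ subspace_UNIV _ v(2,1)] by auto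
    have "poly (\<Prod>\<mu>\<leftarrow>ms. [:-\<mu>, 1:]) m = 0"
      using papply_eigenvector[OF endo_bracket e(2), of "\<Prod>\<mu>\<leftarrow>ms. [:-\<mu>, 1:]"] ms e(1)
      by (metis UNIV_I scale_eq_0_iff)
    then show ?thesis by (induction ms) auto
  qed
  have "v \<in> gen_eig (bracket x) 0" if v: "v \<in> gen_eig (bracket h) m" for v m
  proof -
    have k: "(bracket x ^^ k) v \<in> gen_eig (bracket h) (of_nat k * l + m)" for k
      by (rule gen_eig_funpow_bracket[OF assms(2) v])
    have "inj (\<lambda>k. of_nat k * l + m)" using assms(1) by (auto simp: inj_on_def)
    then have "infinite (range (\<lambda>k. of_nat k * l + m))" by (simp add: range_inj_infinite)
    then obtain k where "of_nat k * l + m \<notin> set ms" by (metis finite_set finite_subset image_subsetI)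
    then have "(bracket x ^^ k) v = 0" using spec[OF k] by blast
    then show ?thesis using gen_eig_0_iff[OF endo_bracket] by blast
  qed
  then have "{w \<in> UNIV. \<exists>l. w \<in> gen_eig (bracket h) l} \<subseteq> gen_eig (bracket x) 0" by auto
  then have "span {w \<in> UNIV. \<exists>l. w \<in> gen_eig (bracket h) l} \<subseteq> gen_eig (bracket x) 0"
    by (rule span_minimal[OF _ subspace_gen_eig[OF endo_bracket]])
  moreover have "v \<in> span {w \<in> UNIV. \<exists>l. w \<in> gen_eig (bracket h) l}"
    by (rule gen_eig_span[OF endo_bracket fdim_UNIV]) auto
  ultimately show ?thesis by blast
qed

text \<open>The automorphism \<open>exp (ad x)\<close> maps \<open>y\<close> to a generalized eigenvector of \<open>ad\<close> of the image of \<open>h\<close>,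
  and all terms of \<open>exp (ad x) y\<close> other than \<open>[x, y]\<close> are generalized eigenvectors of \<open>ad h\<close>.\<close>

lemma bracket_opposite_eigen:
  assumes l: "l \<noteq> 0" and x: "x \<in> gen_eig (bracket h) l" and y: "y \<in> gen_eig (bracket h) (- l)"
  shows "bracket x y \<in> span ad_eigen"
proof -
  obtain N0 where "\<And>v. (bracket x ^^ N0) v = 0"
    using nilpotent_uniform[OF endo_bracket fdim_UNIV] ad_eigen_nilpotent[OF l x] by blast
  \<comment> \<open>\<open>Suc N0\<close> in place of \<open>N0\<close> ensures that the truncated
    series contains the terms for 0 and 1.\<close>
  then have N: "(bracket x ^^ Suc N0) v = 0" for v by simp
  define \<phi> where "\<phi> v = (\<Sum>k<2 * Suc N0. divpow x k v)" for v
  have \<phi>: "endo \<phi>" unfolding \<phi>_def by (rule endo_summed) (rule endo_divpow)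
  have "\<phi> (bracket u v) = bracket (\<phi> u) (\<phi> v)" for u v
    unfolding \<phi>_def by (rule exp_bracket[OF N])
  then have "papply (bracket (\<phi> h)) p (\<phi> v) = \<phi> (papply (bracket h) p v)" for p v
    by (induction p) (auto simp: papply_pCons[OF endo_bracket] endo_zero[OF \<phi>] endo_add[OF \<phi>] endo_scale[OF \<phi>])
  moreover obtain k where "papply (bracket h) ([:- (- l), 1:] ^ k) y = 0" using y by (auto simp: gen_eig_def)
  ultimately have "papply (bracket (\<phi> h)) ([:- (- l), 1:] ^ k) (\<phi> y) = 0" by (simp add: endo_zero[OF \<phi>])
  then have "\<phi> y \<in> gen_eig (bracket (\<phi> h)) (- l)" unfolding gen_eig_def by blast
  then have \<phi>y: "\<phi> y \<in> span ad_eigen" using l by (intro span_base) (auto simp: ad_eigen_def intro!: exI[of _ "\<phi> h"] exI[of _ "- l"])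
  have yS: "y \<in> span ad_eigen"
    using y l by (intro span_base) (auto simp: ad_eigen_def intro!: exI[of _ h] exI[of _ "- l"])
  \<comment> \<open>Such a term belongs to the eigenvalue \<open>(k - 1) * l\<close>, which is not
    0.\<close>
  have "divpow x k y \<in> span ad_eigen" if "k \<ge> 2" for k
  proof -
    have "(bracket x ^^ k) y \<in> gen_eig (bracket h) (of_nat k * l + - l)"
      by (rule gen_eig_funpow_bracket[OF x y])
    moreover have "of_nat k * l + - l \<noteq> 0" using that l by (auto simp: algebra_simps)
    ultimately have "(bracket x ^^ k) y \<in> ad_eigen" unfolding ad_eigen_def by blast
    then show ?thesis unfolding divpow_def by (intro span_scale span_base)
  qed
  then have rest: "(\<Sum>k\<in>{2..<2 * Suc N0}. divpow x k y) \<in> span ad_eigen" by (intro span_sum) auto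
  have "(\<Sum>k\<in>{..<2 * Suc N0} - {0, 1}. divpow x k y) = (\<Sum>k\<in>{2..<2 * Suc N0}. divpow x k y)"
    by (intro sum.cong) auto
  then have "\<phi> y = y + bracket x y + (\<Sum>k\<in>{2..<2 * Suc N0}. divpow x k y)"
    unfolding \<phi>_def by (subst sum.subset_diff[of "{0, 1}"]) (auto simp: divpow_def)
  then have "bracket x y = \<phi> y - y - (\<Sum>k\<in>{2..<2 * Suc N0}. divpow x k y)" by simp
  also have "\<dots> \<in> span ad_eigen" using \<phi>y yS rest by (intro span_diff)
  finally show ?thesis .
qed

text \<open>The span is an ideal: bracketing \<open>x\<close> with a component for the eigenvalue
  \<open>m\<close> leads to \<open>m + l\<close>, and the case \<open>m + l = 0\<close> is
  \<open>bracket_opposite_eigen\<close>.\<close>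

lemma span_ad_eigen: "span ad_eigen = UNIV"
proof -
  let ?N = "span ad_eigen"
  have step: "bracket z x \<in> ?N" if x: "x \<in> ad_eigen" for z x
  proof -
    obtain h l where l: "l \<noteq> 0" "x \<in> gen_eig (bracket h) l" using x by (auto simp: ad_eigen_def)
    have "z \<in> span {w \<in> UNIV. \<exists>m. w \<in> gen_eig (bracket h) m}"
      by (rule gen_eig_span[OF endo_bracket fdim_UNIV]) auto
    then show ?thesis
    proof (rule span_induct_alt)
      fix c w z assume "w \<in> {w \<in> UNIV. \<exists>m. w \<in> gen_eig (bracket h) m}" and z: "bracket z x \<in> ?N"
      then obtain m where m: "w \<in> gen_eig (bracket h) m" by blast
      have "bracket w x \<in> ?N"
      proof (cases "m + l = 0")
        case True
        then have "bracket x w \<in> ?N"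
          using bracket_opposite_eigen[OF l] m by (simp add: add_eq_0_iff2)
        then show ?thesis using bracket_skew[of w x] span_neg by simp
      next
        case False
        then show ?thesis
          using gen_eig_bracket[OF m l(2)] by (intro span_base) (auto simp: ad_eigen_def)
      qed
      then show "bracket (scale c w + z) x \<in> ?N"
        using z by (simp add: bracket_add_left bracket_scale_left span_add span_scale)
    qed (simp add: span_zero)
  qed
  have N: "lie_ideal ?N"
    unfolding lie_ideal_def
  proof (intro conjI allI ballI)
    fix z x assume "x \<in> ?N"
    then show "bracket z x \<in> ?N"
      by (rule span_induct_alt) (use step in \<open>auto simp: bracket_add_right bracket_scale_right
        intro: span_zero span_add span_scale\<close>)
  qed simp
  \<comment> \<open>For \<open>w\<close> in the complement, generalized eigenvectors of
    \<open>ad w\<close> for nonzero eigenvalues lie in \<open>?N\<close>, so \<open>ad w\<close>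
    maps them into \<open>?N \<inter> perp ?N\<close> and kills them. Thus \<open>ad w\<close> is
    nilpotent.\<close>
  have "perp ?N = {0}"
  proof (rule ad_nilpotent_derived_ideal_trivial[OF ideal_perp[OF N]])
    fix w v assume w: "w \<in> span {bracket x y | x y. x \<in> perp ?N \<and> y \<in> perp ?N}"
    have "w \<in> perp ?N"
      using w span_minimal[OF _ ideal_subspace[OF ideal_perp[OF N]],
          of "{bracket x y | x y. x \<in> perp ?N \<and> y \<in> perp ?N}"] ideal_bracket[OF ideal_perp[OF N]] by blast
    have "u \<in> gen_eig (bracket w) 0" if u: "u \<in> gen_eig (bracket w) l" for u l
    proof (cases "l = 0")
      case False
      then have "u \<in> ?N" using u by (intro span_base) (auto simp: ad_eigen_def)
      then have "bracket w u \<in> ?N \<inter> perp ?N"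
        using \<open>w \<in> perp ?N\<close> ideal_bracket[OF N] ideal_bracket_left[OF ideal_perp[OF N]] by blast
      then have "(bracket w ^^ 1) u = 0" using ideal_Int_perp[OF N] by simp
      then show ?thesis using gen_eig_0_iff[OF endo_bracket] by blast
    qed (use u in simp)
    then have "{u \<in> UNIV. \<exists>l. u \<in> gen_eig (bracket w) l} \<subseteq> gen_eig (bracket w) 0" by auto
    then have "span {u \<in> UNIV. \<exists>l. u \<in> gen_eig (bracket w) l} \<subseteq> gen_eig (bracket w) 0"
      by (rule span_minimal[OF _ subspace_gen_eig[OF endo_bracket]])
    moreover have "v \<in> span {u \<in> UNIV. \<exists>l. u \<in> gen_eig (bracket w) l}"
      by (rule gen_eig_span[OF endo_bracket fdim_UNIV]) auto
    ultimately show "v \<in> gen_eig (bracket w) 0" by blast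
  qed
  have "x \<in> ?N" for x
  proof -
    obtain k p where "x = k + p" "k \<in> ?N" "p \<in> perp ?N" using ideal_decomposition[OF N] .
    then show ?thesis using \<open>perp ?N = {0}\<close> by simp
  qed
  then show ?thesis by blast
qed

end

section \<open>Words in a representation\<close>

text \<open>Words up to relations, in two guises: products of operators, with \<open>I\<close> zero,
  and words of the free algebra, with \<open>I\<close> the relation ideal. The laws are stated
  inside words, so that the ambient space needs no product.\<close>

locale lie_words = g: lie_algebra gscale bracket + complex_space scale
  for gscale :: "complex \<Rightarrow> 'g::ab_group_add \<Rightarrow> 'g" and bracket
    and scale :: "complex \<Rightarrow> 'b::ab_group_add \<Rightarrow> 'b"  (infixr "*s" 75)
    and W :: "'g list \<Rightarrow> 'b" and I :: "'b set" +
  assumes subspace_I: "subspace I"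
    and word_add: "W (u @ (x + y) # v) - W (u @ x # v) - W (u @ y # v) \<in> I"
    and word_scale: "W (u @ gscale c x # v) - c *s W (u @ x # v) \<in> I"
    and word_bracket: "W (u @ x # y # v) - W (u @ y # x # v) - W (u @ bracket x y # v) \<in> I"
begin

text \<open>The filtration of the enveloping algebra by word length.\<close>

definition wspan :: "nat \<Rightarrow> 'b set" where
  "wspan n = span (W ` {w. length w \<le> n} \<union> I)"

lemma subspace_wspan [simp]: "subspace (wspan n)"
  by (simp add: wspan_def)

lemma wspan_word: "length w \<le> n \<Longrightarrow> W w \<in> wspan n"
  unfolding wspan_def by (rule span_base) auto

lemma wspan_I: "f \<in> I \<Longrightarrow> f \<in> wspan n"
  unfolding wspan_def by (rule span_base) auto

text \<open>Each exchange of neighbours costs a word with a bracket, one letter shorter: words of at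
  most \<open>n + 1\<close> letters, errors of at most \<open>n\<close>.\<close>

lemma word_move:
  assumes "length p + length w + length q \<le> n"
  shows "W (p @ x # w @ q) - W (p @ w @ x # q) \<in> wspan n"
  using assms
proof (induction w arbitrary: p)
  case Nil
  then show ?case using subspace_0 by simp
next
  case (Cons y w)
  let ?d1 = "W (p @ x # y # w @ q) - W (p @ y # x # w @ q) - W (p @ bracket x y # w @ q)"
  have "?d1 \<in> wspan n" using word_bracket wspan_I by blast
  moreover have "W (p @ bracket x y # w @ q) \<in> wspan n" using Cons.prems by (intro wspan_word) simp
  moreover have "W (p @ y # x # w @ q) - W (p @ y # w @ x # q) \<in> wspan n"
    using Cons.IH[of "p @ [y]"] Cons.prems by simp
  ultimately have "?d1 + W (p @ bracket x y # w @ q) + (W (p @ y # x # w @ q) - W (p @ y # w @ x # q)) \<in> wspan n"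
    by (intro subspace_add) auto
  then show ?case by simp
qed

lemma word_collect:
  assumes "length p + length w \<le> Suc n"
  shows "W (p @ w) - W (p @ replicate (count_list w x) x @ filter (\<lambda>y. y \<noteq> x) w) \<in> wspan n"
  using assms
proof (induction w arbitrary: p)
  case Nil
  then show ?case using subspace_0 by simp
next
  case (Cons y w)
  let ?r = "replicate (count_list w x) x" and ?f = "filter (\<lambda>y. y \<noteq> x) w"
  have IH: "W (p @ y # w) - W (p @ y # ?r @ ?f) \<in> wspan n"
    using Cons.IH[of "p @ [y]"] Cons.prems by simp
  show ?case
  proof (cases "y = x")
    case True
    then show ?thesis using IH by simp
  next
    case False
    have "count_list w x + length ?f = length w"
      by (induction w) auto
    then have "W (p @ y # ?r @ ?f) - W (p @ ?r @ y # ?f) \<in> wspan n"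
      using Cons.prems by (intro word_move) simp
    then have "(W (p @ y # w) - W (p @ y # ?r @ ?f)) + (W (p @ y # ?r @ ?f) - W (p @ ?r @ y # ?f)) \<in> wspan n"
      using IH by (intro subspace_add) auto
    then show ?thesis using False by simp
  qed
qed

text \<open>The letters are expanded from left to right by linearity alone, so the length is
  kept.\<close>

lemma word_in_letters:
  assumes L: "g.span L = UNIV"
  shows "W w \<in> span (W ` {w'. set w' \<subseteq> L \<and> length w' = length w} \<union> I)"
proof -
  have "W (u @ w) \<in> span (W ` {w'. set w' \<subseteq> L \<and> length w' = length u + length w} \<union> I)"
    if "set u \<subseteq> L" for u
    using that
  proof (induction w arbitrary: u)
    case Nil
    then show ?case by (auto intro: span_base)
  next
    case (Cons x w)
    let ?S = "span (W ` {w'. set w' \<subseteq> L \<and> length w' = length u + length (x # w)} \<union> I)"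
    have I: "f \<in> ?S" if "f \<in> I" for f using that by (simp add: span_base)
    have "x \<in> g.span L" using L by simp
    then show ?case
    proof (rule g.span_induct_alt[where h = "\<lambda>x. W (u @ x # w) \<in> ?S"])
      have "W (u @ gscale 0 x # w) - 0 *s W (u @ x # w) \<in> I" by (rule word_scale)
      then show "W (u @ 0 # w) \<in> ?S" using I by simp
    next
      fix c b y assume b: "b \<in> L" and y: "W (u @ y # w) \<in> ?S"
      have "W (u @ b # w) \<in> ?S" using Cons.IH[of "u @ [b]"] Cons.prems b by simp
      moreover have "W (u @ gscale c b # w) - c *s W (u @ b # w) \<in> ?S" using word_scale I by blast
      moreover have "W (u @ (gscale c b + y) # w) - W (u @ gscale c b # w) - W (u @ y # w) \<in> ?S"
        using word_add I by blast
      ultimately have "(W (u @ (gscale c b + y) # w) - W (u @ gscale c b # w) - W (u @ y # w))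
          + ((W (u @ gscale c b # w) - c *s W (u @ b # w)) + c *s W (u @ b # w) + W (u @ y # w)) \<in> ?S"
        using y by (intro span_add span_scale)
      then show "W (u @ (gscale c b + y) # w) \<in> ?S" by simp
    qed
  qed
  from this[of "[]"] show ?thesis by simp
qed

lemma wspan_finite:
  assumes "g.fdim UNIV"
  obtains A where "finite A" "wspan n \<subseteq> span (W ` A \<union> I)"
proof -
  obtain L where L: "finite L" "g.span L = UNIV" using g.fdim_basis[OF assms] by metis
  define A where "A = {w. set w \<subseteq> L \<and> length w \<le> n}"
  have "finite A" unfolding A_def by (rule finite_lists_length_le[OF L(1)])
  moreover have "W w \<in> span (W ` A \<union> I)" if "length w \<le> n" for w
  proof -
    have "W ` {w'. set w' \<subseteq> L \<and> length w' = length w} \<union> I \<subseteq> W ` A \<union> I"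
      using that by (auto simp: A_def)
    from span_mono[OF this] show ?thesis using word_in_letters[OF L(2), of w] by blast
  qed
  then have "wspan n \<subseteq> span (W ` A \<union> I)"
    unfolding wspan_def by (intro span_minimal) (auto intro: span_base)
  ultimately show ?thesis using that by blast
qed

end

lemma complex_space_fun:
  assumes "complex_space s" shows "complex_space (\<lambda>c f v. s c (f v))"
proof -
  interpret complex_space s by fact
  show ?thesis
    by unfold_locales (auto simp: fun_eq_iff scale_right_distrib scale_left_distrib)
qed

text \<open>Here words act by linear operators of the whole type that respect all relations. Modules
  on a proper carrier are brought into this form by \<open>total_extension\<close>.\<close>

locale total_rep = lie_rep gscale bracket scale act UNIV
  for gscale :: "complex \<Rightarrow> 'g::ab_group_add \<Rightarrow> 'g" and bracket
    and scale :: "complex \<Rightarrow> 'b::ab_group_add \<Rightarrow> 'b"  (infixr "*s" 75)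
    and act :: "'g \<Rightarrow> 'b \<Rightarrow> 'b"
begin

abbreviation opscale :: "complex \<Rightarrow> ('b \<Rightarrow> 'b) \<Rightarrow> 'b \<Rightarrow> 'b" where
  "opscale \<equiv> \<lambda>c f v. c *s f v"

sublocale op: complex_space opscale
  by (rule complex_space_fun) unfold_locales

lemma endo_word: "endo (foldr act w)"
  by (induction w) (auto simp: endo_def endo_add[OF endo_act] endo_scale[OF endo_act])

sublocale words: lie_words gscale bracket opscale "foldr act" "{0}"
proof unfold_locales
  fix u v :: "'g list" and x y c
  have sub: "foldr act u a - foldr act u b - foldr act u c = foldr act u (a - b - c)" for a b c
    by (simp add: endo_diff[OF endo_word])
  show "foldr act (u @ (x + y) # v) - foldr act (u @ x # v) - foldr act (u @ y # v) \<in> {0}"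
    by (auto simp: fun_eq_iff add_act endo_add[OF endo_word])
  show "foldr act (u @ gscale c x # v) - opscale c (foldr act (u @ x # v)) \<in> {0}"
    by (auto simp: fun_eq_iff scale_act endo_scale[OF endo_word])
  show "foldr act (u @ x # y # v) - foldr act (u @ y # x # v) - foldr act (u @ bracket x y # v) \<in> {0}"
    by (auto simp: fun_eq_iff bracket_act endo_diff[OF endo_word])
qed (simp_all add: op.subspace_single_0)

definition algebra :: "('b \<Rightarrow> 'b) set" where "algebra = op.span (range (foldr act))"

text \<open>Finite dimension of the image of the enveloping algebra takes the place of finite
  dimension of the space.\<close>

definition fin_type :: bool where "fin_type \<longleftrightarrow> op.fdim algebra"

text \<open>Modulo shorter words the letters of a word commute, so a long word contains a high power of a letter.\<close>

lemma fin_type_if_nilpotent: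
  assumes nil: "\<And>x. x \<in> L \<Longrightarrow> \<exists>n. \<forall>v. (act x ^^ n) v = 0" and L: "g.span L = UNIV"
  shows fin_type
proof -
  obtain Y where Y: "Y \<subseteq> L" "g.independent Y" "L \<subseteq> g.span Y" by (rule g.maximal_independent_subset)
  have finY: "finite Y" using g.fdim_independent[OF g.fdim_UNIV Y(2)] by simp
  have spanY: "g.span Y = UNIV"
    using L Y(3) g.span_minimal[OF Y(3)] by auto
  obtain n where n: "\<And>x v. x \<in> Y \<Longrightarrow> (act x ^^ n x) v = 0" using nil Y(1) by (meson subsetD)
  \<comment> \<open>An exponent common to the finitely many letters; a word longer than
    \<open>card Y * N\<close> then contains some letter at least \<open>N\<close> times.\<close>
  define N where "N = Suc (\<Sum>x\<in>Y. n x)"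
  have N: "(act x ^^ k) v = 0" if "x \<in> Y" "k \<ge> N" for x k v
  proof -
    have "n x \<le> k" using member_le_sum[of x Y n] that finY by (simp add: N_def)
    then have "(act x ^^ k) v = (act x ^^ (k - n x)) ((act x ^^ n x) v)"
      by (simp flip: funpow_add[THEN fun_cong, simplified comp_apply])
    then show ?thesis using n[OF that(1)] endo_zero[OF endo_funpow[OF endo_act]] by simp
  qed
  define A where "A = {w. set w \<subseteq> Y \<and> length w \<le> card Y * N}"
  have "finite A" unfolding A_def by (rule finite_lists_length_le[OF finY])
  have key: "foldr act w \<in> op.span (foldr act ` A)" for w
  proof (induction "length w" arbitrary: w rule: less_induct)
    case less
    \<comment> \<open>Words in the letters \<open>Y\<close> come first, from the claim for shorter
      words; an arbitrary word is a combination of words in \<open>Y\<close> of its own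
      length.\<close>
    have Yw: "foldr act w \<in> op.span (foldr act ` A)" if w: "set w \<subseteq> Y"
      and IH: "\<And>w'. length w' < length w \<Longrightarrow> foldr act w' \<in> op.span (foldr act ` A)" for w
    proof (cases "length w \<le> card Y * N")
      case True
      then show ?thesis using w by (intro op.span_base) (auto simp: A_def)
    next
      case False
      have "\<exists>x\<in>Y. count_list w x \<ge> N"
      proof (rule ccontr)
        assume "\<not> ?thesis"
        then have "(\<Sum>x\<in>Y. count_list w x) \<le> (\<Sum>x\<in>Y. N)" by (intro sum_mono) auto
        then show False using False sum_count_set[OF w finY] by simp
      qed
      then obtain x where x: "x \<in> Y" "count_list w x \<ge> N" by blast
      have "foldr act (replicate k x) v = (act x ^^ k) v" for k v by (induction k) auto
      then have "foldr act (replicate (count_list w x) x @ filter (\<lambda>y. y \<noteq> x) w) = 0"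
        using N[OF x] by (auto simp: fun_eq_iff)
      moreover obtain m where m: "length w = Suc m" using False by (cases w) auto
      ultimately have "foldr act w \<in> words.wspan m"
        using words.word_collect[of "[]" w m x] by simp
      moreover have "words.wspan m \<subseteq> op.span (foldr act ` A)"
        unfolding words.wspan_def
        by (rule op.span_minimal) (use IH m op.span_zero in auto)
      ultimately show ?thesis by blast
    qed
    have "foldr act ` {w'. set w' \<subseteq> Y \<and> length w' = length w} \<union> {0} \<subseteq> op.span (foldr act ` A)"
    proof -
      have "foldr act w' \<in> op.span (foldr act ` A)" if "set w' \<subseteq> Y" "length w' = length w" for w'
        using Yw[OF that(1)] less that(2) by simp
      then show ?thesis using op.span_zero by auto
    qed
    then have "op.span (foldr act ` {w'. set w' \<subseteq> Y \<and> length w' = length w} \<union> {0}) \<subseteq> op.span (foldr act ` A)"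
      by (rule op.span_minimal) simp
    then show ?case using words.word_in_letters[OF spanY] by blast
  qed
  have "op.span (range (foldr act)) \<subseteq> op.span (foldr act ` A)"
    by (rule op.span_minimal) (use key in auto)
  then show ?thesis
    unfolding fin_type_def algebra_def by (intro op.fdimI) (use \<open>finite A\<close> in auto)
qed

end

section \<open>Linear projections and functionals\<close>

context complex_space
begin

lemma projection_exists:
  assumes "subspace W"
  shows "\<exists>p. endo p \<and> (\<forall>v. p v \<in> W) \<and> (\<forall>w\<in>W. p w = w)"
proof -
  interpret vector_space_pair scale scale ..
  obtain C where C: "C \<subseteq> W" "independent C" "W \<subseteq> span C" by (rule maximal_independent_subset)
  then have CW: "span C = W" using assms span_minimal by blast
  obtain D where D: "C \<subseteq> D" "D \<subseteq> UNIV" "independent D" "UNIV \<subseteq> span D"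
    by (rule maximal_independent_subset_extend[OF subset_UNIV C(2)])
  obtain p where p: "Vector_Spaces.linear scale scale p" "\<And>b. b \<in> D \<Longrightarrow> p b = (if b \<in> C then b else 0)"
    using linear_independent_extend[OF D(3), of "\<lambda>b. if b \<in> C then b else 0"] by blast
  have e: "endo p" using p(1) by (simp add: endo_linear)
  have "p v \<in> W" for v
  proof -
    have "p ` D \<subseteq> W" using p(2) C(1) subspace_0[OF assms] by auto
    then have "span (p ` D) \<subseteq> W" by (rule span_minimal[OF _ assms])
    then show ?thesis using endo_span_image[OF e, of v D] D(4) by blast
  qed
  moreover have "p w = w" if "w \<in> span C" for w
    by (rule span_induct_alt[OF that])
      (use p(2) D(1) in \<open>auto simp: endo_zero[OF e] endo_add[OF e] endo_scale[OF e]\<close>)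
  ultimately show ?thesis using e CW by blast
qed

lemma functional_exists:
  assumes "w \<noteq> 0"
  shows "\<exists>f :: 'b \<Rightarrow> complex. (\<forall>u v. f (u + v) = f u + f v) \<and> (\<forall>c v. f (c *s v) = c * f v) \<and> f w = 1"
proof -
  interpret vector_space_pair scale "(*) :: complex \<Rightarrow> complex \<Rightarrow> complex"
    by unfold_locales (auto simp: algebra_simps)
  obtain f where f: "Vector_Spaces.linear scale (*) f" "f w = (1 :: complex)"
    using linear_independent_extend[of "{w}" "\<lambda>_. 1"] assms by auto
  then show ?thesis using Vector_Spaces.linear_iff by blast
qed

end

section \<open>Complete reducibility for representations of finite type\<close>

context total_rep
begin

text \<open>The action on operators by commutators; its invariants are the equivariant
  operators.\<close>

definition adj :: "'g \<Rightarrow> ('b \<Rightarrow> 'b) \<Rightarrow> 'b \<Rightarrow> 'b" where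
  "adj x m v = act x (m v) - m (act x v)"

lemma adj_endo: "op.endo (adj x)"
  by (auto simp: op.endo_def adj_def fun_eq_iff endo_add[OF endo_act] endo_scale[OF endo_act]
      scale_right_diff_distrib)

lemma endo_adj: "endo m \<Longrightarrow> endo (adj x m)"
  unfolding adj_def[abs_def] by (intro endo_subtract endo_comp[OF endo_act] endo_comp[OF _ endo_act])

lemma op_subspace_endo: "op.subspace {m. endo m}"
  unfolding op.subspace_def
  using endo_plus endo_scaled by (auto simp: endo_def scale_right_distrib)

lemma adj_rep:
  assumes "op.subspace E" "\<And>x m. m \<in> E \<Longrightarrow> adj x m \<in> E" "\<And>m. m \<in> E \<Longrightarrow> endo m"
  shows "lie_rep gscale bracket opscale adj E"
proof unfold_locales
  fix m x y c assume m: "m \<in> E"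
  note e = endo_add[OF assms(3)[OF m]] endo_scale[OF assms(3)[OF m]] endo_diff[OF assms(3)[OF m]]
    endo_add[OF endo_act] endo_scale[OF endo_act] endo_diff[OF endo_act] add_act scale_act bracket_act
  show "adj (x + y) m = adj x m + adj y m" by (simp add: adj_def fun_eq_iff e)
  show "adj (gscale c x) m = opscale c (adj x m)" by (simp add: adj_def fun_eq_iff e scale_right_diff_distrib)
  show "adj (bracket x y) m = adj x (adj y m) - adj y (adj x m)" by (simp add: adj_def fun_eq_iff e)
qed (use assms adj_endo in auto)

lemma algebra_basis:
  assumes fin_type
  shows "\<exists>A. finite A \<and> (\<forall>a\<in>A. endo a) \<and> (\<forall>w. foldr act w \<in> op.span A)"
proof -
  obtain A where A: "finite A" "op.independent A" "op.span A = algebra"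
    using op.fdim_basis[of algebra] assms fin_type_def by blast
  have "algebra \<subseteq> {m. endo m}"
    unfolding algebra_def by (rule op.span_minimal[OF _ op_subspace_endo]) (auto simp: endo_word)
  then have "endo a" if "a \<in> A" for a using that A(3) op.span_base by blast
  moreover have "foldr act w \<in> op.span A" for w
    unfolding A(3) algebra_def by (rule op.span_base) simp
  ultimately show ?thesis using A(1) by blast
qed

text \<open>Commutators of a linear projection onto \<open>W\<close> still map into
  \<open>W\<close>, and on \<open>W\<close> they vanish. Hence in the space they generate every
  operator is a scalar on \<open>W\<close>, and an invariant one with nonzero scalar is an
  equivariant projection up to a factor.\<close>

lemma equivariant_projection:
  assumes fin: fin_type and W: "subspace W" "\<And>x w. w \<in> W \<Longrightarrow> act x w \<in> W"
  shows "\<exists>p. endo p \<and> (\<forall>v. p v \<in> W) \<and> (\<forall>w\<in>W. p w = w) \<and> (\<forall>x v. p (act x v) = act x (p v))"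
proof (cases "W = {0}")
  case True
  then show ?thesis by (intro exI[of _ "\<lambda>_. 0"]) (auto simp: endo_def)
next
  case False
  then obtain w0 where w0: "w0 \<in> W" "w0 \<noteq> 0" using subspace_0[OF W(1)] by blast
  obtain p where p: "endo p" "\<And>v. p v \<in> W" "\<And>w. w \<in> W \<Longrightarrow> p w = w"
    using projection_exists[OF W(1)] by blast
  \<comment> \<open>For an operator \<open>m\<close> that is a scalar on \<open>W\<close>, this
    scalar is \<open>\<psi> (m w0)\<close>; that is the functional given to
    \<open>invariant_vector\<close>.\<close>
  obtain \<psi> :: "'b \<Rightarrow> complex" where \<psi>: "\<And>u v. \<psi> (u + v) = \<psi> u + \<psi> v" "\<And>c v. \<psi> (c *s v) = c * \<psi> v" "\<psi> w0 = 1"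
    using functional_exists[OF w0(2)] by blast
  define E where "E = op.span (range (\<lambda>w. foldr adj w p))"
  define Q where "Q = {m. endo m \<and> (\<forall>v. m v \<in> W) \<and> (\<exists>c. \<forall>w\<in>W. m w = c *s w)}"
  have "op.subspace Q"
    unfolding op.subspace_def
  proof (intro conjI ballI allI)
    show "0 \<in> Q" using W(1) by (auto simp: Q_def endo_def subspace_0 intro: exI[of _ 0])
    fix m n assume mn: "m \<in> Q" "n \<in> Q"
    then obtain a b where ab: "\<forall>w\<in>W. m w = a *s w" "\<forall>w\<in>W. n w = b *s w" by (auto simp: Q_def)
    then have "\<forall>w\<in>W. (m + n) w = (a + b) *s w" by (simp add: scale_left_distrib)
    moreover have "endo (m + n)" using endo_plus[of m n] mn by (simp add: Q_def plus_fun_def)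
    ultimately show "m + n \<in> Q" using mn W(1) by (auto simp: Q_def subspace_add)
    fix c
    have "\<forall>w\<in>W. opscale c m w = (c * a) *s w" using ab by simp
    then show "opscale c m \<in> Q" using mn W(1) endo_scaled[of m c] unfolding Q_def by (blast intro: subspace_scale)
  qed
  moreover have "foldr adj w p \<in> Q" for w
  proof (induction w)
    case Nil
    then show ?case using p by (auto simp: Q_def intro: exI[of _ 1])
  next
    case (Cons x w)
    let ?m = "foldr adj w p"
    obtain c where c: "\<forall>w\<in>W. ?m w = c *s w" using Cons by (auto simp: Q_def)
    then have "\<forall>w\<in>W. adj x ?m w = 0 *s w" using W(2) by (simp add: adj_def endo_scale[OF endo_act])
    moreover have mW: "endo ?m" "?m v \<in> W" for v using Cons by (simp_all add: Q_def)
    have "adj x ?m v \<in> W" for v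
      unfolding adj_def[of x ?m v] by (intro subspace_diff[OF W(1)] W(2) mW)
    ultimately show ?case using endo_adj[OF mW(1), of x] unfolding Q_def by auto
  qed
  ultimately have EQ: "E \<subseteq> Q" unfolding E_def by (intro op.span_minimal) auto
  have adjE: "adj x m \<in> E" if "m \<in> E" for x m
  proof -
    have "adj x ` range (\<lambda>w. foldr adj w p) \<subseteq> range (\<lambda>w. foldr adj w p)"
    proof safe
      fix w show "adj x (foldr adj w p) \<in> range (\<lambda>w. foldr adj w p)" by (rule range_eqI[of _ _ "x # w"]) simp
    qed
    then show ?thesis using op.endo_span_image[OF adj_endo] op.span_mono that unfolding E_def by blast
  qed
  interpret ad: lie_rep gscale bracket opscale adj E
    by (rule adj_rep) (use adjE EQ in \<open>auto simp: E_def Q_def\<close>)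
  obtain A where A: "finite A" "\<And>a. a \<in> A \<Longrightarrow> endo a" "\<And>w. foldr act w \<in> op.span A"
    using algebra_basis[OF fin] by blast
  \<comment> \<open>Iterated commutators of \<open>p\<close> are combinations of products
    \<open>a p b\<close> with \<open>a\<close> and \<open>b\<close> in the image of the enveloping
    algebra; finitely many of these products span, which bounds the dimension of
    \<open>E\<close>.\<close>
  define T where "T a b v = a (p (b v))" for a b :: "'b \<Rightarrow> 'b" and v
  define S where "S = op.span ((\<lambda>(a, b). T a b) ` (A \<times> A))"
  have T1: "T (opscale c x + y) b = opscale c (T x b) + T y b" "T 0 b = 0" for c x y b
    by (simp_all add: T_def fun_eq_iff)
  have T2: "T x (opscale c b + b') = opscale c (T x b) + T x b'" "T x 0 = 0" if "x \<in> A" for c x b b'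
    using p(1) A(2)[OF that] by (simp_all add: T_def fun_eq_iff endo_add endo_scale endo_zero)
  have S: "0 \<in> S" "opscale c m + m' \<in> S" if "m \<in> S" "m' \<in> S" for c m m'
    using that by (simp_all add: S_def op.span_zero op.span_add op.span_scale)
  have S0: "0 \<in> S" by (simp add: S_def op.span_zero)
  have TA: "T a b \<in> S" if a: "a \<in> A" and "b \<in> op.span A" for a b
    using that(2)
  proof (rule op.span_induct_alt)
    show "T a 0 \<in> S" unfolding T2(2)[OF a] by (rule S0)
    fix c x y assume "x \<in> A" and y: "T a y \<in> S"
    then have "T a x \<in> S" using a by (auto simp: S_def intro: op.span_base)
    then show "T a (opscale c x + y) \<in> S" unfolding T2(1)[OF a] using y by (rule S(2))
  qed
  have TS: "T a b \<in> S" if "a \<in> op.span A" and b: "b \<in> op.span A" for a b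
    using that(1)
  proof (rule op.span_induct_alt)
    show "T 0 b \<in> S" unfolding T1(2) by (rule S0)
    fix c x y assume "x \<in> A" and y: "T y b \<in> S"
    then show "T (opscale c x + y) b \<in> S" unfolding T1(1) using TA b by (intro S(2))
  qed
  let ?R = "(\<lambda>(u, u'). T (foldr act u) (foldr act u')) ` UNIV"
  have R: "T (foldr act u) (foldr act u') \<in> op.span ?R" for u u'
    by (rule op.span_base) (auto intro: image_eqI[of _ _ "(u, u')"])
  have "foldr adj w p \<in> op.span ?R" for w
  proof (induction w)
    case Nil
    have "T (foldr act []) (foldr act []) = p" by (simp add: T_def fun_eq_iff)
    then show ?case using R[of "[]" "[]"] by simp
  next
    case (Cons x w)
    have "adj x (T (foldr act u) (foldr act u'))
        = T (foldr act (x # u)) (foldr act u') - T (foldr act u) (foldr act (u' @ [x]))" for u u'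
      by (simp add: adj_def fun_eq_iff T_def)
    then have *: "adj x (T (foldr act u) (foldr act u')) \<in> op.span ?R" for u u'
      using op.span_diff[OF R R] by (simp only:)
    have "adj x ` ?R \<subseteq> op.span ?R"
    proof (rule image_subsetI)
      fix m assume "m \<in> ?R"
      then obtain u u' where "m = T (foldr act u) (foldr act u')" by auto
      then show "adj x m \<in> op.span ?R" using * by (simp only:)
    qed
    then have "op.span (adj x ` ?R) \<subseteq> op.span ?R" by (rule op.span_minimal) simp
    then show ?case using op.endo_span_image[OF adj_endo Cons, of x] by auto
  qed
  moreover have "op.span ?R \<subseteq> S"
    by (rule op.span_minimal) (use TS A(3) in \<open>auto simp: S_def\<close>)
  ultimately have "E \<subseteq> S" unfolding E_def S_def by (intro op.span_minimal) auto
  then have fE: "op.fdim E" using A(1) by (intro op.fdimI) (auto simp: E_def S_def)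
  have pE: "p \<in> E" unfolding E_def by (rule op.span_base) (rule range_eqI[of _ _ "[]"], simp)
  have "\<exists>m\<in>E. \<psi> (m w0) \<noteq> 0 \<and> (\<forall>x. adj x m = 0)"
  proof (rule ad.invariant_vector[OF fE])
    show "\<psi> (adj x m w0) = 0" if m: "m \<in> E" for x m
    proof -
      have "m \<in> Q" using m EQ by blast
      then obtain c where "\<forall>w\<in>W. m w = c *s w" unfolding Q_def by blast
      then have "adj x m w0 = 0 *s w0" using w0(1) W(2) by (simp add: adj_def endo_scale[OF endo_act])
      then show ?thesis using \<psi>(2)[of 0 0] by simp
    qed
  qed (use pE p(3) w0 \<psi> in auto)
  then obtain m where m: "m \<in> E" "\<psi> (m w0) \<noteq> 0" "\<And>x. adj x m = 0" by blast
  have "m \<in> Q" using m(1) EQ by blast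
  then obtain c where c: "\<And>w. w \<in> W \<Longrightarrow> m w = c *s w" unfolding Q_def by blast
  have c0: "c \<noteq> 0" using m(2) c[OF w0(1)] \<psi>(2)[of 0 0] by auto
  have mQ: "endo m" "\<And>v. m v \<in> W" using \<open>m \<in> Q\<close> by (simp_all add: Q_def)
  have "m (act x v) = act x (m v)" for x v
    using fun_cong[OF m(3)[of x], of v] by (simp add: adj_def)
  then show ?thesis
    using mQ c c0 W(1)
    by (intro exI[of _ "\<lambda>v. (1 / c) *s m v"]) (auto simp: endo_scaled subspace_scale endo_scale[OF endo_act])
qed

end

section \<open>Banach modules\<close>

lemma total_rep_banach:
  assumes "semisimple_lie_algebra scale bracket" "banach_lie_module scale bracket cscale act"
  shows "total_rep scale bracket cscale act"
proof -
  interpret s: semisimple_lie_algebra scale bracket by fact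
  interpret b: banach_lie_module scale bracket cscale act by fact
  interpret v: complex_space cscale using b.vector_space_axioms by (simp add: complex_space_def)
  have "v.endo (act x)" for x
    using b.act_add b.act_scale by (auto simp: v.endo_def)
  then show ?thesis
    by unfold_locales (use b.add_act b.scale_act b.bracket_act in auto)
qed

text \<open>A power \<open>y = x\<^sup>n \<noteq> 0\<close> would give \<open>ad h\<close> the eigenvalue \<open>n l\<close> on the bounded operators, of modulus at most
  \<open>2 \<parallel>h\<parallel>\<close>.\<close>

lemma banach_act_nilpotent:
  assumes ss: "semisimple_lie_algebra scale bracket" and b: "banach_lie_module scale bracket cscale act"
    and l: "l \<noteq> 0" and x: "x \<in> complex_space.gen_eig scale (bracket h) l"
  shows "\<exists>n. \<forall>v. (act x ^^ n) v = 0"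
proof -
  interpret total_rep scale bracket cscale act by (rule total_rep_banach[OF ss b])
  note bounded_act = banach_lie_module.bounded_act[OF b] and norm_cscale = banach_lie_module.norm_cscale[OF b]
  have adj_act: "adj h (act u) = act (bracket h u)" for u
    by (simp add: fun_eq_iff adj_def bracket_act)
  have "op.papply (adj h) p (act u) = act (g.papply (bracket h) p u)" for p u
    by (induction p)
      (simp_all add: g.papply_pCons[OF g.endo_bracket] op.papply_pCons[OF adj_endo] adj_act,
        auto simp: fun_eq_iff zero_act add_act scale_act)
  moreover obtain k where "g.papply (bracket h) ([:-l, 1:] ^ k) x = 0" using x by (auto simp: g.gen_eig_def)
  ultimately have "op.papply (adj h) ([:-l, 1:] ^ k) (act x) = 0" by (auto simp: zero_act fun_eq_iff)
  then have ax: "act x \<in> op.gen_eig (adj h) l" by (auto simp: op.gen_eig_def)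
  have pow: "act x ^^ n \<in> op.gen_eig (adj h) (of_nat n * l)" for n
  proof (induction n)
    case 0
    have "op.papply (adj h) ([:-0, 1:] ^ 1) id = 0"
      by (auto simp: op.papply_pCons[OF adj_endo] op.endo_zero[OF adj_endo] adj_def fun_eq_iff)
    then show ?case unfolding op.gen_eig_def by (intro CollectI exI[of _ 1]) (simp add: id_def)
  next
    case (Suc n)
    have eq: "l + of_nat n * l = of_nat (Suc n) * l" by (simp add: algebra_simps)
    have "act x \<circ> (act x ^^ n) \<in> op.gen_eig (adj h) (l + of_nat n * l)"
    \<comment> \<open>Composition is the bilinear product, for which commutation with
      \<open>act h\<close> obeys the Leibniz rule as soon as the left factor is additive.\<close>
    proof (rule gen_eig_bilinear[OF adj_endo adj_endo adj_endo, where D = "{m. endo m}" and E = UNIV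
          and p = "\<lambda>m m'. m \<circ> m'"])
      show "op.subspace {m. endo m}" by (rule op_subspace_endo)
      show "complex_space opscale" "complex_space opscale" "complex_space opscale" by unfold_locales
      fix u v :: "'b \<Rightarrow> 'b" assume "u \<in> {m. endo m}"
      then show "adj h (u \<circ> v) = (adj h u \<circ> v) + (u \<circ> adj h v)"
        by (simp add: fun_eq_iff adj_def endo_diff)
    qed (use ax Suc in \<open>auto simp: endo_adj endo_act fun_eq_iff endo_add endo_scale\<close>)
    then show ?case unfolding eq by (simp only: funpow.simps)
  qed
  obtain H where H: "H > 0" "\<And>v. norm (act h v) \<le> norm v * H"
    using bounded_linear.pos_bounded[OF bounded_act[of h]] by blast
  obtain n where n: "real n * cmod l > 2 * H"
    using ex_less_of_nat_mult[of "cmod l" "2 * H"] l by (auto simp: mult.commute)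
  define \<mu> where "\<mu> = of_nat n * l"
  have \<mu>: "cmod \<mu> > 2 * H" using n by (simp add: \<mu>_def norm_mult)
  have "act x ^^ n = 0"
  proof (rule ccontr)
    assume ne: "act x ^^ n \<noteq> 0"
    \<comment> \<open>The eigenvector of \<open>adj h\<close> extracted below has to be bounded for
      the norm estimate, so the chain that leads to it is kept inside the bounded operators.\<close>
    define D where "D = {m. endo m \<and> (\<exists>K\<ge>0. \<forall>v. norm (m v) \<le> norm v * K)}"
    have actD: "act y \<in> D" for y
      using bounded_linear.pos_bounded[OF bounded_act[of y]] endo_act by (auto simp: D_def intro: less_imp_le)
    have compD: "m \<circ> m' \<in> D" if "m \<in> D" "m' \<in> D" for m m'
    proof -
      obtain K K' where K: "K \<ge> 0" "\<And>v. norm (m v) \<le> norm v * K" "K' \<ge> 0" "\<And>v. norm (m' v) \<le> norm v * K'"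
        using \<open>m \<in> D\<close> \<open>m' \<in> D\<close> by (auto simp: D_def)
      have "norm (m (m' v)) \<le> norm v * (K' * K)" for v
        using K(2)[of "m' v"] mult_right_mono[OF K(4)[of v] K(1)] by (simp add: mult.assoc)
      moreover have "endo (m \<circ> m')" using that endo_comp[of m m'] by (simp add: D_def comp_def)
      ultimately show ?thesis using K by (auto simp: D_def intro!: exI[of _ "K' * K"])
    qed
    have addD: "opscale c m + m' \<in> D" if "m \<in> D" "m' \<in> D" for c m m'
    proof -
      obtain K K' where K: "K \<ge> 0" "\<And>v. norm (m v) \<le> norm v * K" "K' \<ge> 0" "\<And>v. norm (m' v) \<le> norm v * K'"
        using \<open>m \<in> D\<close> \<open>m' \<in> D\<close> by (auto simp: D_def)
      have "norm (cscale c (m v) + m' v) \<le> norm v * (cmod c * K + K')" for v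
      proof -
        have "norm (cscale c (m v) + m' v) \<le> cmod c * norm (m v) + norm (m' v)"
          using norm_triangle_ineq[of "cscale c (m v)" "m' v"] by (simp add: norm_cscale)
        also have "\<dots> \<le> cmod c * (norm v * K) + norm v * K'"
          using K(2,4)[of v] by (intro add_mono mult_left_mono) auto
        finally show ?thesis by (simp add: algebra_simps)
      qed
      moreover have "endo (opscale c m + m')"
        using that endo_plus[OF endo_scaled, of m m' c] by (simp add: D_def plus_fun_def)
      ultimately show ?thesis using K unfolding D_def by (auto intro!: exI[of _ "cmod c * K + K'"])
    qed
    have zeroD: "0 \<in> D" by (auto simp: D_def endo_def)
    have D: "op.subspace D"
      unfolding op.subspace_def
    proof (intro conjI ballI allI)
      show "m + m' \<in> D" if "m \<in> D" "m' \<in> D" for m m' using addD[of m m' 1] that by (simp add: plus_fun_def)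
      show "opscale c m \<in> D" if "m \<in> D" for c m using addD[OF that zeroD, of c] by simp
    qed (rule zeroD)
    have adjD: "adj h m \<in> D" if "m \<in> D" for m
    proof -
      have "adj h m = opscale (-1) (m \<circ> act h) + (act h \<circ> m)" by (simp add: adj_def fun_eq_iff)
      also have "\<dots> \<in> D" by (intro addD compD actD that)
      finally show ?thesis .
    qed
    have powD: "act x ^^ k \<in> D" for k
    proof (induction k)
      case 0
      show ?case by (auto simp: D_def endo_def intro!: exI[of _ 1])
    qed (simp only: funpow.simps compD actD)
    obtain y where y: "y \<in> D" "y \<noteq> 0" "adj h y = opscale \<mu> y"
      using op.gen_eig_imp_eigenvector[OF adj_endo adjD D powD ne pow] unfolding \<mu>_def by blast
    obtain K where K: "K \<ge> 0" "\<And>v. norm (y v) \<le> norm v * K" using y(1) by (auto simp: D_def)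
    define r where "r = 2 * H / cmod \<mu>"
    have \<mu>0: "cmod \<mu> > 0" using H(1) \<mu> by linarith
    then have r: "0 \<le> r" "r < 1" using H(1) \<mu> by (simp_all add: r_def pos_divide_less_eq)
    \<comment> \<open>In place of an operator norm, a pointwise bound of \<open>y\<close> is
      improved by the factor \<open>r < 1\<close> again and again, until it tends to 0.\<close>
    have bound: "norm (y v) \<le> norm v * (r ^ j * K)" for j v
    proof (induction j arbitrary: v)
      case (Suc j)
      have rK: "0 \<le> r ^ j * K" using r K by simp
      have "cmod \<mu> * norm (y v) = norm (act h (y v) - y (act h v))"
        using fun_cong[OF y(3), of v] by (simp add: adj_def flip: norm_cscale)
      also have "\<dots> \<le> norm (act h (y v)) + norm (y (act h v))" by (rule norm_triangle_ineq4)
      also have "\<dots> \<le> norm (y v) * H + norm (act h v) * (r ^ j * K)" by (intro add_mono H Suc)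
      also have "\<dots> \<le> (norm v * (r ^ j * K)) * H + (norm v * H) * (r ^ j * K)"
        using Suc[of v] H rK by (intro add_mono mult_right_mono) auto
      finally have "cmod \<mu> * norm (y v) \<le> 2 * H * (norm v * (r ^ j * K))" by (simp add: algebra_simps)
      then have "norm (y v) \<le> 2 * H * (norm v * (r ^ j * K)) / cmod \<mu>"
        using \<mu>0 by (simp add: pos_le_divide_eq mult.commute)
      then show ?case by (simp add: r_def mult_ac)
    qed (use K in simp)
    have "norm (y v) \<le> 0" for v
    proof (rule LIMSEQ_le_const)
      show "(\<lambda>j. norm v * (r ^ j * K)) \<longlonglongrightarrow> 0"
        by (intro tendsto_mult_right_zero tendsto_mult_left_zero LIMSEQ_realpow_zero r)
    qed (use bound in blast)
    then show False using y(2) by (auto simp: fun_eq_iff)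
  qed
  then show ?thesis by (auto simp: fun_eq_iff)
qed

lemma banach_fin_type:
  assumes ss: "semisimple_lie_algebra scale bracket" and b: "banach_lie_module scale bracket cscale act"
  shows "total_rep.fin_type cscale act"
proof -
  interpret total_rep scale bracket cscale act by (rule total_rep_banach[OF ss b])
  show ?thesis
    by (rule fin_type_if_nilpotent[OF _ g.span_ad_eigen])
      (auto simp: g.ad_eigen_def intro: banach_act_nilpotent[OF ss b])
qed

section \<open>Homomorphisms from free modules\<close>

definition free_gen :: "('r, 'x) ring_scheme \<Rightarrow> 'b \<Rightarrow> 'b \<Rightarrow> 'r" where
  "free_gen R b = (\<lambda>c. if c = b then \<one>\<^bsub>R\<^esub> else \<zero>\<^bsub>R\<^esub>)"

lemma (in ring) free_gen_closed: "b \<in> B \<Longrightarrow> free_gen R b \<in> carrier (free_module R B)"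
  by (auto simp: free_gen_def)

lemma left_module_homD:
  assumes "h \<in> left_module_hom R M N"
  shows "m \<in> carrier M \<Longrightarrow> h m \<in> carrier N"
    "m \<in> carrier M \<Longrightarrow> m' \<in> carrier M \<Longrightarrow> h (m \<oplus>\<^bsub>M\<^esub> m') = h m \<oplus>\<^bsub>N\<^esub> h m'"
    "r \<in> carrier R \<Longrightarrow> m \<in> carrier M \<Longrightarrow> h (r \<odot>\<^bsub>M\<^esub> m) = r \<odot>\<^bsub>N\<^esub> h m"
  using assms by (auto simp: left_module_hom_def)

lemma left_module_hom_zero:
  assumes "left_module R M" "left_module R N" "h \<in> left_module_hom R M N"
  shows "h \<zero>\<^bsub>M\<^esub> = \<zero>\<^bsub>N\<^esub>"
proof -
  interpret M: left_module R M by fact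
  interpret N: left_module R N by fact
  have "h (\<zero>\<^bsub>R\<^esub> \<odot>\<^bsub>M\<^esub> \<zero>\<^bsub>M\<^esub>) = \<zero>\<^bsub>R\<^esub> \<odot>\<^bsub>N\<^esub> h \<zero>\<^bsub>M\<^esub>"
    by (rule left_module_homD(3)[OF assms(3)]) auto
  then show ?thesis
    using left_module_homD(1)[OF assms(3)] by (simp add: M.smult_zero_left N.smult_zero_left)
qed

context left_module
begin

lemma free_hom_unique:
  assumes h: "h \<in> left_module_hom R (free_module R B) M" and k: "k \<in> left_module_hom R (free_module R B) M"
    and eq: "\<And>b. b \<in> B \<Longrightarrow> h (free_gen R b) = k (free_gen R b)"
    and f: "f \<in> carrier (free_module R B)"
  shows "h f = k f"
proof -
  have F: "left_module R (free_module R B)" by (rule R.left_module_free_module)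
  have M: "left_module R M" by (rule left_module_axioms)
  have "h f = k f" if "finite A" "f \<in> carrier (free_module R B)" "{b. f b \<noteq> \<zero>\<^bsub>R\<^esub>} \<subseteq> A" for A f
    using that
  proof (induction A arbitrary: f)
    case empty
    then have "f = \<zero>\<^bsub>free_module R B\<^esub>" by (auto simp: fun_eq_iff)
    then show ?case using left_module_hom_zero[OF F M h] left_module_hom_zero[OF F M k] by simp
  next
    case (insert a A)
    show ?case
    proof (cases "a \<in> B")
      case False
      then have "f a = \<zero>\<^bsub>R\<^esub>" using insert.prems by simp
      then show ?thesis using insert by (intro insert.IH) auto
    next
      case True
      define f' where "f' = f(a := \<zero>\<^bsub>R\<^esub>)"
      have f': "f' \<in> carrier (free_module R B)" "{b. f' b \<noteq> \<zero>\<^bsub>R\<^esub>} \<subseteq> A"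
        using insert.prems by (auto simp: f'_def intro: finite_subset[of _ "{b. f b \<noteq> \<zero>\<^bsub>R\<^esub>}"])
      have fa: "f a \<in> carrier R" using insert.prems by simp
      have g: "free_gen R a \<in> carrier (free_module R B)" using True by (rule R.free_gen_closed)
      have "f = f' \<oplus>\<^bsub>free_module R B\<^esub> (f a \<odot>\<^bsub>free_module R B\<^esub> free_gen R a)"
        using insert.prems fa by (auto simp: fun_eq_iff f'_def free_gen_def)
      moreover have "f a \<odot>\<^bsub>free_module R B\<^esub> free_gen R a \<in> carrier (free_module R B)"
        using left_module.smult_closed[OF F fa g] .
      ultimately have *: "e f = e f' \<oplus>\<^bsub>M\<^esub> f a \<odot>\<^bsub>M\<^esub> e (free_gen R a)" if "e \<in> left_module_hom R (free_module R B) M" for e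
        using left_module_homD(2)[OF that f'(1)] left_module_homD(3)[OF that fa g] by metis
      show ?thesis unfolding *[OF h] *[OF k] insert.IH[OF f'] eq[OF True] ..
    qed
  qed
  from this[of "{b. f b \<noteq> \<zero>\<^bsub>R\<^esub>}" f] show ?thesis using f by simp
qed

lemma free_hom_exists:
  assumes v: "\<And>b. b \<in> B \<Longrightarrow> v b \<in> carrier M"
  shows "\<exists>h\<in>left_module_hom R (free_module R B) M. \<forall>b\<in>B. h (free_gen R b) = v b"
proof -
  let ?F = "free_module R B"
  define h where "h f = finsum M (\<lambda>b. f b \<odot>\<^bsub>M\<^esub> v b) {b. f b \<noteq> \<zero>\<^bsub>R\<^esub>}" for f
  have summand: "f b \<odot>\<^bsub>M\<^esub> v b \<in> carrier M" if "f \<in> carrier ?F" "b \<in> B" for f b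
    using that v by (intro smult_closed) auto
  have h_on: "h f = finsum M (\<lambda>b. f b \<odot>\<^bsub>M\<^esub> v b) A"
    if "f \<in> carrier ?F" "finite A" "{b. f b \<noteq> \<zero>\<^bsub>R\<^esub>} \<subseteq> A" "A \<subseteq> B" for f A
    unfolding h_def
    by (rule M.add.finprod_mono_neutral_cong_left)
      (use that summand v in \<open>auto simp: smult_zero_left subset_iff\<close>)
  have h_closed: "h f \<in> carrier M" if "f \<in> carrier ?F" for f
    unfolding h_def by (rule M.finsum_closed) (use that summand in auto)
  have "h (f \<oplus>\<^bsub>?F\<^esub> g) = h f \<oplus>\<^bsub>M\<^esub> h g" if fg: "f \<in> carrier ?F" "g \<in> carrier ?F" for f g
  proof -
    interpret F: left_module R ?F by (rule R.left_module_free_module)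
    let ?A = "{b. f b \<noteq> \<zero>\<^bsub>R\<^esub>} \<union> {b. g b \<noteq> \<zero>\<^bsub>R\<^esub>}"
    have A: "finite ?A" "?A \<subseteq> B" using fg by auto
    have "h (f \<oplus>\<^bsub>?F\<^esub> g) = finsum M (\<lambda>b. (f \<oplus>\<^bsub>?F\<^esub> g) b \<odot>\<^bsub>M\<^esub> v b) ?A"
      by (rule h_on) (use F.M.a_closed[OF fg] A in auto)
    also have "\<dots> = finsum M (\<lambda>b. f b \<odot>\<^bsub>M\<^esub> v b \<oplus>\<^bsub>M\<^esub> g b \<odot>\<^bsub>M\<^esub> v b) ?A"
      by (rule M.finsum_cong') (use fg A summand v in \<open>auto simp: smult_l_distr subset_iff Pi_def\<close>)
    also have "\<dots> = finsum M (\<lambda>b. f b \<odot>\<^bsub>M\<^esub> v b) ?A \<oplus>\<^bsub>M\<^esub> finsum M (\<lambda>b. g b \<odot>\<^bsub>M\<^esub> v b) ?A"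
      by (rule M.finsum_addf) (use fg A summand in \<open>auto simp: subset_iff Pi_def\<close>)
    also have "\<dots> = h f \<oplus>\<^bsub>M\<^esub> h g" using h_on[OF fg(1) A(1) _ A(2)] h_on[OF fg(2) A(1) _ A(2)] by auto
    finally show ?thesis .
  qed
  moreover have "h (r \<odot>\<^bsub>?F\<^esub> f) = r \<odot>\<^bsub>M\<^esub> h f" if f: "f \<in> carrier ?F" and r: "r \<in> carrier R" for f r
  proof -
    interpret F: left_module R ?F by (rule R.left_module_free_module)
    let ?A = "{b. f b \<noteq> \<zero>\<^bsub>R\<^esub>}"
    have A: "finite ?A" "?A \<subseteq> B" using f by auto
    have "h (r \<odot>\<^bsub>?F\<^esub> f) = finsum M (\<lambda>b. (r \<odot>\<^bsub>?F\<^esub> f) b \<odot>\<^bsub>M\<^esub> v b) ?A"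
      by (rule h_on) (use F.smult_closed[OF r f] A r in auto)
    also have "\<dots> = finsum M (\<lambda>b. r \<odot>\<^bsub>M\<^esub> (f b \<odot>\<^bsub>M\<^esub> v b)) ?A"
      by (rule M.finsum_cong') (use f r A summand smult_closed v in \<open>auto simp: smult_assoc subset_iff Pi_def\<close>)
    also have "\<dots> = r \<odot>\<^bsub>M\<^esub> h f"
      unfolding h_def by (rule smult_finsum[symmetric, OF A(1) r]) (use f A summand in \<open>auto simp: Pi_def subset_iff\<close>)
    finally show ?thesis .
  qed
  ultimately have "h \<in> left_module_hom R ?F M"
    unfolding left_module_hom_def using h_closed by blast
  moreover have "h (free_gen R b) = v b" if b: "b \<in> B" for b
  proof -
    have "h (free_gen R b) = finsum M (\<lambda>c. free_gen R b c \<odot>\<^bsub>M\<^esub> v c) {b}"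
      by (rule h_on[OF R.free_gen_closed[OF b]]) (use b in \<open>auto simp: free_gen_def split: if_splits\<close>)
    then show ?thesis using v[OF b] smult_one by (simp add: free_gen_def M.add.finprod_insert)
  qed
  ultimately show ?thesis by blast
qed

end

text \<open>Projectivity of free modules: the values on the generators are lifted.\<close>

lemma free_hom_lift:
  assumes R: "ring R" and N: "left_module R N"
    and d: "d \<in> left_module_hom R (free_module R B') N" and g: "g \<in> left_module_hom R (free_module R B) N"
    and sub: "\<And>f. f \<in> carrier (free_module R B) \<Longrightarrow> g f \<in> d ` carrier (free_module R B')"
  shows "\<exists>h\<in>left_module_hom R (free_module R B) (free_module R B').
    \<forall>f\<in>carrier (free_module R B). d (h f) = g f"
proof -
  interpret R: ring R by fact
  interpret N: left_module R N by fact
  interpret F': left_module R "free_module R B'" by (rule R.left_module_free_module)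
  have "\<exists>w\<in>carrier (free_module R B'). d w = g (free_gen R b)" if "b \<in> B" for b
    using sub[OF R.free_gen_closed[OF that]] by (auto simp del: free_module_sel(1))
  then obtain v where v: "\<And>b. b \<in> B \<Longrightarrow> v b \<in> carrier (free_module R B')"
    "\<And>b. b \<in> B \<Longrightarrow> d (v b) = g (free_gen R b)" by metis
  obtain h where h: "h \<in> left_module_hom R (free_module R B) (free_module R B')"
    "\<And>b. b \<in> B \<Longrightarrow> h (free_gen R b) = v b"
    using F'.free_hom_exists[of B v] v(1) by blast
  have dh: "(\<lambda>f. d (h f)) \<in> left_module_hom R (free_module R B) N"
    unfolding left_module_hom_def
    using left_module_homD[OF h(1)] left_module_homD[OF d] by (auto simp del: free_module_sel)
  have "d (h f) = g f" if "f \<in> carrier (free_module R B)" for f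
    by (rule N.free_hom_unique[OF dh g _ that]) (use h(2) v(2) in simp)
  then show ?thesis using h(1) by blast
qed

section \<open>Homology of the tensored resolution\<close>

lemma left_module_smult_minus:
  assumes "left_module R M" "r \<in> carrier R" "m \<in> carrier M"
  shows "r \<odot>\<^bsub>M\<^esub> (\<ominus>\<^bsub>M\<^esub> m) = \<ominus>\<^bsub>M\<^esub> (r \<odot>\<^bsub>M\<^esub> m)"
proof -
  interpret left_module R M by fact
  have "r \<odot>\<^bsub>M\<^esub> m \<oplus>\<^bsub>M\<^esub> r \<odot>\<^bsub>M\<^esub> (\<ominus>\<^bsub>M\<^esub> m) = \<zero>\<^bsub>M\<^esub>"
    using assms smult_r_distr[OF assms(2,3), of "\<ominus>\<^bsub>M\<^esub> m"] by (simp add: M.r_neg smult_zero_right)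
  then show ?thesis
    using assms by (metis M.add.inv_equality M.a_comm M.add.inv_closed smult_closed)
qed

locale central_resolution =
  fixes R :: "('r, 'x) ring_scheme" and N :: "('r, 'n, 'y) module_scheme"
    and B :: "nat \<Rightarrow> 'b set" and d \<epsilon> and z
  assumes N: "left_module R N" and res: "free_resolution R N B d \<epsilon>"
    and z: "z \<in> carrier R" "\<And>r. r \<in> carrier R \<Longrightarrow> z \<otimes>\<^bsub>R\<^esub> r = r \<otimes>\<^bsub>R\<^esub> z"
    and zN: "\<And>n. n \<in> carrier N \<Longrightarrow> z \<odot>\<^bsub>N\<^esub> n = \<zero>\<^bsub>N\<^esub>"
begin

abbreviation "F k \<equiv> free_module R (B k)"

sublocale N: left_module R N by (rule N)

lemma F_module: "left_module R (F k)"
  by (rule N.R.left_module_free_module)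

lemma resD:
  "\<epsilon> \<in> left_module_hom R (F 0) N"
  "d k \<in> left_module_hom R (F (Suc k)) (F k)"
  "\<epsilon> ` carrier (F 0) = carrier N"
  "d 0 ` carrier (F 1) = {f \<in> carrier (F 0). \<epsilon> f = \<zero>\<^bsub>N\<^esub>}"
  "d (Suc k) ` carrier (F (Suc (Suc k))) = {f \<in> carrier (F (Suc k)). d k f = \<zero>\<^bsub>F k\<^esub>}"
  using res unfolding free_resolution_def by blast+

lemma dd: "f \<in> carrier (F (Suc (Suc k))) \<Longrightarrow> d k (d (Suc k) f) = \<zero>\<^bsub>F k\<^esub>"
  using resD(5)[of k] by blast

text \<open>Centrality of \<open>z\<close> is what makes this map linear over a noncommutative
  ring.\<close>

lemma z_hom: "(\<lambda>f. z \<odot>\<^bsub>F k\<^esub> f) \<in> left_module_hom R (F k) (F k)"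
proof -
  interpret F: left_module R "F k" by (rule F_module)
  have "z \<odot>\<^bsub>F k\<^esub> (r \<odot>\<^bsub>F k\<^esub> f) = r \<odot>\<^bsub>F k\<^esub> (z \<odot>\<^bsub>F k\<^esub> f)" if "r \<in> carrier R" "f \<in> carrier (F k)" for r f
    using that z by (metis F.smult_assoc)
  then show ?thesis
    unfolding left_module_hom_def using F.smult_closed[OF z(1)] F.smult_r_distr[OF z(1)]
    by (auto simp del: free_module_sel)
qed

text \<open>The chain map \<open>z\<close> lifts the zero map of \<open>N\<close>, so it is null-homotopic.\<close>

lemma homotopy:
  obtains h where "\<And>k. h k \<in> left_module_hom R (F k) (F (Suc k))"
    "\<And>f. f \<in> carrier (F 0) \<Longrightarrow> d 0 (h 0 f) = z \<odot>\<^bsub>F 0\<^esub> f"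
    "\<And>k f. f \<in> carrier (F (Suc k)) \<Longrightarrow> d (Suc k) (h (Suc k) f) \<oplus>\<^bsub>F (Suc k)\<^esub> h k (d k f) = z \<odot>\<^bsub>F (Suc k)\<^esub> f"
proof -
  \<comment> \<open>\<open>P\<close> is the part of the homotopy identity that the next step
    consumes, namely its composite with \<open>d k\<close>, together with the initial identity in
    degree 0.\<close>
  define P where "P k h \<longleftrightarrow> h \<in> left_module_hom R (F k) (F (Suc k)) \<and>
    (\<forall>f\<in>carrier (F (Suc k)). d k (h (d k f)) = z \<odot>\<^bsub>F k\<^esub> d k f) \<and>
    (k = 0 \<longrightarrow> (\<forall>f\<in>carrier (F 0). d 0 (h f) = z \<odot>\<^bsub>F 0\<^esub> f))" for k h
  define Q where "Q k h h' \<longleftrightarrow> (\<forall>f\<in>carrier (F (Suc k)).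
    d (Suc k) (h' f) \<oplus>\<^bsub>F (Suc k)\<^esub> h (d k f) = z \<odot>\<^bsub>F (Suc k)\<^esub> f)" for k and h h' :: "('b \<Rightarrow> 'r) \<Rightarrow> 'b \<Rightarrow> 'r"
  have "\<exists>h. \<forall>k. P k (h k) \<and> Q k (h k) (h (Suc k))"
  proof (rule dependent_nat_choice)
    have "z \<odot>\<^bsub>F 0\<^esub> f \<in> d 0 ` carrier (F 1)" if f: "f \<in> carrier (F 0)" for f
      unfolding resD(4)
      using left_module_homD(1)[OF z_hom f] left_module_homD(3)[OF resD(1) z(1) f] left_module_homD(1)[OF resD(1) f] zN
      by (simp del: free_module_sel)
    then obtain h where "h \<in> left_module_hom R (F 0) (F 1)" "\<forall>f\<in>carrier (F 0). d 0 (h f) = z \<odot>\<^bsub>F 0\<^esub> f"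
      using free_hom_lift[OF N.R.ring_axioms F_module resD(2)[of 0] z_hom[of 0]] by auto
    then show "\<exists>h. P 0 h"
      unfolding P_def using left_module_homD(1)[OF resD(2)[of 0]] by auto
  next
    fix h k assume P: "P k h"
    have h: "h \<in> left_module_hom R (F k) (F (Suc k))"
      "\<And>f. f \<in> carrier (F (Suc k)) \<Longrightarrow> d k (h (d k f)) = z \<odot>\<^bsub>F k\<^esub> d k f"
      using P unfolding P_def by blast+
    interpret F: left_module R "F (Suc k)" by (rule F_module)
    interpret F0: left_module R "F k" by (rule F_module)
    note dk = left_module_homD[OF resD(2)[of k]] and hk = left_module_homD[OF h(1)]
    \<comment> \<open>The homotopy identity asks for \<open>h'\<close> with
      \<open>d (Suc k) (h' f) = g f\<close>. By \<open>P\<close> the element \<open>g f\<close> is a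
      cycle, hence a boundary, and freeness gives \<open>h'\<close>.\<close>
    define g where "g f = z \<odot>\<^bsub>F (Suc k)\<^esub> f \<oplus>\<^bsub>F (Suc k)\<^esub> (\<ominus>\<^bsub>F (Suc k)\<^esub> h (d k f))" for f
    have zc: "z \<odot>\<^bsub>F (Suc k)\<^esub> f \<in> carrier (F (Suc k))" if "f \<in> carrier (F (Suc k))" for f
      by (rule F.smult_closed[OF z(1) that])
    have hd: "h (d k f) \<in> carrier (F (Suc k))" if "f \<in> carrier (F (Suc k))" for f
      by (rule hk(1)[OF dk(1)[OF that]])
    have gc: "g f \<in> carrier (F (Suc k))" if "f \<in> carrier (F (Suc k))" for f
      unfolding g_def by (rule F.M.a_closed[OF zc[OF that] F.M.a_inv_closed[OF hd[OF that]]])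
    have g: "g \<in> left_module_hom R (F (Suc k)) (F (Suc k))"
      unfolding left_module_hom_def
    proof (intro CollectI conjI ballI)
      show "g \<in> carrier (F (Suc k)) \<rightarrow> carrier (F (Suc k))" using gc by blast
      fix f f' assume f: "f \<in> carrier (F (Suc k))" and f': "f' \<in> carrier (F (Suc k))"
      have "h (d k (f \<oplus>\<^bsub>F (Suc k)\<^esub> f')) = h (d k f) \<oplus>\<^bsub>F (Suc k)\<^esub> h (d k f')"
        by (simp only: dk(2)[OF f f'] hk(2)[OF dk(1)[OF f] dk(1)[OF f']])
      then show "g (f \<oplus>\<^bsub>F (Suc k)\<^esub> f') = g f \<oplus>\<^bsub>F (Suc k)\<^esub> g f'"
        unfolding g_def F.smult_r_distr[OF z(1) f f']
        using zc[OF f] zc[OF f'] hd[OF f] hd[OF f']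
        by (simp only: F.M.minus_add F.M.a_ac F.M.a_closed F.M.a_inv_closed)
    next
      fix r f assume r: "r \<in> carrier R" and f: "f \<in> carrier (F (Suc k))"
      have "h (d k (r \<odot>\<^bsub>F (Suc k)\<^esub> f)) = r \<odot>\<^bsub>F (Suc k)\<^esub> h (d k f)"
        by (simp only: dk(3)[OF r f] hk(3)[OF r dk(1)[OF f]])
      then show "g (r \<odot>\<^bsub>F (Suc k)\<^esub> f) = r \<odot>\<^bsub>F (Suc k)\<^esub> g f"
        unfolding g_def F.smult_r_distr[OF r zc[OF f] F.M.a_inv_closed[OF hd[OF f]]]
          left_module_smult_minus[OF F_module r hd[OF f]] left_module_homD(3)[OF z_hom r f] by simp
    qed
    have "g f \<in> d (Suc k) ` carrier (F (Suc (Suc k)))" if f: "f \<in> carrier (F (Suc k))" for f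
    proof -
      have z0: "z \<odot>\<^bsub>F k\<^esub> d k f \<in> carrier (F k)" by (rule F0.smult_closed[OF z(1) dk(1)[OF f]])
      have "d k (\<ominus>\<^bsub>F (Suc k)\<^esub> h (d k f)) \<oplus>\<^bsub>F k\<^esub> d k (h (d k f)) = d k (\<ominus>\<^bsub>F (Suc k)\<^esub> h (d k f) \<oplus>\<^bsub>F (Suc k)\<^esub> h (d k f))"
        by (rule dk(2)[symmetric, OF F.M.a_inv_closed[OF hd[OF f]] hd[OF f]])
      also have "\<dots> = \<zero>\<^bsub>F k\<^esub>"
        unfolding F.M.l_neg[OF hd[OF f]] by (rule left_module_hom_zero[OF F_module F_module resD(2)])
      finally have "d k (\<ominus>\<^bsub>F (Suc k)\<^esub> h (d k f)) = \<ominus>\<^bsub>F k\<^esub> (z \<odot>\<^bsub>F k\<^esub> d k f)"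
        unfolding h(2)[OF f] using F0.M.add.inv_equality[OF _ z0 dk(1)[OF F.M.a_inv_closed[OF hd[OF f]]]]
        unfolding a_inv_def by simp
      then have "d k (g f) = \<zero>\<^bsub>F k\<^esub>"
        unfolding g_def dk(2)[OF zc[OF f] F.M.a_inv_closed[OF hd[OF f]]] dk(3)[OF z(1) f]
        by (simp only: F0.M.r_neg[OF z0])
      then show ?thesis unfolding resD(5) using gc[OF f] by blast
    qed
    then obtain h' where h': "h' \<in> left_module_hom R (F (Suc k)) (F (Suc (Suc k)))"
      "\<forall>f\<in>carrier (F (Suc k)). d (Suc k) (h' f) = g f"
      using free_hom_lift[OF N.R.ring_axioms F_module resD(2)[of "Suc k"] g] by blast
    have Q: "Q k h h'"
      unfolding Q_def
    proof
      fix f assume f: "f \<in> carrier (F (Suc k))"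
      show "d (Suc k) (h' f) \<oplus>\<^bsub>F (Suc k)\<^esub> h (d k f) = z \<odot>\<^bsub>F (Suc k)\<^esub> f"
        using h'(2) f zc[OF f] hd[OF f]
        by (simp only: g_def F.M.a_assoc F.M.a_inv_closed F.M.l_neg F.M.r_zero)
    qed
    moreover have "d (Suc k) (h' (d (Suc k) f)) = z \<odot>\<^bsub>F (Suc k)\<^esub> d (Suc k) f" if f: "f \<in> carrier (F (Suc (Suc k)))" for f
    proof -
      have df: "d (Suc k) f \<in> carrier (F (Suc k))" by (rule left_module_homD(1)[OF resD(2) f])
      have "h (d k (d (Suc k) f)) = \<zero>\<^bsub>F (Suc k)\<^esub>"
        unfolding dd[OF f] by (rule left_module_hom_zero[OF F_module F_module h(1)])
      moreover have "d (Suc k) (h' (d (Suc k) f)) \<oplus>\<^bsub>F (Suc k)\<^esub> h (d k (d (Suc k) f)) = z \<odot>\<^bsub>F (Suc k)\<^esub> d (Suc k) f"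
        using Q df unfolding Q_def by blast
      ultimately show ?thesis
        using left_module_homD(1)[OF resD(2) left_module_homD(1)[OF h'(1) df]] by (simp only: F.M.r_zero)
    qed
    ultimately show "\<exists>h'. P (Suc k) h' \<and> Q k h h'" using h'(1) unfolding P_def by blast
  qed
  then obtain h where "\<forall>k. P k (h k) \<and> Q k (h k) (h (Suc k))" by blast
  then show ?thesis using that[of h] unfolding P_def Q_def by blast
qed

end

text \<open>The right-module factor; the closure properties put the tensor relations inside the free
  abelian group.\<close>

locale tensor_side =
  fixes R :: "('r, 'x) ring_scheme" and M :: "('r, 'm, 'y) module_scheme"
  assumes M_add: "m \<in> carrier M \<Longrightarrow> m' \<in> carrier M \<Longrightarrow> m \<oplus>\<^bsub>M\<^esub> m' \<in> carrier M"
    and M_smult: "r \<in> carrier R \<Longrightarrow> m \<in> carrier M \<Longrightarrow> r \<odot>\<^bsub>M\<^esub> m \<in> carrier M"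
begin

abbreviation "G N \<equiv> free_Abelian_group (carrier M \<times> carrier N)"

text \<open>The map \<open>id \<otimes> h\<close> before passing to cosets.\<close>

definition push :: "('n1 \<Rightarrow> 'n2) \<Rightarrow> ('m \<times> 'n1 \<Rightarrow>\<^sub>0 int) \<Rightarrow> ('m \<times> 'n2 \<Rightarrow>\<^sub>0 int)" where
  "push h = frag_extend (\<lambda>(m, n). frag_of (m, h n))"

lemma push_simps [simp]:
  "push h 0 = 0" "push h (frag_of (m, n)) = frag_of (m, h n)"
  "push h (a + b) = push h a + push h b" "push h (a - b) = push h a - push h b" "push h (- a) = - push h a"
  by (simp_all add: push_def frag_extend_add frag_extend_diff frag_extend_minus)

lemma push_closed:
  assumes "\<And>n. n \<in> carrier N \<Longrightarrow> h n \<in> carrier N'" "a \<in> carrier (G N)" shows "push h a \<in> carrier (G N')"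
proof -
  have "Poly_Mapping.keys a \<subseteq> carrier M \<times> carrier N" using assms(2) by simp
  then have "Poly_Mapping.keys (push h a) \<subseteq> carrier M \<times> carrier N'"
  proof (induction rule: frag_induction)
    case (one x)
    then show ?case using assms(1) by (auto simp: keys_frag_of)
  next
    case (diff a b)
    then show ?case using keys_diff[of "push h a" "push h b"] by auto
  qed simp
  then show ?thesis by simp
qed

end

locale tensor_pair = tensor_side R M + N: left_module R N
  for R :: "('r, 'x) ring_scheme" and M :: "('r, 'm, 'y) module_scheme" and N :: "('r, 'n, 'z) module_scheme"
begin

abbreviation "K \<equiv> tensor_kernel R M N"

sublocale G: comm_group "G N"
  by (rule abelian_free_Abelian_group)

lemma relations_closed: "tensor_relations R M N \<subseteq> carrier (G N)"
proof
  have g: "frag_of (m, n) \<in> carrier (G N)" if "m \<in> carrier M" "n \<in> carrier N" for m n using that by simp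
  have "a - b \<in> carrier (G N)" if "a \<in> carrier (G N)" "b \<in> carrier (G N)" for a b
    using that keys_diff[of a b] by auto
  then show "x \<in> carrier (G N)" if "x \<in> tensor_relations R M N" for x
    using that unfolding tensor_relations_def
    by (elim UnE CollectE exE conjE) (simp_all only: g M_add M_smult N.M.a_closed N.smult_closed)
qed

lemma K_subgroup: "subgroup K (G N)"
  unfolding tensor_kernel_def by (rule G.generate_is_subgroup[OF relations_closed])

lemma K_normal: "K \<lhd> G N"
  by (rule G.normal_iff_subgroup[THEN iffD2, OF K_subgroup])

lemma K_closed: "a \<in> K \<Longrightarrow> a \<in> carrier (G N)"
  using subgroup.subset[OF K_subgroup] by blast

lemma K_zero: "0 \<in> K"
  using subgroup.one_closed[OF K_subgroup] by simp

lemma K_add: "a \<in> K \<Longrightarrow> b \<in> K \<Longrightarrow> a + b \<in> K"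
  using subgroup.m_closed[OF K_subgroup, of a b] by simp

lemma K_minus: "a \<in> K \<Longrightarrow> - a \<in> K"
  using subgroup.m_inv_closed[OF K_subgroup, of a] K_closed[of a] by simp

lemma K_diff: "a \<in> K \<Longrightarrow> b \<in> K \<Longrightarrow> a - b \<in> K"
  using K_add[OF _ K_minus] by simp

lemma K_relation: "a \<in> tensor_relations R M N \<Longrightarrow> a \<in> K"
  unfolding tensor_kernel_def by (rule generate.incl)

lemma K_rel_left:
  assumes "m \<in> carrier M" "m' \<in> carrier M" "n \<in> carrier N"
  shows "frag_of (m \<oplus>\<^bsub>M\<^esub> m', n) - frag_of (m, n) - frag_of (m', n) \<in> K"
  by (rule K_relation) (use assms in \<open>auto simp: tensor_relations_def\<close>)

lemma K_rel_right:
  assumes "m \<in> carrier M" "n \<in> carrier N" "n' \<in> carrier N"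
  shows "frag_of (m, n \<oplus>\<^bsub>N\<^esub> n') - frag_of (m, n) - frag_of (m, n') \<in> K"
  by (rule K_relation) (use assms in \<open>auto simp: tensor_relations_def\<close>)

lemma K_rel_balanced:
  assumes "r \<in> carrier R" "m \<in> carrier M" "n \<in> carrier N"
  shows "frag_of (r \<odot>\<^bsub>M\<^esub> m, n) - frag_of (m, r \<odot>\<^bsub>N\<^esub> n) \<in> K"
  by (rule K_relation) (use assms in \<open>auto simp: tensor_relations_def\<close>)

lemma coset_eq_iff:
  assumes "a \<in> carrier (G N)" "b \<in> carrier (G N)"
  shows "K #>\<^bsub>G N\<^esub> a = K #>\<^bsub>G N\<^esub> b \<longleftrightarrow> a - b \<in> K"
proof
  assume "K #>\<^bsub>G N\<^esub> a = K #>\<^bsub>G N\<^esub> b"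
  then have "a \<in> K #>\<^bsub>G N\<^esub> b" using G.rcos_self[OF assms(1) K_subgroup] by simp
  then show "a - b \<in> K" by (auto simp: r_coset_def)
next
  assume "a - b \<in> K"
  then have "a \<in> K #>\<^bsub>G N\<^esub> b" by (auto simp: r_coset_def intro!: bexI[of _ "a - b"])
  then show "K #>\<^bsub>G N\<^esub> a = K #>\<^bsub>G N\<^esub> b"
    using G.repr_independence[OF _ assms(2) K_subgroup] by simp
qed

lemma tensor_carrier: "carrier (tensor R M N) = (\<lambda>a. K #>\<^bsub>G N\<^esub> a) ` carrier (G N)"
  unfolding tensor_def by (rule carrier_FactGroup)

lemma tensor_one: "\<one>\<^bsub>tensor R M N\<^esub> = K"
  by (simp add: tensor_def)

lemma coset_zero: "K #>\<^bsub>G N\<^esub> 0 = K"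
  using G.coset_join2[OF _ K_subgroup K_zero] by simp

lemma tensor_group: "group (tensor R M N)"
  unfolding tensor_def by (rule normal.factorgroup_is_group[OF K_normal])

lemma tensor_mult:
  assumes "a \<in> carrier (G N)" "b \<in> carrier (G N)"
  shows "(K #>\<^bsub>G N\<^esub> a) \<otimes>\<^bsub>tensor R M N\<^esub> (K #>\<^bsub>G N\<^esub> b) = K #>\<^bsub>G N\<^esub> (a + b)"
  using normal.rcos_sum[OF K_normal assms] by (simp add: tensor_def)

text \<open>The universal property of the tensor product, with \<open>H\<close> in the role of the
  kernel of a balanced additive map.\<close>

lemma subgroup_contains_K:
  assumes "subgroup H (G N)"
    and "\<And>m m' n. m \<in> carrier M \<Longrightarrow> m' \<in> carrier M \<Longrightarrow> n \<in> carrier N \<Longrightarrow>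
      frag_of (m \<oplus>\<^bsub>M\<^esub> m', n) - frag_of (m, n) - frag_of (m', n) \<in> H"
    and "\<And>m n n'. m \<in> carrier M \<Longrightarrow> n \<in> carrier N \<Longrightarrow> n' \<in> carrier N \<Longrightarrow>
      frag_of (m, n \<oplus>\<^bsub>N\<^esub> n') - frag_of (m, n) - frag_of (m, n') \<in> H"
    and "\<And>r m n. r \<in> carrier R \<Longrightarrow> m \<in> carrier M \<Longrightarrow> n \<in> carrier N \<Longrightarrow>
      frag_of (r \<odot>\<^bsub>M\<^esub> m, n) - frag_of (m, r \<odot>\<^bsub>N\<^esub> n) \<in> H"
  shows "K \<subseteq> H"
  unfolding tensor_kernel_def
  by (rule G.generate_subgroup_incl[OF _ assms(1)]) (use assms(2-4) in \<open>auto simp: tensor_relations_def\<close>)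

end

lemma (in tensor_side) push_kernel:
  assumes N: "left_module R N" "left_module R N'" and h: "h \<in> left_module_hom R N N'" and a: "a \<in> tensor_kernel R M N"
  shows "push h a \<in> tensor_kernel R M N'"
proof -
  interpret N: tensor_pair R M N using N(1) tensor_side_axioms by (simp add: tensor_pair_def)
  interpret N': tensor_pair R M N' using N(2) tensor_side_axioms by (simp add: tensor_pair_def)
  note hD = left_module_homD[OF h]
  let ?H = "{a \<in> carrier (G N). push h a \<in> tensor_kernel R M N'}"
  have g: "frag_of (m, n) \<in> carrier (G N)" if "m \<in> carrier M" "n \<in> carrier N" for m n using that by simp
  have diff: "a - b \<in> carrier (G N)" if "a \<in> carrier (G N)" "b \<in> carrier (G N)" for a b
    using that keys_diff[of a b] by auto
  have "tensor_kernel R M N \<subseteq> ?H"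
  proof (rule N.subgroup_contains_K)
    show "subgroup ?H (G N)"
    proof (rule N.G.subgroupI)
      show "?H \<subseteq> carrier (G N)" by blast
      show "?H \<noteq> {}" using N'.K_zero by (auto intro: exI[of _ 0])
      show "inv\<^bsub>G N\<^esub> a \<in> ?H" if "a \<in> ?H" for a using that N'.K_minus by simp
      show "a \<otimes>\<^bsub>G N\<^esub> b \<in> ?H" if "a \<in> ?H" "b \<in> ?H" for a b
        using that N'.K_add N.G.m_closed[of a b] by auto
    qed
    fix m m' n n' r
    assume m: "m \<in> carrier M" "m' \<in> carrier M" "n \<in> carrier N"
    show "frag_of (m \<oplus>\<^bsub>M\<^esub> m', n) - frag_of (m, n) - frag_of (m', n) \<in> ?H"
      using m N'.K_rel_left[OF m(1,2) hD(1)[OF m(3)]] by (intro CollectI conjI diff g M_add) auto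
  next
    fix m n n' assume m: "m \<in> carrier M" "n \<in> carrier N" "n' \<in> carrier N"
    show "frag_of (m, n \<oplus>\<^bsub>N\<^esub> n') - frag_of (m, n) - frag_of (m, n') \<in> ?H"
      using m N'.K_rel_right[OF m(1) hD(1)[OF m(2)] hD(1)[OF m(3)]]
      by (intro CollectI conjI diff g N.N.M.a_closed) (auto simp: hD(2))
  next
    fix r m n assume m: "r \<in> carrier R" "m \<in> carrier M" "n \<in> carrier N"
    show "frag_of (r \<odot>\<^bsub>M\<^esub> m, n) - frag_of (m, r \<odot>\<^bsub>N\<^esub> n) \<in> ?H"
      using m N'.K_rel_balanced[OF m(1,2) hD(1)[OF m(3)]]
      by (intro CollectI conjI diff g M_smult N.N.smult_closed) (auto simp: hD(3))
  qed
  then show ?thesis using a by blast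
qed

text \<open>By \<open>push_kernel\<close> all representatives have the same image coset, so
  \<open>the_elem\<close> in \<open>tensor_map\<close> meets a singleton.\<close>

lemma (in tensor_side) tensor_map_coset:
  assumes N: "left_module R N" "left_module R N'" and h: "h \<in> left_module_hom R N N'" and a: "a \<in> carrier (G N)"
  shows "tensor_map R M N' h (tensor_kernel R M N #>\<^bsub>G N\<^esub> a) = tensor_kernel R M N' #>\<^bsub>G N'\<^esub> push h a"
proof -
  interpret N: tensor_pair R M N using N(1) tensor_side_axioms by (simp add: tensor_pair_def)
  interpret N': tensor_pair R M N' using N(2) tensor_side_axioms by (simp add: tensor_pair_def)
  have c: "push h b \<in> carrier (G N')" if "b \<in> carrier (G N)" for b
    by (rule push_closed[OF left_module_homD(1)[OF h] that])
  have "tensor_kernel R M N' #>\<^bsub>G N'\<^esub> push h b = tensor_kernel R M N' #>\<^bsub>G N'\<^esub> push h a"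
    if b: "b \<in> tensor_kernel R M N #>\<^bsub>G N\<^esub> a" for b
  proof -
    obtain k where k: "k \<in> tensor_kernel R M N" "b = k + a" using b by (auto simp: r_coset_def)
    then have "b \<in> carrier (G N)" using N.K_closed[OF k(1)] a N.G.m_closed[of k a] by simp
    moreover have "push h b - push h a \<in> tensor_kernel R M N'"
      using push_kernel[OF N h k(1)] k(2) by simp
    ultimately show ?thesis using N'.coset_eq_iff c a by blast
  qed
  moreover have "a \<in> tensor_kernel R M N #>\<^bsub>G N\<^esub> a" by (rule N.G.rcos_self[OF a N.K_subgroup])
  ultimately have "(\<lambda>b. tensor_kernel R M N' #>\<^bsub>G N'\<^esub> push h b) ` (tensor_kernel R M N #>\<^bsub>G N\<^esub> a)
      = {tensor_kernel R M N' #>\<^bsub>G N'\<^esub> push h a}" by blast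
  then show ?thesis by (simp add: tensor_map_def push_def)
qed

lemma (in tensor_side) tensor_map_image_subgroup:
  assumes N: "left_module R N" "left_module R N'" and h: "h \<in> left_module_hom R N N'"
  shows "subgroup (tensor_map R M N' h ` carrier (tensor R M N)) (tensor R M N')"
proof -
  interpret N: tensor_pair R M N using N(1) tensor_side_axioms by (simp add: tensor_pair_def)
  interpret N': tensor_pair R M N' using N(2) tensor_side_axioms by (simp add: tensor_pair_def)
  have c: "push h b \<in> carrier (G N')" if "b \<in> carrier (G N)" for b
    by (rule push_closed[OF left_module_homD(1)[OF h] that])
  have "tensor_map R M N' h \<in> hom (tensor R M N) (tensor R M N')"
  proof (rule homI)
    show "tensor_map R M N' h x \<in> carrier (tensor R M N')" if "x \<in> carrier (tensor R M N)" for x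
      using that c tensor_map_coset[OF N h] unfolding N.tensor_carrier N'.tensor_carrier by force
    fix x y assume "x \<in> carrier (tensor R M N)" "y \<in> carrier (tensor R M N)"
    then obtain a b where ab: "a \<in> carrier (G N)" "b \<in> carrier (G N)"
      "x = tensor_kernel R M N #>\<^bsub>G N\<^esub> a" "y = tensor_kernel R M N #>\<^bsub>G N\<^esub> b"
      unfolding N.tensor_carrier by blast
    have "a + b \<in> carrier (G N)" using N.G.m_closed[OF ab(1,2)] by simp
    then show "tensor_map R M N' h (x \<otimes>\<^bsub>tensor R M N\<^esub> y)
        = tensor_map R M N' h x \<otimes>\<^bsub>tensor R M N'\<^esub> tensor_map R M N' h y"
      unfolding ab(3,4) N.tensor_mult[OF ab(1,2)]
      using ab(1,2) by (simp only: tensor_map_coset[OF N h] N'.tensor_mult[OF c c] push_simps)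
  qed
  then interpret group_hom "tensor R M N" "tensor R M N'" "tensor_map R M N' h"
    using N.tensor_group N'.tensor_group by (simp add: group_hom_def group_hom_axioms_def)
  show ?thesis by (rule img_is_subgroup)
qed

text \<open>Since \<open>m \<otimes> f = m z \<otimes> f = m \<otimes> z f\<close>, the identity of the tensored complex is null-homotopic.\<close>

theorem tensor_homology_trivial:
  fixes M :: "('r, 'm, 'y) module_scheme"
  assumes N: "left_module R N" and res: "free_resolution R N B d \<epsilon>" and M: "tensor_side R M"
    and z: "z \<in> carrier R" "\<And>r. r \<in> carrier R \<Longrightarrow> z \<otimes>\<^bsub>R\<^esub> r = r \<otimes>\<^bsub>R\<^esub> z"
    and zN: "\<And>n. n \<in> carrier N \<Longrightarrow> z \<odot>\<^bsub>N\<^esub> n = \<zero>\<^bsub>N\<^esub>"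
    and zM: "\<And>m. m \<in> carrier M \<Longrightarrow> z \<odot>\<^bsub>M\<^esub> m = m"
  shows "carrier (tensor_homology R k M B d) = {\<one>\<^bsub>tensor_homology R k M B d\<^esub>}"
proof -
  interpret C: central_resolution R N B d \<epsilon> z by (rule central_resolution.intro[OF N res z zN])
  interpret M: tensor_side R M by (rule M)
  have pair: "tensor_pair R M (C.F j)" for j
    using M C.F_module by (simp add: tensor_pair_def)
  obtain h where h: "\<And>k. h k \<in> left_module_hom R (C.F k) (C.F (Suc k))"
    "\<And>f. f \<in> carrier (C.F 0) \<Longrightarrow> d 0 (h 0 f) = z \<odot>\<^bsub>C.F 0\<^esub> f"
    "\<And>k f. f \<in> carrier (C.F (Suc k)) \<Longrightarrow>
      d (Suc k) (h (Suc k) f) \<oplus>\<^bsub>C.F (Suc k)\<^esub> h k (d k f) = z \<odot>\<^bsub>C.F (Suc k)\<^esub> f"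
    by (rule C.homotopy) blast
  let ?T = "\<lambda>j. tensor R M (C.F j)"
  let ?\<delta> = "\<lambda>j. tensor_map R M (C.F j) (d j)"
  let ?K = "\<lambda>j. tensor_kernel R M (C.F j)"
  define Z where "Z = (case k of 0 \<Rightarrow> carrier (?T 0) | Suc j \<Rightarrow> kernel (?T (Suc j)) (?T j) (?\<delta> j))"
  define D where "D = ?\<delta> k ` carrier (?T (Suc k))"
  interpret P: tensor_pair R M "C.F k" by (rule pair)
  interpret Fk: left_module R "C.F k" by (rule C.F_module)
  have D: "subgroup D (?T k)"
    unfolding D_def by (rule M.tensor_map_image_subgroup[OF C.F_module C.F_module C.resD(2)])
  have Zsub: "Z \<subseteq> carrier (?T k)" by (auto simp: Z_def kernel_def split: nat.splits)
  have hc: "M.push (h j) b \<in> carrier (M.G (C.F (Suc j)))" if "b \<in> carrier (M.G (C.F j))" for j b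
    by (rule M.push_closed[OF left_module_homD(1)[OF h(1)] that])
  have dc: "M.push (d j) b \<in> carrier (M.G (C.F j))" if "b \<in> carrier (M.G (C.F (Suc j)))" for j b
    by (rule M.push_closed[OF left_module_homD(1)[OF C.resD(2)] that])
  have sum_closed: "a + b \<in> carrier (M.G (C.F k))" if "a \<in> carrier (M.G (C.F k))" "b \<in> carrier (M.G (C.F k))" for a b
    using P.G.m_closed[OF that] by simp
  have move: "frag_of (m, f) - frag_of (m, z \<odot>\<^bsub>C.F k\<^esub> f) \<in> ?K k" if "m \<in> carrier M" "f \<in> carrier (C.F k)" for m f
    using P.K_rel_balanced[OF z(1) that] zM[OF that(1)] by simp
  have "Z \<subseteq> D"
  proof
    fix t assume t: "t \<in> Z"
    then obtain a where a: "a \<in> carrier (M.G (C.F k))" "t = ?K k #>\<^bsub>M.G (C.F k)\<^esub> a"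
      using Zsub unfolding P.tensor_carrier by blast
    then have keys: "Poly_Mapping.keys a \<subseteq> carrier M \<times> carrier (C.F k)" by simp
    define b where "b = M.push (h k) a"
    have b: "b \<in> carrier (M.G (C.F (Suc k)))" unfolding b_def by (rule hc[OF a(1)])
    \<comment> \<open>Since multiplication by \<open>z\<close> is invisible in the tensor product,
      the homotopy identity makes \<open>a\<close> the boundary of \<open>b\<close>, up to the term
      from \<open>h (d a)\<close> that appears in positive degree.\<close>
    have "a - M.push (d k) b \<in> ?K k"
    proof (cases k)
      case 0
      have "a - M.push (d k) (M.push (h k) a) \<in> ?K k"
        using keys
      proof (induction rule: frag_induction)
        case zero
        then show ?case using P.K_zero by simp
      next
        case (one x)
        then obtain m f where x: "x = (m, f)" "m \<in> carrier M" "f \<in> carrier (C.F k)" by blast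
        then show ?case using move[OF x(2,3)] h(2) 0 by (simp del: free_module_sel)
      next
        case (diff a b)
        then show ?case using P.K_diff[OF diff] by (simp add: algebra_simps)
      qed
      then show ?thesis by (simp only: b_def)
    next
      case (Suc j)
      have "a - M.push (d k) (M.push (h k) a) - M.push (h j) (M.push (d j) a) \<in> ?K k"
        using keys
      proof (induction rule: frag_induction)
        case zero
        then show ?case using P.K_zero by simp
      next
        case (one x)
        then obtain m f where x: "x = (m, f)" "m \<in> carrier M" "f \<in> carrier (C.F k)" by blast
        have 1: "d k (h k f) \<in> carrier (C.F k)" "h j (d j f) \<in> carrier (C.F k)"
          using x(3) left_module_homD(1)[OF h(1)] left_module_homD(1)[OF C.resD(2)] Suc by (simp_all del: free_module_sel)
        have "d k (h k f) \<oplus>\<^bsub>C.F k\<^esub> h j (d j f) = z \<odot>\<^bsub>C.F k\<^esub> f"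
          using h(3)[of f j] x(3) Suc by (simp del: free_module_sel)
        then have "frag_of (m, z \<odot>\<^bsub>C.F k\<^esub> f) - frag_of (m, d k (h k f)) - frag_of (m, h j (d j f)) \<in> ?K k"
          using P.K_rel_right[OF x(2) 1] by simp
        then have "(frag_of (m, f) - frag_of (m, z \<odot>\<^bsub>C.F k\<^esub> f))
            + (frag_of (m, z \<odot>\<^bsub>C.F k\<^esub> f) - frag_of (m, d k (h k f)) - frag_of (m, h j (d j f))) \<in> ?K k"
          using move[OF x(2,3)] P.K_add by blast
        moreover have "(frag_of (m, f) - frag_of (m, z \<odot>\<^bsub>C.F k\<^esub> f))
            + (frag_of (m, z \<odot>\<^bsub>C.F k\<^esub> f) - frag_of (m, d k (h k f)) - frag_of (m, h j (d j f)))
            = frag_of (m, f) - frag_of (m, d k (h k f)) - frag_of (m, h j (d j f))"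
          by (simp only: diff_conv_add_uminus add.assoc minus_add_cancel)
        ultimately show ?case by (simp only: x(1) M.push_simps)
      next
        case (diff a b)
        then show ?case using P.K_diff[OF diff] by (simp add: algebra_simps)
      qed
      \<comment> \<open>The cycle condition enters here: the boundary of \<open>a\<close> is zero in
        the tensor product, and pushing along \<open>h\<close> preserves this.\<close>
      moreover have "M.push (h j) (M.push (d j) a) \<in> ?K k"
      proof -
        interpret Q: tensor_pair R M "C.F j" by (rule pair)
        have a': "a \<in> carrier (M.G (C.F (Suc j)))" using a(1) Suc by simp
        have "?\<delta> j t = ?K j" using t Q.tensor_one by (simp add: Z_def Suc kernel_def)
        also have "?\<delta> j t = ?K j #>\<^bsub>M.G (C.F j)\<^esub> M.push (d j) a"
          unfolding a(2) Suc by (rule M.tensor_map_coset[OF C.F_module C.F_module C.resD(2) a'])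
        finally have "?K j #>\<^bsub>M.G (C.F j)\<^esub> M.push (d j) a = ?K j #>\<^bsub>M.G (C.F j)\<^esub> 0"
          unfolding Q.coset_zero .
        then have "M.push (d j) a \<in> ?K j"
          using Q.coset_eq_iff[OF dc[OF a'], of 0] by simp
        then show ?thesis
          unfolding Suc by (rule M.push_kernel[OF C.F_module C.F_module h(1)])
      qed
      ultimately have "(a - M.push (d k) (M.push (h k) a) - M.push (h j) (M.push (d j) a))
          + M.push (h j) (M.push (d j) a) \<in> ?K k" by (rule P.K_add)
      then show ?thesis by (simp add: b_def)
    qed
    then have "t = ?K k #>\<^bsub>M.G (C.F k)\<^esub> M.push (d k) b"
      unfolding a(2) using P.coset_eq_iff[OF a(1) dc[OF b]] by simp
    also have "\<dots> = ?\<delta> k (?K (Suc k) #>\<^bsub>M.G (C.F (Suc k))\<^esub> b)"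
      by (rule M.tensor_map_coset[symmetric, OF C.F_module C.F_module C.resD(2) b])
    finally show "t \<in> D"
      unfolding D_def tensor_pair.tensor_carrier[OF pair] using b by blast
  qed
  have coset: "D #>\<^bsub>(?T k)\<lparr>carrier := Z\<rparr>\<^esub> t = D" if "t \<in> Z" for t
  proof -
    have "D #>\<^bsub>?T k\<^esub> t = D"
      by (rule group.coset_join2[OF P.tensor_group _ D]) (use that \<open>Z \<subseteq> D\<close> Zsub in auto)
    then show ?thesis by (simp add: r_coset_def)
  qed
  \<comment> \<open>Some cycle must exist for the set of cosets to be \<open>{D}\<close> and not
    empty.\<close>
  have "Z \<noteq> {}"
  proof (cases k)
    case 0
    then show ?thesis using group.is_monoid[OF P.tensor_group] monoid.one_closed by (auto simp: Z_def)
  next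
    case (Suc j)
    interpret Q: tensor_pair R M "C.F j" by (rule pair)
    have 0: "0 \<in> carrier (M.G (C.F (Suc j)))" by simp
    have "?\<delta> j (?K (Suc j) #>\<^bsub>M.G (C.F (Suc j))\<^esub> 0) = \<one>\<^bsub>?T j\<^esub>"
      unfolding M.tensor_map_coset[OF C.F_module C.F_module C.resD(2) 0] by (simp add: Q.coset_zero Q.tensor_one)
    moreover have "?K (Suc j) #>\<^bsub>M.G (C.F (Suc j))\<^esub> 0 \<in> carrier (?T (Suc j))"
      unfolding tensor_pair.tensor_carrier[OF pair] using 0 by blast
    ultimately show ?thesis by (auto simp: Z_def Suc kernel_def)
  qed
  then have "carrier (((?T k)\<lparr>carrier := Z\<rparr>) Mod D) = {D}"
    using coset by (auto simp: carrier_FactGroup)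
  then show ?thesis by (simp add: tensor_homology_def Let_def Z_def D_def)
qed

text \<open>A balanced pairing composed with \<open>\<epsilon>\<close> is an additive map on the
  chains of degree 0 that kills tensor relations and boundaries, so a nonzero value detects a
  nonzero class.\<close>

theorem tensor_homology_0_nontrivial:
  fixes M :: "('r, 'm, 'y) module_scheme" and \<theta> :: "'m \<Rightarrow> 'n \<Rightarrow> complex"
  assumes N: "left_module R N" and res: "free_resolution R N B d \<epsilon>" and M: "tensor_side R M"
    and \<theta>: "\<And>m m' n. m \<in> carrier M \<Longrightarrow> m' \<in> carrier M \<Longrightarrow> n \<in> carrier N \<Longrightarrow> \<theta> (m \<oplus>\<^bsub>M\<^esub> m') n = \<theta> m n + \<theta> m' n"
      "\<And>m n n'. m \<in> carrier M \<Longrightarrow> n \<in> carrier N \<Longrightarrow> n' \<in> carrier N \<Longrightarrow> \<theta> m (n \<oplus>\<^bsub>N\<^esub> n') = \<theta> m n + \<theta> m n'"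
      "\<And>r m n. r \<in> carrier R \<Longrightarrow> m \<in> carrier M \<Longrightarrow> n \<in> carrier N \<Longrightarrow> \<theta> (r \<odot>\<^bsub>M\<^esub> m) n = \<theta> m (r \<odot>\<^bsub>N\<^esub> n)"
    and ne: "m0 \<in> carrier M" "n0 \<in> carrier N" "\<theta> m0 n0 \<noteq> 0"
  shows "carrier (tensor_homology R 0 M B d) \<noteq> {\<one>\<^bsub>tensor_homology R 0 M B d\<^esub>}"
proof
  assume triv: "carrier (tensor_homology R 0 M B d) = {\<one>\<^bsub>tensor_homology R 0 M B d\<^esub>}"
  interpret N: left_module R N by (rule N)
  interpret M: tensor_side R M by (rule M)
  let ?F = "\<lambda>k. free_module R (B k)"
  have F: "left_module R (?F k)" for k by (rule N.R.left_module_free_module)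
  interpret P: tensor_pair R M "?F 0" using M F by (simp add: tensor_pair_def)
  interpret P1: tensor_pair R M "?F 1" using M F by (simp add: tensor_pair_def)
  have \<epsilon>: "\<epsilon> \<in> left_module_hom R (?F 0) N" "\<epsilon> ` carrier (?F 0) = carrier N"
    and d0: "d 0 \<in> left_module_hom R (?F 1) (?F 0)"
    and d0z: "\<And>f. f \<in> carrier (?F 1) \<Longrightarrow> \<epsilon> (d 0 f) = \<zero>\<^bsub>N\<^esub>"
    using res unfolding free_resolution_def One_nat_def by blast+
  note \<epsilon>D = left_module_homD[OF \<epsilon>(1)]
  let ?D = "tensor_map R M (?F 0) (d 0) ` carrier (tensor R M (?F 1))"
  have D: "subgroup ?D (tensor R M (?F 0))"
    by (rule M.tensor_map_image_subgroup[OF F F d0])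
  \<comment> \<open>In degree 0 every chain is a cycle; trivial homology thus turns every chain into
    a boundary.\<close>
  have all: "t \<in> ?D" if "t \<in> carrier (tensor R M (?F 0))" for t
  proof -
    have "?D #>\<^bsub>tensor R M (?F 0)\<^esub> t \<in> carrier (tensor_homology R 0 M B d)"
      using that by (auto simp: tensor_homology_def Let_def carrier_FactGroup r_coset_def)
    then have "?D #>\<^bsub>tensor R M (?F 0)\<^esub> t = ?D"
      using triv by (simp add: tensor_homology_def Let_def)
    then show ?thesis by (rule group.coset_join1[OF P.tensor_group _ that D])
  qed
  \<comment> \<open>The additive group of complex numbers as a \<open>monoid\<close> record, the
    target for the universal property of the free abelian group.\<close>
  let ?A = "\<lparr>carrier = UNIV, monoid.mult = (+), one = 0\<rparr> :: complex monoid"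
  interpret A: comm_group ?A
  proof (rule comm_groupI)
    show "\<exists>y\<in>carrier ?A. y \<otimes>\<^bsub>?A\<^esub> x = \<one>\<^bsub>?A\<^esub>" for x
      by (rule bexI[of _ "- x"]) auto
  qed auto
  obtain \<Theta> where \<Theta>: "\<Theta> \<in> hom (M.G (?F 0)) ?A"
    "\<And>x. x \<in> carrier M \<times> carrier (?F 0) \<Longrightarrow> \<Theta> (frag_of x) = (case x of (m, f) \<Rightarrow> \<theta> m (\<epsilon> f))"
    using A.free_Abelian_group_universal[of "\<lambda>(m, f). \<theta> m (\<epsilon> f)" "carrier M \<times> carrier (?F 0)"] by auto
  have \<Theta>_add: "\<Theta> (a + b) = \<Theta> a + \<Theta> b" if "a \<in> carrier (M.G (?F 0))" "b \<in> carrier (M.G (?F 0))" for a b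
    using hom_mult[OF \<Theta>(1) that] by simp
  have diff: "a - b \<in> carrier (M.G (?F 0))" if "a \<in> carrier (M.G (?F 0))" "b \<in> carrier (M.G (?F 0))" for a b
    using that keys_diff[of a b] by auto
  have \<Theta>_diff: "\<Theta> (a - b) = \<Theta> a - \<Theta> b" if "a \<in> carrier (M.G (?F 0))" "b \<in> carrier (M.G (?F 0))" for a b
    using \<Theta>_add[OF diff[OF that] that(2)] by simp
  have \<Theta>_of: "\<Theta> (frag_of (m, f)) = \<theta> m (\<epsilon> f)" if "m \<in> carrier M" "f \<in> carrier (?F 0)" for m f
    using \<Theta>(2)[of "(m, f)"] that by (simp del: free_module_sel)
  have g: "frag_of (m, f) \<in> carrier (M.G (?F 0))" if "m \<in> carrier M" "f \<in> carrier (?F 0)" for m f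
    using that by (simp del: free_module_sel)
  let ?H = "{a \<in> carrier (M.G (?F 0)). \<Theta> a = 0}"
  have zero: "0 \<in> carrier (M.G (?F 0))" by simp
  have \<Theta>0: "\<Theta> 0 = 0" using \<Theta>_diff[OF zero zero] by simp
  have "P.K \<subseteq> ?H"
  proof (rule P.subgroup_contains_K)
    show "subgroup ?H (M.G (?F 0))"
    proof (rule P.G.subgroupI)
      show "?H \<subseteq> carrier (M.G (?F 0))" by blast
      show "?H \<noteq> {}" using \<Theta>0 zero by blast
      show "inv\<^bsub>M.G (?F 0)\<^esub> a \<in> ?H" if "a \<in> ?H" for a
        using that \<Theta>_diff[OF zero, of a] \<Theta>0 by (simp del: free_module_sel)
      show "a \<otimes>\<^bsub>M.G (?F 0)\<^esub> b \<in> ?H" if "a \<in> ?H" "b \<in> ?H" for a b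
        using that \<Theta>_add[of a b] P.G.m_closed[of a b] by auto
    qed
  next
    fix m m' f assume m: "m \<in> carrier M" "m' \<in> carrier M" "f \<in> carrier (?F 0)"
    have "\<Theta> (frag_of (m \<oplus>\<^bsub>M\<^esub> m', f) - frag_of (m, f) - frag_of (m', f)) = 0"
      by (simp only: \<Theta>_diff diff g m M.M_add \<Theta>_of \<theta>(1)[OF m(1,2) \<epsilon>D(1)[OF m(3)]]) simp
    then show "frag_of (m \<oplus>\<^bsub>M\<^esub> m', f) - frag_of (m, f) - frag_of (m', f) \<in> ?H"
      by (intro CollectI conjI diff g m M.M_add)
  next
    fix m f f' assume m: "m \<in> carrier M" "f \<in> carrier (?F 0)" "f' \<in> carrier (?F 0)"
    have "\<Theta> (frag_of (m, f \<oplus>\<^bsub>?F 0\<^esub> f') - frag_of (m, f) - frag_of (m, f')) = 0"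
      by (simp only: \<Theta>_diff diff g m P.N.M.a_closed \<Theta>_of \<epsilon>D(2) \<theta>(2)[OF m(1) \<epsilon>D(1)[OF m(2)] \<epsilon>D(1)[OF m(3)]]) simp
    then show "frag_of (m, f \<oplus>\<^bsub>?F 0\<^esub> f') - frag_of (m, f) - frag_of (m, f') \<in> ?H"
      by (intro CollectI conjI diff g m P.N.M.a_closed)
  next
    fix r m f assume m: "r \<in> carrier R" "m \<in> carrier M" "f \<in> carrier (?F 0)"
    have "\<Theta> (frag_of (r \<odot>\<^bsub>M\<^esub> m, f) - frag_of (m, r \<odot>\<^bsub>?F 0\<^esub> f)) = 0"
      by (simp only: \<Theta>_diff g m M.M_smult P.N.smult_closed \<Theta>_of \<epsilon>D(3) \<theta>(3)[OF m(1,2) \<epsilon>D(1)[OF m(3)]]) simp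
    then show "frag_of (r \<odot>\<^bsub>M\<^esub> m, f) - frag_of (m, r \<odot>\<^bsub>?F 0\<^esub> f) \<in> ?H"
      by (intro CollectI conjI diff g m M.M_smult P.N.smult_closed)
  qed
  then have \<Theta>K: "\<Theta> a = 0" if "a \<in> P.K" for a using that by blast
  obtain f0 where f0: "f0 \<in> carrier (?F 0)" "\<epsilon> f0 = n0" using \<epsilon>(2) ne(2) by (metis imageE)
  have "P.K #>\<^bsub>M.G (?F 0)\<^esub> frag_of (m0, f0) \<in> ?D"
    by (rule all) (use g[OF ne(1) f0(1)] in \<open>auto simp only: P.tensor_carrier\<close>)
  then obtain b where b: "b \<in> carrier (M.G (?F 1))"
    "P.K #>\<^bsub>M.G (?F 0)\<^esub> frag_of (m0, f0) = tensor_map R M (?F 0) (d 0) (P1.K #>\<^bsub>M.G (?F 1)\<^esub> b)"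
    unfolding P1.tensor_carrier by blast
  have db: "M.push (d 0) b \<in> carrier (M.G (?F 0))"
    by (rule M.push_closed[OF left_module_homD(1)[OF d0] b(1)])
  have "P.K #>\<^bsub>M.G (?F 0)\<^esub> frag_of (m0, f0) = P.K #>\<^bsub>M.G (?F 0)\<^esub> M.push (d 0) b"
    unfolding b(2) by (rule M.tensor_map_coset[OF F F d0 b(1)])
  then have "frag_of (m0, f0) - M.push (d 0) b \<in> P.K"
    using P.coset_eq_iff[OF g[OF ne(1) f0(1)] db] by simp
  then have "\<theta> m0 n0 = \<Theta> (M.push (d 0) b)"
    using \<Theta>K \<Theta>_diff[OF g[OF ne(1) f0(1)] db] \<Theta>_of[OF ne(1) f0(1)] f0(2) by simp
  also have "M.push (d 0) b \<in> carrier (M.G (?F 0)) \<and> \<Theta> (M.push (d 0) b) = 0"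
  proof -
    have "Poly_Mapping.keys b \<subseteq> carrier M \<times> carrier (?F 1)" using b(1) by simp
    then show ?thesis
    proof (induction rule: frag_induction)
      case zero
      then show ?case using \<Theta>0 by simp
    next
      case (one x)
      then obtain m f where x: "x = (m, f)" "m \<in> carrier M" "f \<in> carrier (?F 1)" by blast
      have "\<theta> m \<zero>\<^bsub>N\<^esub> = 0" using \<theta>(2)[OF x(2), of "\<zero>\<^bsub>N\<^esub>" "\<zero>\<^bsub>N\<^esub>"] by simp
      then show ?case
        using \<Theta>_of[OF x(2) left_module_homD(1)[OF d0 x(3)]] g[OF x(2) left_module_homD(1)[OF d0 x(3)]] d0z[OF x(3)]
        by (simp add: x(1) del: free_module_sel carrier_free_Abelian_group_iff)
    next
      case (diff a b)
      then show ?case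
        using \<Theta>_diff diff by (simp only: M.push_simps) (metis diff_self diff_zero \<open>\<And>b a. a \<in> carrier (M.G (?F 0)) \<Longrightarrow> b \<in> carrier (M.G (?F 0)) \<Longrightarrow> a - b \<in> carrier (M.G (?F 0))\<close>)
    qed
  qed
  then have "\<Theta> (M.push (d 0) b) = 0" by blast
  finally show False using ne(3) by simp
qed

section \<open>The free algebra\<close>

interpretation fs: complex_space "\<lambda>c (f :: 'g list \<Rightarrow> complex) w. c * f w"
  by unfold_locales (auto simp: fun_eq_iff algebra_simps)

definition fin_supp :: "('g list \<Rightarrow> complex) set" where
  "fin_supp = {f. finite {w. f w \<noteq> 0}}"

lemma fin_supp_finite: "f \<in> fin_supp \<Longrightarrow> finite {w. f w \<noteq> 0}"
  by (simp add: fin_supp_def)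

text \<open>The product of \<open>free_algebra\<close> on arbitrary functions: a word has finitely
  many splittings, so bilinearity and associativity hold without conditions on supports.\<close>

definition conv :: "('g list \<Rightarrow> complex) \<Rightarrow> ('g list \<Rightarrow> complex) \<Rightarrow> 'g list \<Rightarrow> complex" (infixl "**" 70) where
  "conv f g w = (\<Sum>i\<le>length w. f (take i w) * g (drop i w))"

lemma conv_Nil: "(f ** g) [] = f [] * g []"
  by (simp add: conv_def)

text \<open>Recursion on the first letter, which turns associativity and \<open>conv_word\<close>
  into inductions.\<close>

lemma conv_Cons: "(f ** g) (x # w) = f [] * g (x # w) + ((\<lambda>w. f (x # w)) ** g) w"
  unfolding conv_def by (simp add: sum.atMost_Suc_shift del: sum.atMost_Suc)

lemma conv_add_left: "(f + f') ** g = f ** g + f' ** g"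
  and conv_add_right: "f ** (g + g') = f ** g + f ** g'"
  and conv_diff_left: "(f - f') ** g = f ** g - f' ** g"
  and conv_diff_right: "f ** (g - g') = f ** g - f ** g'"
  and conv_scale_left: "(\<lambda>w. c * f w) ** g = (\<lambda>w. c * (f ** g) w)"
  and conv_scale_right: "f ** (\<lambda>w. c * g w) = (\<lambda>w. c * (f ** g) w)"
  by (auto simp: conv_def fun_eq_iff sum_distrib_left algebra_simps sum.distrib sum_subtractf)

lemma conv_assoc: "(f ** g) ** h = f ** (g ** h)"
proof
  fix w show "((f ** g) ** h) w = (f ** (g ** h)) w"
  proof (induction w arbitrary: f)
    case Nil
    then show ?case by (simp add: conv_Nil)
  next
    case (Cons x w)
    let ?f = "\<lambda>w. f (x # w)" and ?g = "\<lambda>w. g (x # w)"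
    have "(\<lambda>w. (f ** g) (x # w)) = (\<lambda>w. f [] * ?g w) + ?f ** g"
      by (simp add: conv_Cons fun_eq_iff)
    then show ?case
      by (simp add: conv_Cons conv_Nil conv_add_left conv_scale_left Cons algebra_simps)
  qed
qed

lemma conv_word: "word u ** word v = word (u @ v)"
proof
  fix w
  show "(word u ** word v) w = word (u @ v) w"
  proof (induction u arbitrary: w)
    case Nil
    have "(word [] ** word v) w = (\<Sum>i\<le>length w. if i = 0 then word v w else 0)"
      unfolding conv_def by (intro sum.cong) (auto simp: word_def)
    then show ?case by simp
  next
    case (Cons x u)
    show ?case
    proof (cases w)
      case Nil
      then show ?thesis by (simp add: conv_Nil word_def)
    next
      case (Cons y w')
      have "(\<lambda>w. word (x # u) (y # w)) = (\<lambda>w. (if x = y then 1 else 0) * word u w)"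
        by (auto simp: word_def)
      then show ?thesis
        using Cons.IH[of w'] by (simp add: Cons conv_Cons conv_scale_left) (simp add: word_def)
    qed
  qed
qed

lemma word_fin_supp: "word u \<in> fin_supp"
  by (simp add: word_def fin_supp_def)

lemma subspace_fin_supp: "fs.subspace (fin_supp :: ('g list \<Rightarrow> complex) set)"
  unfolding fs.subspace_def
proof (intro conjI ballI allI)
  show "0 \<in> fin_supp" by (simp add: fin_supp_def)
  fix f g :: "'g list \<Rightarrow> complex" and c assume f: "f \<in> fin_supp" and g: "g \<in> fin_supp"
  have "{w. (f + g) w \<noteq> 0} \<subseteq> {w. f w \<noteq> 0} \<union> {w. g w \<noteq> 0}" by auto
  then show "f + g \<in> fin_supp"
    using finite_subset fin_supp_finite[OF f] fin_supp_finite[OF g] unfolding fin_supp_def by blast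
  have "{w. c * f w \<noteq> 0} \<subseteq> {w. f w \<noteq> 0}" by auto
  then show "(\<lambda>w. c * f w) \<in> fin_supp"
    using finite_subset fin_supp_finite[OF f] unfolding fin_supp_def by blast
qed

lemma span_word: "fs.span (range word) = (fin_supp :: ('g list \<Rightarrow> complex) set)"
proof
  show "fs.span (range word) \<subseteq> (fin_supp :: ('g list \<Rightarrow> complex) set)"
    by (rule fs.span_minimal[OF _ subspace_fin_supp]) (use word_fin_supp in auto)
  show "(fin_supp :: ('g list \<Rightarrow> complex) set) \<subseteq> fs.span (range word)"
  proof
    fix f :: "'g list \<Rightarrow> complex" assume "f \<in> fin_supp"
    then have fin: "finite {w. f w \<noteq> 0}" by (rule fin_supp_finite)
    have "f = (\<Sum>u\<in>{w. f w \<noteq> 0}. (\<lambda>w. f u * word u w))"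
    proof
      fix w
      have "(\<Sum>u\<in>{w. f w \<noteq> 0}. (\<lambda>w. f u * word u w)) w = (\<Sum>u\<in>{w. f w \<noteq> 0}. f u * word u w)"
        using fin by (induction rule: finite_induct) auto
      also have "\<dots> = (\<Sum>u\<in>{w. f w \<noteq> 0}. if u = w then f w else 0)"
        by (intro sum.cong) (auto simp: word_def)
      also have "\<dots> = f w" using fin by simp
      finally show "f w = (\<Sum>u\<in>{w. f w \<noteq> 0}. (\<lambda>w. f u * word u w)) w" by simp
    qed
    also have "\<dots> \<in> fs.span (range word)"
      by (intro fs.span_sum fs.span_scale fs.span_base) auto
    finally show "f \<in> fs.span (range word)" .
  qed
qed

lemma fin_supp_induct [consumes 1, case_names zero step]:
  fixes f :: "'g list \<Rightarrow> complex"
  assumes "f \<in> fin_supp" "P 0" "\<And>c u f. f \<in> fin_supp \<Longrightarrow> P f \<Longrightarrow> P ((\<lambda>w. c * word u w) + f)"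
  shows "P f"
proof -
  have "f \<in> fs.span (range word)" using assms(1) span_word by blast
  then have "f \<in> fin_supp \<and> P f"
  proof (rule fs.span_induct_alt)
    show "0 \<in> fin_supp \<and> P 0" using assms(2) fs.subspace_0[OF subspace_fin_supp] by blast
    fix c and x y :: "'g list \<Rightarrow> complex" assume x: "x \<in> range word" and y: "y \<in> fin_supp \<and> P y"
    then obtain u where u: "x = word u" by blast
    have "(\<lambda>w. c * x w) + y \<in> fin_supp"
      using x y by (intro fs.subspace_add[OF subspace_fin_supp] fs.subspace_scale[OF subspace_fin_supp])
        (auto simp: u word_fin_supp)
    then show "(\<lambda>w. c * x w) + y \<in> fin_supp \<and> P ((\<lambda>w. c * x w) + y)" using assms(3) y u by blast
  qed
  then show ?thesis by blast
qed

lemma fin_supp_add: "f \<in> fin_supp \<Longrightarrow> g \<in> fin_supp \<Longrightarrow> f + g \<in> fin_supp"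
  by (rule fs.subspace_add[OF subspace_fin_supp])

lemma fin_supp_scale: "f \<in> fin_supp \<Longrightarrow> (\<lambda>w. c * f w) \<in> fin_supp"
  by (rule fs.subspace_scale[OF subspace_fin_supp])

lemma fin_supp_diff: "f \<in> fin_supp \<Longrightarrow> g \<in> fin_supp \<Longrightarrow> f - g \<in> fin_supp"
  by (rule fs.subspace_diff[OF subspace_fin_supp])

lemma fin_supp_zero [simp]: "0 \<in> fin_supp"
  by (rule fs.subspace_0[OF subspace_fin_supp])

lemma fin_supp_minus: "f \<in> fin_supp \<Longrightarrow> - f \<in> fin_supp"
  by (rule fs.subspace_neg[OF subspace_fin_supp])

lemma conv_zero [simp]: "0 ** f = 0" "f ** 0 = 0"
  by (auto simp: conv_def fun_eq_iff)

lemma fin_supp_conv: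
  assumes "f \<in> fin_supp" "g \<in> fin_supp" shows "f ** g \<in> fin_supp"
  using assms(1)
proof (induction rule: fin_supp_induct)
  case zero
  show ?case by (simp only: conv_zero fin_supp_zero)
next
  case (step c u f)
  have "word u ** g \<in> fin_supp"
    using assms(2)
  proof (induction rule: fin_supp_induct)
    case zero
    show ?case by (simp only: conv_zero fin_supp_zero)
  next
    case (step c v g)
    then show ?case
      unfolding conv_add_right conv_scale_right conv_word
      by (intro fin_supp_add fin_supp_scale word_fin_supp)
  qed
  then show ?case
    unfolding conv_add_left conv_scale_left using step by (intro fin_supp_add fin_supp_scale)
qed

lemma conv_one_left: "word [] ** f = f"
proof
  fix w
  have "(word [] ** f) w = (\<Sum>i\<le>length w. if i = 0 then f w else 0)"
    unfolding conv_def by (intro sum.cong) (auto simp: word_def)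
  then show "(word [] ** f) w = f w" by simp
qed

lemma conv_one_right: "f ** word [] = f"
proof
  fix w
  have "(f ** word []) w = (\<Sum>i\<le>length w. if i = length w then f w else 0)"
    unfolding conv_def by (intro sum.cong) (auto simp: word_def)
  then show "(f ** word []) w = f w" by simp
qed

lemma free_algebra_sel [simp]:
  "carrier free_algebra = fin_supp" "f \<otimes>\<^bsub>free_algebra\<^esub> g = f ** g" "\<one>\<^bsub>free_algebra\<^esub> = word []"
  "\<zero>\<^bsub>free_algebra\<^esub> = 0" "f \<oplus>\<^bsub>free_algebra\<^esub> g = f + g"
  by (auto simp: free_algebra_def fin_supp_def conv_def word_def fun_eq_iff)

lemma ring_free_algebra: "ring (free_algebra :: ('g list \<Rightarrow> complex) ring)"
proof (rule ringI)
  show "abelian_group (free_algebra :: ('g list \<Rightarrow> complex) ring)"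
  proof (rule abelian_groupI)
    fix f :: "'g list \<Rightarrow> complex" assume "f \<in> carrier free_algebra"
    then have "- f \<in> fin_supp" by (simp add: fin_supp_minus)
    then show "\<exists>g\<in>carrier free_algebra. g \<oplus>\<^bsub>free_algebra\<^esub> f = \<zero>\<^bsub>free_algebra\<^esub>"
      by (intro bexI[of _ "- f"]) simp_all
  qed (use fin_supp_add in \<open>simp_all add: ac_simps\<close>)
  show "monoid (free_algebra :: ('g list \<Rightarrow> complex) ring)"
    by (rule monoidI) (use fin_supp_conv word_fin_supp in
        \<open>simp_all only: free_algebra_sel conv_assoc conv_one_left conv_one_right\<close>)
qed (simp_all only: free_algebra_sel conv_add_left conv_add_right)

interpretation free_algebra: ring "free_algebra :: ('g list \<Rightarrow> complex) ring"
  by (rule ring_free_algebra)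

section \<open>The relation ideal\<close>

context lie_algebra
begin

definition rel_ideal :: "('g list \<Rightarrow> complex) set" where
  "rel_ideal = Idl\<^bsub>free_algebra\<^esub> (uea_relations scale bracket)"

lemma relations_eq:
  "uea_relations scale bracket = {word [x + y] - word [x] - word [y] | x y. True}
   \<union> {word [scale c x] - (\<lambda>w. c * word [x] w) | c x. True}
   \<union> {word [x, y] - word [y, x] - word [bracket x y] | x y. True}"
  by (auto simp: uea_relations_def fun_eq_iff)

lemma relations_fin_supp: "uea_relations scale bracket \<subseteq> fin_supp"
  unfolding relations_eq
  by (auto intro!: fin_supp_diff fin_supp_scale word_fin_supp)

lemma ideal_rel: "ideal rel_ideal free_algebra"
  unfolding rel_ideal_def by (rule free_algebra.genideal_ideal) (use relations_fin_supp in simp)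

lemma relation_in_ideal: "r \<in> uea_relations scale bracket \<Longrightarrow> r \<in> rel_ideal"
  unfolding rel_ideal_def using free_algebra.genideal_self[of "uea_relations scale bracket"] relations_fin_supp by auto

lemma rel_fin_supp: "f \<in> rel_ideal \<Longrightarrow> f \<in> fin_supp"
  using ideal.Icarr[OF ideal_rel] by simp

lemma rel_conv_left: "f \<in> fin_supp \<Longrightarrow> r \<in> rel_ideal \<Longrightarrow> f ** r \<in> rel_ideal"
  using ideal.I_l_closed[OF ideal_rel, of r f] by simp

lemma rel_conv_right: "f \<in> fin_supp \<Longrightarrow> r \<in> rel_ideal \<Longrightarrow> r ** f \<in> rel_ideal"
  using ideal.I_r_closed[OF ideal_rel, of r f] by simp

lemma subspace_rel: "fs.subspace rel_ideal"
  unfolding fs.subspace_def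
proof (intro conjI ballI allI)
  interpret I: additive_subgroup rel_ideal free_algebra
    by (rule ideal.axioms(1)[OF ideal_rel])
  show "0 \<in> rel_ideal" using I.zero_closed by simp
  show "f + g \<in> rel_ideal" if "f \<in> rel_ideal" "g \<in> rel_ideal" for f g
    using I.a_closed[OF that] by simp
  show "(\<lambda>w. c * f w) \<in> rel_ideal" if "f \<in> rel_ideal" for c f
    using rel_conv_left[OF fin_supp_scale[OF word_fin_supp[of "[]"]] that, of c]
    by (simp only: conv_scale_left conv_one_left)
qed

text \<open>Each law comes from a defining relation multiplied by \<open>word u\<close> and
  \<open>word v\<close> on the two sides.\<close>

lemma words_rel: "lie_words scale bracket (\<lambda>c f w. c * f w) word rel_ideal"
proof unfold_locales
  fix u v x y c
  have r: "word u ** r ** word v \<in> rel_ideal" if "r \<in> uea_relations scale bracket" for r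
    by (rule rel_conv_right[OF word_fin_supp rel_conv_left[OF word_fin_supp relation_in_ideal[OF that]]])
  have "word u ** (word [x + y] - word [x] - word [y]) ** word v \<in> rel_ideal"
    by (rule r) (auto simp: relations_eq)
  then show "word (u @ (x + y) # v) - word (u @ x # v) - word (u @ y # v) \<in> rel_ideal"
    by (simp add: conv_diff_left conv_diff_right conv_word)
  have "word u ** (word [scale c x] - (\<lambda>w. c * word [x] w)) ** word v \<in> rel_ideal"
    by (rule r) (auto simp: relations_eq)
  then show "word (u @ scale c x # v) - (\<lambda>w. c * word (u @ x # v) w) \<in> rel_ideal"
    by (simp add: conv_diff_left conv_diff_right conv_scale_left conv_scale_right conv_word)
  have "word u ** (word [x, y] - word [y, x] - word [bracket x y]) ** word v \<in> rel_ideal"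
    by (rule r) (auto simp: relations_eq)
  then show "word (u @ x # y # v) - word (u @ y # x # v) - word (u @ bracket x y # v) \<in> rel_ideal"
    by (simp add: conv_diff_left conv_diff_right conv_word)
qed (rule subspace_rel)

end

section \<open>Evaluation in a representation\<close>

context total_rep
begin

definition ev :: "('g list \<Rightarrow> complex) \<Rightarrow> 'b \<Rightarrow> 'b" where
  "ev f v = (\<Sum>w | f w \<noteq> 0. f w *s foldr act w v)"

lemma ev_superset:
  assumes "finite A" "{w. f w \<noteq> 0} \<subseteq> A" shows "ev f v = (\<Sum>w\<in>A. f w *s foldr act w v)"
  unfolding ev_def by (rule sum.mono_neutral_left) (use assms in auto)

lemma ev_word: "ev (word w) = foldr act w"
proof
  fix v
  have "ev (word w) v = (\<Sum>u\<in>{w}. word w u *s foldr act u v)"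
    by (rule ev_superset) (auto simp: word_def)
  then show "ev (word w) v = foldr act w v" by (simp add: word_def)
qed

lemma ev_add:
  assumes "f \<in> fin_supp" "g \<in> fin_supp" shows "ev (f + g) v = ev f v + ev g v"
proof -
  let ?A = "{w. f w \<noteq> 0} \<union> {w. g w \<noteq> 0}"
  have A: "finite ?A" using assms fin_supp_finite by blast
  have "ev (f + g) v = (\<Sum>w\<in>?A. (f + g) w *s foldr act w v)" by (rule ev_superset[OF A]) auto
  also have "\<dots> = (\<Sum>w\<in>?A. f w *s foldr act w v) + (\<Sum>w\<in>?A. g w *s foldr act w v)"
    by (simp add: scale_left_distrib sum.distrib)
  also have "\<dots> = ev f v + ev g v"
    using ev_superset[OF A, of f v] ev_superset[OF A, of g v] by auto
  finally show ?thesis .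
qed

lemma ev_scale: assumes "f \<in> fin_supp" shows "ev (\<lambda>w. c * f w) v = c *s ev f v"
proof -
  have "ev (\<lambda>w. c * f w) v = (\<Sum>w | f w \<noteq> 0. (c * f w) *s foldr act w v)"
    by (rule ev_superset) (use fin_supp_finite[OF assms] in auto)
  then show ?thesis by (simp add: ev_def scale_sum_right)
qed

lemma ev_zero [simp]: "ev 0 v = 0"
  by (simp add: ev_def)

lemma ev_diff: "f \<in> fin_supp \<Longrightarrow> g \<in> fin_supp \<Longrightarrow> ev (f - g) v = ev f v - ev g v"
  using ev_add[of f "\<lambda>w. (-1) * g w" v] ev_scale[of g "-1" v] fin_supp_scale[of g "-1"]
  by (simp add: fun_diff_def plus_fun_def)

lemma endo_ev: "endo (ev f)"
  unfolding ev_def[abs_def] by (rule endo_summed) (rule endo_scaled[OF endo_word])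

lemma ev_conv:
  assumes "f \<in> fin_supp" "g \<in> fin_supp" shows "ev (f ** g) v = ev f (ev g v)"
  using assms(1)
proof (induction rule: fin_supp_induct)
  case zero
  show ?case by (simp only: conv_zero ev_zero)
next
  case (step c u f)
  have "ev (word u ** g) v = foldr act u (ev g v)"
    using assms(2)
  proof (induction rule: fin_supp_induct)
    case zero
    show ?case by (simp only: conv_zero ev_zero endo_zero[OF endo_word])
  next
    case (step c w g)
    have 1: "(\<lambda>w'. c * word w w') \<in> fin_supp" "(\<lambda>w'. c * word (u @ w) w') \<in> fin_supp"
      by (intro fin_supp_scale word_fin_supp)+
    show ?case
      unfolding conv_add_right conv_scale_right conv_word ev_add[OF 1(2) fin_supp_conv[OF word_fin_supp step(1)]]
        ev_add[OF 1(1) step(1)] ev_scale[OF word_fin_supp] ev_word step(2)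
      by (simp add: endo_add[OF endo_word] endo_scale[OF endo_word])
  qed
  moreover have 1: "(\<lambda>w. c * word u w) \<in> fin_supp" by (intro fin_supp_scale word_fin_supp)
  moreover have 2: "(\<lambda>w. c * (word u ** g) w) \<in> fin_supp"
    by (intro fin_supp_scale fin_supp_conv word_fin_supp assms)
  ultimately show ?case
    unfolding conv_add_left conv_scale_left ev_add[OF 2 fin_supp_conv[OF step(1) assms(2)]] ev_add[OF 1 step(1)]
      ev_scale[OF word_fin_supp] ev_scale[OF fin_supp_conv[OF word_fin_supp assms(2)]] ev_word step(2)
    by simp
qed

text \<open>The elements that act as zero form a two-sided ideal, so the generating relations
  suffice.\<close>

lemma ev_relation: assumes "r \<in> g.rel_ideal" shows "ev r v = 0"
proof -
  let ?J = "{f \<in> fin_supp. \<forall>v. ev f v = 0}"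
  have word_diff: "ev (f - g - h) v = ev f v - ev g v - ev h v" if "f \<in> fin_supp" "g \<in> fin_supp" "h \<in> fin_supp" for f g h v
    using that by (simp only: ev_diff fin_supp_diff)
  have "ideal ?J (free_algebra :: ('g list \<Rightarrow> complex) ring)"
  proof (rule idealI[OF ring_free_algebra])
    show "subgroup ?J (add_monoid (free_algebra :: ('g list \<Rightarrow> complex) ring))"
    proof (rule group.subgroupI[OF free_algebra.add.is_group])
      show "?J \<noteq> {}" by (auto intro: exI[of _ 0])
      fix f g assume f: "f \<in> ?J" and g: "g \<in> ?J"
      then show "f \<otimes>\<^bsub>add_monoid free_algebra\<^esub> g \<in> ?J" using ev_add fin_supp_add[of f g] by simp
    next
      fix f assume f: "f \<in> ?J"
      have mf: "- f \<in> fin_supp" using f fin_supp_minus by blast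
      have "\<ominus>\<^bsub>free_algebra\<^esub> f = - f"
        by (rule free_algebra.minus_equality) (use f mf in simp_all)
      moreover have "ev (- f) v = 0" for v
        using ev_scale[of f "-1" v] f by (simp add: fun_Compl_def)
      ultimately show "inv\<^bsub>add_monoid free_algebra\<^esub> f \<in> ?J"
        using mf by (simp add: a_inv_def)
    qed auto
  qed (use fin_supp_conv in \<open>auto simp: ev_conv endo_zero[OF endo_ev]\<close>)
  moreover have "uea_relations gscale bracket \<subseteq> ?J"
  proof
    fix r assume r: "r \<in> uea_relations gscale bracket"
    have "ev r v = 0" for v
      using r unfolding g.relations_eq
    proof (elim UnE CollectE exE conjE)
      fix x y assume "r = word [x + y] - word [x] - word [y]"
      then show ?thesis by (simp add: word_diff word_fin_supp ev_word add_act)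
    next
      fix c x assume "r = word [gscale c x] - (\<lambda>w. c * word [x] w)"
      then show ?thesis
        by (simp add: ev_diff fin_supp_scale ev_scale word_fin_supp ev_word scale_act)
    next
      fix x y assume "r = word [x, y] - word [y, x] - word [bracket x y]"
      then show ?thesis by (simp add: word_diff word_fin_supp ev_word bracket_act)
    qed
    then show "r \<in> ?J" using r g.relations_fin_supp by blast
  qed
  ultimately have "g.rel_ideal \<subseteq> ?J"
    unfolding g.rel_ideal_def by (rule free_algebra.genideal_minimal)
  then show ?thesis using assms by blast
qed

lemma ev_in_subspace:
  assumes "subspace E" "\<And>x v. v \<in> E \<Longrightarrow> act x v \<in> E" "v \<in> E" shows "ev f v \<in> E"
proof -
  have "foldr act w v \<in> E" for w using assms(2,3) by (induction w) auto
  then show ?thesis unfolding ev_def using assms(1) by (intro subspace_sum subspace_scale)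
qed

lemma ev_equivariant:
  assumes "endo p" "\<And>x v. p (act x v) = act x (p v)" shows "p (ev f v) = ev f (p v)"
proof -
  have "p (foldr act w v) = foldr act w (p v)" for w using assms(2) by (induction w) auto
  then show ?thesis by (simp add: ev_def endo_sum[OF assms(1)] endo_scale[OF assms(1)])
qed

lemma act_ev: "f \<in> fin_supp \<Longrightarrow> act x (ev f v) = ev (word [x] ** f) v"
  using ev_conv[OF word_fin_supp, of f "[x]"] by (simp add: ev_word)

end

lemma sum_fun_at: "(\<Sum>i\<in>A. f i) v = (\<Sum>i\<in>A. f i v)"
  by (induction A rule: infinite_finite_induct) auto

context total_rep
begin

text \<open>Operators under left multiplication: left ideals of the image of the enveloping algebra
  are submodules here, so \<open>equivariant_projection\<close> applies to them.\<close>

definition lmult :: "'g \<Rightarrow> ('b \<Rightarrow> 'b) \<Rightarrow> 'b \<Rightarrow> 'b" where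
  "lmult x m v = act x (m v)"

lemma lmult_rep: "total_rep gscale bracket opscale lmult"
  by unfold_locales
    (auto simp: op.endo_def lmult_def fun_eq_iff endo_add[OF endo_act] endo_scale[OF endo_act] add_act scale_act bracket_act)

lemma lmult_word: "foldr lmult w m v = foldr act w (m v)"
  by (induction w arbitrary: v) (auto simp: lmult_def)

lemma lmult_fin_type:
  assumes fin_type shows "total_rep.fin_type opscale lmult"
proof -
  interpret L: total_rep gscale bracket opscale lmult by (rule lmult_rep)
  obtain A where A: "finite A" "\<forall>w. foldr act w \<in> op.span A" using algebra_basis[OF assms] by blast
  define c where "c a = (\<lambda>(m :: 'b \<Rightarrow> 'b) v. a (m v))" for a :: "'b \<Rightarrow> 'b"
  have "c a \<in> L.op.span (c ` A)" if "a \<in> op.span A" for a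
    using that
  proof (rule op.span_induct_alt)
    have "c 0 = 0" by (simp add: c_def fun_eq_iff)
    then show "c 0 \<in> L.op.span (c ` A)" by (simp only: L.op.span_zero)
    fix d x y assume "x \<in> A" and y: "c y \<in> L.op.span (c ` A)"
    then have x: "c x \<in> L.op.span (c ` A)" by (intro L.op.span_base) blast
    have "c (opscale d x + y) = L.opscale d (c x) + c y" by (simp add: c_def fun_eq_iff)
    then show "c (opscale d x + y) \<in> L.op.span (c ` A)"
      using L.op.span_add[OF L.op.span_scale[OF x] y] by (simp only:)
  qed
  moreover have "foldr lmult w = c (foldr act w)" for w
    by (simp add: fun_eq_iff c_def lmult_word)
  ultimately have "L.algebra \<subseteq> L.op.span (c ` A)"
    unfolding L.algebra_def using A(2) by (intro L.op.span_minimal) auto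
  then show ?thesis
    unfolding L.fin_type_def using A(1) by (intro L.op.fdimI) (auto simp: L.algebra_def)
qed

end

section \<open>Embedding a simple module\<close>

text \<open>Applying \<open>J\<close> to \<open>s0\<close> gives a submodule, and \<open>u\<close>
  keeps it from being zero. \<open>J\<close> will be the whole free algebra and the annihilator of
  \<open>V\<close>.\<close>

lemma cyclic_simple:
  assumes S: "total_rep gscale bracket sS aS" and C: "module.subspace sS C"
    and stable: "\<And>x s. s \<in> C \<Longrightarrow> aS x s \<in> C"
    and simple: "\<And>W. module.subspace sS W \<Longrightarrow> W \<subseteq> C \<Longrightarrow> (\<And>x s. s \<in> W \<Longrightarrow> aS x s \<in> W) \<Longrightarrow> W = {0} \<or> W = C"
    and J: "0 \<in> J" "J \<subseteq> fin_supp" "\<And>f g. f \<in> J \<Longrightarrow> g \<in> J \<Longrightarrow> f + g \<in> J" "\<And>c f. f \<in> J \<Longrightarrow> (\<lambda>w. c * f w) \<in> J"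
      "\<And>x f. f \<in> J \<Longrightarrow> word [x] ** f \<in> J"
    and u: "u \<in> J" "s0 \<in> C" "total_rep.ev sS aS u s0 \<noteq> 0"
  shows "C = {total_rep.ev sS aS f s0 | f. f \<in> J}"
proof -
  interpret S: total_rep gscale bracket sS aS by (rule S)
  let ?D = "{S.ev f s0 | f. f \<in> J}"
  have "?D = {0} \<or> ?D = C"
  proof (rule simple)
    show "S.subspace ?D"
      unfolding S.subspace_def
    proof (intro conjI ballI allI)
      show "0 \<in> ?D" by (rule CollectI, rule exI[of _ 0]) (simp only: J(1) S.ev_zero simp_thms)
      fix s t assume "s \<in> ?D" "t \<in> ?D"
      then obtain f g where fg: "f \<in> J" "g \<in> J" "s = S.ev f s0" "t = S.ev g s0" by blast
      then have "s + t = S.ev (f + g) s0" using S.ev_add[of f g s0] J(2) by (simp add: subset_iff)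
      then show "s + t \<in> ?D" using J(3)[OF fg(1,2)] by blast
      fix c
      have "sS c s = S.ev (\<lambda>w. c * f w) s0" using fg S.ev_scale[of f c s0] J(2) by auto
      then show "sS c s \<in> ?D" using J(4)[OF fg(1)] by blast
    qed
    show "?D \<subseteq> C" using S.ev_in_subspace[OF C stable u(2)] by blast
    fix x s assume "s \<in> ?D"
    then obtain f where f: "f \<in> J" "s = S.ev f s0" by blast
    then have "aS x s = S.ev (word [x] ** f) s0" using S.act_ev[of f x s0] J(2) by auto
    then show "aS x s \<in> ?D" using J(5)[OF f(1)] by blast
  qed
  then show ?thesis using u(1,3) by blast
qed

text \<open>An embedding amounts to a nonzero vector of \<open>V\<close> killed by all
  \<open>f\<close> that kill \<open>s0\<close>. The operators of these \<open>f\<close> form a left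
  ideal \<open>K\<close>; a projection onto \<open>K\<close> that commutes with left multiplication
  sends the identity to an \<open>e\<close> in \<open>K\<close> with \<open>f = f e\<close> on
  \<open>V\<close>, so each \<open>v - e v\<close> is killed.\<close>

lemma embedding_exists:
  assumes V: "total_rep gscale bracket sV aV" and finV: "total_rep.fin_type sV aV"
    and S: "total_rep gscale bracket sS aS" and C: "module.subspace sS C"
    and stable: "\<And>x s. s \<in> C \<Longrightarrow> aS x s \<in> C"
    and simple: "\<And>W. module.subspace sS W \<Longrightarrow> W \<subseteq> C \<Longrightarrow> (\<And>x s. s \<in> W \<Longrightarrow> aS x s \<in> W) \<Longrightarrow> W = {0} \<or> W = C"
    and s0: "s0 \<in> C" "s0 \<noteq> 0"
    and ann: "\<And>f s. f \<in> fin_supp \<Longrightarrow> (\<And>v. total_rep.ev sV aV f v = 0) \<Longrightarrow> s \<in> C \<Longrightarrow> total_rep.ev sS aS f s = 0"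
  shows "\<exists>j. (\<forall>s\<in>C. \<forall>t\<in>C. j (s + t) = j s + j t) \<and> (\<forall>c. \<forall>s\<in>C. j (sS c s) = sV c (j s)) \<and>
    (\<forall>x. \<forall>s\<in>C. j (aS x s) = aV x (j s)) \<and> inj_on j C"
proof -
  interpret V: total_rep gscale bracket sV aV by (rule V)
  interpret S: total_rep gscale bracket sS aS by (rule S)
  interpret L: total_rep gscale bracket V.opscale V.lmult by (rule V.lmult_rep)
  define K where "K = {V.ev f | f. f \<in> fin_supp \<and> S.ev f s0 = 0}"
  have Lev: "L.ev f m v = V.ev f (m v)" for f m v
    unfolding L.ev_def V.ev_def by (simp add: sum_fun_at V.lmult_word)
  have "\<exists>p. V.op.endo p \<and> (\<forall>v. p v \<in> K) \<and> (\<forall>w\<in>K. p w = w) \<and> (\<forall>x v. p (V.lmult x v) = V.lmult x (p v))"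
  proof (rule L.equivariant_projection[OF V.lmult_fin_type[OF finV]])
    show "V.op.subspace K"
      unfolding V.op.subspace_def
    proof (intro conjI ballI allI)
      have "V.ev 0 = 0" by (rule ext) (simp only: V.ev_zero zero_fun_apply)
      then show "0 \<in> K"
        unfolding K_def by (intro CollectI exI[of _ 0] conjI) (simp_all only: S.ev_zero fin_supp_zero)
      fix m n assume "m \<in> K" "n \<in> K"
      then obtain f g where fg: "f \<in> fin_supp" "g \<in> fin_supp" "S.ev f s0 = 0" "S.ev g s0 = 0" "m = V.ev f" "n = V.ev g"
        by (auto simp: K_def)
      have "m + n = V.ev (f + g)" using fg by (simp add: fun_eq_iff V.ev_add)
      then show "m + n \<in> K" using fg fin_supp_add[of f g] by (auto simp: K_def S.ev_add intro!: exI[of _ "f + g"])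
      fix c
      have "V.opscale c m = V.ev (\<lambda>w. c * f w)" using fg by (simp add: fun_eq_iff V.ev_scale)
      then show "V.opscale c m \<in> K"
        using fg fin_supp_scale[of f c] by (auto simp: K_def S.ev_scale intro!: exI[of _ "\<lambda>w. c * f w"])
    qed
    fix x m assume "m \<in> K"
    then obtain f where f: "f \<in> fin_supp" "S.ev f s0 = 0" "m = V.ev f" by (auto simp: K_def)
    have "V.lmult x m = V.ev (word [x] ** f)" using f by (simp add: fun_eq_iff V.lmult_def V.act_ev)
    moreover have "S.ev (word [x] ** f) s0 = 0" using S.act_ev[OF f(1), of x s0] f(2) by simp
    ultimately show "V.lmult x m \<in> K" using fin_supp_conv[OF word_fin_supp f(1)] by (auto simp: K_def)
  qed
  then obtain p where p: "V.op.endo p" "\<And>m. p m \<in> K" "\<And>m. m \<in> K \<Longrightarrow> p m = m"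
    "\<And>x m. p (V.lmult x m) = V.lmult x (p m)" by blast
  define e where "e = p (\<lambda>v. v)"
  obtain f0 where f0: "f0 \<in> fin_supp" "S.ev f0 s0 = 0" "e = V.ev f0"
    using p(2)[of "\<lambda>v. v"] by (auto simp: K_def e_def)
  have pe: "p (V.ev f) v = V.ev f (e v)" for f v
  proof -
    have "V.ev f = L.ev f (\<lambda>v. v)" by (simp add: fun_eq_iff Lev)
    then have "p (V.ev f) = L.ev f e" using L.ev_equivariant[OF p(1,4), of f "\<lambda>v. v"] by (simp add: e_def)
    then show ?thesis by (simp add: Lev)
  qed
  have kill: "V.ev f (v - e v) = 0" if f: "f \<in> fin_supp" "S.ev f s0 = 0" for f v
  proof -
    have "V.ev f \<in> K" using f by (auto simp: K_def)
    then have "V.ev f v = V.ev f (e v)" using pe[of f v] p(3) by simp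
    then show ?thesis by (simp add: V.endo_diff[OF V.endo_ev])
  qed
  \<comment> \<open>If \<open>e\<close> were the identity of \<open>V\<close>, then
    \<open>word [] - f0\<close> would act as zero on \<open>V\<close>, hence on \<open>s0\<close> by
    \<open>ann\<close>; but \<open>f0\<close> kills \<open>s0\<close>, so \<open>s0\<close> would be
    zero.\<close>
  have "\<exists>v. v - e v \<noteq> 0"
  proof (rule ccontr)
    assume "\<not> ?thesis"
    then have "V.ev (word [] - f0) v = 0" for v
      by (simp add: V.ev_diff[OF word_fin_supp f0(1)] V.ev_word flip: f0(3))
    then have "S.ev (word [] - f0) s0 = 0"
      by (rule ann[OF fin_supp_diff[OF word_fin_supp f0(1)] _ s0(1)])
    then show False using s0(2) f0(2) by (simp add: S.ev_diff[OF word_fin_supp f0(1)] S.ev_word)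
  qed
  then obtain v0 where v0: "v0 - e v0 \<noteq> 0" by blast
  define v1 where "v1 = v0 - e v0"
  have ex: "\<exists>f. f \<in> fin_supp \<and> S.ev f s0 = s" if "s \<in> C" for s
  proof -
    have "C = {S.ev f s0 | f. f \<in> fin_supp}"
      by (rule cyclic_simple[OF S C stable simple, where u = "word []"])
        (use s0 in \<open>simp_all add: fin_supp_add fin_supp_scale fin_supp_conv word_fin_supp S.ev_word\<close>)
    then show ?thesis using that by blast
  qed
  \<comment> \<open>The map that sends \<open>f s0\<close> to \<open>f v1\<close>; the choice of
    \<open>f\<close> is immaterial by \<open>kill\<close>.\<close>
  define j where "j s = V.ev (SOME f. f \<in> fin_supp \<and> S.ev f s0 = s) v1" for s
  have j: "j (S.ev f s0) = V.ev f v1" if f: "f \<in> fin_supp" for f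
  proof -
    define h where "h = (SOME h. h \<in> fin_supp \<and> S.ev h s0 = S.ev f s0)"
    have h: "h \<in> fin_supp \<and> S.ev h s0 = S.ev f s0"
      unfolding h_def by (rule someI[of _ f]) (use f in simp)
    then have "S.ev (h - f) s0 = 0" using f by (simp add: S.ev_diff)
    then have "V.ev (h - f) v1 = 0" unfolding v1_def by (intro kill) (use h f fin_supp_diff in auto)
    then show ?thesis using h f by (simp add: j_def V.ev_diff flip: h_def)
  qed
  have j_add: "j (s + t) = j s + j t" if "s \<in> C" "t \<in> C" for s t
  proof -
    from ex[OF that(1)] ex[OF that(2)] obtain f g
      where fg: "f \<in> fin_supp" "S.ev f s0 = s" "g \<in> fin_supp" "S.ev g s0 = t" by blast
    then show ?thesis
      using j[OF fg(1)] j[OF fg(3)] j[OF fin_supp_add[OF fg(1,3)]] by (simp add: S.ev_add V.ev_add)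
  qed
  have j_scale: "j (sS c s) = sV c (j s)" if "s \<in> C" for c s
  proof -
    obtain f where f: "f \<in> fin_supp" "S.ev f s0 = s" using ex[OF \<open>s \<in> C\<close>] by blast
    then show ?thesis using j[OF f(1)] j[OF fin_supp_scale[OF f(1), of c]] by (simp add: S.ev_scale V.ev_scale)
  qed
  have j_act: "j (aS x s) = aV x (j s)" if "s \<in> C" for x s
  proof -
    obtain f where f: "f \<in> fin_supp" "S.ev f s0 = s" using ex[OF \<open>s \<in> C\<close>] by blast
    then show ?thesis
      using j[OF f(1)] j[OF fin_supp_conv[OF word_fin_supp f(1)], of "[x]"]
        S.act_ev[OF f(1), of x s0] V.act_ev[OF f(1), of x v1] f(2) by simp
  qed
  have js0: "j s0 = v1" using j[OF word_fin_supp, of "[]"] by (simp add: S.ev_word V.ev_word)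
  have "{s \<in> C. j s = 0} = {0} \<or> {s \<in> C. j s = 0} = C"
  proof (rule simple)
    have "j 0 = 0" using j_scale[OF s0(1), of 0] by simp
    then show "S.subspace {s \<in> C. j s = 0}"
      using C by (auto simp: S.subspace_def j_add j_scale)
  qed (use stable j_act in auto)
  moreover have "s0 \<notin> {s \<in> C. j s = 0}" using js0 v0 by (simp add: v1_def)
  ultimately have ker: "s = 0" if "s \<in> C" "j s = 0" for s
    using s0(1) that by blast
  have "inj_on j C"
  proof (rule inj_onI)
    fix s t assume st: "s \<in> C" "t \<in> C" "j s = j t"
    have "j (s + sS (-1) t) = 0"
      using st C j_scale[OF st(2), of "-1"] by (subst j_add) (auto simp: S.subspace_neg)
    then have "s + sS (-1) t = 0"
      using st C by (intro ker) (auto simp: S.subspace_diff)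
    then show "s = t" by simp
  qed
  then show ?thesis using j_add j_scale j_act by blast
qed

section \<open>Separating central elements\<close>

text \<open>The relation ideal is the kernel of a linear projection, so the words of length at most \<open>n\<close> modulo
  relations form a finite-dimensional subspace, on which the Lie algebra acts by commutators. The trace on \<open>C\<close>
  is an invariant functional on the annihilator of \<open>V\<close> there.\<close>

lemma central_element_exists:
  assumes V: "total_rep gscale bracket sV aV"
    and S: "total_rep gscale bracket sS aS" and C: "complex_space.fdim sS C"
    and stable: "\<And>x s. s \<in> C \<Longrightarrow> aS x s \<in> C"
    and simple: "\<And>W. module.subspace sS W \<Longrightarrow> W \<subseteq> C \<Longrightarrow> (\<And>x s. s \<in> W \<Longrightarrow> aS x s \<in> W) \<Longrightarrow> W = {0} \<or> W = C"
    and u0: "u0 \<in> fin_supp" "\<And>v. total_rep.ev sV aV u0 v = 0" and s0: "s0 \<in> C" "total_rep.ev sS aS u0 s0 \<noteq> 0"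
  shows "\<exists>z\<in>fin_supp. (\<forall>x. word [x] ** z - z ** word [x] \<in> lie_algebra.rel_ideal gscale bracket) \<and>
    (\<forall>v. total_rep.ev sV aV z v = 0) \<and> (\<forall>s\<in>C. total_rep.ev sS aS z s = s)"
proof -
  interpret V: total_rep gscale bracket sV aV by (rule V)
  interpret S: total_rep gscale bracket sS aS by (rule S)
  interpret U: lie_words gscale bracket "\<lambda>c f w. c * f w" word V.g.rel_ideal
    by (rule V.g.words_rel)
  define I where "I = V.g.rel_ideal"
  note sC = S.fdim_subspace[OF C]
  define J where "J = {f \<in> fin_supp. \<forall>v. V.ev f v = 0}"
  have J: "0 \<in> J" "J \<subseteq> fin_supp" "\<And>f g. f \<in> J \<Longrightarrow> g \<in> J \<Longrightarrow> f + g \<in> J" "\<And>c f. f \<in> J \<Longrightarrow> (\<lambda>w. c * f w) \<in> J"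
      "\<And>x f. f \<in> J \<Longrightarrow> word [x] ** f \<in> J"
    using fin_supp_add fin_supp_scale fin_supp_conv[OF word_fin_supp]
    by (auto simp: J_def V.ev_add V.ev_scale V.ev_conv[OF word_fin_supp] V.endo_zero[OF V.endo_ev])
  have "C = {S.ev f s0 | f. f \<in> J}"
    by (rule cyclic_simple[OF S sC stable simple J, where u = u0]) (use u0 s0 in \<open>auto simp: J_def\<close>)
  \<comment> \<open>By simplicity some element of the annihilator of \<open>V\<close> fixes
    \<open>s0\<close>, so 1 is an eigenvalue of it on \<open>C\<close>. Its trace may still vanish,
    whence the polynomial \<open>p\<close> below.\<close>
  then obtain u where u: "u \<in> J" "S.ev u s0 = s0" using s0(1) by auto
  have s0n: "s0 \<noteq> 0" using s0(2) S.endo_zero[OF S.endo_ev] by auto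
  let ?T = "S.ev u"
  have evC: "S.ev f s \<in> C" if "s \<in> C" for f s by (rule S.ev_in_subspace[OF sC stable that])
  obtain ms where ms: "\<forall>p. S.tr C (S.papply ?T p) = (\<Sum>\<mu>\<leftarrow>ms. poly p \<mu>)"
    "\<forall>s\<in>C. S.papply ?T (\<Prod>\<mu>\<leftarrow>ms. [:-\<mu>, 1:]) s = 0"
    using S.trace_polynomial[OF S.endo_ev C evC, of u] by blast
  have "poly (\<Prod>\<mu>\<leftarrow>ms. [:-\<mu>, 1:]) 1 = 0"
    using S.papply_eigenvector[OF S.endo_ev, of u s0 1 "\<Prod>\<mu>\<leftarrow>ms. [:-\<mu>, 1:]"] u(2) ms(2) s0(1) s0n by simp
  then have "1 \<in> set ms" by (induction ms) auto
  \<comment> \<open>\<open>p\<close> vanishes at all eigenvalues other than 1, so the trace of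
    \<open>p(u)\<close> is the multiplicity of 1 times \<open>poly p 1\<close>. The factor
    \<open>[:0, 1:]\<close> keeps \<open>p(u)\<close> in the annihilator of
    \<open>V\<close>.\<close>
  define p where "p = [:0, 1:] * (\<Prod>\<mu>\<in>set ms - {1}. [:-\<mu>, 1:])"
  have p0: "poly p 0 = 0" by (simp add: p_def)
  have p1: "poly p 1 \<noteq> 0" by (simp add: p_def poly_prod)
  have p\<mu>: "poly p \<mu> = 0" if "\<mu> \<in> set ms" "\<mu> \<noteq> 1" for \<mu>
    using that by (auto simp: p_def poly_prod)
  have "(\<Sum>\<mu>\<leftarrow>ms. poly p \<mu>) = (\<Sum>\<mu>\<leftarrow>ms. if \<mu> = 1 then poly p 1 else 0)"
    by (intro arg_cong[of _ _ sum_list] map_cong) (use p\<mu> in auto)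
  also have "\<dots> = of_nat (count_list ms 1) * poly p 1" by (induction ms) (auto simp: algebra_simps)
  finally have trp: "S.tr C (S.papply ?T p) \<noteq> 0"
    using ms(1) p1 \<open>1 \<in> set ms\<close> count_list_0_iff[of ms 1] by simp
  have "\<exists>u'\<in>fin_supp. (\<forall>s. S.ev u' s = S.papply ?T q s) \<and> (\<forall>v. V.ev u' v = V.papply (V.ev u) q v)" for q
  proof (induction q)
    case 0
    show ?case
      by (intro bexI[of _ 0] conjI allI) (simp_all only: S.ev_zero V.ev_zero S.papply_0 V.papply_0 fin_supp_zero)
  next
    case (pCons a q)
    then obtain u' where u': "u' \<in> fin_supp" "\<And>s. S.ev u' s = S.papply ?T q s" "\<And>v. V.ev u' v = V.papply (V.ev u) q v"
      by blast
    have uf: "u \<in> fin_supp" using u(1) J(2) by blast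
    have 1: "(\<lambda>w. a * word [] w) \<in> fin_supp" by (intro fin_supp_scale word_fin_supp)
    have 2: "u ** u' \<in> fin_supp" by (rule fin_supp_conv[OF uf u'(1)])
    show ?case
      by (intro bexI[of _ "(\<lambda>w. a * word [] w) + u ** u'"] conjI allI)
        (simp_all only: S.ev_add[OF 1 2] V.ev_add[OF 1 2] S.ev_scale[OF word_fin_supp] V.ev_scale[OF word_fin_supp]
          S.ev_conv[OF uf u'(1)] V.ev_conv[OF uf u'(1)] u'(2,3) S.ev_word V.ev_word foldr.simps id_apply
          S.papply_pCons[OF S.endo_ev] V.papply_pCons[OF V.endo_ev] fin_supp_add[OF 1 2])
  qed
  then obtain u' where u': "u' \<in> fin_supp" "\<And>s. S.ev u' s = S.papply ?T p s" "\<And>v. V.ev u' v = V.papply (V.ev u) p v"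
    by blast
  have evu': "V.ev u' v = 0" for v
  proof -
    have "V.ev u v = sV 0 v" using u(1) by (simp add: J_def)
    then show ?thesis using V.papply_eigenvector[OF V.endo_ev, of u v 0 p] u'(3) p0 by simp
  qed
  \<comment> \<open>\<open>\<pi> = id - pr\<close> picks a normal form in every residue class, so
    that subspaces of the free algebra can stand for subspaces of the quotient.\<close>
  obtain pr where pr: "fs.endo pr" "\<And>f. pr f \<in> I" "\<And>f. f \<in> I \<Longrightarrow> pr f = f"
    using fs.projection_exists[OF V.g.subspace_rel] unfolding I_def by blast
  define \<pi> where "\<pi> f = f - pr f" for f
  have \<pi>: "fs.endo \<pi>" unfolding \<pi>_def using fs.endo_subtract[OF fs.endo_id pr(1)] by simp
  have \<pi>_I: "\<pi> f = 0" if "f \<in> I" for f using pr(3)[OF that] by (simp add: \<pi>_def)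
  have \<pi>_diff: "f - \<pi> f \<in> I" for f using pr(2) by (simp add: \<pi>_def)
  have \<pi>_eq: "\<pi> f = \<pi> g" if "f - g \<in> I" for f g
    using \<pi>_I[OF that] by (simp add: fs.endo_diff[OF \<pi>])
  have \<pi>_idem: "\<pi> (\<pi> f) = \<pi> f" for f using \<pi>_eq[OF \<pi>_diff] by simp
  have I_fin: "f \<in> fin_supp" if "f \<in> I" for f using that V.g.rel_fin_supp by (simp add: I_def)
  have \<pi>_fin: "\<pi> f \<in> fin_supp" if "f \<in> fin_supp" for f
    unfolding \<pi>_def by (rule fin_supp_diff[OF that I_fin[OF pr(2)]])
  have V\<pi>: "V.ev (\<pi> f) v = V.ev f v" if f: "f \<in> fin_supp" for f v
    using V.ev_relation[of "f - \<pi> f" v] \<pi>_diff[of f] V.ev_diff[OF f \<pi>_fin[OF f], of v] by (simp add: I_def)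
  have S\<pi>: "S.ev (\<pi> f) v = S.ev f v" if f: "f \<in> fin_supp" for f v
    using S.ev_relation[of "f - \<pi> f" v] \<pi>_diff[of f] S.ev_diff[OF f \<pi>_fin[OF f], of v] by (simp add: I_def)
  define ad where "ad x f = word [x] ** f - f ** word [x]" for x :: 'a and f
  have ad_endo: "fs.endo (ad x)" for x
    unfolding fs.endo_def ad_def
    by (auto simp: conv_add_left conv_add_right conv_scale_left conv_scale_right fun_eq_iff algebra_simps)
  have ad_fin: "ad x f \<in> fin_supp" if "f \<in> fin_supp" for x f
    unfolding ad_def by (intro fin_supp_diff fin_supp_conv word_fin_supp that)
  have ad_I: "ad x f \<in> I" if "f \<in> I" for x f
    unfolding ad_def I_def
    by (intro fs.subspace_diff[OF V.g.subspace_rel] V.g.rel_conv_left V.g.rel_conv_right word_fin_supp)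
      (use that in \<open>simp_all add: I_def\<close>)
  \<comment> \<open>A bound for the word lengths in \<open>u'\<close> selects the step of the length
    filtration in which the argument takes place.\<close>
  obtain n where n: "\<And>w. u' w \<noteq> 0 \<Longrightarrow> length w \<le> n"
  proof -
    have "finite (length ` {w. u' w \<noteq> 0})" using fin_supp_finite[OF u'(1)] by simp
    then obtain n where "\<forall>k\<in>length ` {w. u' w \<noteq> 0}. k \<le> n" using finite_nat_set_iff_bounded_le by blast
    then show ?thesis using that by blast
  qed
  let ?U = "U.wspan n"
  have I_U: "f \<in> ?U" if "f \<in> I" for f using U.wspan_I that by (simp add: I_def)
  have u'U: "u' \<in> ?U"
  proof -
    have "u' = (\<Sum>u\<in>{w. u' w \<noteq> 0}. (\<lambda>w. u' u * word u w))"
      using fin_supp_finite[OF u'(1)] by (auto simp: fun_eq_iff sum_fun_at word_def if_distrib cong: if_cong)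
    also have "\<dots> \<in> ?U"
      by (intro fs.subspace_sum fs.subspace_scale U.subspace_wspan U.wspan_word) (use n in auto)
    finally show ?thesis .
  qed
  have U_fin: "?U \<subseteq> fin_supp"
    unfolding U.wspan_def
    by (rule fs.span_minimal[OF _ subspace_fin_supp]) (use word_fin_supp V.g.rel_fin_supp in auto)
  have ad_U: "ad x f \<in> ?U" if "f \<in> ?U" for x f
  proof -
    have "ad x ` (word ` {w. length w \<le> n} \<union> V.g.rel_ideal) \<subseteq> ?U"
    proof (rule image_subsetI)
      fix f assume f: "f \<in> word ` {w. length w \<le> n} \<union> V.g.rel_ideal"
      show "ad x f \<in> ?U"
      proof (cases "f \<in> V.g.rel_ideal")
        case True
        then show ?thesis using ad_I I_U by (simp add: I_def)
      next
        case False
        then obtain w where w: "length w \<le> n" "f = word w" using f by blast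
        then show ?thesis using U.word_move[of "[]" w "[]" n x] by (simp add: ad_def conv_word)
      qed
    qed
    then have "fs.span (ad x ` (word ` {w. length w \<le> n} \<union> V.g.rel_ideal)) \<subseteq> ?U"
      by (rule fs.span_minimal) simp
    then show ?thesis using fs.endo_span_image[OF ad_endo] that unfolding U.wspan_def by blast
  qed
  define E where "E = {f \<in> ?U. \<pi> f = f \<and> (\<forall>v. V.ev f v = 0)}"
  have E_fin: "f \<in> fin_supp" if "f \<in> E" for f using that U_fin by (auto simp: E_def)
  have \<pi>U: "\<pi> f \<in> ?U" if "f \<in> ?U" for f
    unfolding \<pi>_def by (rule fs.subspace_diff[OF U.subspace_wspan that I_U[OF pr(2)]])
  have \<pi>E: "\<pi> f \<in> E" if f: "f \<in> ?U" "\<And>v. V.ev f v = 0" for f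
    using \<pi>U[OF f(1)] \<pi>_idem f U_fin V\<pi> by (auto simp: E_def)
  have V_ad: "V.ev (ad x f) v = aV x (V.ev f v) - V.ev f (aV x v)" if "f \<in> fin_supp" for x f v
    unfolding ad_def using that
    by (simp add: V.ev_diff fin_supp_conv word_fin_supp V.ev_conv V.ev_word)
  have S_ad: "S.ev (ad x f) v = aS x (S.ev f v) - S.ev f (aS x v)" if "f \<in> fin_supp" for x f v
    unfolding ad_def using that
    by (simp add: S.ev_diff fin_supp_conv word_fin_supp S.ev_conv S.ev_word)
  have rel1: "word [x + y] - word [x] - word [y] \<in> I" "word [gscale c x] - (\<lambda>w. c * word [x] w) \<in> I"
    "word [x, y] - word [y, x] - word [bracket x y] \<in> I" for x y c
    unfolding I_def by (rule V.g.relation_in_ideal; auto simp: V.g.relations_eq)+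
  have comm_I: "r ** f - f ** r \<in> I" if "r \<in> I" "f \<in> fin_supp" for r f
    using that unfolding I_def
    by (intro fs.subspace_diff[OF V.g.subspace_rel] V.g.rel_conv_left V.g.rel_conv_right)
  interpret W: lie_rep gscale bracket "\<lambda>c f w. c * f w" "\<lambda>x f. \<pi> (ad x f)" E
  proof unfold_locales
    show "fs.endo (\<lambda>f. \<pi> (ad x f))" for x by (rule fs.endo_comp[OF \<pi> ad_endo])
    show "fs.subspace E"
      unfolding E_def fs.subspace_def
      using U_fin fs.subspace_0[OF U.subspace_wspan[of n]] fs.subspace_add[OF U.subspace_wspan[of n]]
        fs.subspace_scale[OF U.subspace_wspan[of n]]
      by (auto simp: fs.endo_zero[OF \<pi>] fs.endo_add[OF \<pi>] fs.endo_scale[OF \<pi>] V.ev_add V.ev_scale subset_iff)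
    fix f x y c assume f: "f \<in> E"
    then have fU: "f \<in> ?U" "\<And>v. V.ev f v = 0" by (auto simp: E_def)
    note ff = E_fin[OF f]
    show "\<pi> (ad x f) \<in> E"
      by (rule \<pi>E[OF ad_U[OF fU(1)]]) (simp add: V_ad[OF ff] fU(2) V.endo_zero[OF V.endo_act])
    have "\<pi> (ad (x + y) f) = \<pi> (ad x f + ad y f)"
    proof (rule \<pi>_eq)
      have "ad (x + y) f - (ad x f + ad y f)
          = (word [x + y] - word [x] - word [y]) ** f - f ** (word [x + y] - word [x] - word [y])"
        by (simp add: ad_def conv_diff_left conv_diff_right)
      then show "ad (x + y) f - (ad x f + ad y f) \<in> I" using comm_I[OF rel1(1) ff] by simp
    qed
    then show "\<pi> (ad (x + y) f) = \<pi> (ad x f) + \<pi> (ad y f)" by (simp add: fs.endo_add[OF \<pi>])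
    have "\<pi> (ad (gscale c x) f) = \<pi> (\<lambda>w. c * ad x f w)"
    proof (rule \<pi>_eq)
      have "ad (gscale c x) f - (\<lambda>w. c * ad x f w)
          = (word [gscale c x] - (\<lambda>w. c * word [x] w)) ** f - f ** (word [gscale c x] - (\<lambda>w. c * word [x] w))"
        by (simp add: ad_def conv_diff_left conv_diff_right conv_scale_left conv_scale_right fun_eq_iff algebra_simps)
      then show "ad (gscale c x) f - (\<lambda>w. c * ad x f w) \<in> I" using comm_I[OF rel1(2) ff] by simp
    qed
    then show "\<pi> (ad (gscale c x) f) = (\<lambda>w. c * \<pi> (ad x f) w)" by (simp add: fs.endo_scale[OF \<pi>])
    \<comment> \<open>Passing to the normal form in between does not change the residue class of a
      commutator; this yields the bracket law.\<close>
    have step: "\<pi> (ad x (\<pi> g)) = \<pi> (ad x g)" for x g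
    proof (rule \<pi>_eq)
      have "ad x (g - \<pi> g) \<in> I" by (rule ad_I[OF \<pi>_diff])
      then have "- ad x (g - \<pi> g) \<in> I"
        unfolding I_def by (rule fs.subspace_neg[OF V.g.subspace_rel])
      then show "ad x (\<pi> g) - ad x g \<in> I" by (simp add: fs.endo_diff[OF ad_endo])
    qed
    have "\<pi> (ad (bracket x y) f) = \<pi> (ad x (ad y f) - ad y (ad x f))"
    proof (rule \<pi>_eq)
      let ?r = "word [x, y] - word [y, x] - word [bracket x y]"
      have w: "word [x, y] = word [x] ** word [y]" "word [y, x] = word [y] ** word [x]" by (simp_all add: conv_word)
      have "ad (bracket x y) f - (ad x (ad y f) - ad y (ad x f)) = - (?r ** f - f ** ?r)"
        unfolding w ad_def conv_diff_left conv_diff_right conv_assoc by (simp add: algebra_simps)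
      moreover have "- (?r ** f - f ** ?r) \<in> I"
        using comm_I[OF rel1(3) ff] fs.subspace_neg[OF V.g.subspace_rel] unfolding I_def by blast
      ultimately show "ad (bracket x y) f - (ad x (ad y f) - ad y (ad x f)) \<in> I" by simp
    qed
    then show "\<pi> (ad (bracket x y) f) = \<pi> (ad x (\<pi> (ad y f))) - \<pi> (ad y (\<pi> (ad x f)))"
      by (simp add: fs.endo_diff[OF \<pi>] step)
  qed
  have fE: "fs.fdim E"
  proof -
    obtain A where A: "finite A" "?U \<subseteq> fs.span (word ` A \<union> V.g.rel_ideal)"
      using U.wspan_finite[OF V.g.fdim_UNIV] by blast
    have "f \<in> fs.span (\<pi> ` word ` A)" if f: "f \<in> E" for f
    proof -
      have "f \<in> fs.span (word ` A \<union> V.g.rel_ideal)" "\<pi> f = f" using f A(2) by (auto simp: E_def)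
      then have "f \<in> fs.span (\<pi> ` (word ` A \<union> V.g.rel_ideal))" using fs.endo_span_image[OF \<pi>] by metis
      moreover have "\<pi> ` (word ` A \<union> V.g.rel_ideal) \<subseteq> insert 0 (\<pi> ` word ` A)" using \<pi>_I by (auto simp: I_def)
      ultimately show ?thesis using fs.span_mono fs.span_insert_0 by blast
    qed
    then show ?thesis using A(1) by (intro fs.fdimI[OF W.subspace_E, of "\<pi> ` word ` A"]) auto
  qed
  define lam where "lam f = S.tr C (S.ev f)" for f
  have evendo: "S.endo (S.ev f)" for f by (rule S.endo_ev)
  have aev: "S.endo (\<lambda>v. aS x (S.ev f v))" "S.endo (\<lambda>v. S.ev f (aS x v))" for x f
    by (rule S.endo_comp[OF S.endo_act evendo]) (rule S.endo_comp[OF evendo S.endo_act])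
  have "\<exists>z\<in>E. lam z \<noteq> 0 \<and> (\<forall>x. \<pi> (ad x z) = 0)"
  proof (rule W.invariant_vector[OF fE])
    fix f g assume f: "f \<in> E" and g: "g \<in> E"
    have "S.ev (f + g) = (\<lambda>s. S.ev f s + S.ev g s)" by (rule ext) (rule S.ev_add[OF E_fin[OF f] E_fin[OF g]])
    then show "lam (f + g) = lam f + lam g" using S.tr_add[OF C evendo evC evendo evC] by (simp add: lam_def)
  next
    fix c f assume f: "f \<in> E"
    have "S.ev (\<lambda>w. c * f w) = (\<lambda>s. sS c (S.ev f s))" by (rule ext) (rule S.ev_scale[OF E_fin[OF f]])
    then show "lam (\<lambda>w. c * f w) = c * lam f" using S.tr_scale[OF C evendo evC] by (simp add: lam_def)
  next
    fix x f assume f: "f \<in> E"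
    have "S.ev (\<pi> (ad x f)) = (\<lambda>s. aS x (S.ev f s) - S.ev f (aS x s))"
      by (rule ext) (simp add: S\<pi>[OF ad_fin[OF E_fin[OF f]]] S_ad[OF E_fin[OF f]])
    then have "lam (\<pi> (ad x f)) = S.tr C (\<lambda>s. aS x (S.ev f s)) - S.tr C (\<lambda>s. S.ev f (aS x s))"
      unfolding lam_def using S.tr_diff[OF C aev(1) _ aev(2)] stable evC by simp
    also have "S.tr C (\<lambda>s. aS x (S.ev f s)) = S.tr C (\<lambda>s. S.ev f (aS x s))"
      by (rule S.tr_commute[OF C S.endo_act stable evendo evC])
    finally show "lam (\<pi> (ad x f)) = 0" by simp
  next
    show "\<pi> u' \<in> E" by (rule \<pi>E[OF u'U evu'])
    have "S.ev (\<pi> u') = S.papply ?T p" by (rule ext) (simp add: S\<pi>[OF u'(1)] u'(2))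
    then show "lam (\<pi> u') \<noteq> 0" using trp by (simp add: lam_def)
  qed
  then obtain z where z: "z \<in> E" "lam z \<noteq> 0" "\<And>x. \<pi> (ad x z) = 0" by blast
  have adz: "ad x z \<in> I" for x using \<pi>_diff[of "ad x z"] z(3) by simp
  have zf: "z \<in> fin_supp" by (rule E_fin[OF z(1)])
  have zcomm: "aS x (S.ev z s) = S.ev z (aS x s)" for x s
    using S.ev_relation[of "ad x z" s] adz[of x] S_ad[OF zf, of x s] by (simp add: I_def)
  have "C \<noteq> {0}" using s0(1) s0n by auto
  \<comment> \<open>Schur's lemma: the eigenspace of \<open>z\<close> in \<open>C\<close> is a
    submodule, because \<open>z\<close> commutes with the action.\<close>
  then obtain c e where e: "e \<in> C" "e \<noteq> 0" "S.ev z e = sS c e"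
    using S.eigenvector_exists[OF evendo C evC, of z] by blast
  have "{s \<in> C. S.ev z s = sS c s} = {0} \<or> {s \<in> C. S.ev z s = sS c s} = C"
  proof (rule simple)
    show "S.subspace {s \<in> C. S.ev z s = sS c s}"
      using sC by (auto simp: S.subspace_def S.endo_add[OF evendo] S.endo_scale[OF evendo] S.endo_zero[OF evendo]
          S.scale_right_distrib mult.commute)
  qed (use stable zcomm in \<open>auto simp: S.endo_scale[OF S.endo_act] simp flip: zcomm\<close>)
  then have zc: "S.ev z s = sS c s" if "s \<in> C" for s using e that by blast
  \<comment> \<open>A scalar 0 would make the trace \<open>lam z\<close> vanish.\<close>
  have "c \<noteq> 0"
  proof
    assume "c = 0"
    then have "lam z = S.tr C (\<lambda>s. sS 0 s)" unfolding lam_def by (intro S.tr_cong[OF _ C]) (simp add: zc)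
    then show False using z(2) S.tr_scale[OF C S.endo_id, of 0] by simp
  qed
  define z' where "z' = (\<lambda>w. (1 / c) * z w)"
  have "z' \<in> fin_supp" unfolding z'_def by (rule fin_supp_scale[OF zf])
  moreover have "word [x] ** z' - z' ** word [x] \<in> V.g.rel_ideal" for x
  proof -
    have "word [x] ** z' - z' ** word [x] = (\<lambda>w. (1 / c) * ad x z w)"
      unfolding z'_def ad_def conv_scale_left conv_scale_right by (simp add: fun_eq_iff right_diff_distrib)
    also have "\<dots> \<in> V.g.rel_ideal" using adz by (intro fs.subspace_scale[OF V.g.subspace_rel]) (simp add: I_def)
    finally show ?thesis .
  qed
  moreover have "V.ev z' v = 0" for v
    unfolding z'_def V.ev_scale[OF zf] using z(1) by (simp add: E_def)
  moreover have "S.ev z' s = s" if "s \<in> C" for s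
    unfolding z'_def S.ev_scale[OF zf] zc[OF that] using \<open>c \<noteq> 0\<close> by simp
  ultimately show ?thesis by blast
qed

section \<open>Modules over the enveloping algebra\<close>

context lie_algebra
begin

definition cls :: "('g list \<Rightarrow> complex) \<Rightarrow> ('g list \<Rightarrow> complex) set" where
  "cls f = rel_ideal +>\<^bsub>free_algebra\<^esub> f"

lemma cls_eq: "cls f = {r + f | r. r \<in> rel_ideal}"
  by (auto simp: cls_def a_r_coset_def')

lemma uea_carrier: "carrier (uea scale bracket) = cls ` fin_supp"
  by (auto simp: uea_def FactRing_def A_RCOSETS_def' cls_def rel_ideal_def)

lemma uea_mult:
  "f \<in> fin_supp \<Longrightarrow> g \<in> fin_supp \<Longrightarrow> cls f \<otimes>\<^bsub>uea scale bracket\<^esub> cls g = cls (f ** g)"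
  using ideal.rcoset_mult_add[OF ideal_rel, of f g] by (simp add: uea_def FactRing_def cls_def rel_ideal_def)

lemma uea_add:
  "f \<in> fin_supp \<Longrightarrow> g \<in> fin_supp \<Longrightarrow> cls f \<oplus>\<^bsub>uea scale bracket\<^esub> cls g = cls (f + g)"
  using abelian_subgroup.a_rcos_sum[OF abelian_subgroupI3[OF ideal.axioms(1)[OF ideal_rel]
      ring.is_abelian_group[OF ring_free_algebra]], of f g]
  by (simp add: uea_def FactRing_def cls_def rel_ideal_def)

lemma uea_one: "\<one>\<^bsub>uea scale bracket\<^esub> = cls (word [])"
  by (simp add: uea_def FactRing_def cls_def rel_ideal_def)

lemma uea_ring: "ring (uea scale bracket)"
  unfolding uea_def using ideal.quotient_is_ring[OF ideal_rel] by (simp add: rel_ideal_def)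

lemma cls_self: "f \<in> cls f"
  unfolding cls_eq using fs.subspace_0[OF subspace_rel] by force

lemma cls_eqI: assumes "f - g \<in> rel_ideal" shows "cls f = cls g"
proof -
  have "r + f \<in> cls g" if "r \<in> rel_ideal" for r
    unfolding cls_eq using fs.subspace_add[OF subspace_rel that assms]
    by (intro CollectI exI[of _ "r + (f - g)"]) simp
  moreover have "r + g \<in> cls f" if "r \<in> rel_ideal" for r
    unfolding cls_eq using fs.subspace_diff[OF subspace_rel that assms]
    by (intro CollectI exI[of _ "r - (f - g)"]) simp
  ultimately show ?thesis unfolding cls_eq by blast
qed

text \<open>Commuting with letters modulo relations passes to words and then to their linear
  combinations.\<close>

lemma central_cls:
  assumes z: "z \<in> fin_supp" "\<And>x. word [x] ** z - z ** word [x] \<in> rel_ideal" and r: "r \<in> carrier (uea scale bracket)"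
  shows "cls z \<otimes>\<^bsub>uea scale bracket\<^esub> r = r \<otimes>\<^bsub>uea scale bracket\<^esub> cls z"
proof -
  obtain f where f: "f \<in> fin_supp" "r = cls f" using r unfolding uea_carrier by blast
  have w: "z ** word w - word w ** z \<in> rel_ideal" for w
  proof (induction w)
    case Nil
    show ?case
      by (simp only: conv_one_left conv_one_right diff_self fs.subspace_0[OF subspace_rel])
  next
    case (Cons x w)
    have xw: "word (x # w) = word [x] ** word w" by (simp add: conv_word)
    have "- (word [x] ** z - z ** word [x]) ** word w \<in> rel_ideal"
      by (rule rel_conv_right[OF word_fin_supp fs.subspace_neg[OF subspace_rel z(2)]])
    moreover have "word [x] ** (z ** word w - word w ** z) \<in> rel_ideal"
      by (rule rel_conv_left[OF word_fin_supp Cons])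
    ultimately have "- (word [x] ** z - z ** word [x]) ** word w + word [x] ** (z ** word w - word w ** z) \<in> rel_ideal"
      by (rule fs.subspace_add[OF subspace_rel])
    also have "- (word [x] ** z - z ** word [x]) ** word w + word [x] ** (z ** word w - word w ** z)
        = z ** word (x # w) - word (x # w) ** z"
      unfolding xw minus_diff_eq conv_diff_left conv_diff_right conv_assoc by simp
    finally show ?case .
  qed
  have "z ** f - f ** z \<in> rel_ideal"
    using f(1)
  proof (induction rule: fin_supp_induct)
    case zero
    show ?case by (simp only: conv_zero diff_self fs.subspace_0[OF subspace_rel])
  next
    case (step c u f)
    have "(\<lambda>w. c * (z ** word u - word u ** z) w) + (z ** f - f ** z) \<in> rel_ideal"
      by (rule fs.subspace_add[OF subspace_rel fs.subspace_scale[OF subspace_rel w] step(2)])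
    also have "(\<lambda>w. c * (z ** word u - word u ** z) w) + (z ** f - f ** z)
        = z ** ((\<lambda>w. c * word u w) + f) - ((\<lambda>w. c * word u w) + f) ** z"
      unfolding conv_add_left conv_add_right conv_scale_left conv_scale_right
      by (auto simp: fun_eq_iff algebra_simps)
    finally show ?case .
  qed
  then show ?thesis using cls_eqI by (simp add: f(2) uea_mult z(1) f(1))
qed

end

context total_rep
begin

lemma ev_cls: assumes "f \<in> fin_supp" "g \<in> g.cls f" shows "ev g v = ev f v"
proof -
  obtain r where r: "r \<in> g.rel_ideal" "g = r + f" using assms(2) by (auto simp: g.cls_eq)
  then show ?thesis using ev_add[OF g.rel_fin_supp[OF r(1)] assms(1)] ev_relation by simp
qed

abbreviation V :: "('g, 'b) lmod" where "V \<equiv> \<lparr>mcarrier = UNIV, mscale = scale, mact = act\<rparr>"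

lemma left_uea_smult: "f \<in> fin_supp \<Longrightarrow> g.cls f \<odot>\<^bsub>left_uea_module V\<^esub> v = ev f v"
proof -
  assume f: "f \<in> fin_supp"
  have "(\<lambda>g. ev g v) ` g.cls f = (\<lambda>g. ev f v) ` g.cls f"
    by (rule image_cong[OF refl]) (rule ev_cls[OF f])
  also have "\<dots> = {ev f v}" using g.cls_self[of f] by (rule image_constant)
  finally have "(\<lambda>f. \<Sum>w | f w \<noteq> 0. f w *s foldr act w v) ` g.cls f = {ev f v}"
    unfolding ev_def .
  then show ?thesis by (simp add: left_uea_module_def)
qed

lemma left_uea_sel:
  "carrier (left_uea_module V) = UNIV" "u \<oplus>\<^bsub>left_uea_module V\<^esub> v = u + v" "\<zero>\<^bsub>left_uea_module V\<^esub> = 0"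
  by (simp_all add: left_uea_module_def)

lemma left_module_uea: "left_module (uea gscale bracket) (left_uea_module V)"
proof -
  have "abelian_group (left_uea_module V)"
  proof (rule abelian_groupI)
    show "\<exists>y\<in>carrier (left_uea_module V). y \<oplus>\<^bsub>left_uea_module V\<^esub> x = \<zero>\<^bsub>left_uea_module V\<^esub>" for x
      by (rule bexI[of _ "- x"]) (simp_all add: left_uea_sel)
  qed (simp_all add: left_uea_sel ac_simps)
  then show ?thesis
    unfolding left_module_def left_module_axioms_def g.uea_carrier
    by (auto simp: g.uea_ring left_uea_sel left_uea_smult g.uea_add g.uea_mult g.uea_one fin_supp_add fin_supp_conv
        word_fin_supp ev_add ev_conv ev_word endo_add[OF endo_ev])
qed

end

section \<open>Lie modules on a subspace\<close>

text \<open>The action is precomposed with a linear projection onto the carrier; the values lie in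
  the carrier, which the projection fixes, so the laws extend to the whole type.\<close>

lemma total_extension:
  assumes ss: "semisimple_lie_algebra gscale bracket" and S: "lie_module gscale bracket S"
  shows "\<exists>\<sigma>. total_rep gscale bracket (mscale S) \<sigma> \<and> (\<forall>x. \<forall>s\<in>mcarrier S. \<sigma> x s = mact S x s)"
proof -
  interpret s: semisimple_lie_algebra gscale bracket by (rule ss)
  interpret S: lie_module gscale bracket S by (rule S)
  interpret c: complex_space "mscale S" using S.vector_space_axioms by (simp add: complex_space_def)
  obtain p where p: "c.endo p" "\<And>v. p v \<in> mcarrier S" "\<And>v. v \<in> mcarrier S \<Longrightarrow> p v = v"
    using c.projection_exists[OF S.subspace_carrier] by blast
  have "total_rep gscale bracket (mscale S) (\<lambda>x s. mact S x (p s))"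
    by unfold_locales
      (use p in \<open>auto simp: c.endo_def S.act_add S.act_scale S.add_act S.scale_act S.bracket_act S.act_closed\<close>)
  then show ?thesis using p(3) by (intro exI[of _ "\<lambda>x s. mact S x (p s)"]) simp
qed

locale sub_module = total_rep gscale bracket "mscale S" \<sigma> + S: lie_module gscale bracket S
  for gscale :: "complex \<Rightarrow> 'g::ab_group_add \<Rightarrow> 'g" and bracket and S :: "('g, 's::ab_group_add) lmod"
    and \<sigma> :: "'g \<Rightarrow> 's \<Rightarrow> 's" +
  assumes \<sigma>: "s \<in> mcarrier S \<Longrightarrow> \<sigma> x s = mact S x s"
begin

abbreviation "C \<equiv> mcarrier S"
abbreviation "D \<equiv> right_uea_module (dual_lmod S)"

lemma \<sigma>_closed: "s \<in> C \<Longrightarrow> \<sigma> x s \<in> C"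
  using \<sigma> S.act_closed by simp

lemma word_closed: "s \<in> C \<Longrightarrow> foldr \<sigma> w s \<in> C"
  by (induction w) (auto simp: \<sigma>_closed)

lemma ev_closed: "s \<in> C \<Longrightarrow> ev f s \<in> C"
  by (rule ev_in_subspace[OF S.subspace_carrier \<sigma>_closed])

lemma dual_carrier: "\<phi> \<in> carrier D \<longleftrightarrow> (\<forall>s. s \<notin> C \<longrightarrow> \<phi> s = 0) \<and>
    (\<forall>s\<in>C. \<forall>t\<in>C. \<phi> (s + t) = \<phi> s + \<phi> t) \<and> (\<forall>c. \<forall>s\<in>C. \<phi> (mscale S c s) = c * \<phi> s)"
  by (simp add: right_uea_module_def dual_lmod_def)

lemma dual_add: "\<phi> \<oplus>\<^bsub>D\<^esub> \<psi> = \<phi> + \<psi>"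
  by (simp add: right_uea_module_def)

lemma dual_sum:
  assumes "\<phi> \<in> carrier D" "\<And>i. i \<in> A \<Longrightarrow> s i \<in> C"
  shows "\<phi> (\<Sum>i\<in>A. s i) = (\<Sum>i\<in>A. \<phi> (s i))"
proof -
  have "\<phi> (mscale S 0 0) = 0 * \<phi> 0"
    using assms(1) S.subspace_carrier subspace_0 unfolding dual_carrier by blast
  then have "\<phi> 0 = 0" by simp
  then have "(\<Sum>i\<in>A. s i) \<in> C \<and> \<phi> (\<Sum>i\<in>A. s i) = (\<Sum>i\<in>A. \<phi> (s i))"
    using assms S.subspace_carrier unfolding dual_carrier
    by (induction A rule: infinite_finite_induct) (auto simp: subspace_0 subspace_add)
  then show ?thesis by blast
qed

text \<open>\<open>fold\<close> lets the first letter act first on the functional, and transposition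
  reverses the order, which is why \<open>foldr\<close> appears on vectors.\<close>

lemma dual_word:
  assumes "\<phi> \<in> carrier D"
  shows "fold (mact (dual_lmod S)) w \<phi> = (\<lambda>s. if s \<in> C then \<phi> (foldr \<sigma> w s) else 0)"
  using assms
proof (induction w arbitrary: \<phi>)
  case Nil
  then show ?case by (auto simp: fun_eq_iff dual_carrier)
next
  case (Cons x w)
  let ?\<psi> = "mact (dual_lmod S) x \<phi>"
  have \<psi>: "?\<psi> s = (if s \<in> C then \<phi> (\<sigma> x s) else 0)" for s by (simp add: dual_lmod_def \<sigma>)
  have "?\<psi> \<in> carrier D"
    using Cons.prems S.subspace_carrier \<sigma>_closed unfolding dual_carrier
    by (auto simp: \<psi> subspace_add subspace_scale add_act endo_add[OF endo_act] endo_scale[OF endo_act])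
  note IH = Cons.IH[OF this]
  show ?case
    unfolding fold_Cons o_apply IH by (auto simp: fun_eq_iff \<psi> word_closed)
qed

lemma dual_smult:
  assumes f: "f \<in> fin_supp" and \<phi>: "\<phi> \<in> carrier D"
  shows "g.cls f \<odot>\<^bsub>D\<^esub> \<phi> = (\<lambda>s. if s \<in> C then \<phi> (ev f s) else 0)"
proof -
  have "(\<Sum>w | g w \<noteq> 0. mscale (dual_lmod S) (g w) (fold (mact (dual_lmod S)) w \<phi>))
      = (\<lambda>s. if s \<in> C then \<phi> (ev f s) else 0)" if g: "g \<in> g.cls f" for g
  proof
    fix s
    have "(\<Sum>w | g w \<noteq> 0. mscale (dual_lmod S) (g w) (fold (mact (dual_lmod S)) w \<phi>)) s
        = (\<Sum>w | g w \<noteq> 0. g w * (if s \<in> C then \<phi> (foldr \<sigma> w s) else 0))"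
      unfolding sum_fun_at dual_word[OF \<phi>] by (simp add: dual_lmod_def)
    also have "\<dots> = (if s \<in> C then \<phi> (ev g s) else 0)"
    proof (cases "s \<in> C")
      case True
      have "\<phi> (ev g s) = (\<Sum>w | g w \<noteq> 0. \<phi> (mscale S (g w) (foldr \<sigma> w s)))"
        unfolding ev_def
        by (rule dual_sum[OF \<phi>]) (use True word_closed S.subspace_carrier in \<open>auto intro: subspace_scale\<close>)
      also have "\<dots> = (\<Sum>w | g w \<noteq> 0. g w * \<phi> (foldr \<sigma> w s))"
        by (intro sum.cong refl) (use \<phi> True word_closed in \<open>auto simp: dual_carrier\<close>)
      finally show ?thesis using True by simp
    qed simp
    finally show "(\<Sum>w | g w \<noteq> 0. mscale (dual_lmod S) (g w) (fold (mact (dual_lmod S)) w \<phi>)) s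
        = (if s \<in> C then \<phi> (ev f s) else 0)" using ev_cls[OF f g] by simp
  qed
  then have "(\<lambda>g. \<Sum>w | g w \<noteq> 0. mscale (dual_lmod S) (g w) (fold (mact (dual_lmod S)) w \<phi>)) ` g.cls f
      = {\<lambda>s. if s \<in> C then \<phi> (ev f s) else 0}"
    using g.cls_self[of f] by auto
  then show ?thesis by (simp add: right_uea_module_def)
qed

lemma tensor_side_dual: "tensor_side (uea gscale bracket) D"
proof
  show "\<phi> \<oplus>\<^bsub>D\<^esub> \<psi> \<in> carrier D" if "\<phi> \<in> carrier D" "\<psi> \<in> carrier D" for \<phi> \<psi>
    using that unfolding dual_add dual_carrier by (auto simp: algebra_simps)
  fix r \<phi> assume "r \<in> carrier (uea gscale bracket)" and \<phi>: "\<phi> \<in> carrier D"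
  then obtain f where f: "f \<in> fin_supp" "r = g.cls f" unfolding g.uea_carrier by blast
  show "r \<odot>\<^bsub>D\<^esub> \<phi> \<in> carrier D"
    unfolding f(2) dual_smult[OF f(1) \<phi>]
    using \<phi> ev_closed S.subspace_carrier unfolding dual_carrier
    by (auto simp: subspace_add subspace_scale endo_add[OF endo_ev] endo_scale[OF endo_ev])
qed

end

lemma sub_module_exists:
  assumes "semisimple_lie_algebra gscale bracket" "lie_module gscale bracket S"
  shows "\<exists>\<sigma>. sub_module gscale bracket S \<sigma>"
proof -
  obtain \<sigma> where "total_rep gscale bracket (mscale S) \<sigma>" "\<And>x s. s \<in> mcarrier S \<Longrightarrow> \<sigma> x s = mact S x s"
    using total_extension[OF assms] by blast
  then show ?thesis
    using assms(2) by (intro exI[of _ \<sigma>]) (simp add: sub_module_def sub_module_axioms_def)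
qed

text \<open>What was shown for arbitrary free resolutions thereby holds for the chosen one.\<close>

lemma tor_resolution:
  fixes R :: "('r, 'x) ring_scheme" and N :: "('r, 'n, 'y) module_scheme"
  assumes "left_module R N"
  obtains B :: "nat \<Rightarrow> ('r, 'n) gen set" and d \<epsilon> where "free_resolution R N B d \<epsilon>" "tor R k M N = tensor_homology R k M B d"
proof -
  let ?P = "\<lambda>(B :: nat \<Rightarrow> ('r, 'n) gen set, d, \<epsilon>). free_resolution R N B d \<epsilon>"
  obtain B' d' \<epsilon>' where "?P (B', d', \<epsilon>')"
    using free_resolution_exists[OF assms] unfolding prod.case by blast
  then have P: "?P (Eps ?P)" by (rule someI)
  obtain B d \<epsilon> where t: "Eps ?P = (B, d, \<epsilon>)" by (metis prod_cases3)
  show ?thesis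
    by (rule that[of B d \<epsilon>]) (use P in \<open>simp_all add: tor_def t\<close>)
qed

section \<open>Vanishing and non-vanishing of Tor\<close>

definition equivariant_embedding ::
  "('g, 'a::ab_group_add) lmod \<Rightarrow> ('g, 'b::ab_group_add) lmod \<Rightarrow> ('a \<Rightarrow> 'b) \<Rightarrow> bool" where
  "equivariant_embedding M N j \<longleftrightarrow> (\<forall>s\<in>mcarrier M. \<forall>t\<in>mcarrier M. j (s + t) = j s + j t) \<and>
    (\<forall>c. \<forall>s\<in>mcarrier M. j (mscale M c s) = mscale N c (j s)) \<and>
    (\<forall>x. \<forall>s\<in>mcarrier M. j (mact M x s) = mact N x (j s)) \<and> inj_on j (mcarrier M)"

lemma embedding_if_tor_nonzero:
  fixes S :: "('g::ab_group_add, 's::ab_group_add) lmod"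
  assumes V: "total_rep gscale bracket sV aV" and finV: "total_rep.fin_type sV aV"
    and S: "simple_lie_module gscale bracket S" and fdS: "fd_lie_module gscale bracket S"
    and tor: "carrier (taylor_tor gscale bracket k S \<lparr>mcarrier = UNIV, mscale = sV, mact = aV\<rparr>)
      \<noteq> {\<one>\<^bsub>taylor_tor gscale bracket k S \<lparr>mcarrier = UNIV, mscale = sV, mact = aV\<rparr>\<^esub>}"
  shows "\<exists>j. equivariant_embedding S \<lparr>mcarrier = UNIV, mscale = sV, mact = aV\<rparr> j"
proof -
  interpret V: total_rep gscale bracket sV aV by (rule V)
  have lS: "lie_module gscale bracket S" using S by (simp add: simple_lie_module_def)
  obtain \<sigma> where "sub_module gscale bracket S \<sigma>"
    using sub_module_exists[OF V.g.semisimple_lie_algebra_axioms lS] by blast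
  then interpret S: sub_module gscale bracket S \<sigma> .
  have simple: "W = {0} \<or> W = S.C"
    if "S.subspace W" "W \<subseteq> S.C" "\<And>x s. s \<in> W \<Longrightarrow> \<sigma> x s \<in> W" for W
  proof (rule simple_lie_module.simple[OF S])
    show "S.S.submodule W"
      unfolding S.S.submodule_def using that S.\<sigma> by (metis subsetD)
  qed
  have C: "S.fdim S.C"
    using fd_lie_module.finite_dimensional[OF fdS] S.S.subspace_carrier by (auto simp: S.fdim_def)
  obtain s0 where s0: "s0 \<in> S.C" "s0 \<noteq> 0"
    using simple_lie_module.nonzero[OF S] S.subspace_0[OF S.S.subspace_carrier] by blast
  have "S.ev f s = 0" if f: "f \<in> fin_supp" "\<And>v. V.ev f v = 0" and s: "s \<in> S.C" for f s
  proof (rule ccontr)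
    assume "S.ev f s \<noteq> 0"
    then obtain z where z: "z \<in> fin_supp" "\<And>x. word [x] ** z - z ** word [x] \<in> V.g.rel_ideal"
      "\<And>v. V.ev z v = 0" "\<And>s. s \<in> S.C \<Longrightarrow> S.ev z s = s"
      using central_element_exists[OF V S.total_rep_axioms C S.\<sigma>_closed simple f s] by blast
    let ?R = "uea gscale bracket"
    obtain B d \<epsilon> where res: "free_resolution ?R (left_uea_module V.V) B d \<epsilon>"
      "tor ?R k S.D (left_uea_module V.V) = tensor_homology ?R k S.D B d"
      using tor_resolution[OF V.left_module_uea] by blast
    have "carrier (tensor_homology ?R k S.D B d) = {\<one>\<^bsub>tensor_homology ?R k S.D B d\<^esub>}"
    proof (rule tensor_homology_trivial[OF V.left_module_uea res(1) S.tensor_side_dual, where z = "V.g.cls z"])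
      show "V.g.cls z \<in> carrier ?R" unfolding V.g.uea_carrier using z(1) by blast
      show "V.g.cls z \<otimes>\<^bsub>?R\<^esub> r = r \<otimes>\<^bsub>?R\<^esub> V.g.cls z" if "r \<in> carrier ?R" for r
        by (rule V.g.central_cls[OF z(1,2) that])
      show "V.g.cls z \<odot>\<^bsub>left_uea_module V.V\<^esub> v = \<zero>\<^bsub>left_uea_module V.V\<^esub>" for v
        by (simp add: V.left_uea_smult[OF z(1)] V.left_uea_sel z(3))
      show "V.g.cls z \<odot>\<^bsub>S.D\<^esub> \<phi> = \<phi>" if "\<phi> \<in> carrier S.D" for \<phi>
        unfolding S.dual_smult[OF z(1) that] using that z(4) by (auto simp: fun_eq_iff S.dual_carrier)
    qed
    then show False using tor res(2) by (simp add: taylor_tor_def)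
  qed
  then obtain j where "\<forall>s\<in>S.C. \<forall>t\<in>S.C. j (s + t) = j s + j t"
    "\<forall>c. \<forall>s\<in>S.C. j (mscale S c s) = sV c (j s)" "\<forall>x. \<forall>s\<in>S.C. j (\<sigma> x s) = aV x (j s)" "inj_on j S.C"
    using embedding_exists[OF V finV S.total_rep_axioms S.S.subspace_carrier S.\<sigma>_closed simple s0] by blast
  then show ?thesis using S.\<sigma> unfolding equivariant_embedding_def by auto
qed

lemma tor_0_nonzero_if_embedding:
  fixes S :: "('g::ab_group_add, 's::ab_group_add) lmod"
  assumes V: "total_rep gscale bracket sV aV" and finV: "total_rep.fin_type sV aV"
    and S: "lie_module gscale bracket S" "mcarrier S \<noteq> {0}"
    and j: "equivariant_embedding S \<lparr>mcarrier = UNIV, mscale = sV, mact = aV\<rparr> j"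
  shows "carrier (taylor_tor gscale bracket 0 S \<lparr>mcarrier = UNIV, mscale = sV, mact = aV\<rparr>)
      \<noteq> {\<one>\<^bsub>taylor_tor gscale bracket 0 S \<lparr>mcarrier = UNIV, mscale = sV, mact = aV\<rparr>\<^esub>}"
proof -
  interpret V: total_rep gscale bracket sV aV by (rule V)
  obtain \<sigma> where "sub_module gscale bracket S \<sigma>"
    using sub_module_exists[OF V.g.semisimple_lie_algebra_axioms S(1)] by blast
  then interpret S: sub_module gscale bracket S \<sigma> .
  have j_add: "j (s + t) = j s + j t" if "s \<in> S.C" "t \<in> S.C" for s t
    using j that unfolding equivariant_embedding_def by blast
  have j_scale: "j (mscale S c s) = sV c (j s)" if "s \<in> S.C" for c s
    using j that unfolding equivariant_embedding_def by simp
  have j_act: "j (\<sigma> x s) = aV x (j s)" if "s \<in> S.C" for x s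
    using j that unfolding equivariant_embedding_def by (simp add: S.\<sigma>)
  have j_inj: "inj_on j S.C" using j unfolding equivariant_embedding_def by blast
  note sC = S.S.subspace_carrier
  have j_sum: "(\<Sum>i\<in>A. t i) \<in> S.C \<and> j (\<Sum>i\<in>A. t i) = (\<Sum>i\<in>A. j (t i))" if "\<And>i. i \<in> A \<Longrightarrow> t i \<in> S.C" for A :: "'g list set" and t
    using that
  proof (induction A rule: infinite_finite_induct)
    case (insert i A)
    then show ?case by (simp add: j_add S.subspace_add[OF sC])
  qed (use j_scale[of 0 0] S.subspace_0[OF sC] in simp_all)
  have j_word: "j (foldr \<sigma> w s) = foldr aV w (j s)" if "s \<in> S.C" for w s
    using that by (induction w) (simp_all add: j_act S.word_closed)
  have j_ev: "j (S.ev f s) = V.ev f (j s)" if "s \<in> S.C" for f s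
    unfolding S.ev_def V.ev_def
    using j_sum[of "{w. f w \<noteq> 0}" "\<lambda>w. mscale S (f w) (foldr \<sigma> w s)"] that
    by (simp add: j_scale j_word S.word_closed S.subspace_scale[OF sC])
  define W where "W = j ` S.C"
  obtain p where p: "V.endo p" "\<And>v. p v \<in> W" "\<And>w. w \<in> W \<Longrightarrow> p w = w" "\<And>x v. p (aV x v) = aV x (p v)"
  proof -
    have "V.subspace W"
      unfolding W_def V.subspace_def
    proof (intro conjI ballI allI)
      have "j 0 = 0" using j_scale[of 0 0] S.subspace_0[OF sC] by simp
      then show "0 \<in> j ` S.C" using S.subspace_0[OF sC] by (metis image_eqI)
      show "x + y \<in> j ` S.C" if xy: "x \<in> j ` S.C" "y \<in> j ` S.C" for x y
        using xy S.subspace_add[OF sC] by (auto simp flip: j_add)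
      show "sV c x \<in> j ` S.C" if x: "x \<in> j ` S.C" for c x
        using x S.subspace_scale[OF sC] by (auto simp flip: j_scale)
    qed
    moreover have "aV x w \<in> W" if "w \<in> W" for x w
      using that S.\<sigma>_closed by (auto simp: W_def simp flip: j_act)
    ultimately have "\<exists>p. V.endo p \<and> (\<forall>v. p v \<in> W) \<and> (\<forall>w\<in>W. p w = w) \<and> (\<forall>x v. p (aV x v) = aV x (p v))"
      by (rule V.equivariant_projection[OF finV])
    then obtain q where "V.endo q \<and> (\<forall>v. q v \<in> W) \<and> (\<forall>w\<in>W. q w = w) \<and> (\<forall>x v. q (aV x v) = aV x (q v))"
      by (elim exE)
    then show ?thesis by (intro that[of q]) simp_all
  qed
  \<comment> \<open>\<open>i\<close> is the equivariant retraction of \<open>V\<close> onto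
    \<open>S\<close> along \<open>j\<close>; its equivariance makes the pairing
    \<open>\<phi> (i v)\<close> balanced over the enveloping algebra.\<close>
  define i where "i v = inv_into S.C j (p v)" for v
  have i: "i v \<in> S.C" "j (i v) = p v" for v
    using p(2)[of v] by (simp_all add: i_def W_def inv_into_into f_inv_into_f)
  have i_eq: "i v = s" if "s \<in> S.C" "j s = p v" for v s
    using inj_onD[OF j_inj, of "i v" s] that i by simp
  have i_add: "i (u + v) = i u + i v" for u v
    by (rule i_eq) (use i S.subspace_add[OF sC] in \<open>simp_all add: j_add V.endo_add[OF p(1)]\<close>)
  have i_ev: "i (V.ev f v) = S.ev f (i v)" for f v
    by (rule i_eq) (use i S.ev_closed in \<open>simp_all add: j_ev V.ev_equivariant[OF p(1,4)]\<close>)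
  obtain s0 where s0: "s0 \<in> S.C" "s0 \<noteq> 0" using S(2) S.subspace_0[OF sC] by blast
  obtain \<psi> :: "'s \<Rightarrow> complex" where \<psi>: "\<And>u v. \<psi> (u + v) = \<psi> u + \<psi> v" "\<And>c v. \<psi> (mscale S c v) = c * \<psi> v" "\<psi> s0 = 1"
    using S.functional_exists[OF s0(2)] by blast
  define \<phi>0 where "\<phi>0 s = (if s \<in> S.C then \<psi> s else 0)" for s
  have \<phi>0: "\<phi>0 \<in> carrier S.D"
    unfolding S.dual_carrier \<phi>0_def using sC \<psi>(1,2) by (simp add: S.subspace_add S.subspace_scale)
  let ?R = "uea gscale bracket"
  obtain B d \<epsilon> where res: "free_resolution ?R (left_uea_module V.V) B d \<epsilon>"
    "tor ?R 0 S.D (left_uea_module V.V) = tensor_homology ?R 0 S.D B d"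
    using tor_resolution[OF V.left_module_uea] by blast
  have "carrier (tensor_homology ?R 0 S.D B d) \<noteq> {\<one>\<^bsub>tensor_homology ?R 0 S.D B d\<^esub>}"
  proof (rule tensor_homology_0_nontrivial[OF V.left_module_uea res(1) S.tensor_side_dual,
        where \<theta> = "\<lambda>\<phi> v. \<phi> (i v)" and ?m0.0 = \<phi>0 and ?n0.0 = "j s0"])
    show "(r \<odot>\<^bsub>S.D\<^esub> \<phi>) (i v) = \<phi> (i (r \<odot>\<^bsub>left_uea_module V.V\<^esub> v))"
      if r: "r \<in> carrier ?R" and \<phi>: "\<phi> \<in> carrier S.D" for r \<phi> v
    proof -
      obtain f where f: "f \<in> fin_supp" "r = V.g.cls f" using r unfolding V.g.uea_carrier by blast
      show ?thesis unfolding f(2) S.dual_smult[OF f(1) \<phi>] V.left_uea_smult[OF f(1)] i_ev using i(1) by simp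
    qed
    have "i (j s0) = s0" by (rule i_eq) (use s0 p(3) in \<open>auto simp: W_def\<close>)
    then show "\<phi>0 (i (j s0)) \<noteq> 0" using s0 \<psi>(3) by (simp add: \<phi>0_def)
  qed (use \<phi>0 i in \<open>auto simp: S.dual_add V.left_uea_sel i_add S.dual_carrier\<close>)
  then show ?thesis using res(2) by (simp add: taylor_tor_def)
qed

section \<open>Isomorphism classes\<close>

lemma lmod_iso_sym:
  assumes M: "lie_module scale bracket M" and iso: "lmod_iso M N"
  shows "lmod_iso N M"
proof -
  interpret M: lie_module scale bracket M by (rule M)
  obtain f where f: "bij_betw f (mcarrier M) (mcarrier N)"
    "\<And>u v. u \<in> mcarrier M \<Longrightarrow> v \<in> mcarrier M \<Longrightarrow> f (u + v) = f u + f v"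
    "\<And>c v. v \<in> mcarrier M \<Longrightarrow> f (mscale M c v) = mscale N c (f v)"
    "\<And>x v. v \<in> mcarrier M \<Longrightarrow> f (mact M x v) = mact N x (f v)"
    using iso unfolding lmod_iso_def by blast
  define h where "h = inv_into (mcarrier M) f"
  have h: "h (f v) = v" if "v \<in> mcarrier M" for v
    using f(1) that by (simp add: h_def bij_betw_def)
  have ex: "\<exists>v\<in>mcarrier M. u = f v" if "u \<in> mcarrier N" for u
    using f(1) that by (auto simp: bij_betw_def)
  show ?thesis
    unfolding lmod_iso_def
  proof (intro exI[of _ h] conjI ballI allI)
    show "bij_betw h (mcarrier N) (mcarrier M)" unfolding h_def by (rule bij_betw_inv_into[OF f(1)])
  next
    fix u v assume "u \<in> mcarrier N" "v \<in> mcarrier N"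
    then obtain a b where "a \<in> mcarrier M" "b \<in> mcarrier M" "u = f a" "v = f b" using ex by blast
    then show "h (u + v) = h u + h v"
      using h M.subspace_add[OF M.subspace_carrier] by (simp flip: f(2))
  next
    fix c v assume "v \<in> mcarrier N"
    then obtain b where "b \<in> mcarrier M" "v = f b" using ex by blast
    then show "h (mscale N c v) = mscale M c (h v)"
      using h M.subspace_scale[OF M.subspace_carrier] by (simp flip: f(3))
  next
    fix x v assume "v \<in> mcarrier N"
    then obtain b where "b \<in> mcarrier M" "v = f b" using ex by blast
    then show "h (mact N x v) = mact M x (h v)" using h M.act_closed by (simp flip: f(4))
  qed
qed

lemma lmod_iso_trans:
  assumes "lmod_iso M N" "lmod_iso N P" shows "lmod_iso M P"
proof -
  obtain f where f: "bij_betw f (mcarrier M) (mcarrier N)"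
    "\<forall>u\<in>mcarrier M. \<forall>v\<in>mcarrier M. f (u + v) = f u + f v"
    "\<forall>c. \<forall>v\<in>mcarrier M. f (mscale M c v) = mscale N c (f v)"
    "\<forall>x. \<forall>v\<in>mcarrier M. f (mact M x v) = mact N x (f v)"
    using assms(1) unfolding lmod_iso_def by blast
  obtain h where h: "bij_betw h (mcarrier N) (mcarrier P)"
    "\<forall>u\<in>mcarrier N. \<forall>v\<in>mcarrier N. h (u + v) = h u + h v"
    "\<forall>c. \<forall>v\<in>mcarrier N. h (mscale N c v) = mscale P c (h v)"
    "\<forall>x. \<forall>v\<in>mcarrier N. h (mact N x v) = mact P x (h v)"
    using assms(2) unfolding lmod_iso_def by blast
  have "f v \<in> mcarrier N" if "v \<in> mcarrier M" for v using f(1) that by (auto simp: bij_betw_def)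
  then show ?thesis
    unfolding lmod_iso_def using bij_betw_trans[OF f(1) h(1)] f(2-) h(2-)
    by (intro exI[of _ "h \<circ> f"]) simp
qed

lemma iso_class_eq:
  assumes "lie_module scale bracket M" "lmod_iso M N"
  shows "iso_class scale bracket M = iso_class scale bracket N"
  unfolding iso_class_def using lmod_iso_trans[OF lmod_iso_sym[OF assms]] lmod_iso_trans[OF assms(2)] by blast

lemma simple_transport:
  assumes M: "simple_lie_module scale bracket M" and N: "lie_module scale bracket N" and iso: "lmod_iso M N"
  shows "simple_lie_module scale bracket N"
proof -
  interpret M: simple_lie_module scale bracket M by (rule M)
  interpret N: lie_module scale bracket N by (rule N)
  obtain f where f: "bij_betw f (mcarrier M) (mcarrier N)"
    "\<And>u v. u \<in> mcarrier M \<Longrightarrow> v \<in> mcarrier M \<Longrightarrow> f (u + v) = f u + f v"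
    "\<And>c v. v \<in> mcarrier M \<Longrightarrow> f (mscale M c v) = mscale N c (f v)"
    "\<And>x v. v \<in> mcarrier M \<Longrightarrow> f (mact M x v) = mact N x (f v)"
    using iso unfolding lmod_iso_def by blast
  have f0: "f 0 = 0" using f(3)[of 0 0] M.subspace_0[OF M.subspace_carrier] by simp
  have img: "f ` mcarrier M = mcarrier N" and inj: "inj_on f (mcarrier M)" using f(1) by (auto simp: bij_betw_def)
  show ?thesis
  proof
    show "mcarrier N \<noteq> {0}"
    proof
      assume "mcarrier N = {0}"
      then have "f v = f 0" if "v \<in> mcarrier M" for v using that img f0 by auto
      then have "mcarrier M \<subseteq> {0}" using inj_onD[OF inj] M.subspace_0[OF M.subspace_carrier] by blast
      then show False using M.nonzero M.subspace_0[OF M.subspace_carrier] by blast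
    qed
    fix W assume W: "N.submodule W"
    define W' where "W' = {v \<in> mcarrier M. f v \<in> W}"
    have "M.submodule W'"
      using W M.subspace_carrier M.act_closed f0
      unfolding M.submodule_def N.submodule_def W'_def
      by (auto simp: f M.subspace_def N.subspace_def)
    then have "W' = {0} \<or> W' = mcarrier M" by (rule M.simple)
    moreover have "W = f ` W'" using W img by (auto simp: W'_def N.submodule_def)
    ultimately show "W = {0} \<or> W = mcarrier N" using f0 img by auto
  qed
qed

lemma fd_transport:
  assumes M: "fd_lie_module scale bracket M" and N: "lie_module scale bracket N" and iso: "lmod_iso M N"
  shows "fd_lie_module scale bracket N"
proof -
  interpret M: fd_lie_module scale bracket M by (rule M)
  interpret N: lie_module scale bracket N by (rule N)
  obtain f where f: "bij_betw f (mcarrier M) (mcarrier N)"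
    "\<And>u v. u \<in> mcarrier M \<Longrightarrow> v \<in> mcarrier M \<Longrightarrow> f (u + v) = f u + f v"
    "\<And>c v. v \<in> mcarrier M \<Longrightarrow> f (mscale M c v) = mscale N c (f v)"
    using iso unfolding lmod_iso_def by blast
  have f0: "f 0 = 0" using f(3)[of 0 0] M.subspace_0[OF M.subspace_carrier] by simp
  have img: "f ` mcarrier M = mcarrier N" using f(1) by (auto simp: bij_betw_def)
  obtain B where B: "finite B" "mcarrier M = M.span B" using M.finite_dimensional by blast
  have span: "v \<in> mcarrier M \<and> f v \<in> N.span (f ` B)" if "v \<in> M.span B" for v
    using that
  proof (rule M.span_induct_alt)
    fix c x y assume x: "x \<in> B" and y: "y \<in> mcarrier M \<and> f y \<in> N.span (f ` B)"
    have "x \<in> mcarrier M" unfolding B(2) using x by (rule M.span_base)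
    then show "mscale M c x + y \<in> mcarrier M \<and> f (mscale M c x + y) \<in> N.span (f ` B)"
      using x y M.subspace_carrier
      by (simp add: f M.subspace_add M.subspace_scale N.span_add N.span_scale N.span_base)
  qed (use f0 M.subspace_0[OF M.subspace_carrier] N.span_zero in auto)
  have "mcarrier N \<subseteq> N.span (f ` B)"
  proof
    fix u assume "u \<in> mcarrier N"
    then obtain v where "v \<in> mcarrier M" "u = f v" unfolding img[symmetric] by (elim imageE)
    then show "u \<in> N.span (f ` B)" using span[of v] B(2) by simp
  qed
  moreover have "f ` B \<subseteq> mcarrier N"
    unfolding img[symmetric] B(2) by (rule image_mono[OF M.span_superset])
  then have "N.span (f ` B) \<subseteq> mcarrier N" by (rule N.span_minimal[OF _ N.subspace_carrier])
  ultimately show ?thesis using B(1) by unfold_locales (intro exI[of _ "f ` B"], auto)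
qed

text \<open>This supplies a member of the isomorphism class, on which the spectrum can test
  \<open>Tor\<close>.\<close>

lemma coordinate_copy:
  assumes M: "fd_lie_module scale bracket M"
  shows "\<exists>S :: 'g::ab_group_add coord_lmod. lie_module scale bracket S \<and> lmod_iso M S"
proof -
  interpret M: fd_lie_module scale bracket M by (rule M)
  interpret c: complex_space "mscale M" using M.vector_space_axioms by (simp add: complex_space_def)
  have "c.fdim (mcarrier M)"
    using M.finite_dimensional M.subspace_carrier by (auto simp: c.fdim_def)
  then obtain B where B: "finite B" "M.independent B" "M.span B = mcarrier M" by (rule c.fdim_basis)
  obtain b where b: "bij_betw b {..<card B} B"
    using ex_bij_betw_nat_finite[OF B(1)] by (auto simp: atLeast0LessThan)
  define n where "n = card B"
  define co where "co v = (\<lambda>i. if i < n then M.representation B v (b i) else 0)" for v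
  define li where "li f = (\<Sum>i<n. mscale M (f i) (b i))" for f :: "nat \<Rightarrow> complex"
  define C where "C = {f :: nat \<Rightarrow> complex. \<forall>i\<ge>n. f i = 0}"
  note sC = M.subspace_carrier
  have bB: "b i \<in> B" if "i < n" for i using b that by (auto simp: bij_betw_def n_def)
  have bM: "b i \<in> mcarrier M" if "i < n" for i using bB[OF that] B(3) M.span_base by blast
  have li_M: "li f \<in> mcarrier M" for f
    unfolding li_def using bM by (intro M.subspace_sum[OF sC] M.subspace_scale[OF sC]) auto
  have li_co: "li (co v) = v" if "v \<in> mcarrier M" for v
  proof -
    have "li (co v) = (\<Sum>i<n. mscale M (M.representation B v (b i)) (b i))"
      unfolding li_def co_def by (intro sum.cong) auto
    also have "\<dots> = (\<Sum>x\<in>B. mscale M (M.representation B v x) x)"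
      using sum.reindex_bij_betw[OF b, of "\<lambda>x. mscale M (M.representation B v x) x"] by (simp add: n_def)
    also have "\<dots> = v" using M.sum_representation_eq[OF B(2) _ B(1) subset_refl] that B(3) by simp
    finally show ?thesis .
  qed
  have co_C: "co v \<in> C" for v by (simp add: co_def C_def)
  have co_li: "co (li f) = f" if "f \<in> C" for f
  proof
    fix i
    show "co (li f) i = f i"
    proof (cases "i < n")
      case True
      have "M.representation B (li f) (b i) = (\<Sum>k<n. f k * M.representation B (b k) (b i))"
      proof -
        have sp: "b k \<in> M.span B" if "k \<in> {..<n}" for k using bM that B(3) by simp
        show ?thesis
          unfolding li_def
          by (subst M.representation_sum[OF B(2)])
            (use sp in \<open>simp_all add: M.span_scale M.representation_scale[OF B(2)]\<close>)
      qed
      also have "\<dots> = (\<Sum>k<n. if k = i then f i else 0)"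
      proof (intro sum.cong refl)
        fix k assume "k \<in> {..<n}"
        then have "b k = b i \<longleftrightarrow> k = i" using b True by (auto simp: bij_betw_def n_def inj_on_def)
        then show "f k * M.representation B (b k) (b i) = (if k = i then f i else 0)"
          using B(2) bB \<open>k \<in> {..<n}\<close> by (auto simp: M.representation_basis)
      qed
      also have "\<dots> = f i" using True by simp
      finally show ?thesis using True by (simp add: co_def)
    next
      case False
      then show ?thesis using that by (simp add: co_def C_def)
    qed
  qed
  have co_add: "co (u + v) = co u + co v" if "u \<in> mcarrier M" "v \<in> mcarrier M" for u v
    using that B(2,3) by (auto simp: co_def fun_eq_iff M.representation_add)
  have co_scale: "co (mscale M c v) = (\<lambda>i. c * co v i)" if "v \<in> mcarrier M" for c v
    using that B(2,3) by (auto simp: co_def fun_eq_iff M.representation_scale)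
  have li_add: "li (f + h) = li f + li h" for f h
    by (simp add: li_def M.scale_left_distrib sum.distrib)
  have li_scale: "li (\<lambda>i. c * f i) = mscale M c (li f)" for c f
    by (simp add: li_def M.scale_sum_right)
  define S :: "('g, nat \<Rightarrow> complex) lmod" where
    "S = \<lparr>mcarrier = C, mscale = (\<lambda>c f i. c * f i), mact = (\<lambda>x f. co (mact M x (li f)))\<rparr>"
  have co_diff: "co (u - v) = co u - co v" if "u \<in> mcarrier M" "v \<in> mcarrier M" for u v
    using co_add[OF M.subspace_diff[OF sC that] that(2)] by (simp add: algebra_simps)
  have "lie_module scale bracket S"
  proof -
    interpret S: vector_space "mscale S"
      by unfold_locales (auto simp: S_def fun_eq_iff algebra_simps)
    have "S.subspace (mcarrier S)" unfolding S.subspace_def by (auto simp: S_def C_def)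
    then show ?thesis
      by unfold_locales
        (use li_M M.act_closed in \<open>simp_all add: S_def co_C li_add li_scale li_co M.act_add M.act_scale M.add_act
          M.scale_act M.bracket_act co_add co_scale co_diff M.subspace_add[OF sC] M.subspace_scale[OF sC]\<close>)
  qed
  moreover have "lmod_iso M S"
    unfolding lmod_iso_def
  proof (intro exI[of _ co] conjI ballI allI)
    show "bij_betw co (mcarrier M) (mcarrier S)"
      by (rule bij_betw_byWitness[of _ li]) (use li_co co_li co_C li_M in \<open>auto simp: S_def\<close>)
  qed (use co_add co_scale li_co in \<open>simp_all add: S_def\<close>)
  ultimately show ?thesis by blast
qed

theorem corollary3p7:
  fixes scale :: "complex \<Rightarrow> 'g::ab_group_add \<Rightarrow> 'g"
    and bracket :: "'g \<Rightarrow> 'g \<Rightarrow> 'g"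
    and cscale :: "complex \<Rightarrow> 'v::banach \<Rightarrow> 'v"
    and act :: "'g \<Rightarrow> 'v \<Rightarrow> 'v"
  assumes "semisimple_lie_algebra scale bracket"
    and "banach_lie_module scale bracket cscale act"
  shows "taylor_spectrum scale bracket \<lparr>mcarrier = UNIV, mscale = cscale, mact = act\<rparr>
       = simple_submodule_classes scale bracket \<lparr>mcarrier = UNIV, mscale = cscale, mact = act\<rparr>"
proof -
  let ?V = "\<lparr>mcarrier = UNIV, mscale = cscale, mact = act\<rparr>"
  have V: "total_rep scale bracket cscale act" by (rule total_rep_banach[OF assms])
  have finV: "total_rep.fin_type cscale act" by (rule banach_fin_type[OF assms])
  interpret V: total_rep scale bracket cscale act by (rule V)
  have lV: "lie_module scale bracket ?V" using assms(2) by (simp add: banach_lie_module_def)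
  have sub: "lie_module scale bracket (?V\<lparr>mcarrier := W\<rparr>)"
    if "V.subspace W" "\<And>x v. v \<in> W \<Longrightarrow> act x v \<in> W" for W
    by unfold_locales
      (use that in \<open>simp_all add: V.scale_right_distrib V.scale_left_distrib V.endo_add[OF V.endo_act] V.endo_scale[OF V.endo_act] V.add_act V.scale_act V.bracket_act\<close>)
  have submoduleD: "V.subspace W \<and> (\<forall>x. \<forall>v\<in>W. act x v \<in> W)" if "lie_module.submodule ?V W" for W
    using that unfolding lie_module.submodule_def[OF lV] by simp
  show ?thesis
  proof (intro equalityI subsetI)
    fix c assume "c \<in> taylor_spectrum scale bracket ?V"
    then have c: "c \<in> simple_dual scale bracket" and
      "\<exists>S\<in>c. \<exists>k. carrier (taylor_tor scale bracket k S ?V) \<noteq> {\<one>\<^bsub>taylor_tor scale bracket k S ?V\<^esub>}"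
      unfolding taylor_spectrum_def by simp_all
    from this(2) obtain S k where Sc: "S \<in> c"
      and tor: "carrier (taylor_tor scale bracket k S ?V) \<noteq> {\<one>\<^bsub>taylor_tor scale bracket k S ?V\<^esub>}"
      by (elim bexE exE)
    obtain S0 :: "'g coord_lmod" where S0: "c = iso_class scale bracket S0" "simple_lie_module scale bracket S0"
        "fd_lie_module scale bracket S0"
      using c unfolding simple_dual_def by blast
    \<comment> \<open>\<open>S\<close> is some member of the class, so simplicity and finite
      dimension are carried over from \<open>S0\<close>.\<close>
    have S: "lie_module scale bracket S" "lmod_iso S0 S" using Sc S0(1) by (simp_all add: iso_class_def)
    have S0m: "lie_module scale bracket S0" using S0(2) by (simp add: simple_lie_module_def)
    have simpleS: "simple_lie_module scale bracket S" by (rule simple_transport[OF S0(2) S])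
    have fdS: "fd_lie_module scale bracket S" by (rule fd_transport[OF S0(3) S])
    obtain j where "equivariant_embedding S ?V j"
      using embedding_if_tor_nonzero[OF V finV simpleS fdS tor] by blast
    then have j: "\<And>s t. s \<in> mcarrier S \<Longrightarrow> t \<in> mcarrier S \<Longrightarrow> j (s + t) = j s + j t"
      "\<And>a s. s \<in> mcarrier S \<Longrightarrow> j (mscale S a s) = cscale a (j s)"
      "\<And>x s. s \<in> mcarrier S \<Longrightarrow> j (mact S x s) = act x (j s)" "inj_on j (mcarrier S)"
      by (auto simp: equivariant_embedding_def)
    interpret S: lie_module scale bracket S by (rule S(1))
    define W where "W = j ` mcarrier S"
    have sW: "V.subspace W"
      unfolding V.subspace_def
    proof (intro conjI ballI allI)
      have "j 0 = 0" using j(2)[of 0 0] S.subspace_0[OF S.subspace_carrier] by simp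
      then show "0 \<in> W" using S.subspace_0[OF S.subspace_carrier] unfolding W_def by (metis image_eqI)
      show "x + y \<in> W" if "x \<in> W" "y \<in> W" for x y
        using that S.subspace_add[OF S.subspace_carrier] by (auto simp: W_def simp flip: j(1))
      show "cscale a x \<in> W" if "x \<in> W" for a x
        using that S.subspace_scale[OF S.subspace_carrier] by (auto simp: W_def simp flip: j(2))
    qed
    have aW: "act x v \<in> W" if "v \<in> W" for x v
      using that S.act_closed by (auto simp: W_def simp flip: j(3))
    have lW: "lie_module scale bracket (?V\<lparr>mcarrier := W\<rparr>)" by (rule sub[OF sW aW])
    have iso: "lmod_iso S (?V\<lparr>mcarrier := W\<rparr>)"
      unfolding lmod_iso_def using j by (intro exI[of _ j]) (auto simp: bij_betw_def W_def)
    have "lie_module.submodule ?V W" unfolding lie_module.submodule_def[OF lV] using sW aW by simp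
    moreover have "simple_lie_module scale bracket (?V\<lparr>mcarrier := W\<rparr>)"
      by (rule simple_transport[OF simpleS lW iso])
    moreover have "c = iso_class scale bracket (?V\<lparr>mcarrier := W\<rparr>)"
      unfolding S0(1) iso_class_eq[OF S0m S(2)] by (rule iso_class_eq[OF S(1) iso])
    ultimately show "c \<in> simple_submodule_classes scale bracket ?V"
      unfolding simple_submodule_classes_def by blast
  next
    fix c assume "c \<in> simple_submodule_classes scale bracket ?V"
    then obtain W where W: "c = iso_class scale bracket (?V\<lparr>mcarrier := W\<rparr>)" "lie_module.submodule ?V W"
      "simple_lie_module scale bracket (?V\<lparr>mcarrier := W\<rparr>)"
      unfolding simple_submodule_classes_def by blast
    have sW: "V.subspace W" "\<And>x v. v \<in> W \<Longrightarrow> act x v \<in> W" using submoduleD[OF W(2)] by auto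
    have lW: "lie_module scale bracket (?V\<lparr>mcarrier := W\<rparr>)" by (rule sub[OF sW])
    interpret W: simple_lie_module scale bracket "?V\<lparr>mcarrier := W\<rparr>" by (rule W(3))
    have simple: "U = {0} \<or> U = W"
      if "V.subspace U" "U \<subseteq> W" "\<And>x v. v \<in> U \<Longrightarrow> act x v \<in> U" for U
    proof -
      have "lie_module.submodule (?V\<lparr>mcarrier := W\<rparr>) U"
        unfolding lie_module.submodule_def[OF lW] using that by simp
      then show ?thesis using W.simple[of U] by simp
    qed
    obtain w0 where w0: "w0 \<in> W" "w0 \<noteq> 0" using W.nonzero V.subspace_0[OF sW(1)] by auto
    \<comment> \<open>By simplicity \<open>W\<close> is the orbit of \<open>w0\<close> under the
      image of the enveloping algebra, which is finite-dimensional by \<open>finV\<close>.\<close>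
    have fdW: "fd_lie_module scale bracket (?V\<lparr>mcarrier := W\<rparr>)"
    proof
      obtain A where A: "finite A" "\<forall>w. foldr act w \<in> V.op.span A" using V.algebra_basis[OF finV] by blast
      have "a w0 \<in> V.span ((\<lambda>a. a w0) ` A)" if "a \<in> V.op.span A" for a
        using that
        by (rule V.op.span_induct_alt) (auto intro: V.span_zero V.span_add V.span_scale V.span_base)
      then have word: "foldr act w w0 \<in> V.span ((\<lambda>a. a w0) ` A)" for w using A(2) by blast
      have "W = {V.ev f w0 | f. f \<in> fin_supp}"
        by (rule cyclic_simple[OF V sW(1,2) simple, where u = "word []"])
          (use w0 in \<open>simp_all add: fin_supp_add fin_supp_scale fin_supp_conv word_fin_supp V.ev_word\<close>)
      then have "W \<subseteq> V.span ((\<lambda>a. a w0) ` A)"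
        using word by (auto simp: V.ev_def intro!: V.span_sum V.span_scale)
      then have "V.fdim W" using sW(1) A(1) by (intro V.fdimI) auto
      then obtain B where "finite B" "V.span B = W" by (metis V.fdim_basis)
      then show "\<exists>B. finite B \<and> mcarrier (?V\<lparr>mcarrier := W\<rparr>) = W.span B" by auto
    qed
    obtain S :: "'g coord_lmod" where S: "lie_module scale bracket S" "lmod_iso (?V\<lparr>mcarrier := W\<rparr>) S"
      using coordinate_copy[OF fdW] by blast
    have simpleS: "simple_lie_module scale bracket S" by (rule simple_transport[OF W(3) S])
    have c: "c = iso_class scale bracket S" unfolding W(1) by (rule iso_class_eq[OF lW S(2)])
    then have "c \<in> simple_dual scale bracket"
      unfolding simple_dual_def using simpleS fd_transport[OF fdW S] by blast
    moreover have "S \<in> c" using S unfolding W(1) iso_class_def by blast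
    moreover obtain j where j: "bij_betw j (mcarrier S) W"
      "\<forall>u\<in>mcarrier S. \<forall>v\<in>mcarrier S. j (u + v) = j u + j v"
      "\<forall>a. \<forall>v\<in>mcarrier S. j (mscale S a v) = cscale a (j v)" "\<forall>x. \<forall>v\<in>mcarrier S. j (mact S x v) = act x (j v)"
      using lmod_iso_sym[OF lW S(2)] unfolding lmod_iso_def by auto
    have "carrier (taylor_tor scale bracket 0 S ?V) \<noteq> {\<one>\<^bsub>taylor_tor scale bracket 0 S ?V\<^esub>}"
      by (rule tor_0_nonzero_if_embedding[OF V finV S(1) simple_lie_module.nonzero[OF simpleS], of j])
        (use j in \<open>simp add: equivariant_embedding_def bij_betw_def\<close>)
    ultimately show "c \<in> taylor_spectrum scale bracket ?V"
      unfolding taylor_spectrum_def by blast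
  qed
qed

end
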